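(* Let $F$ be a non-Archimedean local field. Let $m_1,m_2,r\ge1$, $n=m_1+m_2+r$, and let $\pi\in\mathrm{Alg}(G_r)$. Then there are isomorphisms of $G_n$-representations $$\begin{aligned}{}^u\mathrm{ind}_{H^F_{m_1,m_2,r}}^{G_n}\pi\otimes\zeta^F\otimes\nu^{m_2-m_1}&\cong{}^u\mathrm{ind}_{H^F_{m_1,m_2,r}}^{G_n}\pi\otimes\widehat\zeta^F\otimes\nu^{m_2-m_1}\\&\cong{}^u\mathrm{ind}_{H^B_{m_1-1,m_2,r}}^{G_n}\pi\otimes\zeta^B\otimes\nu^{m_2-m_1+1}\\&\cong{}^u\mathrm{ind}_{H^R_{m_1-1+m_2,r}}^{G_n}\pi\otimes\zeta^R\otimes\nu^{m_1+m_2-1}.\end{aligned}$$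
   Context: $G_n=\mathrm{GL}_n(F)$, $\nu(g)=|\det g|_F$, $\mathrm{Alg}(G)$ the category of smooth complex representations; ${}^u\mathrm{ind}$ is unnormalized compact induction. $U_n\subset G_n$ is the group of unipotent upper triangular matrices, $\bar\psi$ a nontrivial additive character of $F$, $\varphi_n$ a non-degenerate character of $U_n$ (e.g. $\varphi_n(u)=\bar\psi(u_{1,2}+\dots+u_{n-1,n})$). Representations of $G_r$ and powers of $\nu$ are viewed on the groups below through their projection to $G_r$. Bessel: for $m_1,m_2,r\ge0$, $H^B_{m_1,m_2,r}\subset G_{m_1+m_2+r+1}$ is the group of matrices $\begin{pmatrix}u_1&x&y\\&h&z\\&&u_2\end{pmatrix}$ with $u_1\in U_{m_1}$, $u_2\in U_{m_2}$, $h=\mathrm{diag}(1,g)$, $g\in G_r$, and $x,y,z$ arbitrary of sizes $m_1\times(r+1)$, $m_1\times m_2$, $(r+1)\times m_2$; $\zeta^B$ is the character sending it to $\varphi_{m_1}(u_1)\varphi_{m_2}(u_2)\bar\psi(x_{m_1,1})\bar\psi(z_{1,1})\nu(g)^{-(m_2-m_1)/2}$ (factors for missing blocks omitted). Rankin-Selberg: $H^R_{m,r}=H^B_{0,m,r}$, $\zeta^R=\zeta^B$. Fourier-Jacobi: $H'_r=\left\{\begin{pmatrix}1&w^t&a\\&g&v\\&&1\end{pmatrix}: v,w\in F^r,a\in F,g\in G_r\right\}\cong G_r\ltimes K_r$, where $K_r$ is the Heisenberg group of triples $(a,v,w)$ (the case $g=1$). For a nontrivial character $\lambda$ of $F$ and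 a character $\mu$ of $G_r$, $\widetilde\omega_{\mu,\lambda}$ is the $H'_r$-representation on the Bruhat-Schwartz space $S(F^r)$ with $((a,v,w).f)(x)=\lambda(a-w^tx-w^tv)f(x+v)$, $(g.f)(x)=\mu(g)f(g^{-1}x)$; $\widehat\omega_{\mu,\lambda}$ is the one with $((a,v,w).f)(y)=\lambda(a+y^tv)f(y+w)$, $(g.f)(y)=\mu(g)f(g^ty)$. $H^F_{m_1,m_2,r}\subset G_{m_1+m_2+r}$ is the group of matrices $\begin{pmatrix}u_1&x&y\\&h&z\\&&u_2\end{pmatrix}$, $u_1\in U_{m_1-1}$, $u_2\in U_{m_2-1}$, $h\in H'_r$, $x,y,z$ arbitrary of the appropriate sizes. The representations above extend to $H^F_{m_1,m_2,r}$ by letting this matrix act by $f\mapsto\varphi_{m_1}(u_1')\varphi_{m_2}(u_2')(h.f)$, where $u_1'=\begin{pmatrix}u_1&x_1\\&1\end{pmatrix}\in U_{m_1}$ with $x_1$ the first column of $x$ and $u_2'=\begin{pmatrix}1&z_{r+2}\\&u_2\end{pmatrix}\in U_{m_2}$ with $z_{r+2}$ the last row of $z$. Then $\zeta^F=\nu^{(m_1-m_2)/2}\widetilde\omega_{\nu^{-1/2},\lambda}$, $\widehat\zeta^F=\nu^{(m_1-m_2)/2}\widehat\omega_{\nu^{1/2},\lambda}$. *)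

theory Defs
  imports
    "HOL-Analysis.Function_Topology"
    "Jordan_Normal_Form.Determinant"
    "Jordan_Normal_Form.VS_Connect"
begin

section \<open>Non-Archimedean local fields\<close>

text \<open>The last axiom normalises the absolute value: a uniformiser has absolute value
  \<open>1/q\<close>, where \<open>q\<close> is the cardinality of the residue field (ring of integers modulo its
  maximal ideal).\<close>

class nonarch_local_field = field + metric_space +
  fixes nabs :: "'a \<Rightarrow> real"
  assumes dist_nabs: "dist x y = nabs (x - y)"
    and nabs_mult: "nabs (x * y) = nabs x * nabs y"
    and nabs_ultrametric: "nabs (x + y) \<le> max (nabs x) (nabs y)"
    and nabs_nontrivial: "\<exists>x. x \<noteq> 0 \<and> nabs x \<noteq> 1"
    and locally_compact: "\<exists>U K. open U \<and> compact K \<and> x \<in> U \<and> U \<subseteq> K"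
    and nabs_normalised: "\<exists>p. (\<forall>x. nabs x < 1 \<longrightarrow> nabs x \<le> nabs p) \<and>
      nabs p = 1 / real (card ({x. nabs x \<le> 1} //
        {(x, y). nabs x \<le> 1 \<and> nabs y \<le> 1 \<and> nabs (x - y) < 1}))"

text \<open>Characters are smooth, that is, their kernel is open.\<close>

definition nontrivial_add_char :: "('f::nonarch_local_field \<Rightarrow> complex) \<Rightarrow> bool" where
  "nontrivial_add_char \<chi> \<longleftrightarrow>
     (\<forall>x y. \<chi> (x + y) = \<chi> x * \<chi> y) \<and> (\<forall>x. \<chi> x \<noteq> 0) \<and> open {x. \<chi> x = 1} \<and> (\<exists>x. \<chi> x \<noteq> 1)"


section \<open>Matrix groups\<close>

definition GL :: "nat \<Rightarrow> 'f::field mat monoid" where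
  "GL n = units_of (ring_mat TYPE('f) n ())"

definition vec_top :: "nat \<Rightarrow> 'f::topological_space vec topology" where
  "vec_top n = pullback_topology (carrier_vec n)
     (\<lambda>x. \<lambda>i\<in>{..<n}. x $ i) (product_topology (\<lambda>_. euclidean) {..<n})"

text \<open>Inversion is continuous for the topology that \<open>GL n\<close> inherits from the space of all
  matrices, so no separate condition on inverses is needed.\<close>

definition GL_top :: "nat \<Rightarrow> 'f::nonarch_local_field mat topology" where
  "GL_top n = pullback_topology (carrier (GL n))
     (\<lambda>A. \<lambda>ij\<in>{..<n} \<times> {..<n}. A $$ ij) (product_topology (\<lambda>_. euclidean) ({..<n} \<times> {..<n}))"

definition nu :: "real \<Rightarrow> 'f::nonarch_local_field mat \<Rightarrow> complex" where
  "nu s g = complex_of_real (nabs (det g) powr s)"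

definition unip :: "nat \<Rightarrow> 'f::field mat set" where
  "unip n = {u \<in> carrier_mat n n. upper_triangular u \<and> (\<forall>i<n. u $$ (i, i) = 1)}"

text \<open>Non-degenerate means nontrivial on every simple root subgroup, whose elements are the
  matrices \<open>addrow_mat n a i (Suc i)\<close>, the identity plus \<open>a\<close> at position \<open>(i, i+1)\<close>.\<close>

definition nondegenerate_char :: "nat \<Rightarrow> ('f::nonarch_local_field mat \<Rightarrow> complex) \<Rightarrow> bool" where
  "nondegenerate_char n \<phi> \<longleftrightarrow>
     (\<forall>u\<in>unip n. \<forall>v\<in>unip n. \<phi> (u * v) = \<phi> u * \<phi> v) \<and> (\<forall>u\<in>unip n. \<phi> u \<noteq> 0) \<and>
     openin (subtopology (GL_top n) (unip n)) {u \<in> unip n. \<phi> u = 1} \<and>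
     (\<forall>i. Suc i < n \<longrightarrow> (\<exists>a. \<phi> (addrow_mat n a i (Suc i)) \<noteq> 1))"

definition block_upper :: "'f::zero mat \<Rightarrow> 'f mat \<Rightarrow> 'f mat \<Rightarrow> 'f mat \<Rightarrow> 'f mat \<Rightarrow> 'f mat \<Rightarrow> 'f mat" where
  "block_upper u1 x y h z u2 =
     four_block_mat (four_block_mat u1 x (0\<^sub>m (dim_row h) (dim_col u1)) h) (y @\<^sub>r z)
       (0\<^sub>m (dim_row u2) (dim_col u1 + dim_col h)) u2"

text \<open>The \<open>p \<times> q\<close> block whose upper left entry is at position \<open>(i0, j0)\<close> (counted from 0).\<close>

definition block :: "'f mat \<Rightarrow> nat \<Rightarrow> nat \<Rightarrow> nat \<Rightarrow> nat \<Rightarrow> 'f mat" where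
  "block A i0 j0 p q = mat p q (\<lambda>(i, j). A $$ (i0 + i, j0 + j))"


section \<open>Smooth representations\<close>

record ('g, 'w) rep = "(complex, 'w) module" +
  act :: "'g \<Rightarrow> 'w \<Rightarrow> 'w"

definition smooth_rep :: "nat \<Rightarrow> ('f::nonarch_local_field mat, 'w) rep \<Rightarrow> bool" where
  "smooth_rep n \<pi> \<longleftrightarrow>
     module class_ring \<pi> \<and>
     (\<forall>g\<in>carrier (GL n). act \<pi> g \<in> module_hom class_ring \<pi> \<pi>) \<and>
     (\<forall>v\<in>carrier \<pi>. act \<pi> (1\<^sub>m n) v = v) \<and>
     (\<forall>g\<in>carrier (GL n). \<forall>h\<in>carrier (GL n). \<forall>v\<in>carrier \<pi>.
        act \<pi> (g * h) v = act \<pi> g (act \<pi> h v)) \<and>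
     (\<forall>v\<in>carrier \<pi>. openin (GL_top n) {g \<in> carrier (GL n). act \<pi> g v = v})"

definition rep_iso :: "'g set \<Rightarrow> ('g, 'v) rep \<Rightarrow> ('g, 'w) rep \<Rightarrow> bool" where
  "rep_iso G \<rho> \<sigma> \<longleftrightarrow> (\<exists>T \<in> module_hom class_ring \<rho> \<sigma>. bij_betw T (carrier \<rho>) (carrier \<sigma>) \<and>
     (\<forall>g\<in>G. \<forall>v\<in>carrier \<rho>. T (act \<rho> g v) = act \<sigma> g (T v)))"

definition pull :: "('h \<Rightarrow> 'g) \<Rightarrow> ('g, 'w) rep \<Rightarrow> ('h, 'w) rep" where
  "pull p \<rho> = \<lparr>carrier = carrier \<rho>, mult = mult \<rho>, one = one \<rho>, zero = zero \<rho>, add = add \<rho>,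
     smult = smult \<rho>, act = (\<lambda>h. act \<rho> (p h))\<rparr>"

definition twist :: "('g \<Rightarrow> complex) \<Rightarrow> ('g, 'w) rep \<Rightarrow> ('g, 'w) rep" where
  "twist \<chi> \<rho> = \<rho>\<lparr>act := \<lambda>g v. \<chi> g \<odot>\<^bsub>\<rho>\<^esub> act \<rho> g v\<rparr>"

text \<open>The tensor product over the complex numbers: a finite multiset of pairs stands for the
  sum of the corresponding pure tensors, and \<open>tensor_rel\<close> is the additive congruence
  generated by the bilinearity relations. The congruence classes form a group because the
  class of \<open>(- a, b)\<close> is inverse to that of \<open>(a, b)\<close>.\<close>

definition formal_sums :: "('a, 'r) partial_object_scheme \<Rightarrow> ('b, 's) partial_object_scheme
    \<Rightarrow> ('a \<times> 'b) multiset set" where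
  "formal_sums A B = {X. set_mset X \<subseteq> carrier A \<times> carrier B}"

inductive_set tensor_rel :: "(complex, 'a, 'r) module_scheme \<Rightarrow> (complex, 'b, 's) module_scheme
    \<Rightarrow> (('a \<times> 'b) multiset \<times> ('a \<times> 'b) multiset) set"
  for A B where
  refl: "X \<in> formal_sums A B \<Longrightarrow> (X, X) \<in> tensor_rel A B"
| sym: "(X, Y) \<in> tensor_rel A B \<Longrightarrow> (Y, X) \<in> tensor_rel A B"
| trans: "(X, Y) \<in> tensor_rel A B \<Longrightarrow> (Y, Z) \<in> tensor_rel A B \<Longrightarrow> (X, Z) \<in> tensor_rel A B"
| plus: "(X, Y) \<in> tensor_rel A B \<Longrightarrow> Z \<in> formal_sums A B \<Longrightarrow> (X + Z, Y + Z) \<in> tensor_rel A B"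
| add_left: "a \<in> carrier A \<Longrightarrow> a' \<in> carrier A \<Longrightarrow> b \<in> carrier B \<Longrightarrow>
    ({#(a \<oplus>\<^bsub>A\<^esub> a', b)#}, {#(a, b), (a', b)#}) \<in> tensor_rel A B"
| add_right: "a \<in> carrier A \<Longrightarrow> b \<in> carrier B \<Longrightarrow> b' \<in> carrier B \<Longrightarrow>
    ({#(a, b \<oplus>\<^bsub>B\<^esub> b')#}, {#(a, b), (a, b')#}) \<in> tensor_rel A B"
| scale: "a \<in> carrier A \<Longrightarrow> b \<in> carrier B \<Longrightarrow>
    ({#(c \<odot>\<^bsub>A\<^esub> a, b)#}, {#(a, c \<odot>\<^bsub>B\<^esub> b)#}) \<in> tensor_rel A B"
| zero: "b \<in> carrier B \<Longrightarrow> ({#(\<zero>\<^bsub>A\<^esub>, b)#}, {#}) \<in> tensor_rel A B"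

definition tensor :: "('g, 'a) rep \<Rightarrow> ('g, 'b) rep \<Rightarrow> ('g, ('a \<times> 'b) multiset set) rep" where
  "tensor A B = \<lparr>
     carrier = formal_sums A B // tensor_rel A B,
     mult = undefined, one = undefined,
     zero = tensor_rel A B `` {{#}},
     add = (\<lambda>P Q. \<Union>X\<in>P. \<Union>Y\<in>Q. tensor_rel A B `` {X + Y}),
     smult = (\<lambda>c P. \<Union>X\<in>P. tensor_rel A B `` {image_mset (\<lambda>(a, b). (c \<odot>\<^bsub>A\<^esub> a, b)) X}),
     act = (\<lambda>g P. \<Union>X\<in>P. tensor_rel A B `` {image_mset (\<lambda>(a, b). (act A g a, act B g b)) X})\<rparr>"

text \<open>Unnormalised compact induction from the subgroup \<open>H\<close> to \<open>GL n\<close>; the group acts by right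
  translation, and compactness of the support is modulo \<open>H\<close>.\<close>

definition cind :: "nat \<Rightarrow> 'f mat set \<Rightarrow> ('f::nonarch_local_field mat, 'w) rep
    \<Rightarrow> ('f mat, 'f mat \<Rightarrow> 'w) rep" where
  "cind n H \<sigma> = \<lparr>
     carrier = {f \<in> carrier (GL n) \<rightarrow>\<^sub>E carrier \<sigma>.
       (\<forall>h\<in>H. \<forall>g\<in>carrier (GL n). f (h * g) = act \<sigma> h (f g)) \<and>
       (\<exists>K. subgroup K (GL n) \<and> openin (GL_top n) K \<and>
          (\<forall>g\<in>carrier (GL n). \<forall>k\<in>K. f (g * k) = f g)) \<and>
       (\<exists>C. compactin (GL_top n) C \<and>
          (\<forall>g\<in>carrier (GL n). f g \<noteq> \<zero>\<^bsub>\<sigma>\<^esub> \<longrightarrow> (\<exists>h\<in>H. \<exists>c\<in>C. g = h * c)))},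
     mult = undefined, one = undefined,
     zero = (\<lambda>g\<in>carrier (GL n). \<zero>\<^bsub>\<sigma>\<^esub>),
     add = (\<lambda>f f'. \<lambda>g\<in>carrier (GL n). f g \<oplus>\<^bsub>\<sigma>\<^esub> f' g),
     smult = (\<lambda>c f. \<lambda>g\<in>carrier (GL n). c \<odot>\<^bsub>\<sigma>\<^esub> f g),
     act = (\<lambda>x f. \<lambda>g\<in>carrier (GL n). f (g * x))\<rparr>"


section \<open>Bessel and Rankin-Selberg subgroups\<close>

definition HB :: "nat \<Rightarrow> nat \<Rightarrow> nat \<Rightarrow> 'f::field mat set" where
  "HB m1 m2 r = {block_upper u1 x y (four_block_mat (1\<^sub>m 1) (0\<^sub>m 1 r) (0\<^sub>m r 1) g) z u2 | u1 x y g z u2.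
     u1 \<in> unip m1 \<and> u2 \<in> unip m2 \<and> g \<in> carrier (GL r) \<and>
     x \<in> carrier_mat m1 (r + 1) \<and> y \<in> carrier_mat m1 m2 \<and> z \<in> carrier_mat (r + 1) m2}"

definition projB :: "nat \<Rightarrow> nat \<Rightarrow> 'f mat \<Rightarrow> 'f mat" where
  "projB m1 r A = block A (m1 + 1) (m1 + 1) r r"

text \<open>The entry \<open>x\<^sub>m\<^sub>1\<^sub>,\<^sub>1\<close> is at position \<open>(m1 - 1, m1)\<close> of the full matrix and \<open>z\<^sub>1\<^sub>,\<^sub>1\<close> at
  position \<open>(m1, m1 + r + 1)\<close>, counting from 0.\<close>

definition zetaB :: "(nat \<Rightarrow> 'f::nonarch_local_field mat \<Rightarrow> complex) \<Rightarrow> ('f \<Rightarrow> complex)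
    \<Rightarrow> nat \<Rightarrow> nat \<Rightarrow> nat \<Rightarrow> 'f mat \<Rightarrow> complex" where
  "zetaB \<phi> \<psi> m1 m2 r A =
     \<phi> m1 (block A 0 0 m1 m1) * \<phi> m2 (block A (m1 + r + 1) (m1 + r + 1) m2 m2) *
     (if m1 = 0 then 1 else \<psi> (A $$ (m1 - 1, m1))) *
     (if m2 = 0 then 1 else \<psi> (A $$ (m1, m1 + r + 1))) *
     nu (- (real m2 - real m1) / 2) (projB m1 r A)"

definition HR :: "nat \<Rightarrow> nat \<Rightarrow> 'f::field mat set" where
  "HR m r = HB 0 m r"

definition projR :: "nat \<Rightarrow> 'f mat \<Rightarrow> 'f mat" where
  "projR r A = projB 0 r A"

definition zetaR :: "(nat \<Rightarrow> 'f::nonarch_local_field mat \<Rightarrow> complex) \<Rightarrow> ('f \<Rightarrow> complex)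
    \<Rightarrow> nat \<Rightarrow> nat \<Rightarrow> 'f mat \<Rightarrow> complex" where
  "zetaR \<phi> \<psi> m r A = zetaB \<phi> \<psi> 0 m r A"


section \<open>Weil representations and Fourier-Jacobi subgroups\<close>

definition schwartz :: "nat \<Rightarrow> ('f::nonarch_local_field vec \<Rightarrow> complex) set" where
  "schwartz r = {f \<in> extensional (carrier_vec r).
     (\<forall>x\<in>carrier_vec r. \<exists>U. openin (vec_top r) U \<and> x \<in> U \<and> (\<forall>y\<in>U. f y = f x)) \<and>
     compactin (vec_top r) (vec_top r closure_of {x \<in> carrier_vec r. f x \<noteq> 0})}"

definition HJ :: "nat \<Rightarrow> 'f::field mat set" where
  "HJ r = {block_upper (1\<^sub>m 1) w a g v (1\<^sub>m 1) | w a g v.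
     w \<in> carrier_mat 1 r \<and> a \<in> carrier_mat 1 1 \<and> g \<in> carrier (GL r) \<and> v \<in> carrier_mat r 1}"

text \<open>Writing an element of \<open>HJ r\<close> with blocks \<open>w\<^sup>t, a, g, v\<close> as a product \<open>k g\<close> with \<open>k\<close> in the
  Heisenberg group, \<open>k\<close> is the triple \<open>(a, v, w')\<close> with \<open>w' = (g\<^sup>-\<^sup>1)\<^sup>t w\<close>.\<close>

definition HJ_g :: "nat \<Rightarrow> 'f mat \<Rightarrow> 'f mat" where
  "HJ_g r h = block h 1 1 r r"

definition HJ_k :: "nat \<Rightarrow> 'f::field mat \<Rightarrow> 'f \<times> 'f vec \<times> 'f vec" where
  "HJ_k r h = (h $$ (0, r + 1), vec r (\<lambda>i. h $$ (i + 1, r + 1)),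
     transpose_mat (inv\<^bsub>GL r\<^esub> (HJ_g r h)) *\<^sub>v vec r (\<lambda>j. h $$ (0, j + 1)))"

definition schwartz_rep :: "nat \<Rightarrow> ('g \<Rightarrow> ('f vec \<Rightarrow> complex) \<Rightarrow> 'f vec \<Rightarrow> complex)
    \<Rightarrow> ('g, 'f::nonarch_local_field vec \<Rightarrow> complex) rep" where
  "schwartz_rep r \<omega> = \<lparr>
     carrier = schwartz r, mult = undefined, one = undefined,
     zero = (\<lambda>x\<in>carrier_vec r. 0),
     add = (\<lambda>f f'. \<lambda>x\<in>carrier_vec r. f x + f' x),
     smult = (\<lambda>c f. \<lambda>x\<in>carrier_vec r. c * f x),
     act = \<omega>\<rparr>"

definition tilde_k :: "nat \<Rightarrow> ('f::nonarch_local_field \<Rightarrow> complex) \<Rightarrow> 'f \<times> 'f vec \<times> 'f vec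
    \<Rightarrow> ('f vec \<Rightarrow> complex) \<Rightarrow> 'f vec \<Rightarrow> complex" where
  "tilde_k r lam = (\<lambda>(a, v, w) f. \<lambda>x\<in>carrier_vec r. lam (a - w \<bullet> x - w \<bullet> v) * f (x + v))"

definition tilde_g :: "nat \<Rightarrow> ('f::nonarch_local_field mat \<Rightarrow> complex) \<Rightarrow> 'f mat
    \<Rightarrow> ('f vec \<Rightarrow> complex) \<Rightarrow> 'f vec \<Rightarrow> complex" where
  "tilde_g r \<mu> g f = (\<lambda>x\<in>carrier_vec r. \<mu> g * f (inv\<^bsub>GL r\<^esub> g *\<^sub>v x))"

definition omega_tilde :: "nat \<Rightarrow> ('f::nonarch_local_field mat \<Rightarrow> complex) \<Rightarrow> ('f \<Rightarrow> complex)
    \<Rightarrow> ('f mat, 'f vec \<Rightarrow> complex) rep" where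
  "omega_tilde r \<mu> lam = schwartz_rep r (\<lambda>h f. tilde_k r lam (HJ_k r h) (tilde_g r \<mu> (HJ_g r h) f))"

definition hat_k :: "nat \<Rightarrow> ('f::nonarch_local_field \<Rightarrow> complex) \<Rightarrow> 'f \<times> 'f vec \<times> 'f vec
    \<Rightarrow> ('f vec \<Rightarrow> complex) \<Rightarrow> 'f vec \<Rightarrow> complex" where
  "hat_k r lam = (\<lambda>(a, v, w) f. \<lambda>y\<in>carrier_vec r. lam (a + y \<bullet> v) * f (y + w))"

definition hat_g :: "nat \<Rightarrow> ('f::nonarch_local_field mat \<Rightarrow> complex) \<Rightarrow> 'f mat
    \<Rightarrow> ('f vec \<Rightarrow> complex) \<Rightarrow> 'f vec \<Rightarrow> complex" where
  "hat_g r \<mu> g f = (\<lambda>y\<in>carrier_vec r. \<mu> g * f (transpose_mat g *\<^sub>v y))"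

definition omega_hat :: "nat \<Rightarrow> ('f::nonarch_local_field mat \<Rightarrow> complex) \<Rightarrow> ('f \<Rightarrow> complex)
    \<Rightarrow> ('f mat, 'f vec \<Rightarrow> complex) rep" where
  "omega_hat r \<mu> lam = schwartz_rep r (\<lambda>h f. hat_k r lam (HJ_k r h) (hat_g r \<mu> (HJ_g r h) f))"

definition HF :: "nat \<Rightarrow> nat \<Rightarrow> nat \<Rightarrow> 'f::field mat set" where
  "HF m1 m2 r = {block_upper u1 x y h z u2 | u1 x y h z u2.
     u1 \<in> unip (m1 - 1) \<and> u2 \<in> unip (m2 - 1) \<and> h \<in> HJ r \<and>
     x \<in> carrier_mat (m1 - 1) (r + 2) \<and> y \<in> carrier_mat (m1 - 1) (m2 - 1) \<and>
     z \<in> carrier_mat (r + 2) (m2 - 1)}"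

definition projF :: "nat \<Rightarrow> nat \<Rightarrow> 'f mat \<Rightarrow> 'f mat" where
  "projF m1 r A = block A m1 m1 r r"

text \<open>The two diagonal blocks of sizes \<open>m1\<close> and \<open>m2\<close> overlap \<open>h\<close> in its first and last diagonal
  entry; they are the matrices obtained from \<open>u1\<close> by adjoining the first column of \<open>x\<close> and from
  \<open>u2\<close> by adjoining the last row of \<open>z\<close>.\<close>

definition extendF :: "(nat \<Rightarrow> 'f::nonarch_local_field mat \<Rightarrow> complex) \<Rightarrow> nat \<Rightarrow> nat \<Rightarrow> nat
    \<Rightarrow> ('f mat, 'w) rep \<Rightarrow> ('f mat, 'w) rep" where
  "extendF \<phi> m1 m2 r \<omega> =
     twist (\<lambda>A. \<phi> m1 (block A 0 0 m1 m1) * \<phi> m2 (block A (m1 + r) (m1 + r) m2 m2))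
       (pull (\<lambda>A. block A (m1 - 1) (m1 - 1) (r + 2) (r + 2)) \<omega>)"

definition zetaF :: "(nat \<Rightarrow> 'f::nonarch_local_field mat \<Rightarrow> complex) \<Rightarrow> ('f \<Rightarrow> complex)
    \<Rightarrow> nat \<Rightarrow> nat \<Rightarrow> nat \<Rightarrow> ('f mat, 'f vec \<Rightarrow> complex) rep" where
  "zetaF \<phi> lam m1 m2 r = twist (\<lambda>A. nu ((real m1 - real m2) / 2) (projF m1 r A))
     (extendF \<phi> m1 m2 r (omega_tilde r (nu (- 1 / 2)) lam))"

definition zetaF_hat :: "(nat \<Rightarrow> 'f::nonarch_local_field mat \<Rightarrow> complex) \<Rightarrow> ('f \<Rightarrow> complex)
    \<Rightarrow> nat \<Rightarrow> nat \<Rightarrow> nat \<Rightarrow> ('f mat, 'f vec \<Rightarrow> complex) rep" where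
  "zetaF_hat \<phi> lam m1 m2 r = twist (\<lambda>A. nu ((real m1 - real m2) / 2) (projF m1 r A))
     (extendF \<phi> m1 m2 r (omega_hat r (nu (1 / 2)) lam))"

end

theory Submission
  imports Defs "HOL-Analysis.Product_Topology" "HOL-Analysis.Elementary_Metric_Spaces"
begin

text \<open>Let H be the Fourier-Jacobi group: block upper triangular matrices with one GL_r block g
  and unipotent corners. Let w be the part of the row just above g lying over its columns, and v the
  part of the column just right of g lying beside its rows. The representation on S(F^r) is itself
  induced from a subgroup of H, in two ways. In the model \<open>omega_hat\<close> an element acts
  on functions of y, up to a scalar, through the substitution of g^t y + w for y, so evaluation at 0
  realises S(F^r) as induced from the subgroup \<open>row_free\<close>, where w = 0. In the model
  \<open>omega_tilde\<close> the substitution is g^(-1)(x + v) for x, and the subgroup is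
  \<open>col_free\<close>, where v = 0. Induction in stages then rewrites the two Fourier-Jacobi
  inductions as inductions of \<pi>, twisted by a power of \<nu> and a generic character, from
  \<open>row_free\<close> and \<open>col_free\<close>.

  The group \<open>row_free\<close> for (m1, m2) is the Bessel group of type (m1 - 1, m2). A
  permutation matrix moving one index past the GL_r block carries \<open>col_free\<close> to the
  Bessel group of type (m1, m2 - 1). The Fourier transform on S(F^r) intertwines the two models; its
  Jacobian |det g| is the quotient of the factors with exponents 1/2 and -1/2. Hence the Bessel
  inductions of types (a + 1, b) and (a, b + 1) are both isomorphic to the Fourier-Jacobi induction
  for (a + 1, b + 1), and repeating this until the first index is 0 reaches the Rankin-Selberg
  induction. The powers of \<nu> agree throughout: every induction of Bessel type (a, b) carries
  exponent (b - a) / 2.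

  The choice of the characters is immaterial. Since F is self-dual, every non-degenerate character
  is \<open>lam\<close> of a linear form in the superdiagonal entries with nonzero coefficients, and
  conjugation by a diagonal matrix that is trivial on the GL_r block carries any such list of
  coefficients to any other.

  The main lemmas are \<open>fourier_inversion\<close> and \<open>fourier_GL\<close> (Fourier
  analysis on F^r, from an explicitly constructed Haar functional),
  \<open>add_char_self_dual\<close> and \<open>unip_char_formula\<close> (characters),
  \<open>theta_inj\<close> and \<open>theta_surj\<close> (the tensor product with S(F^r) as a space
  of vector-valued functions), \<open>cind_iso_conj\<close> and \<open>cind_stages\<close> (compact
  induction), \<open>row_shear_proper\<close> and \<open>col_shear_proper\<close> (control of
  supports). They combine in \<open>hat_bessel_iso\<close>, \<open>tilde_bessel_iso\<close>,
  \<open>fourier_iso\<close> and \<open>bessel_step\<close>.\<close>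

section \<open>Non-Archimedean local fields\<close>

lemma nabs_eq_0_iff [simp]: "nabs x = 0 \<longleftrightarrow> x = (0::'f::nonarch_local_field)"
  using dist_nabs[of x 0] by (metis diff_zero dist_eq_0_iff)

lemma nabs_zero [simp]: "nabs (0::'f::nonarch_local_field) = 0"
  by (simp only: nabs_eq_0_iff)

lemma nabs_nonneg [simp]: "0 \<le> nabs (x::'f::nonarch_local_field)"
  using dist_nabs[of x 0] by (metis diff_zero zero_le_dist)

lemma nabs_minus [simp]: "nabs (- x) = nabs (x::'f::nonarch_local_field)"
  using dist_nabs[of x 0] dist_nabs[of 0 x] by (simp add: dist_commute)

lemma nabs_minus_commute: "nabs (x - y) = nabs (y - x :: 'f::nonarch_local_field)"
  using nabs_minus[of "x - y"] by simp

lemma nabs_one [simp]: "nabs (1::'f::nonarch_local_field) = 1"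
  using nabs_mult[of "1::'f" 1] by simp

lemma nabs_inverse: "nabs (inverse x) = inverse (nabs (x::'f::nonarch_local_field))"
proof (cases "x = 0")
  case False
  then have "nabs x * nabs (inverse x) = 1"
    by (metis nabs_mult nabs_one right_inverse)
  then show ?thesis
    by (metis inverse_unique)
next
  case True
  moreover have "nabs (0::'f) = 0" by (simp only: nabs_eq_0_iff)
  ultimately show ?thesis by simp
qed

lemma nabs_divide: "nabs (x / y) = nabs x / nabs (y::'f::nonarch_local_field)"
  by (simp add: divide_inverse nabs_mult nabs_inverse)

lemma nabs_power: "nabs (x ^ k) = nabs (x::'f::nonarch_local_field) ^ k"
  by (induction k) (auto simp: nabs_mult)

lemma nabs_pos_iff [simp]: "0 < nabs x \<longleftrightarrow> x \<noteq> (0::'f::nonarch_local_field)"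
  by (metis nabs_eq_0_iff nabs_nonneg order_le_less order_less_irrefl)

lemma nabs_add_le: "nabs x \<le> M \<Longrightarrow> nabs y \<le> M \<Longrightarrow> nabs (x + y :: 'f::nonarch_local_field) \<le> M"
  using nabs_ultrametric[of x y] by simp

lemma nabs_diff_le: "nabs x \<le> M \<Longrightarrow> nabs y \<le> M \<Longrightarrow> nabs (x - y :: 'f::nonarch_local_field) \<le> M"
  using nabs_add_le[of x M "- y"] by simp

lemma nabs_sum_le:
  fixes f :: "'i \<Rightarrow> 'f::nonarch_local_field"
  assumes "0 \<le> M" "\<And>i. i \<in> A \<Longrightarrow> nabs (f i) \<le> M"
  shows "nabs (sum f A) \<le> M"
  using assms by (induction A rule: infinite_finite_induct) (auto intro: nabs_add_le)

definition residues_of :: "'f::nonarch_local_field itself \<Rightarrow> 'f set set" where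
  "residues_of _ = {x. nabs x \<le> 1} // {(x, y). nabs x \<le> 1 \<and> nabs y \<le> 1 \<and> nabs (x - y) < 1}"

definition res_card :: "'f::nonarch_local_field itself \<Rightarrow> nat" where
  "res_card T = card (residues_of T)"

text \<open>The normalisation axiom gives p bounding all elements of absolute value below 1.
  Nontriviality puts a nonzero element into the open unit ball, so p is nonzero; the residue field
  has at least two elements because 0 and 1 have different residues, so the absolute value of p is
  below 1.\<close>

lemma uniformizer_exists:
  "\<exists>p::'f::nonarch_local_field. (\<forall>x::'f. nabs x < 1 \<longrightarrow> nabs x \<le> nabs p) \<and>
     nabs p = 1 / real (res_card TYPE('f)) \<and> 0 < nabs p \<and> nabs p < 1"
proof -
  obtain p :: 'f where p: "\<forall>x::'f. nabs x < 1 \<longrightarrow> nabs x \<le> nabs p"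
    "nabs p = 1 / real (res_card TYPE('f))"
    using nabs_normalised[where 'a='f] unfolding res_card_def residues_of_def by blast
  obtain x0 :: 'f where x0: "x0 \<noteq> 0" "nabs x0 \<noteq> 1"
    using nabs_nontrivial[where 'a='f] by blast
  obtain x :: 'f where x: "x \<noteq> 0" "nabs x < 1"
  proof (cases "nabs x0 < 1")
    case False
    then have "nabs (inverse x0) < 1"
      using x0 by (simp add: nabs_inverse inverse_less_1_iff)
    then show ?thesis using that[of "inverse x0"] x0 by simp
  qed (use x0 that in blast)
  then have pos: "0 < nabs p"
    using p(1) by (metis less_le_trans nabs_pos_iff)
  let ?E = "{(x::'f, y). nabs x \<le> 1 \<and> nabs y \<le> 1 \<and> nabs (x - y) < 1}"
  \<comment> \<open>An infinite set has \<open>card\<close> 0 and 1 / 0 = 0, so positivity of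
    \<open>nabs p\<close> forces finiteness.\<close>
  have fin: "finite (residues_of TYPE('f))"
    using pos p(2) card.infinite unfolding res_card_def by fastforce
  have "?E `` {0} \<in> residues_of TYPE('f)" "?E `` {1} \<in> residues_of TYPE('f)"
    unfolding residues_of_def by (rule quotientI; simp)+
  moreover have "1 \<in> ?E `` {1}" "1 \<notin> ?E `` {0}"
    by auto
  then have "?E `` {0} \<noteq> ?E `` {1}"
    by blast
  ultimately have "card {?E `` {0}, ?E `` {1}} \<le> res_card TYPE('f)"
    unfolding res_card_def by (intro card_mono[OF fin]) auto
  then have "res_card TYPE('f) \<ge> 2"
    using \<open>?E `` {0} \<noteq> ?E `` {1}\<close> by simp
  then have "nabs p < 1"
    using p(2) by simp
  then show ?thesis using p pos by blast
qed

text \<open>No value lies strictly between \<open>nabs p\<close> and 1, so an element of the open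
  unit ball may be divided by p without leaving the closed unit ball; this stops after finitely many
  divisions. Elements outside the unit ball are inverted first.\<close>

lemma nabs_eq_power:
  fixes p x :: "'f::nonarch_local_field"
  assumes p: "\<forall>x::'f. nabs x < 1 \<longrightarrow> nabs x \<le> nabs p" "0 < nabs p" "nabs p < 1" and "x \<noteq> 0"
  shows "\<exists>k::int. nabs x = nabs p powi k"
proof -
  have small: "\<exists>k::nat. nabs y = nabs p ^ k" if y: "y \<noteq> 0" "nabs y \<le> 1" for y :: 'f
  proof -
    obtain k0 where "nabs p ^ k0 < nabs y"
      using real_arch_pow_inv[of "nabs y" "nabs p"] p y by auto
    then show ?thesis
      using y
    proof (induction k0 arbitrary: y)
      case (Suc k)
      show ?case
      proof (cases "nabs y < 1")
        case True
        have "nabs (y / p) \<le> 1" using True p by (simp add: nabs_divide)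
        moreover have "nabs p ^ k < nabs (y / p)" using Suc.prems(1) p(2)
          by (simp add: nabs_divide pos_less_divide_eq mult.commute)
        moreover have "y / p \<noteq> 0" using p(2) Suc.prems by auto
        ultimately obtain j where "nabs (y / p) = nabs p ^ j" using Suc.IH by blast
        then have "nabs y = nabs p ^ Suc j" using p(2) by (simp add: nabs_divide field_simps)
        then show ?thesis by blast
      next
        case False
        then have "nabs y = nabs p ^ 0" using Suc.prems by simp
        then show ?thesis by blast
      qed
    qed auto
  qed
  show ?thesis
  proof (cases "nabs x \<le> 1")
    case True
    then obtain k where "nabs x = nabs p ^ k" using small assms by blast
    then show ?thesis by (metis power_int_of_nat)
  next
    case False
    then have "nabs (inverse x) \<le> 1" by (simp add: nabs_inverse inverse_le_1_iff)
    then obtain k where "nabs (inverse x) = nabs p ^ k" using small[of "inverse x"] assms by auto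
    then have "nabs x = inverse (nabs p ^ k)" by (metis inverse_inverse_eq nabs_inverse)
    then show ?thesis by (metis power_int_minus power_int_of_nat)
  qed
qed

lemma ex_small: "0 < e \<Longrightarrow> \<exists>x::'f::nonarch_local_field. x \<noteq> 0 \<and> nabs x \<le> e \<and> nabs x \<le> 1"
proof -
  assume e: "0 < e"
  obtain p :: 'f where p: "0 < nabs p" "nabs p < 1" using uniformizer_exists by blast
  obtain k where k: "nabs p ^ k < e" using real_arch_pow_inv[OF e p(2)] by blast
  show ?thesis
    using k p by (intro exI[of _ "p ^ k"]) (auto simp: nabs_power power_le_one)
qed

lemma ex_large: "\<exists>x::'f::nonarch_local_field. x \<noteq> 0 \<and> e \<le> nabs x \<and> 1 \<le> nabs x"
proof -
  obtain e' where e': "e \<le> e'" "1 \<le> e'" using that[of "max e 1"] by simp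
  then obtain x :: 'f where x: "x \<noteq> 0" "nabs x \<le> 1 / e'"
    using ex_small[of "1 / e'"] by auto
  have "e' \<le> 1 / nabs x"
    using x e' by (simp add: field_simps)
  then have "e' \<le> nabs (1 / x)"
    by (simp add: nabs_divide)
  then show ?thesis using x(1) e' by (intro exI[of _ "1 / x"]) auto
qed

lemma continuous_on_add_nonarch: "continuous_on UNIV (\<lambda>z. fst z + snd z :: 'f::nonarch_local_field)"
  unfolding continuous_on_iff
proof (intro ballI allI impI)
  fix z :: "'f \<times> 'f" and e :: real
  assume e: "0 < e"
  show "\<exists>d>0. \<forall>z'\<in>UNIV. dist z' z < d \<longrightarrow> dist (fst z' + snd z') (fst z + snd z) < e"
  proof (intro exI[of _ e] conjI e ballI impI)
    fix z' :: "'f \<times> 'f" assume "dist z' z < e"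
    then have "dist (fst z') (fst z) < e" "dist (snd z') (snd z) < e"
      by (meson dist_fst_le dist_snd_le le_less_trans)+
    then have "max (nabs (fst z' - fst z)) (nabs (snd z' - snd z)) < e" by (simp add: dist_nabs)
    then have "nabs ((fst z' - fst z) + (snd z' - snd z)) < e"
      using nabs_ultrametric le_less_trans by blast
    then show "dist (fst z' + snd z') (fst z + snd z) < e"
      by (simp add: dist_nabs split_def algebra_simps)
  qed
qed

lemma continuous_on_mult_nonarch: "continuous_on UNIV (\<lambda>z. fst z * snd z :: 'f::nonarch_local_field)"
  unfolding continuous_on_iff
proof (intro ballI allI impI)
  fix z :: "'f \<times> 'f" and e :: real
  assume e: "0 < e"
  obtain x y where z: "z = (x, y)" by (cases z)
  \<comment> \<open>The difference of products is (x' - x) y' + x (y' - y). By the ultrametric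
    inequality each term only has to be below e, and \<open>?M\<close> dominates both nabs y' and
    nabs x.\<close>
  let ?M = "1 + nabs x + nabs y"
  let ?d = "min 1 (e / ?M)"
  have M: "?M > 0" using nabs_nonneg[of x] nabs_nonneg[of y] by linarith
  show "\<exists>d>0. \<forall>z'\<in>UNIV. dist z' z < d \<longrightarrow> dist (fst z' * snd z') (fst z * snd z) < e"
  proof (intro exI[of _ ?d] conjI ballI impI)
    show "0 < ?d" using e M by simp
    fix z' :: "'f \<times> 'f" assume zz: "dist z' z < ?d"
    obtain x' y' where z': "z' = (x', y')" by (cases z')
    have d: "nabs (x' - x) < ?d" "nabs (y' - y) < ?d"
      using zz dist_fst_le[of z' z] dist_snd_le[of z' z] by (auto simp: dist_nabs z z')
    have "nabs (x' - x) * nabs y' < e"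
    proof -
      have "nabs y' \<le> ?M"
        using nabs_ultrametric[of "y' - y" y] d nabs_nonneg[of x] nabs_nonneg[of y]
        by (auto simp del: nabs_nonneg)
      then have "nabs (x' - x) * nabs y' \<le> nabs (x' - x) * ?M"
        by (intro mult_left_mono) auto
      also have "\<dots> < e / ?M * ?M" using d M by (intro mult_strict_right_mono) auto
      finally show ?thesis using M by simp
    qed
    moreover have "nabs x * nabs (y' - y) < e"
    proof -
      have "nabs x * nabs (y' - y) \<le> ?M * nabs (y' - y)"
        using nabs_nonneg[of y] by (intro mult_right_mono) auto
      also have "\<dots> < ?M * (e / ?M)" using d M by (intro mult_strict_left_mono) auto
      finally show ?thesis using M by simp
    qed
    ultimately have "nabs ((x' - x) * y' + x * (y' - y)) < e"
      using nabs_ultrametric[of "(x' - x) * y'" "x * (y' - y)"] by (simp add: nabs_mult)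
    then show "dist (fst z' * snd z') (fst z * snd z) < e"
      by (simp add: dist_nabs z z' algebra_simps)
  qed
qed

lemma continuous_on_inverse_nonarch: "continuous_on {x. x \<noteq> 0} (inverse :: 'f \<Rightarrow> 'f::nonarch_local_field)"
  unfolding continuous_on_iff
proof (intro ballI allI impI)
  fix x :: 'f and e :: real
  assume "x \<in> {x. x \<noteq> 0}" and e: "0 < e"
  then have x: "x \<noteq> 0" by simp
  \<comment> \<open>The first bound keeps nabs x' at least nabs x, hence controls the denominator x'
    x; the second bounds the numerator x - x'.\<close>
  let ?d = "min (nabs x) (e * (nabs x * nabs x))"
  show "\<exists>d>0. \<forall>x'\<in>{x. x \<noteq> 0}. dist x' x < d \<longrightarrow> dist (inverse x') (inverse x) < e"
  proof (intro exI[of _ ?d] conjI ballI impI)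
    show "0 < ?d" using e x by (simp del: nabs_pos_iff) (simp add: nabs_nonneg less_le)
    fix x' :: 'f assume "x' \<in> {x. x \<noteq> 0}" and d: "dist x' x < ?d"
    then have x': "x' \<noteq> 0" by simp
    have "nabs x \<le> nabs x'"
      using nabs_ultrametric[of "x - x'" x'] d by (auto simp: dist_nabs nabs_minus_commute)
    then have "nabs x * nabs x \<le> nabs x' * nabs x" by (intro mult_right_mono) auto
    have "inverse x' - inverse x = (x - x') / (x' * x)" using x x' by (simp add: field_simps)
    then have "dist (inverse x') (inverse x) = nabs (x - x') / (nabs x' * nabs x)"
      by (simp add: dist_nabs nabs_divide nabs_mult)
    also have "\<dots> \<le> nabs (x - x') / (nabs x * nabs x)"
      using \<open>nabs x * nabs x \<le> nabs x' * nabs x\<close> x x' by (intro divide_left_mono) (auto simp: nabs_nonneg)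
    also have "\<dots> < e"
    proof -
      have "0 < nabs x * nabs x" using x by simp
      then show ?thesis using d by (simp add: dist_nabs nabs_minus_commute pos_divide_less_eq)
    qed
    finally show "dist (inverse x') (inverse x) < e" .
  qed
qed

lemma open_nabs_le: "0 < e \<Longrightarrow> open {x::'f::nonarch_local_field. nabs (x - a) \<le> e}"
  unfolding open_dist
proof (intro ballI)
  fix x assume e: "0 < e" and x: "x \<in> {x::'f. nabs (x - a) \<le> e}"
  show "\<exists>e'>0. \<forall>y. dist y x < e' \<longrightarrow> y \<in> {x. nabs (x - a) \<le> e}"
  proof (intro exI[of _ e] conjI e allI impI)
    fix y assume "dist y x < e"
    then have "nabs ((y - x) + (x - a)) \<le> e" using x by (intro nabs_add_le) (auto simp: dist_nabs)
    then show "y \<in> {x. nabs (x - a) \<le> e}" by simp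
  qed
qed

text \<open>Local compactness at 0 gives one compact closed ball. Multiplication by an element of
  large absolute value is continuous and stretches it over any given ball, which is closed in the
  image.\<close>

lemma compact_nabs_le: "compact {x::'f::nonarch_local_field. nabs x \<le> M}"
proof -
  obtain U K where U: "open U" "compact K" "(0::'f) \<in> U" "U \<subseteq> K" using locally_compact[of "0::'f"] by blast
  then obtain e where e: "0 < e" "ball 0 e \<subseteq> U" using open_contains_ball by blast
  have cl: "{x::'f. nabs x \<le> b} = cball 0 b" for b by (auto simp: dist_nabs)
  have "compact (K \<inter> cball 0 (e / 2))" using U by (intro compact_Int_closed) auto
  moreover have "K \<inter> cball 0 (e / 2) = cball 0 (e / 2)" using e U by fastforce
  ultimately have c: "compact {x::'f. nabs x \<le> e / 2}" unfolding cl by simp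
  obtain a :: 'f where a: "a \<noteq> 0" "nabs a \<ge> M / (e / 2)" using ex_large by blast
  have "continuous_on UNIV ((*) a)"
    using continuous_on_compose2[OF continuous_on_mult_nonarch, of UNIV "\<lambda>x. (a, x)"]
    by (simp add: continuous_on_Pair continuous_on_id continuous_on_const)
  then have "compact ((*) a ` {x. nabs x \<le> e / 2})"
    by (intro compact_continuous_image c) (auto intro: continuous_on_subset)
  then have "compact ((*) a ` {x. nabs x \<le> e / 2} \<inter> cball 0 M)" by (intro compact_Int_closed) auto
  moreover have "(*) a ` {x. nabs x \<le> e / 2} \<inter> cball 0 M = {x. nabs x \<le> M}"
  proof -
    have "x \<in> (*) a ` {x. nabs x \<le> e / 2}" if "nabs x \<le> M" for x
    proof
      show "x = a * (x / a)" using a by simp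
      have "nabs x \<le> e / 2 * nabs a" using that a e by (simp add: field_simps)
      then show "x / a \<in> {x. nabs x \<le> e / 2}" using a by (simp add: nabs_divide field_simps)
    qed
    then show ?thesis unfolding cl by (auto simp: dist_nabs)
  qed
  ultimately show ?thesis by simp
qed


section \<open>Pointwise field operations on continuous maps\<close>

lemma continuous_map_nonarch_comp2:
  fixes h :: "'f::topological_space \<times> 'f \<Rightarrow> 'f"
  assumes h: "continuous_on UNIV h"
    and f: "continuous_map X euclidean f" and g: "continuous_map X euclidean g"
  shows "continuous_map X euclidean (\<lambda>x. h (f x, g x))"
proof -
  have "continuous_map X (prod_topology euclidean euclidean) (\<lambda>x. (f x, g x))"
    using f g by (intro continuous_map_pairedI)
  moreover have "continuous_map (prod_topology euclidean euclidean) euclidean h"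
    using h by (simp add: euclidean_product_topology)
  ultimately show ?thesis
    using continuous_map_compose[of X _ "\<lambda>x. (f x, g x)" _ h] by (simp add: comp_def)
qed

lemma continuous_map_add_nonarch:
  fixes f g :: "'a \<Rightarrow> 'f::nonarch_local_field"
  assumes "continuous_map X euclidean f" "continuous_map X euclidean g"
  shows "continuous_map X euclidean (\<lambda>x. f x + g x)"
  using continuous_map_nonarch_comp2[OF continuous_on_add_nonarch assms] by simp

lemma continuous_map_mult_nonarch:
  fixes f g :: "'a \<Rightarrow> 'f::nonarch_local_field"
  assumes "continuous_map X euclidean f" "continuous_map X euclidean g"
  shows "continuous_map X euclidean (\<lambda>x. f x * g x)"
  using continuous_map_nonarch_comp2[OF continuous_on_mult_nonarch assms] by simp

lemma continuous_map_inverse_nonarch: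
  fixes f :: "'a \<Rightarrow> 'f::nonarch_local_field"
  assumes f: "continuous_map X euclidean f" and nz: "\<And>x. x \<in> topspace X \<Longrightarrow> f x \<noteq> 0"
  shows "continuous_map X euclidean (\<lambda>x. inverse (f x))"
proof -
  have "continuous_map X (subtopology euclidean {x. x \<noteq> 0}) f"
    using f nz by (simp add: continuous_map_in_subtopology)
  moreover have "continuous_map (subtopology euclidean {x::'f. x \<noteq> 0}) euclidean inverse"
    using continuous_on_inverse_nonarch by simp
  ultimately show ?thesis
    using continuous_map_compose[of X _ f _ inverse] by (simp add: comp_def)
qed

lemma continuous_map_sum_nonarch:
  fixes f :: "'i \<Rightarrow> 'a \<Rightarrow> 'f::nonarch_local_field"
  assumes "\<And>i. i \<in> I \<Longrightarrow> continuous_map X euclidean (f i)"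
  shows "continuous_map X euclidean (\<lambda>x. \<Sum>i\<in>I. f i x)"
  using assms by (induction I rule: infinite_finite_induct) (auto intro: continuous_map_add_nonarch)

lemma continuous_map_prod_nonarch:
  fixes f :: "'i \<Rightarrow> 'a \<Rightarrow> 'f::nonarch_local_field"
  assumes "\<And>i. i \<in> I \<Longrightarrow> continuous_map X euclidean (f i)"
  shows "continuous_map X euclidean (\<lambda>x. \<Prod>i\<in>I. f i x)"
  using assms by (induction I rule: infinite_finite_induct) (auto intro: continuous_map_mult_nonarch)

section \<open>GL_n as a topological group with entrywise topology\<close>

section \<open>General linear groups\<close>

lemma carrier_GL: "carrier (GL n) = {A \<in> carrier_mat n n. det A \<noteq> (0::'f::field)}"
proof (rule Set.set_eqI)
  fix A :: "'f mat"
  have "A \<in> Units (ring_mat TYPE('f) n ()) \<longleftrightarrow> A \<in> carrier_mat n n \<and> det A \<noteq> 0"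
  proof (intro iffI conjI)
    assume A: "A \<in> Units (ring_mat TYPE('f) n ())"
    then show "A \<in> carrier_mat n n" by (simp add: Units_def ring_mat_simps)
    show "det A \<noteq> 0" by (rule unit_imp_det_non_zero[OF A])
  next
    assume "A \<in> carrier_mat n n \<and> det A \<noteq> 0"
    then show "A \<in> Units (ring_mat TYPE('f) n ())" by (simp add: det_non_zero_imp_unit)
  qed
  then show "A \<in> carrier (GL n) \<longleftrightarrow> A \<in> {A \<in> carrier_mat n n. det A \<noteq> (0::'f::field)}"
    by (simp add: GL_def units_of_carrier)
qed

lemma GL_mult [simp]: "x \<otimes>\<^bsub>GL n\<^esub> y = x * y"
  by (simp add: GL_def units_of_mult ring_mat_simps)

lemma GL_one [simp]: "\<one>\<^bsub>GL n\<^esub> = 1\<^sub>m n"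
  by (simp add: GL_def units_of_one ring_mat_simps)

lemma GL_group: "group (GL n)"
proof -
  interpret ring "ring_mat TYPE('a::field) n ()" by (rule ring_mat)
  show ?thesis unfolding GL_def by (rule units_group)
qed

lemma GL_carrier_mat: "A \<in> carrier (GL n) \<Longrightarrow> A \<in> carrier_mat n n"
  by (simp add: carrier_GL)

lemma GL_dim [simp]: "A \<in> carrier (GL n) \<Longrightarrow> dim_row A = n" "A \<in> carrier (GL n) \<Longrightarrow> dim_col A = n"
  by (auto simp: carrier_GL)

lemma GL_det: "A \<in> carrier (GL n) \<Longrightarrow> det A \<noteq> 0"
  by (simp add: carrier_GL)

lemma GL_mult_closed [intro]: "A \<in> carrier (GL n) \<Longrightarrow> B \<in> carrier (GL n) \<Longrightarrow> A * B \<in> carrier (GL n)"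
  using group.is_monoid[OF GL_group] monoid.m_closed by fastforce

lemma GL_one_closed [simp]: "1\<^sub>m n \<in> carrier (GL n)"
  using group.is_monoid[OF GL_group] monoid.one_closed by fastforce

lemma GL_inv_closed [intro]: "A \<in> carrier (GL n) \<Longrightarrow> inv\<^bsub>GL n\<^esub> A \<in> carrier (GL n)"
  using group.inv_closed[OF GL_group] by blast

lemma GL_l_inv: "A \<in> carrier (GL n) \<Longrightarrow> inv\<^bsub>GL n\<^esub> A * A = 1\<^sub>m n"
  using group.l_inv[OF GL_group, of A n] by simp

lemma GL_r_inv: "A \<in> carrier (GL n) \<Longrightarrow> A * inv\<^bsub>GL n\<^esub> A = 1\<^sub>m n"
  using group.r_inv[OF GL_group, of A n] by simp

lemma GL_assoc: "A \<in> carrier (GL n) \<Longrightarrow> B \<in> carrier (GL n) \<Longrightarrow> C \<in> carrier (GL n) \<Longrightarrow> A * B * C = A * (B * C)"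
  by (metis GL_carrier_mat assoc_mult_mat)

lemma GL_mult_one [simp]: "A \<in> carrier (GL n) \<Longrightarrow> A * 1\<^sub>m n = A" "A \<in> carrier (GL n) \<Longrightarrow> 1\<^sub>m n * A = A"
  by (auto dest: GL_carrier_mat)

lemma GL_inv_cancel:
  assumes "A \<in> carrier (GL n)" "B \<in> carrier (GL n)"
  shows "inv\<^bsub>GL n\<^esub> A * (A * B) = B" "A * (inv\<^bsub>GL n\<^esub> A * B) = B"
    "B * A * inv\<^bsub>GL n\<^esub> A = B" "B * inv\<^bsub>GL n\<^esub> A * A = B"
  using assms GL_inv_closed[OF assms(1)]
  by (simp_all add: GL_assoc[symmetric] GL_l_inv GL_r_inv)
    (simp_all add: GL_assoc GL_l_inv GL_r_inv)

lemma GL_inv_eq: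
  assumes "A \<in> carrier (GL n)" "B \<in> carrier (GL n)" "A * B = 1\<^sub>m n"
  shows "inv\<^bsub>GL n\<^esub> A = B"
  using assms GL_inv_cancel(1)[OF assms(1,2)]
    GL_inv_closed[OF assms(1)] by simp

text \<open>The initial topology for a family of coordinate functions. \<open>GL_top\<close> and
  \<open>vec_top\<close> are both of this kind, so one criterion reduces continuity into either of
  them to continuity of the entries.\<close>

definition coord_top :: "'x set \<Rightarrow> 'i set \<Rightarrow> ('i \<Rightarrow> 'x \<Rightarrow> 'f::topological_space) \<Rightarrow> 'x topology" where
  "coord_top S I c = pullback_topology S (\<lambda>x. \<lambda>i\<in>I. c i x) (product_topology (\<lambda>_. euclidean) I)"

lemma topspace_coord_top [simp]: "topspace (coord_top S I c) = S"
  by (auto simp: coord_top_def topspace_pullback_topology)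

lemma continuous_map_coord_top:
  "continuous_map X (coord_top S I c) F \<longleftrightarrow>
     F \<in> topspace X \<rightarrow> S \<and> (\<forall>i\<in>I. continuous_map X euclidean (\<lambda>x. c i (F x)))"
proof
  let ?P = "product_topology (\<lambda>_. euclidean) I"
  assume L: "continuous_map X (coord_top S I c) F"
  then have F: "F \<in> topspace X \<rightarrow> S"
    using continuous_map_funspace by fastforce
  have "continuous_map X euclidean (\<lambda>x. c i (F x))" if i: "i \<in> I" for i
  proof -
    have "continuous_map (coord_top S I c) euclidean ((\<lambda>f. f i) \<circ> (\<lambda>x. \<lambda>i\<in>I. c i x))"
      unfolding coord_top_def
      by (rule continuous_map_pullback[OF continuous_map_product_projection[OF i]])
    from continuous_map_compose[OF L this] show ?thesis using i by (simp add: comp_def)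
  qed
  with F show "F \<in> topspace X \<rightarrow> S \<and> (\<forall>i\<in>I. continuous_map X euclidean (\<lambda>x. c i (F x)))" by blast
next
  let ?P = "product_topology (\<lambda>_. euclidean) I"
  assume R: "F \<in> topspace X \<rightarrow> S \<and> (\<forall>i\<in>I. continuous_map X euclidean (\<lambda>x. c i (F x)))"
  show "continuous_map X (coord_top S I c) F"
    unfolding coord_top_def
  proof (rule continuous_map_pullback')
    show "continuous_map X ?P ((\<lambda>x. \<lambda>i\<in>I. c i x) \<circ> F)"
      using R by (auto simp: continuous_map_componentwise comp_def)
    show "topspace X \<subseteq> F -` S" using R by auto
  qed
qed

lemma continuous_map_coord: "i \<in> I \<Longrightarrow> continuous_map (coord_top S I c) euclidean (c i)"
  using continuous_map_coord_top[of "coord_top S I c" S I c id] continuous_map_id by auto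

lemma GL_top_coord: "GL_top n = coord_top (carrier (GL n)) ({..<n} \<times> {..<n}) (\<lambda>ij A. A $$ ij)"
  by (simp add: GL_top_def coord_top_def)

lemma vec_top_coord: "vec_top n = coord_top (carrier_vec n) {..<n} (\<lambda>i x. x $ i)"
  by (simp add: vec_top_def coord_top_def)

lemma topspace_GL_top [simp]: "topspace (GL_top n) = carrier (GL n)"
  by (simp add: GL_top_coord)

lemma topspace_vec_top [simp]: "topspace (vec_top n) = carrier_vec n"
  by (simp add: vec_top_coord)

lemma continuous_map_GL_top:
  "continuous_map X (GL_top n) F \<longleftrightarrow> F \<in> topspace X \<rightarrow> carrier (GL n) \<and>
     (\<forall>i<n. \<forall>j<n. continuous_map X euclidean (\<lambda>x. F x $$ (i, j)))"
  by (auto simp: GL_top_coord continuous_map_coord_top)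

lemma continuous_map_GL_entry:
  "i < n \<Longrightarrow> j < n \<Longrightarrow> continuous_map (GL_top n) euclidean (\<lambda>A. A $$ (i, j))"
  using continuous_map_coord[of "(i, j)" "{..<n} \<times> {..<n}"] by (simp add: GL_top_coord)

lemma continuous_map_vec_entry: "i < n \<Longrightarrow> continuous_map (vec_top n) euclidean (\<lambda>x. x $ i)"
  using continuous_map_coord[of i "{..<n}"] by (simp add: vec_top_coord)

lemma GL_mult_index:
  assumes "A \<in> carrier (GL n)" "B \<in> carrier (GL n)" "i < n" "j < n"
  shows "(A * B) $$ (i, j) = (\<Sum>k\<in>{0..<n}. A $$ (i, k) * B $$ (k, j))"
  using assms by (simp add: scalar_prod_def)

lemma continuous_map_mat_mult:
  fixes F G :: "'a \<Rightarrow> 'f::nonarch_local_field mat"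
  assumes F: "continuous_map X (GL_top n) F" and G: "continuous_map X (GL_top n) G"
  shows "continuous_map X (GL_top n) (\<lambda>x. F x * G x)"
  unfolding continuous_map_GL_top
proof (intro conjI allI impI)
  have FG: "F x \<in> carrier (GL n)" "G x \<in> carrier (GL n)" if "x \<in> topspace X" for x
    using F G that by (auto simp: continuous_map_GL_top)
  show "(\<lambda>x. F x * G x) \<in> topspace X \<rightarrow> carrier (GL n)"
    using FG by blast
  fix i j assume ij: "i < n" "j < n"
  have "continuous_map X euclidean (\<lambda>x. \<Sum>k\<in>{0..<n}. F x $$ (i, k) * G x $$ (k, j))"
    using F G ij by (intro continuous_map_sum_nonarch continuous_map_mult_nonarch) (auto simp: continuous_map_GL_top)
  then show "continuous_map X euclidean (\<lambda>x. (F x * G x) $$ (i, j))"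
    by (rule continuous_map_eq) (simp add: GL_mult_index[OF FG ij])
qed

lemma continuous_map_det:
  fixes F :: "'a \<Rightarrow> 'f::nonarch_local_field mat"
  assumes F: "\<And>x. x \<in> topspace X \<Longrightarrow> F x \<in> carrier_mat n n"
    and c: "\<And>i j. i < n \<Longrightarrow> j < n \<Longrightarrow> continuous_map X euclidean (\<lambda>x. F x $$ (i, j))"
  shows "continuous_map X euclidean (\<lambda>x. det (F x))"
proof -
  have "continuous_map X euclidean
      (\<lambda>x. \<Sum>p | p permutes {0..<n}. signof p * (\<Prod>i = 0..<n. F x $$ (i, p i)))"
    by (intro continuous_map_sum_nonarch continuous_map_mult_nonarch continuous_map_prod_nonarch c)
      (auto simp: permutes_in_image)
  then show ?thesis
    by (rule continuous_map_eq) (simp add: det_def'[OF F])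
qed

text \<open>The adjugate formula shows the entries of the inverse as polynomials in the entries
  divided by the determinant, which is how inversion is seen to be continuous.\<close>

lemma GL_inv_adj:
  assumes A: "A \<in> carrier (GL n)"
  shows "inv\<^bsub>GL n\<^esub> A = inverse (det A) \<cdot>\<^sub>m adj_mat A"
proof (rule GL_inv_eq[OF A])
  have c: "A \<in> carrier_mat n n" using A GL_carrier_mat by blast
  have adj: "adj_mat A \<in> carrier_mat n n" using adj_mat(1)[OF c] .
  show 1: "A * (inverse (det A) \<cdot>\<^sub>m adj_mat A) = 1\<^sub>m n"
    using adj_mat(2)[OF c] GL_det[OF A] by (auto simp: mult_smult_distrib[OF c adj] intro!: eq_matI)
  have B: "inverse (det A) \<cdot>\<^sub>m adj_mat A \<in> carrier_mat n n" using adj by simp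
  have "det A * det (inverse (det A) \<cdot>\<^sub>m adj_mat A) = 1"
    using det_mult[OF c B] 1 by simp
  then show "inverse (det A) \<cdot>\<^sub>m adj_mat A \<in> carrier (GL n)"
    using B by (auto simp: carrier_GL)
qed

lemma continuous_map_mat_inv:
  "continuous_map (GL_top n) (GL_top n) (\<lambda>A. inv\<^bsub>GL n\<^esub> A :: 'f::nonarch_local_field mat)"
  unfolding continuous_map_GL_top
proof (intro conjI allI impI)
  show "(\<lambda>A::'f mat. inv\<^bsub>GL n\<^esub> A) \<in> topspace (GL_top n) \<rightarrow> carrier (GL n)"
    by (simp add: Pi_iff GL_inv_closed)
  fix i j assume ij: "i < n" "j < n"
  have "continuous_map (GL_top n) euclidean (\<lambda>A::'f mat. det (mat_delete A j i))"
  proof (rule continuous_map_det[where n="n - 1"])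
    show "mat_delete A j i \<in> carrier_mat (n - 1) (n - 1)" if "A \<in> topspace (GL_top n)" for A :: "'f mat"
      using that by (simp add: mat_delete_def)
    fix i' j' assume ij': "i' < n - 1" "j' < n - 1"
    have "continuous_map (GL_top n) euclidean
        (\<lambda>A::'f mat. A $$ (if i' < j then i' else Suc i', if j' < i then j' else Suc j'))"
      using ij' by (intro continuous_map_GL_entry) auto
    then show "continuous_map (GL_top n) euclidean (\<lambda>A::'f mat. mat_delete A j i $$ (i', j'))"
      by (rule continuous_map_eq) (use ij' in \<open>simp add: mat_delete_def\<close>)
  qed
  moreover have "continuous_map (GL_top n) euclidean (\<lambda>A::'f mat. det A)"
    by (rule continuous_map_det[where n=n]) (simp_all add: GL_carrier_mat continuous_map_GL_entry)
  ultimately have "continuous_map (GL_top n) euclidean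
     (\<lambda>A::'f mat. inverse (det A) * ((-1) ^ (j + i) * det (mat_delete A j i)))"
    by (intro continuous_map_mult_nonarch continuous_map_inverse_nonarch) (auto simp: GL_det)
  then show "continuous_map (GL_top n) euclidean (\<lambda>A::'f mat. (inv\<^bsub>GL n\<^esub> A) $$ (i, j))"
    by (rule continuous_map_eq) (use ij in \<open>auto simp: GL_inv_adj adj_mat_def cofactor_def\<close>)
qed

lemma compactin_bounded:
  fixes f :: "'a \<Rightarrow> 'f::nonarch_local_field"
  assumes "compactin X C" "continuous_map X euclidean f"
  shows "\<exists>M. \<forall>x\<in>C. nabs (f x) \<le> M"
proof -
  have "compact (f ` C)"
    using image_compactin[OF assms] by simp
  then have "bounded (f ` C)" by (rule compact_imp_bounded)
  then obtain M where "\<forall>y\<in>f ` C. dist 0 y \<le> M" using bounded_any_center by blast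
  then show ?thesis by (auto simp: dist_nabs)
qed

text \<open>The sum of the individual bounds serves for all coordinates at once. In this form
  compactness in GL_n or F^r becomes a bound on entries.\<close>

lemma compactin_bounded_finite:
  fixes f :: "'i \<Rightarrow> 'a \<Rightarrow> 'f::nonarch_local_field"
  assumes C: "compactin X C" and "finite I" and f: "\<And>i. i \<in> I \<Longrightarrow> continuous_map X euclidean (f i)"
  shows "\<exists>M\<ge>0. \<forall>i\<in>I. \<forall>x\<in>C. nabs (f i x) \<le> M"
proof -
  have "\<forall>i\<in>I. \<exists>M. \<forall>x\<in>C. nabs (f i x) \<le> M" using compactin_bounded[OF C f] by blast
  then obtain M where M: "\<forall>i\<in>I. \<forall>x\<in>C. nabs (f i x) \<le> M i" by metis
  have "nabs (f i x) \<le> (\<Sum>i\<in>I. \<bar>M i\<bar>)" if "i \<in> I" "x \<in> C" for i x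
  proof -
    have "M i \<le> \<bar>M i\<bar>" by simp
    also have "\<dots> \<le> (\<Sum>i\<in>I. \<bar>M i\<bar>)" using \<open>finite I\<close> that by (intro member_le_sum) auto
    finally show ?thesis using M that by force
  qed
  then show ?thesis by (intro exI[of _ "\<Sum>i\<in>I. \<bar>M i\<bar>"]) (auto intro: sum_nonneg)
qed

lemma compactin_GL_mult:
  fixes C D :: "'f::nonarch_local_field mat set"
  assumes "compactin (GL_top n) C" "compactin (GL_top n) D"
  shows "compactin (GL_top n) {a * b | a b. a \<in> C \<and> b \<in> D}"
proof -
  have "compactin (prod_topology (GL_top n) (GL_top n)) (C \<times> D)"
    using assms by (simp add: compactin_Times)
  moreover have "continuous_map (prod_topology (GL_top n) (GL_top n)) (GL_top n) (\<lambda>z::'f mat \<times> 'f mat. fst z * snd z)"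
    by (intro continuous_map_mat_mult continuous_map_fst continuous_map_snd)
  ultimately have "compactin (GL_top n) ((\<lambda>z. fst z * snd z) ` (C \<times> D))"
    using image_compactin by blast
  moreover have "(\<lambda>z. fst z * snd z) ` (C \<times> D) = {a * b | a b. a \<in> C \<and> b \<in> D}" by force
  ultimately show ?thesis by simp
qed

lemma continuous_map_GL_translate:
  fixes a b :: "'f::nonarch_local_field mat"
  assumes "a \<in> carrier (GL n)" "b \<in> carrier (GL n)"
  shows "continuous_map (GL_top n) (GL_top n) (\<lambda>g. a * g * b)"
  using assms by (intro continuous_map_mat_mult) (auto simp: id_def[symmetric])

section \<open>Boxes in F^r, uniform local constancy and Schwartz functions\<close>

definition box :: "nat \<Rightarrow> real \<Rightarrow> 'f::nonarch_local_field vec set" where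
  "box r \<rho> = {x \<in> carrier_vec r. \<forall>i<r. nabs (x $ i) \<le> \<rho>}"

lemma box_carrier: "x \<in> box r \<rho> \<Longrightarrow> x \<in> carrier_vec r"
  by (simp add: box_def)

lemma zero_in_box [simp]: "0 \<le> \<rho> \<Longrightarrow> 0\<^sub>v r \<in> box r \<rho>"
  by (simp add: box_def)

lemma box_add: "x \<in> box r \<rho> \<Longrightarrow> y \<in> box r \<rho> \<Longrightarrow> x + y \<in> box r \<rho>"
proof -
  assume x: "x \<in> box r \<rho>" and y: "y \<in> box r \<rho>"
  have "nabs ((x + y) $ i) \<le> \<rho>" if "i < r" for i
    using nabs_add_le[of "x $ i" \<rho> "y $ i"] x y that by (auto simp: box_def)
  then show ?thesis using x y by (auto simp: box_def)
qed

lemma box_uminus [simp]: "x \<in> carrier_vec r \<Longrightarrow> - x \<in> box r \<rho> \<longleftrightarrow> x \<in> box r \<rho>"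
  by (auto simp: box_def)

lemma box_diff: "x \<in> box r \<rho> \<Longrightarrow> y \<in> box r \<rho> \<Longrightarrow> x - y \<in> box r \<rho>"
proof -
  assume x: "x \<in> box r \<rho>" and y: "y \<in> box r \<rho>"
  have "nabs ((x - y) $ i) \<le> \<rho>" if "i < r" for i
    using nabs_diff_le[of "x $ i" \<rho> "y $ i"] x y that by (auto simp: box_def)
  then show ?thesis using x y by (auto simp: box_def)
qed

lemma box_mono: "\<rho> \<le> \<sigma> \<Longrightarrow> box r \<rho> \<subseteq> box r \<sigma>"
  by (fastforce simp: box_def)

text \<open>By the ultrametric inequality a box is an additive subgroup, so translation by one of
  its elements neither enters nor leaves it. Cosets of boxes therefore partition F^r, and functions
  constant on them replace all limit arguments.\<close>

lemma box_add_iff: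
  assumes "d \<in> box r \<rho>" "x \<in> carrier_vec r"
  shows "x + d \<in> box r \<rho> \<longleftrightarrow> x \<in> box r \<rho>"
proof
  assume "x + d \<in> box r \<rho>"
  then have "(x + d) - d \<in> box r \<rho>" using assms box_diff by blast
  moreover have "(x + d) - d = x" using assms by (intro eq_vecI) (auto simp: box_def)
  ultimately show "x \<in> box r \<rho>" by simp
qed (use assms box_add in blast)

lemma vec_minus_plus: "x \<in> carrier_vec r \<Longrightarrow> y \<in> carrier_vec r \<Longrightarrow> x + (y - x) = (y :: 'f::nonarch_local_field vec)"
  by (intro eq_vecI) auto

text \<open>Boxes are a neighbourhood basis of 0: a product of finitely many balls contains the box
  of the least radius, and a box is itself a product of open balls.\<close>

lemma openin_vec_top:
  fixes U :: "'f::nonarch_local_field vec set"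
  shows "openin (vec_top r) U \<longleftrightarrow>
     U \<subseteq> carrier_vec r \<and> (\<forall>x\<in>U. \<exists>\<rho>>0. \<forall>d\<in>box r \<rho>. x + d \<in> U)"
proof (intro iffI conjI ballI)
  assume U: "openin (vec_top r) U"
  then show "U \<subseteq> carrier_vec r" using openin_subset by fastforce
  fix x assume x: "x \<in> U"
  let ?c = "\<lambda>x::'f vec. \<lambda>i\<in>{..<r}. x $ i"
  obtain W where W: "openin (product_topology (\<lambda>_. euclidean) {..<r}) W" "U = ?c -` W \<inter> carrier_vec r"
    using U unfolding vec_top_def openin_pullback_topology by blast
  then obtain X where X: "?c x \<in> Pi\<^sub>E {..<r} X" "\<And>i. open (X i)" "Pi\<^sub>E {..<r} X \<subseteq> W"
    using product_topology_open_contains_basis[OF W(1), of "?c x"] x by auto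
  have "\<exists>e>0. \<forall>y. dist y (x $ i) < e \<longrightarrow> y \<in> X i" if "i < r" for i
  proof -
    have "?c x i \<in> X i" using X(1) that by (meson PiE_mem lessThan_iff)
    then have "x $ i \<in> X i" using that by simp
    then show ?thesis using X(2)[of i] unfolding open_dist by blast
  qed
  then obtain e where e: "\<And>i. i < r \<Longrightarrow> e i > 0" "\<And>i y. i < r \<Longrightarrow> dist y (x $ i) < e i \<Longrightarrow> y \<in> X i"
    by metis
  \<comment> \<open>Inserting 1 keeps the minimum over a nonempty set when r = 0; halving makes the
    resulting bound strict.\<close>
  define \<rho> where "\<rho> = Min (insert 1 (e ` {..<r})) / 2"
  have pos: "Min (insert 1 (e ` {..<r})) > 0" using e(1) by (subst Min_gr_iff) auto
  have \<rho>: "\<rho> < e i" if "i < r" for i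
  proof -
    have "Min (insert 1 (e ` {..<r})) \<le> e i" using that by (intro Min_le) auto
    then show ?thesis using pos \<rho>_def by linarith
  qed
  show "\<exists>\<rho>>0. \<forall>d\<in>box r \<rho>. x + d \<in> U"
  proof (intro exI[of _ \<rho>] conjI ballI)
    show "\<rho> > 0" using pos by (simp add: \<rho>_def)
    fix d :: "'f vec" assume d: "d \<in> box r \<rho>"
    have xc: "x \<in> carrier_vec r" using x W(2) by simp
    have "(x + d) $ i \<in> X i" if "i < r" for i
    proof (rule e(2)[OF that])
      have "nabs (d $ i) \<le> \<rho>" using d that by (simp add: box_def)
      then have "nabs (d $ i) < e i" using \<rho>[OF that] by linarith
      then show "dist ((x + d) $ i) (x $ i) < e i"
        using d that xc by (auto simp: dist_nabs box_def)
    qed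
    then have "?c (x + d) \<in> Pi\<^sub>E {..<r} X" by auto
    moreover have "x + d \<in> carrier_vec r" using xc d by (auto simp: box_def)
    ultimately show "x + d \<in> U" using W(2) X(3) by blast
  qed
next
  assume R: "U \<subseteq> carrier_vec r \<and> (\<forall>x\<in>U. \<exists>\<rho>>0. \<forall>d\<in>box r \<rho>. x + d \<in> U)"
  let ?c = "\<lambda>x::'f vec. \<lambda>i\<in>{..<r}. x $ i"
  show "openin (vec_top r) U"
  proof (subst openin_subopen, intro ballI)
    fix x assume x: "x \<in> U"
    then have xc: "x \<in> carrier_vec r" using R by blast
    from x R obtain \<rho> where \<rho>: "\<rho> > 0" "\<And>d. d \<in> box r \<rho> \<Longrightarrow> x + d \<in> U" by blast
    let ?W = "Pi\<^sub>E {..<r} (\<lambda>i. {y. nabs (y - x $ i) \<le> \<rho>})"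
    have "openin (product_topology (\<lambda>_. euclidean) {..<r}) ?W"
      using open_nabs_le[OF \<rho>(1)] by (subst openin_PiE) auto
    then have "openin (vec_top r) (?c -` ?W \<inter> carrier_vec r)"
      unfolding vec_top_def openin_pullback_topology by blast
    moreover have "x \<in> ?c -` ?W \<inter> carrier_vec r" using xc \<rho> by (simp add: restrict_PiE_iff)
    moreover have "?c -` ?W \<inter> carrier_vec r \<subseteq> U"
    proof
      fix y assume y: "y \<in> ?c -` ?W \<inter> carrier_vec r"
      then have "y - x \<in> box r \<rho>" using xc by (auto simp: box_def restrict_PiE_iff)
      then show "y \<in> U" using \<rho>(2) vec_minus_plus[OF xc, of y] y by fastforce
    qed
    ultimately show "\<exists>T. openin (vec_top r) T \<and> x \<in> T \<and> T \<subseteq> U" by blast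
  qed
qed

lemma compactin_box: "compactin (vec_top r) (box r M :: 'f::nonarch_local_field vec set)"
proof -
  let ?P = "product_topology (\<lambda>_. euclidean :: 'f topology) {..<r}"
  have "compactin ?P (Pi\<^sub>E {..<r} (\<lambda>_. {x. nabs x \<le> M}))"
    using compact_nabs_le[of M] by (auto simp: compactin_PiE)
  moreover have "continuous_map ?P (vec_top r) (\<lambda>g. vec r g)"
    unfolding vec_top_coord continuous_map_coord_top
  proof (intro conjI ballI)
    fix i assume i: "i \<in> {..<r}"
    show "continuous_map ?P euclidean (\<lambda>g. vec r g $ i)"
      using continuous_map_product_projection[OF i, of "\<lambda>_. euclidean :: 'f topology"] i by simp
  qed auto
  ultimately have "compactin (vec_top r) (vec r ` Pi\<^sub>E {..<r} (\<lambda>_. {x::'f. nabs x \<le> M}))"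
    by (rule image_compactin)
  moreover have "vec r ` Pi\<^sub>E {..<r} (\<lambda>_. {x::'f. nabs x \<le> M}) = box r M"
  proof (intro Set.equalityI subsetI)
    fix x :: "'f vec" assume x: "x \<in> box r M"
    then have "x = vec r (\<lambda>i\<in>{..<r}. x $ i)" by (intro eq_vecI) (auto simp: box_def)
    moreover have "(\<lambda>i\<in>{..<r}. x $ i) \<in> Pi\<^sub>E {..<r} (\<lambda>_. {x::'f. nabs x \<le> M})"
      using x by (auto simp: box_def)
    ultimately show "x \<in> vec r ` Pi\<^sub>E {..<r} (\<lambda>_. {x::'f. nabs x \<le> M})" by (rule image_eqI)
  next
    fix x :: "'f vec" assume "x \<in> vec r ` Pi\<^sub>E {..<r} (\<lambda>_. {x::'f. nabs x \<le> M})"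
    then obtain g where "x = vec r g" "g \<in> Pi\<^sub>E {..<r} (\<lambda>_. {x::'f. nabs x \<le> M})" by blast
    then show "x \<in> box r M" by (simp add: box_def PiE_iff)
  qed
  ultimately show ?thesis by simp
qed

lemma compactin_vec_top_bounded:
  fixes C :: "'f::nonarch_local_field vec set"
  assumes "compactin (vec_top r) C"
  shows "\<exists>M. C \<subseteq> box r M"
proof -
  obtain M where "\<forall>i\<in>{..<r}. \<forall>x\<in>C. nabs (x $ i) \<le> M"
    using compactin_bounded_finite[OF assms, of "{..<r}" "\<lambda>i x. x $ i"] continuous_map_vec_entry by auto
  moreover have "C \<subseteq> carrier_vec r" using assms compactin_subset_topspace by fastforce
  ultimately show ?thesis by (intro exI[of _ M]) (auto simp: box_def)
qed

lemma closedin_box: "0 < M \<Longrightarrow> closedin (vec_top r) (box r M :: 'f::nonarch_local_field vec set)"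
  unfolding closedin_def
proof (intro conjI)
  assume M: "0 < M"
  show "openin (vec_top r) (topspace (vec_top r) - (box r M :: 'f vec set))"
    unfolding openin_vec_top
  proof (intro conjI ballI)
    fix x :: "'f vec" assume x: "x \<in> topspace (vec_top r) - box r M"
    show "\<exists>\<rho>>0. \<forall>d\<in>box r \<rho>. x + d \<in> topspace (vec_top r) - box r M"
      using x M by (intro exI[of _ M]) (auto simp: box_add_iff box_carrier)
  qed auto
qed (auto simp: box_def)

definition loc_const :: "nat \<Rightarrow> real \<Rightarrow> ('f::nonarch_local_field vec \<Rightarrow> 'w) \<Rightarrow> bool" where
  "loc_const r \<rho> \<Phi> \<longleftrightarrow> (\<forall>x\<in>carrier_vec r. \<forall>d\<in>box r \<rho>. \<Phi> (x + d) = \<Phi> x)"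

definition supported :: "nat \<Rightarrow> real \<Rightarrow> 'w \<Rightarrow> ('f::nonarch_local_field vec \<Rightarrow> 'w) \<Rightarrow> bool" where
  "supported r M z \<Phi> \<longleftrightarrow> (\<forall>x\<in>carrier_vec r. \<Phi> x \<noteq> z \<longrightarrow> x \<in> box r M)"

lemma loc_const_mono: "loc_const r \<rho> \<Phi> \<Longrightarrow> \<sigma> \<le> \<rho> \<Longrightarrow> loc_const r \<sigma> \<Phi>"
  unfolding loc_const_def using box_mono by blast

lemma supported_mono: "supported r M z \<Phi> \<Longrightarrow> M \<le> N \<Longrightarrow> supported r N z \<Phi>"
  unfolding supported_def using box_mono by blast

text \<open>Compactness of \<open>box r M\<close>, applied to the cover by the cosets
  \<open>x + box r (e x)\<close>, which are open because boxes are open subgroups.\<close>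

lemma finite_box_cover:
  fixes e :: "'f::nonarch_local_field vec \<Rightarrow> real"
  assumes e: "\<And>x. x \<in> box r M \<Longrightarrow> 0 < e x"
  shows "\<exists>F. finite F \<and> F \<subseteq> box r M \<and> (\<forall>y\<in>box r M. \<exists>x\<in>F. y - x \<in> box r (e x))"
proof -
  let ?U = "\<lambda>x. {y \<in> carrier_vec r. y - x \<in> box r (e x)}"
  have op: "openin (vec_top r) (?U x)" if x: "x \<in> box r M" for x
    unfolding openin_vec_top
  proof (intro conjI ballI)
    fix y assume y: "y \<in> ?U x"
    have "y + d \<in> ?U x" if d: "d \<in> box r (e x)" for d
    proof -
      have "(y + d) - x = (y - x) + d" using x y d by (intro eq_vecI) (auto simp: box_def)
      then show ?thesis using y d by (auto intro: box_add dest: box_carrier)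
    qed
    then show "\<exists>\<rho>>0. \<forall>d\<in>box r \<rho>. y + d \<in> ?U x" using e[OF x] by blast
  qed auto
  have "x \<in> ?U x" if x: "x \<in> box r M" for x
  proof -
    have "x - x = 0\<^sub>v r" using x by (auto simp: box_def)
    then show ?thesis using x e[OF x] by (auto dest: box_carrier)
  qed
  then have "box r M \<subseteq> \<Union> (?U ` box r M)" by blast
  then obtain \<F> where F: "finite \<F>" "\<F> \<subseteq> ?U ` box r M" "box r M \<subseteq> \<Union>\<F>"
    using compactinD[OF compactin_box[of r M], of "?U ` box r M"] op by auto
  then obtain F where "F \<subseteq> box r M" "finite F" "\<F> = ?U ` F"
    using finite_subset_image[of \<F> ?U "box r M"] by blast
  then show ?thesis using F(3) by (intro exI[of _ F]) auto
qed

text \<open>A Lebesgue number argument: finitely many cosets on which \<Phi> is constant cover the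
  supporting box, and their smallest radius works there. Outside that box the function stays at z,
  since small translations do not enter it.\<close>

lemma loc_const_uniform:
  fixes \<Phi> :: "'f::nonarch_local_field vec \<Rightarrow> 'w"
  assumes lc: "\<And>x. x \<in> carrier_vec r \<Longrightarrow> \<exists>\<rho>>0. \<forall>d\<in>box r \<rho>. \<Phi> (x + d) = \<Phi> x"
    and sup: "supported r M z \<Phi>"
  shows "\<exists>\<rho>>0. loc_const r \<rho> \<Phi>"
proof -
  obtain e where e: "\<And>x. x \<in> carrier_vec r \<Longrightarrow> 0 < e x"
    "\<And>x d. x \<in> carrier_vec r \<Longrightarrow> d \<in> box r (e x) \<Longrightarrow> \<Phi> (x + d) = \<Phi> x"
  proof -
    have "\<forall>x\<in>carrier_vec r. \<exists>\<rho>. 0 < \<rho> \<and> (\<forall>d\<in>box r \<rho>. \<Phi> (x + d) = \<Phi> x)" using lc by auto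
    then obtain e where "\<forall>x\<in>carrier_vec r. 0 < e x \<and> (\<forall>d\<in>box r (e x). \<Phi> (x + d) = \<Phi> x)"
      by (rule bchoice[THEN exE])
    then show ?thesis using that by blast
  qed
  \<comment> \<open>A positive radius is needed because \<open>?M\<close> is one of the numbers
    whose minimum defines \<rho>.\<close>
  let ?M = "max M 1"
  have sup': "supported r ?M z \<Phi>" using sup by (rule supported_mono) simp
  obtain F :: "'f vec set" where F: "finite F" "F \<subseteq> box r ?M" "\<forall>y\<in>box r ?M. \<exists>x\<in>F. y - x \<in> box r (e x)"
  proof -
    have "\<exists>F. finite F \<and> F \<subseteq> box r ?M \<and> (\<forall>y\<in>box r ?M. \<exists>x\<in>F. y - x \<in> box r (e x))"
      by (rule finite_box_cover, rule e(1), erule box_carrier)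
    then show ?thesis using that by (elim exE conjE)
  qed
  define \<rho> where "\<rho> = Min (insert ?M (e ` F))"
  have \<rho>: "0 < \<rho>" "\<rho> \<le> ?M" "\<And>x. x \<in> F \<Longrightarrow> \<rho> \<le> e x"
  proof -
    have "\<forall>y\<in>insert ?M (e ` F). 0 < y" using e(1)[OF box_carrier[OF subsetD[OF F(2)]]] by auto
    then show "0 < \<rho>" unfolding \<rho>_def using F(1) by (subst Min_gr_iff) auto
    show "\<rho> \<le> ?M" unfolding \<rho>_def using F(1) by (intro Min_le) auto
    show "\<rho> \<le> e x" if "x \<in> F" for x unfolding \<rho>_def using F(1) that by (intro Min_le) auto
  qed
  have "\<Phi> (y + d) = \<Phi> y" if y: "y \<in> carrier_vec r" and d: "d \<in> box r \<rho>" for y d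
  proof (cases "y \<in> box r ?M")
    case True
    then obtain x where x: "x \<in> F" "y - x \<in> box r (e x)" by (rule bexE[OF bspec[OF F(3)]])
    have xc: "x \<in> carrier_vec r" using x(1) F(2) box_carrier by blast
    have dx: "d \<in> box r (e x)" using d \<rho>(3)[OF x(1)] box_mono by blast
    have "\<Phi> (x + (y - x)) = \<Phi> x" by (rule e(2)[OF xc x(2)])
    moreover have "\<Phi> (x + ((y - x) + d)) = \<Phi> x" by (rule e(2)[OF xc box_add[OF x(2) dx]])
    moreover have "x + ((y - x) + d) = y + d" using xc y box_carrier[OF d] by (intro eq_vecI) auto
    ultimately show ?thesis using vec_minus_plus[OF xc y] by simp
  next
    case False
    have "d \<in> box r ?M" using d \<rho>(2) box_mono by blast
    then have "y + d \<notin> box r ?M" using False y by (simp add: box_add_iff)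
    moreover have "y + d \<in> carrier_vec r" using y box_carrier[OF d] by simp
    ultimately show ?thesis using False y sup' unfolding supported_def by metis
  qed
  then show ?thesis using \<rho>(1) unfolding loc_const_def by blast
qed

text \<open>Bounded and compact support agree because boxes are compact and closed, and local
  constancy is uniform by \<open>loc_const_uniform\<close>. The topological definition is thereby
  replaced by two explicit radii.\<close>

lemma schwartz_iff:
  fixes f :: "'f::nonarch_local_field vec \<Rightarrow> complex"
  shows "f \<in> schwartz r \<longleftrightarrow> f \<in> extensional (carrier_vec r) \<and>
     (\<exists>\<rho>>0. loc_const r \<rho> f) \<and> (\<exists>M. supported r M 0 f)"
proof (intro iffI conjI)
  assume f: "f \<in> schwartz r"
  then show "f \<in> extensional (carrier_vec r)" by (simp add: schwartz_def)
  have sub: "{x \<in> carrier_vec r. f x \<noteq> 0} \<subseteq> vec_top r closure_of {x \<in> carrier_vec r. f x \<noteq> 0}"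
    by (rule closure_of_subset) auto
  moreover have "compactin (vec_top r) (vec_top r closure_of {x \<in> carrier_vec r. f x \<noteq> 0})"
    using f by (simp add: schwartz_def)
  ultimately obtain M where M: "supported r M 0 f"
    using compactin_vec_top_bounded unfolding supported_def by blast
  then show "\<exists>M. supported r M 0 f" by blast
  show "\<exists>\<rho>>0. loc_const r \<rho> f"
  proof (rule loc_const_uniform[OF _ M])
    fix x :: "'f vec" assume "x \<in> carrier_vec r"
    then obtain U where "openin (vec_top r) U" "x \<in> U" "\<forall>y\<in>U. f y = f x"
      using f unfolding schwartz_def by blast
    then show "\<exists>\<rho>>0. \<forall>d\<in>box r \<rho>. f (x + d) = f x" unfolding openin_vec_top by meson
  qed
next
  assume R: "f \<in> extensional (carrier_vec r) \<and> (\<exists>\<rho>>0. loc_const r \<rho> f) \<and> (\<exists>M. supported r M 0 f)"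
  then obtain \<rho> M where \<rho>: "0 < \<rho>" "loc_const r \<rho> f" and M0: "supported r M 0 f" by blast
  define N where "N = max M 1"
  have N: "0 < N" "supported r N 0 f" using supported_mono[OF M0, of N] by (auto simp: N_def)
  have "vec_top r closure_of {x \<in> carrier_vec r. f x \<noteq> 0} \<subseteq> box r N"
    using N by (intro closure_of_minimal closedin_box) (auto simp: supported_def)
  then have "compactin (vec_top r) (vec_top r closure_of {x \<in> carrier_vec r. f x \<noteq> 0})"
    by (rule closed_compactin[OF compactin_box]) simp
  moreover have "\<exists>U. openin (vec_top r) U \<and> x \<in> U \<and> (\<forall>y\<in>U. f y = f x)" if x: "x \<in> carrier_vec r" for x
  proof (intro exI[of _ "{y \<in> carrier_vec r. f y = f x}"] conjI)
    have "\<exists>\<rho>>0. \<forall>d\<in>box r \<rho>. y + d \<in> {y \<in> carrier_vec r. f y = f x}"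
      if y: "y \<in> {y \<in> carrier_vec r. f y = f x}" for y
      using y \<rho> by (intro exI[of _ \<rho>]) (auto simp: loc_const_def dest: box_carrier)
    then show "openin (vec_top r) {y \<in> carrier_vec r. f y = f x}"
      unfolding openin_vec_top by blast
  qed (use x in auto)
  ultimately show "f \<in> schwartz r" using R by (simp add: schwartz_def)
qed

section \<open>Test functions and indicators of cosets\<close>

section \<open>Test functions\<close>

lemma real_zero_less_one: "(0::real) < 1"
  by simp

text \<open>Schwartz functions without extensionality: values outside \<open>carrier_vec r\<close>
  are free, so that sums, translates and composites can be written as plain lambda terms.\<close>

definition test_fun :: "nat \<Rightarrow> ('f::nonarch_local_field vec \<Rightarrow> complex) \<Rightarrow> bool" where
  "test_fun r f \<longleftrightarrow> (\<exists>\<rho>>0. loc_const r \<rho> f) \<and> (\<exists>M. supported r M 0 f)"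

lemma schwartz_iff_test_fun: "f \<in> schwartz r \<longleftrightarrow> f \<in> extensional (carrier_vec r) \<and> test_fun r f"
  by (auto simp: schwartz_iff test_fun_def)

lemma test_funI: "0 < \<rho> \<Longrightarrow> loc_const r \<rho> f \<Longrightarrow> supported r M 0 f \<Longrightarrow> test_fun r f"
  unfolding test_fun_def by blast

lemma test_fun_radius:
  assumes "test_fun r (f :: 'f::nonarch_local_field vec \<Rightarrow> complex)" "0 < e"
  obtains \<rho> M where "0 < \<rho>" "\<rho> \<le> e" "loc_const r \<rho> f" "0 < M" "supported r M 0 f"
proof -
  obtain \<rho> M where *: "0 < \<rho>" "loc_const r \<rho> f" "supported r M 0 f"
    using assms unfolding test_fun_def by blast
  show ?thesis
    by (rule that[of "min \<rho> e" "max M 1"])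
      (use * assms loc_const_mono[OF *(2)] supported_mono[OF *(3)] in auto)
qed

lemma test_fun_radius2:
  fixes f g :: "'f::nonarch_local_field vec \<Rightarrow> complex"
  assumes "test_fun r f" "test_fun r g" "0 < e"
  obtains \<rho> M where "0 < \<rho>" "\<rho> \<le> e" "loc_const r \<rho> f" "loc_const r \<rho> g"
    "supported r M 0 f" "supported r M 0 g"
proof -
  obtain \<rho> M where 1: "0 < \<rho>" "\<rho> \<le> e" "loc_const r \<rho> f" "0 < M" "supported r M 0 f"
    using test_fun_radius[OF assms(1,3)] by blast
  obtain \<rho>' M' where 2: "0 < \<rho>'" "\<rho>' \<le> e" "loc_const r \<rho>' g" "0 < M'" "supported r M' 0 g"
    using test_fun_radius[OF assms(2,3)] by blast
  show ?thesis
    by (rule that[of "min \<rho> \<rho>'" "max M M'"])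
      (use 1 2 loc_const_mono[OF 1(3)] loc_const_mono[OF 2(3)] supported_mono[OF 1(5)] supported_mono[OF 2(5)] in auto)
qed

lemma test_fun_add:
  fixes f g :: "'f::nonarch_local_field vec \<Rightarrow> complex"
  assumes "test_fun r f" "test_fun r g"
  shows "test_fun r (\<lambda>x. f x + g x)"
proof -
  obtain \<rho> M where 1: "0 < \<rho>" "loc_const r \<rho> f" "loc_const r \<rho> g" "supported r M 0 f" "supported r M 0 g"
    using test_fun_radius2[OF assms real_zero_less_one] by blast
  show ?thesis
    by (rule test_funI[OF 1(1), of _ _ M]) (use 1 in \<open>auto simp: loc_const_def supported_def\<close>)
qed

lemma test_fun_mult:
  fixes f \<chi> :: "'f::nonarch_local_field vec \<Rightarrow> complex"
  assumes "test_fun r f" "loc_const r \<sigma> \<chi>" "0 < \<sigma>"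
  shows "test_fun r (\<lambda>x. f x * \<chi> x)"
proof -
  obtain \<rho> M where 1: "0 < \<rho>" "\<rho> \<le> \<sigma>" "loc_const r \<rho> f" "supported r M 0 f"
    using test_fun_radius[OF assms(1,3)] by blast
  have "loc_const r \<rho> \<chi>" using loc_const_mono[OF assms(2) 1(2)] .
  then show ?thesis
    by (intro test_funI[OF 1(1), of _ _ M]) (use 1 in \<open>auto simp: loc_const_def supported_def\<close>)
qed

lemma test_fun_scale: "test_fun r f \<Longrightarrow> test_fun r (\<lambda>x. c * f x)"
  using test_fun_mult[of r f 1 "\<lambda>_. c"] by (simp add: loc_const_def mult.commute)

lemma test_fun_sum:
  fixes f :: "'i \<Rightarrow> 'f::nonarch_local_field vec \<Rightarrow> complex"
  assumes "\<And>i. i \<in> A \<Longrightarrow> test_fun r (f i)"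
  shows "test_fun r (\<lambda>x. \<Sum>i\<in>A. f i x)"
proof -
  have z: "test_fun r (\<lambda>x::'f vec. 0)" by (rule test_funI[of 1 _ _ 1]) (auto simp: loc_const_def supported_def)
  show ?thesis using assms
    by (induction A rule: infinite_finite_induct) (auto intro: test_fun_add simp: z)
qed

lemma test_fun_translate:
  fixes f :: "'f::nonarch_local_field vec \<Rightarrow> complex"
  assumes "test_fun r f" "v \<in> carrier_vec r"
  shows "test_fun r (\<lambda>x. f (x + v))"
proof -
  obtain \<rho> M where 1: "0 < \<rho>" "loc_const r \<rho> f" "supported r M 0 f"
    using test_fun_radius[OF assms(1) real_zero_less_one] by blast
  have "\<exists>N. v \<in> box r N"
    using assms(2) by (intro exI[of _ "\<Sum>i<r. nabs (v $ i)"]) (auto simp: box_def intro!: member_le_sum)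
  then obtain N where N: "v \<in> box r N" by blast
  show ?thesis
  proof (rule test_funI[OF 1(1), of _ _ "max M N"])
    show "loc_const r \<rho> (\<lambda>x. f (x + v))"
      unfolding loc_const_def
    proof (intro ballI)
      fix x d :: "'f vec" assume x: "x \<in> carrier_vec r" and d: "d \<in> box r \<rho>"
      have "x + d + v = (x + v) + d" using x box_carrier[OF d] assms(2) by (intro eq_vecI) auto
      then show "f (x + d + v) = f (x + v)"
        using 1(2) x d assms(2) unfolding loc_const_def by simp
    qed
    show "supported r (max M N) 0 (\<lambda>x. f (x + v))"
      unfolding supported_def
    proof (intro ballI impI)
      fix x :: "'f vec" assume x: "x \<in> carrier_vec r" "f (x + v) \<noteq> 0"
      then have "x + v \<in> box r M" using 1(3) assms(2) unfolding supported_def by simp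
      then have "x + v \<in> box r (max M N)" using box_mono[of M "max M N" r] by auto
      moreover have "v \<in> box r (max M N)" using N box_mono[of N "max M N" r] by auto
      ultimately show "x \<in> box r (max M N)" using box_add_iff x(1) by blast
    qed
  qed
qed

text \<open>The indicator function of the coset \<open>x + box r \<rho>\<close>. By
  \<open>loc_const_decomp\<close> every test function is a finite linear combination of such
  indicators.\<close>

definition ind :: "nat \<Rightarrow> real \<Rightarrow> 'f::nonarch_local_field vec \<Rightarrow> 'f vec \<Rightarrow> complex" where
  "ind r \<rho> x y = (if y - x \<in> box r \<rho> then 1 else 0)"

lemma ind_loc_const:
  fixes x :: "'f::nonarch_local_field vec"
  assumes "x \<in> carrier_vec r" shows "loc_const r \<rho> (ind r \<rho> x)"
  unfolding loc_const_def
proof (intro ballI)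
  fix y d :: "'f vec" assume y: "y \<in> carrier_vec r" and d: "d \<in> box r \<rho>"
  have "y + d - x = (y - x) + d" using assms y box_carrier[OF d] by (intro eq_vecI) auto
  then show "ind r \<rho> x (y + d) = ind r \<rho> x y" using box_add_iff[OF d, of "y - x"] assms y by (simp add: ind_def)
qed

lemma ind_test_fun:
  fixes x :: "'f::nonarch_local_field vec"
  assumes "x \<in> carrier_vec r" "0 < \<rho>" shows "test_fun r (ind r \<rho> x)"
proof -
  have z: "test_fun r (ind r \<rho> (0\<^sub>v r :: 'f vec))"
    by (rule test_funI[OF assms(2) ind_loc_const, where M=\<rho>]) (auto simp: supported_def ind_def)
  have "test_fun r (\<lambda>y. ind r \<rho> (0\<^sub>v r :: 'f vec) (y + - x))"
    by (rule test_fun_translate[OF z]) (use assms in auto)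
  moreover have "(\<lambda>y. ind r \<rho> (0\<^sub>v r :: 'f vec) (y + - x)) = ind r \<rho> x"
  proof
    fix y :: "'f vec"
    have "y + - x - 0\<^sub>v r = y - x" using assms by (intro eq_vecI) auto
    then show "ind r \<rho> (0\<^sub>v r :: 'f vec) (y + - x) = ind r \<rho> x y" by (simp only: ind_def)
  qed
  ultimately show ?thesis by simp
qed

section \<open>Sums over cosets and the Haar functional\<close>

definition crep :: "nat \<Rightarrow> real \<Rightarrow> 'f::nonarch_local_field vec \<Rightarrow> 'f vec" where
  "crep r \<rho> x = (SOME y. y \<in> carrier_vec r \<and> y - x \<in> box r \<rho>)"

definition creps :: "nat \<Rightarrow> real \<Rightarrow> 'f::nonarch_local_field vec set" where
  "creps r \<rho> = crep r \<rho> ` carrier_vec r"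

lemma crep:
  fixes x :: "'f::nonarch_local_field vec"
  assumes "x \<in> carrier_vec r" "0 < \<rho>"
  shows "crep r \<rho> x \<in> carrier_vec r" "crep r \<rho> x - x \<in> box r \<rho>" "x - crep r \<rho> x \<in> box r \<rho>"
proof -
  have "x - x \<in> box r \<rho>" using assms by (auto simp: box_def)
  then have "\<exists>y. y \<in> carrier_vec r \<and> y - x \<in> box r \<rho>" using assms by blast
  from someI_ex[OF this] show 1: "crep r \<rho> x \<in> carrier_vec r" "crep r \<rho> x - x \<in> box r \<rho>"
    unfolding crep_def by blast+
  have "x - crep r \<rho> x = - (crep r \<rho> x - x)" using 1(1) assms by (intro eq_vecI) auto
  then show "x - crep r \<rho> x \<in> box r \<rho>" using 1 assms by simp
qed

text \<open>The predicate under the choice operator depends only on the coset, hence so does the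
  chosen representative.\<close>

lemma crep_eq:
  fixes x y :: "'f::nonarch_local_field vec"
  assumes x: "x \<in> carrier_vec r" and y: "y \<in> carrier_vec r" and d: "y - x \<in> box r \<rho>"
  shows "crep r \<rho> y = crep r \<rho> x"
proof -
  have "z - y \<in> box r \<rho> \<longleftrightarrow> z - x \<in> box r \<rho>" if z: "z \<in> carrier_vec r" for z :: "'f vec"
  proof -
    have "z - x = (z - y) + (y - x)" using x y z by (intro eq_vecI) auto
    then show ?thesis using box_add_iff[OF d, of "z - y"] y z by simp
  qed
  then have "(\<lambda>z. z \<in> carrier_vec r \<and> z - y \<in> box r \<rho>) = (\<lambda>z. z \<in> carrier_vec r \<and> z - x \<in> box r \<rho>)" by blast
  then show ?thesis unfolding crep_def by simp
qed

lemma creps_carrier: "0 < \<rho> \<Longrightarrow> x \<in> creps r \<rho> \<Longrightarrow> x \<in> carrier_vec r"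
  unfolding creps_def using crep(1) by blast

lemma crep_creps:
  fixes x :: "'f::nonarch_local_field vec"
  assumes "0 < \<rho>" "x \<in> creps r \<rho>" shows "crep r \<rho> x = x"
proof -
  obtain y where y: "y \<in> carrier_vec r" "x = crep r \<rho> y" using assms(2) unfolding creps_def by blast
  then show ?thesis using crep_eq[OF y(1) _ crep(2)[OF y(1) assms(1)]] crep(1)[OF y(1) assms(1)] by simp
qed

lemma finite_creps_box:
  assumes "0 < \<rho>" shows "finite (creps r \<rho> \<inter> box r M :: 'f::nonarch_local_field vec set)"
proof -
  obtain F :: "'f vec set" where F: "finite F" "F \<subseteq> box r M" "\<forall>y\<in>box r M. \<exists>x\<in>F. y - x \<in> box r \<rho>"
    using finite_box_cover[of r M "\<lambda>_. \<rho>", OF assms] by (elim exE conjE)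
  have "creps r \<rho> \<inter> box r M \<subseteq> crep r \<rho> ` F"
  proof
    fix y :: "'f vec" assume y: "y \<in> creps r \<rho> \<inter> box r M"
    then have "y \<in> box r M" by simp
    then obtain x where x: "x \<in> F" "y - x \<in> box r \<rho>" by (rule bexE[OF bspec[OF F(3)]])
    have "y = crep r \<rho> y" using crep_creps[OF assms, of y r] y by simp
    also have "\<dots> = crep r \<rho> x"
      using crep_eq[OF _ _ x(2)] x(1) F(2) y by (auto dest!: subsetD box_carrier)
    finally show "y \<in> crep r \<rho> ` F" using x(1) by blast
  qed
  then show ?thesis using F(1) finite_subset by blast
qed

text \<open>For f constant on cosets of \<open>box r \<rho>\<close>, this is its integral in units
  of the volume of that box. Summing only where f is nonzero makes the index set finite for
  boundedly supported f without naming a bound.\<close>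

definition csum :: "nat \<Rightarrow> real \<Rightarrow> ('f::nonarch_local_field vec \<Rightarrow> complex) \<Rightarrow> complex" where
  "csum r \<rho> f = (\<Sum>x | x \<in> creps r \<rho> \<and> f x \<noteq> 0. f x)"

lemma csum_box:
  fixes f :: "'f::nonarch_local_field vec \<Rightarrow> complex"
  assumes "0 < \<rho>" "supported r M 0 f"
  shows "csum r \<rho> f = (\<Sum>x\<in>creps r \<rho> \<inter> box r M. f x)"
  unfolding csum_def
  by (rule sum.mono_neutral_left[OF finite_creps_box[OF assms(1)]])
    (use assms creps_carrier[OF assms(1)] in \<open>auto simp: supported_def\<close>)

lemma csum_cong: "0 < \<rho> \<Longrightarrow> (\<And>x. x \<in> carrier_vec r \<Longrightarrow> f x = g x) \<Longrightarrow> csum r \<rho> f = csum r \<rho> g"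
  unfolding csum_def using creps_carrier by (intro sum.cong) fastforce+

text \<open>Translation by v permutes the cosets and so reindexes their representatives; replacing a
  translated representative by the chosen one does not change the value of f.\<close>

lemma csum_translate:
  fixes f :: "'f::nonarch_local_field vec \<Rightarrow> complex"
  assumes \<rho>: "0 < \<rho>" and lc: "loc_const r \<rho> f" and v: "v \<in> carrier_vec r"
  shows "csum r \<rho> (\<lambda>x. f (x + v)) = csum r \<rho> f"
proof -
  have fc: "f (crep r \<rho> x) = f x" if "x \<in> carrier_vec r" for x
    using lc that crep[OF that \<rho>] vec_minus_plus[OF that crep(1)[OF that \<rho>]]
    unfolding loc_const_def by metis
  have inv: "crep r \<rho> (crep r \<rho> (x + u) + w) = x"
    if x: "x \<in> creps r \<rho>" and u: "u \<in> carrier_vec r" "w \<in> carrier_vec r" "u + w = 0\<^sub>v r" for x u w :: "'f vec"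
  proof -
    have xc: "x \<in> carrier_vec r" "x + u \<in> carrier_vec r" using creps_carrier[OF \<rho> x] u by auto
    let ?z = "crep r \<rho> (x + u)"
    have z: "?z \<in> carrier_vec r" "?z - (x + u) \<in> box r \<rho>" using crep[OF xc(2) \<rho>] by auto
    have "u $ i + w $ i = 0" if "i < r" for i
      using u that by (metis carrier_vecD index_add_vec(1) index_zero_vec(1))
    then have "?z + w - x = ?z - (x + u)"
      using xc z u by (intro eq_vecI) (auto simp: algebra_simps eq_neg_iff_add_eq_0)
    then have "crep r \<rho> (?z + w) = crep r \<rho> x"
      using z xc u by (intro crep_eq) auto
    then show ?thesis using crep_creps[OF \<rho> x] by simp
  qed
  have mv: "- v \<in> carrier_vec r" "v + - v = 0\<^sub>v r" "- v + v = 0\<^sub>v r" using v by (auto intro!: eq_vecI)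
  show ?thesis
    unfolding csum_def
  proof (rule sum.reindex_bij_witness[of _ "\<lambda>x. crep r \<rho> (x + - v)" "\<lambda>x. crep r \<rho> (x + v)"])
    fix x assume x: "x \<in> {x \<in> creps r \<rho>. f (x + v) \<noteq> 0}"
    then have xc: "x \<in> carrier_vec r" using creps_carrier[OF \<rho>] by blast
    then have xv: "x + v \<in> carrier_vec r" using v by simp
    show "crep r \<rho> (crep r \<rho> (x + v) + - v) = x" using inv[of x v "- v"] x v mv by simp
    show "f (crep r \<rho> (x + v)) = f (x + v)" using fc[OF xv] .
    then show "crep r \<rho> (x + v) \<in> {x \<in> creps r \<rho>. f x \<noteq> 0}" using x xv by (auto simp: creps_def)
  next
    fix x assume x: "x \<in> {x \<in> creps r \<rho>. f x \<noteq> 0}"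
    then have xc: "x \<in> carrier_vec r" using creps_carrier[OF \<rho>] by blast
    then have xv: "x + - v \<in> carrier_vec r" using v by simp
    show *: "crep r \<rho> (crep r \<rho> (x + - v) + v) = x" using inv[of x "- v" v] x v mv by simp
    have "f (crep r \<rho> (x + - v) + v) = f (crep r \<rho> (crep r \<rho> (x + - v) + v))"
      using fc crep(1)[OF xv \<rho>] v by simp
    then show "crep r \<rho> (x + - v) \<in> {x \<in> creps r \<rho>. f (x + v) \<noteq> 0}"
      using x xv * by (auto simp: creps_def)
  qed
qed

text \<open>Exactly one representative has y in its coset, and f takes the same value at
  both.\<close>

lemma loc_const_decomp:
  fixes f :: "'f::nonarch_local_field vec \<Rightarrow> complex"
  assumes \<rho>: "0 < \<rho>" and lc: "loc_const r \<rho> f" and sup: "supported r M 0 f" and y: "y \<in> carrier_vec r"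
  shows "f y = (\<Sum>x\<in>creps r \<rho> \<inter> box r M. f x * ind r \<rho> x y)"
proof -
  have fc: "f (crep r \<rho> y) = f y"
    using lc y crep[OF y \<rho>] vec_minus_plus[OF y crep(1)[OF y \<rho>]] unfolding loc_const_def by metis
  have eq: "f x * ind r \<rho> x y = (if x = crep r \<rho> y then f y else 0)" if x: "x \<in> creps r \<rho>" for x
  proof (cases "y - x \<in> box r \<rho>")
    case True
    then have "crep r \<rho> y = crep r \<rho> x" using crep_eq[OF creps_carrier[OF \<rho> x] y] by blast
    then show ?thesis using True fc crep_creps[OF \<rho> x] by (simp add: ind_def)
  next
    case False
    then have "x \<noteq> crep r \<rho> y" using crep(3)[OF y \<rho>] by auto
    then show ?thesis using False by (simp add: ind_def)
  qed
  have "(\<Sum>x\<in>creps r \<rho> \<inter> box r M. f x * ind r \<rho> x y) = (\<Sum>x\<in>creps r \<rho> \<inter> box r M. if x = crep r \<rho> y then f y else 0)"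
    using eq by (intro sum.cong) auto
  also have "\<dots> = (if crep r \<rho> y \<in> creps r \<rho> \<inter> box r M then f y else 0)"
    by (simp add: finite_creps_box[OF \<rho>])
  also have "\<dots> = f y"
    using fc sup crep(1)[OF y \<rho>] y by (auto simp: supported_def creps_def)
  finally show ?thesis by simp
qed

text \<open>Translation invariant linear functionals, that is, multiples of Haar integration. The
  last clause expresses independence of values outside \<open>carrier_vec r\<close>, on which test
  functions are unrestricted.\<close>

definition invariant_functional :: "nat \<Rightarrow> (('f::nonarch_local_field vec \<Rightarrow> complex) \<Rightarrow> complex) \<Rightarrow> bool" where
  "invariant_functional r J \<longleftrightarrow>
     (\<forall>f g. test_fun r f \<longrightarrow> test_fun r g \<longrightarrow> J (\<lambda>x. f x + g x) = J f + J g) \<and>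
     (\<forall>c f. test_fun r f \<longrightarrow> J (\<lambda>x. c * f x) = c * J f) \<and>
     (\<forall>v\<in>carrier_vec r. \<forall>f. test_fun r f \<longrightarrow> J (\<lambda>x. f (x + v)) = J f) \<and>
     (\<forall>f g. test_fun r f \<longrightarrow> (\<forall>x\<in>carrier_vec r. f x = g x) \<longrightarrow> J f = J g)"

lemma invariant_functionalD:
  assumes "invariant_functional r J"
  shows "test_fun r f \<Longrightarrow> test_fun r g \<Longrightarrow> J (\<lambda>x. f x + g x) = J f + J g"
    "test_fun r f \<Longrightarrow> J (\<lambda>x. c * f x) = c * J f"
    "v \<in> carrier_vec r \<Longrightarrow> test_fun r f \<Longrightarrow> J (\<lambda>x. f (x + v)) = J f"
    "test_fun r f \<Longrightarrow> (\<And>x. x \<in> carrier_vec r \<Longrightarrow> f x = g x) \<Longrightarrow> J f = J g"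
  using assms unfolding invariant_functional_def by blast+

lemma invariant_functional_sum:
  fixes f :: "'i \<Rightarrow> 'f::nonarch_local_field vec \<Rightarrow> complex"
  assumes J: "invariant_functional r J" and "\<And>i. i \<in> A \<Longrightarrow> test_fun r (f i)"
  shows "J (\<lambda>x. \<Sum>i\<in>A. c i * f i x) = (\<Sum>i\<in>A. c i * J (f i))"
proof -
  have z: "test_fun r (\<lambda>x::'f vec. 0)" using test_fun_sum[of "{}" r "\<lambda>_ _. 0"] by simp
  have "J (\<lambda>x. 0 * 0) = 0 * J (\<lambda>x. 0)" by (rule invariant_functionalD(2)[OF J z])
  then have J0: "J (\<lambda>x. 0) = 0" by simp
  from assms(2) show ?thesis
  proof (induction A rule: infinite_finite_induct)
    case (insert i A)
    have "J (\<lambda>x. c i * f i x + (\<Sum>i\<in>A. c i * f i x)) = J (\<lambda>x. c i * f i x) + J (\<lambda>x. \<Sum>i\<in>A. c i * f i x)"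
      using insert.prems by (intro invariant_functionalD(1)[OF J] test_fun_scale test_fun_sum) auto
    then show ?case using insert invariant_functionalD(2)[OF J, of "f i" "c i"] by simp
  qed (use J0 in auto)
qed

lemma invariant_functional_ind:
  fixes x :: "'f::nonarch_local_field vec"
  assumes J: "invariant_functional r J" and x: "x \<in> carrier_vec r" and \<rho>: "0 < \<rho>"
  shows "J (ind r \<rho> x) = J (ind r \<rho> (0\<^sub>v r :: 'f vec))"
proof -
  have "J (\<lambda>y. ind r \<rho> (0\<^sub>v r :: 'f vec) (y + - x)) = J (ind r \<rho> (0\<^sub>v r :: 'f vec))"
    using x by (intro invariant_functionalD(3)[OF J] ind_test_fun[OF _ \<rho>]) auto
  moreover have "(\<lambda>y. ind r \<rho> (0\<^sub>v r :: 'f vec) (y + - x)) = ind r \<rho> x"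
  proof
    fix y :: "'f vec"
    have "y + - x - 0\<^sub>v r = y - x" using x by (intro eq_vecI) auto
    then show "ind r \<rho> (0\<^sub>v r :: 'f vec) (y + - x) = ind r \<rho> x y" by (simp only: ind_def)
  qed
  ultimately show ?thesis by simp
qed

text \<open>After decomposing f into coset indicators, translation invariance gives all of them the
  same value under J. So J is determined by a single number; this is the uniqueness of Haar
  measure.\<close>

lemma invariant_functional_csum:
  fixes f :: "'f::nonarch_local_field vec \<Rightarrow> complex"
  assumes J: "invariant_functional r J" and \<rho>: "0 < \<rho>" and lc: "loc_const r \<rho> f" and sup: "supported r M 0 f"
  shows "J f = csum r \<rho> f * J (ind r \<rho> (0\<^sub>v r :: 'f vec))"
proof -
  have "J f = J (\<lambda>y. \<Sum>x\<in>creps r \<rho> \<inter> box r M. f x * ind r \<rho> x y)"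
    by (rule invariant_functionalD(4)[OF J test_funI[OF \<rho> lc sup]])
      (rule loc_const_decomp[OF \<rho> lc sup])
  also have "\<dots> = (\<Sum>x\<in>creps r \<rho> \<inter> box r M. f x * J (ind r \<rho> x))"
    using creps_carrier[OF \<rho>] by (intro invariant_functional_sum[OF J] ind_test_fun[OF _ \<rho>]) auto
  also have "\<dots> = (\<Sum>x\<in>creps r \<rho> \<inter> box r M. f x * J (ind r \<rho> (0\<^sub>v r :: 'f vec)))"
  proof (rule sum.cong[OF HOL.refl])
    fix x :: "'f vec" assume "x \<in> creps r \<rho> \<inter> box r M"
    from creps_carrier[OF \<rho> IntD1[OF this]] have "x \<in> carrier_vec r" .
    from invariant_functional_ind[OF J this \<rho>]
    show "f x * J (ind r \<rho> x) = f x * J (ind r \<rho> (0\<^sub>v r :: 'f vec))" by simp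
  qed
  also have "\<dots> = csum r \<rho> f * J (ind r \<rho> (0\<^sub>v r :: 'f vec))"
    by (simp add: csum_box[OF \<rho> sup] sum_distrib_right)
  finally show ?thesis .
qed

lemma csum_linear:
  fixes f g :: "'f::nonarch_local_field vec \<Rightarrow> complex"
  assumes \<rho>: "0 < \<rho>" and "supported r M 0 f" "supported r M 0 g"
  shows "csum r \<rho> (\<lambda>x. f x + g x) = csum r \<rho> f + csum r \<rho> g" "csum r \<rho> (\<lambda>x. c * f x) = c * csum r \<rho> f"
proof -
  have 1: "supported r M 0 (\<lambda>x. f x + g x)" "supported r M 0 (\<lambda>x. c * f x)"
    using assms by (auto simp: supported_def)
  show "csum r \<rho> (\<lambda>x. f x + g x) = csum r \<rho> f + csum r \<rho> g"
    by (simp add: csum_box[OF \<rho> 1(1)] csum_box[OF \<rho> assms(2)] csum_box[OF \<rho> assms(3)] sum.distrib)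
  show "csum r \<rho> (\<lambda>x. c * f x) = c * csum r \<rho> f"
    by (simp add: csum_box[OF \<rho> 1(2)] csum_box[OF \<rho> assms(2)] sum_distrib_left)
qed

text \<open>Refining cosets from radius \<rho> to \<sigma> multiplies every coset sum by the same
  factor, the number of small cosets in the large box. Ratios of coset sums are therefore
  independent of the radius.\<close>

lemma csum_translate_functional:
  fixes f :: "'f::nonarch_local_field vec \<Rightarrow> complex"
  assumes \<rho>: "0 < \<rho>" and \<sigma>: "0 < \<sigma>" "\<sigma> \<le> \<rho>" and lc: "loc_const r \<rho> f" and sup: "supported r M 0 f"
  shows "csum r \<sigma> f = csum r \<rho> f * csum r \<sigma> (ind r \<rho> (0\<^sub>v r :: 'f vec))"
proof -
  let ?B = "creps r \<rho> \<inter> box r M"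
  have lc\<sigma>: "loc_const r \<sigma> (ind r \<rho> (0\<^sub>v r :: 'f vec))"
    by (rule loc_const_mono[OF ind_loc_const \<sigma>(2)]) simp
  have tr: "csum r \<sigma> (ind r \<rho> x) = csum r \<sigma> (ind r \<rho> (0\<^sub>v r :: 'f vec))" if x: "x \<in> carrier_vec r" for x :: "'f vec"
  proof -
    have "csum r \<sigma> (\<lambda>y. ind r \<rho> (0\<^sub>v r :: 'f vec) (y + - x)) = csum r \<sigma> (ind r \<rho> (0\<^sub>v r :: 'f vec))"
      using x by (intro csum_translate[OF \<sigma>(1) lc\<sigma>]) auto
    moreover have "(\<lambda>y. ind r \<rho> (0\<^sub>v r :: 'f vec) (y + - x)) = ind r \<rho> x"
    proof
      fix y :: "'f vec"
      have "y + - x - 0\<^sub>v r = y - x" using x by (intro eq_vecI) auto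
      then show "ind r \<rho> (0\<^sub>v r :: 'f vec) (y + - x) = ind r \<rho> x y" by (simp only: ind_def)
    qed
    ultimately show ?thesis by simp
  qed
  have sup_ind: "supported r (max M \<rho>) 0 (ind r \<rho> x)" if x: "x \<in> ?B" for x
    unfolding supported_def
  proof (intro ballI impI)
    fix y assume y: "y \<in> carrier_vec r" "ind r \<rho> x y \<noteq> 0"
    then have "y - x \<in> box r \<rho>" by (simp add: ind_def split: if_splits)
    then have 1: "y - x \<in> box r (max M \<rho>)" using box_mono[of \<rho> "max M \<rho>" r] by auto
    have xB: "x \<in> box r (max M \<rho>)" using x box_mono[of M "max M \<rho>" r] by auto
    have "x + (y - x) = y" using y(1) box_carrier[OF xB] by (intro vec_minus_plus) auto
    then show "y \<in> box r (max M \<rho>)" using box_add[OF xB 1] by simp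
  qed
  \<comment> \<open>Additivity of coset sums needs a common support bound, so the bound is carried
    through the induction.\<close>
  have lin: "csum r \<sigma> (\<lambda>y. \<Sum>x\<in>A. f x * ind r \<rho> x y) = (\<Sum>x\<in>A. f x * csum r \<sigma> (ind r \<rho> x)) \<and>
      supported r (max M \<rho>) 0 (\<lambda>y. \<Sum>x\<in>A. f x * ind r \<rho> x y)"
    if "finite A" "A \<subseteq> ?B" for A
    using that
  proof (induction A rule: finite_induct)
    case empty
    then show ?case by (simp add: csum_def supported_def)
  next
    case (insert a A)
    have a: "supported r (max M \<rho>) 0 (\<lambda>y. f a * ind r \<rho> a y)"
      using sup_ind[of a] insert.prems by (auto simp: supported_def)
    have IH: "csum r \<sigma> (\<lambda>y. \<Sum>x\<in>A. f x * ind r \<rho> x y) = (\<Sum>x\<in>A. f x * csum r \<sigma> (ind r \<rho> x))"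
      "supported r (max M \<rho>) 0 (\<lambda>y. \<Sum>x\<in>A. f x * ind r \<rho> x y)"
      using insert by auto
    have "supported r (max M \<rho>) 0 (\<lambda>y. f a * ind r \<rho> a y + (\<Sum>x\<in>A. f x * ind r \<rho> x y))"
      using a IH(2) unfolding supported_def by force
    moreover have "csum r \<sigma> (\<lambda>y. f a * ind r \<rho> a y) = f a * csum r \<sigma> (ind r \<rho> a)"
      using csum_linear(2)[OF \<sigma>(1) sup_ind[of a] sup_ind[of a]] insert.prems by simp
    ultimately show ?case
      using csum_linear(1)[OF \<sigma>(1) a IH(2)] IH(1) insert.hyps by simp
  qed
  have "csum r \<sigma> f = csum r \<sigma> (\<lambda>y. \<Sum>x\<in>?B. f x * ind r \<rho> x y)"
    by (rule csum_cong[OF \<sigma>(1)]) (rule loc_const_decomp[OF \<rho> lc sup])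
  also have "\<dots> = (\<Sum>x\<in>?B. f x * csum r \<sigma> (ind r \<rho> x))"
    using lin[of ?B] finite_creps_box[OF \<rho>] by blast
  also have "\<dots> = (\<Sum>x\<in>?B. f x * csum r \<sigma> (ind r \<rho> (0\<^sub>v r :: 'f vec)))"
  proof (rule sum.cong[OF HOL.refl])
    fix x :: "'f vec" assume "x \<in> ?B"
    from tr[OF creps_carrier[OF \<rho> IntD1[OF this]]]
    show "f x * csum r \<sigma> (ind r \<rho> x) = f x * csum r \<sigma> (ind r \<rho> (0\<^sub>v r :: 'f vec))" by simp
  qed
  also have "\<dots> = csum r \<rho> f * csum r \<sigma> (ind r \<rho> (0\<^sub>v r :: 'f vec))"
    by (simp add: csum_box[OF \<rho> sup] sum_distrib_right)
  finally show ?thesis .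
qed

text \<open>The sum counts the representatives in the support, a finite set that contains the
  representative of 0.\<close>

lemma csum_indicator_nonzero:
  fixes f :: "'f::nonarch_local_field vec \<Rightarrow> complex"
  assumes \<rho>: "0 < \<rho>" and lc: "loc_const r \<rho> f" and sup: "supported r M 0 f"
    and f: "\<And>x. f x \<in> {0, 1}" "f (0\<^sub>v r) = 1"
  shows "csum r \<rho> f \<noteq> 0"
proof -
  let ?S = "{x \<in> creps r \<rho>. f x \<noteq> 0}"
  have "f x = 1" if "x \<in> ?S" for x using f(1)[of x] that by auto
  then have "csum r \<rho> f = (\<Sum>x\<in>?S. 1)" unfolding csum_def by (intro sum.cong) auto
  then have "csum r \<rho> f = of_nat (card ?S)" by simp
  moreover have "finite ?S"
  proof (rule finite_subset)
    show "?S \<subseteq> creps r \<rho> \<inter> box r M" using sup creps_carrier[OF \<rho>] by (auto simp: supported_def)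
  qed (rule finite_creps_box[OF \<rho>])
  moreover have "crep r \<rho> (0\<^sub>v r) \<in> ?S"
  proof -
    have z: "0\<^sub>v r \<in> carrier_vec r" by simp
    have "f (crep r \<rho> (0\<^sub>v r)) = f (0\<^sub>v r)"
      using lc z crep[OF z \<rho>] vec_minus_plus[OF z crep(1)[OF z \<rho>]] unfolding loc_const_def by metis
    then show ?thesis using f(2) by (auto simp: creps_def)
  qed
  ultimately show ?thesis by (metis card_gt_0_iff empty_iff of_nat_eq_0_iff order_less_irrefl)
qed

text \<open>Haar integration giving the unit box volume 1. Every admissible radius yields the same
  quotient; the condition that \<rho> is at most 1 makes the unit box a union of cosets.\<close>

definition haar :: "nat \<Rightarrow> ('f::nonarch_local_field vec \<Rightarrow> complex) \<Rightarrow> complex" where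
  "haar r f = (let \<rho> = SOME \<rho>. 0 < \<rho> \<and> \<rho> \<le> 1 \<and> loc_const r \<rho> f
     in csum r \<rho> f / csum r \<rho> (ind r 1 (0\<^sub>v r :: 'f vec)))"

lemma ind_indicator: "ind r \<rho> x y \<in> {0, 1}"
  by (simp add: ind_def)

lemma ind_zero:
  fixes x :: "'f::nonarch_local_field vec"
  assumes "x \<in> carrier_vec r"
  shows "ind r \<rho> (0\<^sub>v r :: 'f vec) x = (if x \<in> box r \<rho> then 1 else 0)"
proof -
  have "x - 0\<^sub>v r = x" using assms by (intro eq_vecI) auto
  then show ?thesis by (simp add: ind_def)
qed

lemma supported_ind_zero: "supported r \<rho> 0 (ind r \<rho> (0\<^sub>v r :: 'f::nonarch_local_field vec))"
  by (simp add: supported_def ind_zero)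

lemma csum_ind_nonzero:
  assumes "0 < \<sigma>" "\<sigma> \<le> \<rho>"
  shows "csum r \<sigma> (ind r \<rho> (0\<^sub>v r :: 'f::nonarch_local_field vec)) \<noteq> 0"
proof (rule csum_indicator_nonzero[OF assms(1) _ supported_ind_zero ind_indicator])
  show "loc_const r \<sigma> (ind r \<rho> (0\<^sub>v r :: 'f vec))"
    by (rule loc_const_mono[OF ind_loc_const assms(2)]) simp
  show "ind r \<rho> (0\<^sub>v r :: 'f vec) (0\<^sub>v r :: 'f vec) = 1" using assms by (simp add: ind_zero)
qed

lemma csum_ratio_step:
  fixes f :: "'f::nonarch_local_field vec \<Rightarrow> complex"
  assumes "0 < \<sigma>" "\<sigma> \<le> \<rho>" "\<rho> \<le> 1" "loc_const r \<rho> f" "supported r M 0 f"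
  shows "csum r \<sigma> f / csum r \<sigma> (ind r 1 (0\<^sub>v r :: 'f vec)) = csum r \<rho> f / csum r \<rho> (ind r 1 (0\<^sub>v r :: 'f vec))"
proof -
  have \<rho>: "0 < \<rho>" using assms by simp
  have lc: "loc_const r \<rho> (ind r 1 (0\<^sub>v r :: 'f vec))"
    by (rule loc_const_mono[OF ind_loc_const assms(3)]) simp
  show ?thesis
    using csum_translate_functional[OF \<rho> assms(1,2,4,5)]
      csum_translate_functional[OF \<rho> assms(1,2) lc supported_ind_zero]
      csum_ind_nonzero[OF assms(1,2), where 'f='f and r=r]
    by simp
qed

lemma haar_eq:
  fixes f :: "'f::nonarch_local_field vec \<Rightarrow> complex"
  assumes "0 < \<rho>" "\<rho> \<le> 1" "loc_const r \<rho> f" "supported r M 0 f"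
  shows "haar r f = csum r \<rho> f / csum r \<rho> (ind r 1 (0\<^sub>v r :: 'f vec))"
proof -
  define \<sigma> where "\<sigma> = (SOME \<rho>. 0 < \<rho> \<and> \<rho> \<le> 1 \<and> loc_const r \<rho> f)"
  have "0 < \<sigma> \<and> \<sigma> \<le> 1 \<and> loc_const r \<sigma> f"
    unfolding \<sigma>_def by (rule someI[of _ \<rho>]) (use assms in blast)
  then have \<sigma>: "0 < \<sigma>" "\<sigma> \<le> 1" "loc_const r \<sigma> f" by auto
  have "0 < min \<rho> \<sigma>" "min \<rho> \<sigma> \<le> \<rho>" "min \<rho> \<sigma> \<le> \<sigma>" using assms \<sigma> by auto
  then have "csum r \<sigma> f / csum r \<sigma> (ind r 1 (0\<^sub>v r :: 'f vec)) = csum r \<rho> f / csum r \<rho> (ind r 1 (0\<^sub>v r :: 'f vec))"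
    using csum_ratio_step[of "min \<rho> \<sigma>" \<rho> r f M] csum_ratio_step[of "min \<rho> \<sigma>" \<sigma> r f M] assms \<sigma> by simp
  then show ?thesis unfolding haar_def \<sigma>_def[symmetric] Let_def .
qed

lemma haar_invariant: "invariant_functional r (haar r :: ('f::nonarch_local_field vec \<Rightarrow> complex) \<Rightarrow> complex)"
  unfolding invariant_functional_def
proof (intro conjI allI impI ballI)
  fix f g :: "'f vec \<Rightarrow> complex" and c assume f: "test_fun r f"
  obtain \<rho> M where 1: "0 < \<rho>" "\<rho> \<le> 1" "loc_const r \<rho> f" "0 < M" "supported r M 0 f"
    by (rule test_fun_radius[OF f real_zero_less_one])
  have "loc_const r \<rho> (\<lambda>x. c * f x)" "supported r M 0 (\<lambda>x. c * f x)"
    using 1 by (auto simp: loc_const_def supported_def)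
  then show "haar r (\<lambda>x. c * f x) = c * haar r f"
    using haar_eq[OF 1(1-3,5)] haar_eq[OF 1(1,2), of r "\<lambda>x. c * f x" M] csum_linear(2)[OF 1(1,5,5)] by simp
  {
    assume eq: "\<forall>x\<in>carrier_vec r. f x = g x"
    have "loc_const r \<rho> g" unfolding loc_const_def
    proof (intro ballI)
      fix x d :: "'f vec" assume x: "x \<in> carrier_vec r" and d: "d \<in> box r \<rho>"
      have "x + d \<in> carrier_vec r" using x box_carrier[OF d] by simp
      then show "g (x + d) = g x" using eq x d 1(3) unfolding loc_const_def by metis
    qed
    moreover have "supported r M 0 g" using eq 1(5) unfolding supported_def by metis
    moreover have "csum r \<rho> f = csum r \<rho> g" by (rule csum_cong[OF 1(1)]) (rule eq[rule_format])
    ultimately show "haar r f = haar r g" using haar_eq[OF 1(1-3,5)] haar_eq[OF 1(1,2), of r g M] by simp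
  }
next
  fix f g :: "'f vec \<Rightarrow> complex" assume f: "test_fun r f" "test_fun r g"
  obtain \<rho> M where 1: "0 < \<rho>" "\<rho> \<le> 1" "loc_const r \<rho> f" "loc_const r \<rho> g" "supported r M 0 f" "supported r M 0 g"
    by (rule test_fun_radius2[OF f real_zero_less_one])
  have "loc_const r \<rho> (\<lambda>x. f x + g x)" "supported r M 0 (\<lambda>x. f x + g x)"
    using 1 by (auto simp: loc_const_def supported_def)
  then show "haar r (\<lambda>x. f x + g x) = haar r f + haar r g"
    using haar_eq[OF 1(1,2,3,5)] haar_eq[OF 1(1,2,4,6)] haar_eq[OF 1(1,2), of r "\<lambda>x. f x + g x" M]
      csum_linear(1)[OF 1(1,5,6)] by (simp add: add_divide_distrib)
next
  fix v :: "'f vec" and f :: "'f vec \<Rightarrow> complex" assume v: "v \<in> carrier_vec r" and f: "test_fun r f"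
  obtain \<rho> M where 1: "0 < \<rho>" "\<rho> \<le> 1" "loc_const r \<rho> f" "0 < M" "supported r M 0 f"
    by (rule test_fun_radius[OF f real_zero_less_one])
  have lc: "loc_const r \<rho> (\<lambda>x. f (x + v))"
    unfolding loc_const_def
  proof (intro ballI)
    fix x d :: "'f vec" assume x: "x \<in> carrier_vec r" and d: "d \<in> box r \<rho>"
    have "x + d + v = (x + v) + d" using x box_carrier[OF d] v by (intro eq_vecI) auto
    then show "f (x + d + v) = f (x + v)" using 1(3) x d v unfolding loc_const_def by simp
  qed
  obtain \<rho>' N where sup: "supported r N 0 (\<lambda>x. f (x + v))"
    by (rule test_fun_radius[OF test_fun_translate[OF f v] real_zero_less_one])
  show "haar r (\<lambda>x. f (x + v)) = haar r f"
    using haar_eq[OF 1(1-3,5)] haar_eq[OF 1(1,2) lc sup] csum_translate[OF 1(1,3) v] by simp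
qed

lemmas haar_add = invariant_functionalD(1)[OF haar_invariant]
lemmas haar_scale = invariant_functionalD(2)[OF haar_invariant]
lemmas haar_translate = invariant_functionalD(3)[OF haar_invariant]
lemmas haar_cong = invariant_functionalD(4)[OF haar_invariant]

lemma haar_unit_box: "haar r (ind r 1 (0\<^sub>v r :: 'f::nonarch_local_field vec)) = 1"
proof -
  have "loc_const r 1 (ind r 1 (0\<^sub>v r :: 'f vec))" by (rule ind_loc_const) simp
  from haar_eq[OF real_zero_less_one order_refl this supported_ind_zero]
  show ?thesis using csum_ind_nonzero[OF real_zero_less_one order_refl, where 'f='f and r=r] by simp
qed

text \<open>At one radius that suits both f and the unit box, J is a constant times the coset sum;
  the constant is eliminated by evaluating J on the unit box.\<close>

lemma invariant_functional_unique:
  fixes f :: "'f::nonarch_local_field vec \<Rightarrow> complex"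
  assumes J: "invariant_functional r J" and f: "test_fun r f"
  shows "J f = J (ind r 1 (0\<^sub>v r :: 'f vec)) * haar r f"
proof -
  obtain \<rho> M where 1: "0 < \<rho>" "\<rho> \<le> 1" "loc_const r \<rho> f" "0 < M" "supported r M 0 f"
    by (rule test_fun_radius[OF f real_zero_less_one])
  have lc: "loc_const r \<rho> (ind r 1 (0\<^sub>v r :: 'f vec))"
    by (rule loc_const_mono[OF ind_loc_const 1(2)]) simp
  show ?thesis
    using invariant_functional_csum[OF J 1(1,3,5)] invariant_functional_csum[OF J 1(1) lc supported_ind_zero]
      haar_eq[OF 1(1-3,5)] csum_ind_nonzero[OF 1(1,2), where 'f='f and r=r] by simp
qed

lemma haar_indicator_nonzero:
  fixes f :: "'f::nonarch_local_field vec \<Rightarrow> complex"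
  assumes f: "test_fun r f" "\<And>x. f x \<in> {0, 1}" "f (0\<^sub>v r) = 1"
  shows "haar r f \<noteq> 0"
proof -
  obtain \<rho> M where 1: "0 < \<rho>" "\<rho> \<le> 1" "loc_const r \<rho> f" "0 < M" "supported r M 0 f"
    by (rule test_fun_radius[OF f(1) real_zero_less_one])
  show ?thesis
    using haar_eq[OF 1(1-3,5)] csum_indicator_nonzero[OF 1(1,3,5) f(2,3)]
      csum_ind_nonzero[OF 1(1,2), where 'f='f and r=r] by simp
qed

section \<open>Linear change of variables in the Haar integral\<close>

lemma addrow_mat_GL: "k \<noteq> l \<Longrightarrow> addrow_mat n a k l \<in> carrier (GL n)" for a :: "'f::field"
  by (simp add: carrier_GL det_addrow_mat)

lemma multrow_mat_GL: "k < n \<Longrightarrow> a \<noteq> 0 \<Longrightarrow> multrow_mat n k a \<in> carrier (GL n)" for a :: "'f::field"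
  by (simp add: carrier_GL det_multrow_mat)

lemma addrow_mat_vec:
  fixes a :: "'f::field"
  assumes "k < n" "l < n" "x \<in> carrier_vec n" "i < n"
  shows "(addrow_mat n a k l *\<^sub>v x) $ i = (if i = k then a * x $ l + x $ i else x $ i)"
proof (cases "i = k")
  case True
  have "(a \<cdot>\<^sub>v unit_vec n l + unit_vec n k) \<bullet> x = a * (unit_vec n l \<bullet> x) + unit_vec n k \<bullet> x"
    using assms by (subst add_scalar_prod_distrib[of _ n]) auto
  then show ?thesis using True assms by (simp add: row_addrow)
next
  case False
  then show ?thesis using assms by (simp add: row_addrow)
qed

lemma multrow_mat_vec:
  fixes a :: "'f::field"
  assumes "k < n" "x \<in> carrier_vec n" "i < n"
  shows "(multrow_mat n k a *\<^sub>v x) $ i = (if i = k then a * x $ i else x $ i)"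
proof -
  have "(multrow_mat n k a *\<^sub>v x) $ i = (\<Sum>j\<in>{0..<n}. row (multrow_mat n k a) i $ j * x $ j)"
    using assms by (simp add: scalar_prod_def)
  also have "\<dots> = (\<Sum>j\<in>{0..<n}. (if j = i then (if i = k then a * x $ i else x $ i) else 0))"
    by (rule sum.cong[OF HOL.refl]) (use assms in auto)
  finally show ?thesis using assms by simp
qed

text \<open>If column j vanished from row j on, it would be a combination of the first j columns,
  which are unit vectors. That gives a kernel vector with entry 1 at position j, contradicting
  invertibility.\<close>

lemma unit_column_exists:
  fixes A :: "'f::field mat"
  assumes A: "A \<in> carrier (GL n)" and j: "j < n"
    and unit: "\<And>i c. i < n \<Longrightarrow> c < j \<Longrightarrow> A $$ (i, c) = (if i = c then 1 else 0)"
  shows "\<exists>i. j \<le> i \<and> i < n \<and> A $$ (i, j) \<noteq> 0"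
proof (rule ccontr)
  assume no: "\<not> ?thesis"
  define x where "x = vec n (\<lambda>c. if c < j then - A $$ (c, j) else if c = j then 1 else 0)"
  have xc: "x \<in> carrier_vec n" by (simp add: x_def)
  have "A *\<^sub>v x = 0\<^sub>v n"
  proof (rule eq_vecI)
    fix i assume "i < dim_vec (0\<^sub>v n :: 'f vec)"
    then have i: "i < n" by simp
    have "(A *\<^sub>v x) $ i = (\<Sum>c\<in>{0..<n}. A $$ (i, c) * x $ c)"
      using A i xc by (simp add: scalar_prod_def)
    also have "\<dots> = (\<Sum>c\<in>{0..<n}. (if c = i then (if i < j then - A $$ (i, j) else 0) else 0)
        + (if c = j then A $$ (i, j) else 0))"
      by (rule sum.cong[OF HOL.refl]) (use i unit in \<open>auto simp: x_def\<close>)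
    also have "\<dots> = (if i < j then - A $$ (i, j) else 0) + A $$ (i, j)"
      using i j by (simp add: sum.distrib)
    also have "\<dots> = 0" using no i by auto
    finally show "(A *\<^sub>v x) $ i = 0\<^sub>v n $ i" using i by simp
  qed (use A in auto)
  then have "inv\<^bsub>GL n\<^esub> A *\<^sub>v (A *\<^sub>v x) = 0\<^sub>v n"
    using GL_carrier_mat[OF GL_inv_closed[OF A]] by (auto intro!: eq_vecI simp: scalar_prod_def)
  then have "1\<^sub>m n *\<^sub>v x = 0\<^sub>v n"
    using assoc_mult_mat_vec[OF GL_carrier_mat[OF GL_inv_closed[OF A]] GL_carrier_mat[OF A] xc]
    by (simp add: GL_l_inv[OF A])
  then have "x $ j = 0" using j xc by simp
  then show False using j by (simp add: x_def)
qed

text \<open>Gaussian elimination as an induction principle: left multiplication by transvections and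
  by diagonal matrices with one nontrivial entry reduces every invertible matrix to the identity. It
  evaluates a multiplicative function from its values on elementary matrices.\<close>

lemma GL_reduce:
  fixes A :: "'f::field mat"
  assumes one: "P (1\<^sub>m n)"
    and add: "\<And>A a k l. A \<in> carrier (GL n) \<Longrightarrow> k < n \<Longrightarrow> l < n \<Longrightarrow> k \<noteq> l \<Longrightarrow>
      P (addrow_mat n a k l * A) \<Longrightarrow> P A"
    and mult: "\<And>A a k. A \<in> carrier (GL n) \<Longrightarrow> k < n \<Longrightarrow> a \<noteq> 0 \<Longrightarrow> P (multrow_mat n k a * A) \<Longrightarrow> P A"
    and A: "A \<in> carrier (GL n)"
  shows "P A"
proof -
  \<comment> \<open>\<open>U j A\<close> says that the first j columns of A are already those of the
    identity.\<close>
  define U where "U j A \<longleftrightarrow> A \<in> carrier (GL n) \<and>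
    (\<forall>i<n. \<forall>c<j. A $$ (i, c) = (if i = c then 1 else (0::'f)))" for j A
  have addU: "U j (addrow_mat n a k l * A)" if "U j A" "k < n" "j \<le> l" "l < n" "k \<noteq> l" for j A k l a
  proof -
    have Ac: "A \<in> carrier (GL n)" using that by (simp add: U_def)
    have e: "addrow_mat n a k l * A = addrow a k l A"
      using addrow_mat[OF GL_carrier_mat[OF Ac] that(4)] by simp
    show ?thesis unfolding U_def
      using that GL_mult_closed[OF addrow_mat_GL[OF that(5), of n a] Ac] GL_dim[OF Ac]
      unfolding e by (auto simp: U_def)
  qed
  have ent: "(addrow_mat n a k l * A) $$ (i, c) = (if k = i then a * A $$ (l, c) + A $$ (i, c) else A $$ (i, c))"
    if "A \<in> carrier (GL n)" "i < n" "c < n" "l < n" for A :: "'f mat" and a k l i c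
    using addrow_mat[OF GL_carrier_mat[OF that(1)] that(4), symmetric] that by simp
  have main: "U j A \<Longrightarrow> P A" if "j \<le> n" for j A
    using that
  proof (induction "n - j" arbitrary: j A)
    case 0
    then have "A = 1\<^sub>m n"
      by (intro eq_matI) (auto simp: U_def)
    then show ?case using one by simp
  next
    case (Suc d)
    have j: "j < n" using Suc.hyps(2) by simp
    have IH: "P A" if "U (Suc j) A" for A
      using Suc.hyps(1)[of "Suc j" A] Suc.hyps(2) j that by simp
    \<comment> \<open>Each transvection with the pivot row removes one nonzero off-diagonal entry of
      column j, so their number is the induction measure.\<close>
    have clear: "P A" if "U j A" "A $$ (j, j) = 1" for A
      using that
    proof (induction "card {i. i < n \<and> i \<noteq> j \<and> A $$ (i, j) \<noteq> 0}" arbitrary: A)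
      case 0
      then have "\<forall>i<n. i \<noteq> j \<longrightarrow> A $$ (i, j) = 0" by auto
      then have "U (Suc j) A" using 0 by (auto simp: U_def less_Suc_eq)
      then show ?case by (rule IH)
    next
      case (Suc m)
      let ?S = "{i. i < n \<and> i \<noteq> j \<and> A $$ (i, j) \<noteq> 0}"
      obtain i where i: "i \<in> ?S" using Suc.hyps(2) by (metis card.empty equals0I nat.distinct(1))
      let ?B = "addrow_mat n (- A $$ (i, j)) i j * A"
      have Ac: "A \<in> carrier (GL n)" using Suc.prems by (simp add: U_def)
      have eB: "?B $$ (i', j) = (if i = i' then 0 else A $$ (i', j))" if "i' < n" for i'
        using ent[OF Ac that j j] Suc.prems(2) by auto
      have "{i'. i' < n \<and> i' \<noteq> j \<and> ?B $$ (i', j) \<noteq> 0} = ?S - {i}"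
        by (auto simp: eB split: if_splits)
      then have "m = card {i'. i' < n \<and> i' \<noteq> j \<and> ?B $$ (i', j) \<noteq> 0}"
        using Suc.hyps(2) i by simp
      moreover have "U j ?B" by (rule addU[OF Suc.prems(1)]) (use i j in auto)
      moreover have "?B $$ (j, j) = 1" using eB[OF j] Suc.prems(2) i by auto
      ultimately have "P ?B" by (rule Suc.hyps(1))
      then show ?case using add[OF Ac, of i j "- A $$ (i, j)"] i j by simp
    qed
    have scale: "P A" if "U j A" "A $$ (j, j) \<noteq> 0" for A
    proof -
      have Ac: "A \<in> carrier (GL n)" using that by (simp add: U_def)
      let ?a = "inverse (A $$ (j, j))"
      have a: "?a \<noteq> 0" using that by simp
      let ?B = "multrow_mat n j ?a * A"
      have e: "?B = multrow j ?a A" using multrow_mat[OF GL_carrier_mat[OF Ac]] by simp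
      have "U j ?B" unfolding U_def
        using that GL_mult_closed[OF multrow_mat_GL[OF j a] Ac] GL_dim[OF Ac] j
        by (auto simp: e U_def)
      moreover have "?B $$ (j, j) = 1" using j that GL_dim[OF Ac] by (simp add: e)
      ultimately have "P ?B" by (rule clear)
      then show ?thesis using mult[OF Ac j a] by blast
    qed
    have Ac: "A \<in> carrier (GL n)" using Suc.prems by (simp add: U_def)
    show ?case
    proof (cases "A $$ (j, j) = 0")
      case False
      then show ?thesis using scale Suc.prems by blast
    next
      case True
      \<comment> \<open>A vanishing pivot is repaired by adding a lower row whose entry in column j
        is nonzero.\<close>
      obtain i where i: "j \<le> i" "i < n" "A $$ (i, j) \<noteq> 0"
        using unit_column_exists[OF Ac j] Suc.prems unfolding U_def by blast
      then have ij: "j \<noteq> i" using True by auto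
      have "U j (addrow_mat n 1 j i * A)" using addU[OF Suc.prems(1) j i(1,2) ij] .
      moreover have "(addrow_mat n 1 j i * A) $$ (j, j) \<noteq> 0" using ent[OF Ac j j i(2)] i True by simp
      ultimately have "P (addrow_mat n 1 j i * A)" by (rule scale)
      then show ?thesis using add[OF Ac j i(2) ij] by blast
    qed
  qed
  show ?thesis using main[of 0 A] A by (simp add: U_def)
qed

text \<open>The constant is one plus the sum of the absolute values of all entries. It bounds both
  the radius of local constancy and the support of a composite with a linear map.\<close>

lemma mat_vec_box:
  fixes A :: "'f::nonarch_local_field mat"
  assumes A: "A \<in> carrier_mat n m"
  shows "\<exists>C>0. \<forall>\<rho>\<ge>0. \<forall>x\<in>box m \<rho>. A *\<^sub>v x \<in> box n (C * \<rho>)"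
proof -
  define C where "C = 1 + (\<Sum>i<n. \<Sum>j<m. nabs (A $$ (i, j)))"
  have C: "0 < C" unfolding C_def by (intro add_pos_nonneg sum_nonneg) auto
  have le: "nabs (A $$ (i, j)) \<le> C" if "i < n" "j < m" for i j
  proof -
    have "nabs (A $$ (i, j)) \<le> (\<Sum>j<m. nabs (A $$ (i, j)))" using that by (intro member_le_sum) auto
    also have "\<dots> \<le> (\<Sum>i<n. \<Sum>j<m. nabs (A $$ (i, j)))"
      using that by (intro member_le_sum[where f="\<lambda>i. \<Sum>j<m. nabs (A $$ (i, j))"] sum_nonneg) auto
    finally show ?thesis by (simp add: C_def)
  qed
  have "A *\<^sub>v x \<in> box n (C * \<rho>)" if \<rho>: "0 \<le> \<rho>" and x: "x \<in> box m \<rho>" for \<rho> and x :: "'f vec"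
  proof -
    have xc: "x \<in> carrier_vec m" using box_carrier[OF x] .
    have "nabs ((A *\<^sub>v x) $ i) \<le> C * \<rho>" if i: "i < n" for i
    proof -
      have "(A *\<^sub>v x) $ i = (\<Sum>j\<in>{0..<m}. A $$ (i, j) * x $ j)"
        using A i xc by (simp add: scalar_prod_def)
      moreover have "nabs (\<Sum>j\<in>{0..<m}. A $$ (i, j) * x $ j) \<le> C * \<rho>"
      proof (rule nabs_sum_le)
        show "0 \<le> C * \<rho>" using C \<rho> by simp
        fix j assume j: "j \<in> {0..<m}"
        have "nabs (x $ j) \<le> \<rho>" using x j by (simp add: box_def)
        then show "nabs (A $$ (i, j) * x $ j) \<le> C * \<rho>"
          unfolding nabs_mult using le[OF i, of j] j C by (intro mult_mono) auto
      qed
      ultimately show ?thesis by simp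
    qed
    then show ?thesis using A xc by (simp add: box_def)
  qed
  then show ?thesis using C by blast
qed

lemma test_fun_comp:
  fixes f :: "'f::nonarch_local_field vec \<Rightarrow> complex"
  assumes A: "A \<in> carrier (GL r)" and f: "test_fun r f"
  shows "test_fun r (\<lambda>x. f (A *\<^sub>v x))"
proof -
  obtain \<rho> M where 1: "0 < \<rho>" "\<rho> \<le> 1" "loc_const r \<rho> f" "0 < M" "supported r M 0 f"
    by (rule test_fun_radius[OF f real_zero_less_one])
  have Ac: "A \<in> carrier_mat r r" "inv\<^bsub>GL r\<^esub> A \<in> carrier_mat r r"
    using A GL_inv_closed[OF A] GL_carrier_mat by blast+
  obtain C where C: "0 < C" "\<forall>\<rho>\<ge>0. \<forall>x\<in>box r \<rho>. A *\<^sub>v x \<in> box r (C * \<rho>)"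
    using mat_vec_box[OF Ac(1)] by blast
  obtain D where D: "0 < D" "\<forall>\<rho>\<ge>0. \<forall>x\<in>box r \<rho>. inv\<^bsub>GL r\<^esub> A *\<^sub>v x \<in> box r (D * \<rho>)"
    using mat_vec_box[OF Ac(2)] by blast
  show ?thesis
  proof (rule test_funI)
    show "0 < \<rho> / C" using 1 C by simp
    show "loc_const r (\<rho> / C) (\<lambda>x. f (A *\<^sub>v x))" unfolding loc_const_def
    proof (intro ballI)
      fix x d :: "'f vec" assume x: "x \<in> carrier_vec r" and d: "d \<in> box r (\<rho> / C)"
      have "A *\<^sub>v d \<in> box r (C * (\<rho> / C))"
        by (rule C(2)[rule_format]) (use d 1(1) C(1) in simp_all)
      then have "A *\<^sub>v d \<in> box r \<rho>" using C(1) by simp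
      then show "f (A *\<^sub>v (x + d)) = f (A *\<^sub>v x)"
        using 1(3) x Ac(1) mult_add_distrib_mat_vec[OF Ac(1) x box_carrier[OF d]]
        unfolding loc_const_def by simp
    qed
    show "supported r (D * M) 0 (\<lambda>x. f (A *\<^sub>v x))" unfolding supported_def
    proof (intro ballI impI)
      fix x :: "'f vec" assume x: "x \<in> carrier_vec r" "f (A *\<^sub>v x) \<noteq> 0"
      then have "A *\<^sub>v x \<in> box r M" using 1(5) Ac(1) unfolding supported_def by simp
      then have "inv\<^bsub>GL r\<^esub> A *\<^sub>v (A *\<^sub>v x) \<in> box r (D * M)" using D(2) 1(4) by simp
      moreover have "inv\<^bsub>GL r\<^esub> A *\<^sub>v (A *\<^sub>v x) = x"
        using assoc_mult_mat_vec[OF Ac(2,1) x(1)] GL_l_inv[OF A] x(1) by simp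
      ultimately show "x \<in> box r (D * M)" by simp
    qed
  qed
qed

text \<open>The volume of the preimage of the unit box under A; by uniqueness of the Haar functional
  it is the factor in the change of variables formula.\<close>

definition modulus :: "nat \<Rightarrow> 'f::nonarch_local_field mat \<Rightarrow> complex" where
  "modulus r A = haar r (\<lambda>x. ind r 1 (0\<^sub>v r :: 'f vec) (A *\<^sub>v x))"

text \<open>Integrating f composed with A is again translation invariant in f, because f(A x + v) =
  f(A (x + u)) with u = A^(-1) v. Uniqueness makes it a multiple of \<open>haar r\<close>, and the
  multiple is read off on the unit box.\<close>

lemma haar_comp:
  fixes f :: "'f::nonarch_local_field vec \<Rightarrow> complex"
  assumes A: "A \<in> carrier (GL r)" and f: "test_fun r f"
  shows "haar r (\<lambda>x. f (A *\<^sub>v x)) = modulus r A * haar r f"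
proof -
  have Ac: "A \<in> carrier_mat r r" "inv\<^bsub>GL r\<^esub> A \<in> carrier_mat r r"
    using A GL_inv_closed[OF A] GL_carrier_mat by blast+
  have "invariant_functional r (\<lambda>f. haar r (\<lambda>x::'f vec. f (A *\<^sub>v x)))"
    unfolding invariant_functional_def
  proof (intro conjI allI impI ballI)
    fix f g :: "'f vec \<Rightarrow> complex" assume "test_fun r f" "test_fun r g"
    then show "haar r (\<lambda>x. f (A *\<^sub>v x) + g (A *\<^sub>v x)) = haar r (\<lambda>x. f (A *\<^sub>v x)) + haar r (\<lambda>x. g (A *\<^sub>v x))"
      by (intro haar_add test_fun_comp[OF A])
  next
    fix f :: "'f vec \<Rightarrow> complex" and c assume "test_fun r f"
    then show "haar r (\<lambda>x. c * f (A *\<^sub>v x)) = c * haar r (\<lambda>x. f (A *\<^sub>v x))"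
      by (intro haar_scale test_fun_comp[OF A])
  next
    fix f :: "'f vec \<Rightarrow> complex" and v :: "'f vec" assume f: "test_fun r f" and v: "v \<in> carrier_vec r"
    let ?w = "inv\<^bsub>GL r\<^esub> A *\<^sub>v v"
    have w: "?w \<in> carrier_vec r" using Ac(2) v by simp
    have Aw: "A *\<^sub>v ?w = v" using assoc_mult_mat_vec[OF Ac(1,2) v] GL_r_inv[OF A] v by simp
    have "haar r (\<lambda>x. f (A *\<^sub>v (x + ?w))) = haar r (\<lambda>x. f (A *\<^sub>v x))"
      by (rule haar_translate[OF w test_fun_comp[OF A f]])
    moreover have "haar r (\<lambda>x. f (A *\<^sub>v (x + ?w))) = haar r (\<lambda>x. f (A *\<^sub>v x + v))"
    proof (rule haar_cong)
      show "test_fun r (\<lambda>x. f (A *\<^sub>v (x + ?w)))"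
        by (rule test_fun_translate[OF test_fun_comp[OF A f] w])
      fix x :: "'f vec" assume "x \<in> carrier_vec r"
      then show "f (A *\<^sub>v (x + ?w)) = f (A *\<^sub>v x + v)"
        using mult_add_distrib_mat_vec[OF Ac(1) _ w] Aw by simp
    qed
    ultimately show "haar r (\<lambda>x. f (A *\<^sub>v x + v)) = haar r (\<lambda>x. f (A *\<^sub>v x))" by simp
  next
    fix f g :: "'f vec \<Rightarrow> complex" assume f: "test_fun r f" and "\<forall>x\<in>carrier_vec r. f x = g x"
    then show "haar r (\<lambda>x. f (A *\<^sub>v x)) = haar r (\<lambda>x. g (A *\<^sub>v x))"
      using Ac(1) by (intro haar_cong test_fun_comp[OF A f]) auto
  qed
  from invariant_functional_unique[OF this f] show ?thesis unfolding modulus_def .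
qed

lemma modulus_one: "modulus r (1\<^sub>m r :: 'f::nonarch_local_field mat) = 1"
proof -
  have "haar r (\<lambda>x. ind r 1 (0\<^sub>v r :: 'f vec) (1\<^sub>m r *\<^sub>v x)) = haar r (ind r 1 (0\<^sub>v r :: 'f vec))"
    by (rule haar_cong[OF test_fun_comp[OF GL_one_closed ind_test_fun]]) auto
  then show ?thesis unfolding modulus_def using haar_unit_box by simp
qed

lemma modulus_mult:
  fixes A B :: "'f::nonarch_local_field mat"
  assumes A: "A \<in> carrier (GL r)" and B: "B \<in> carrier (GL r)"
  shows "modulus r (A * B) = modulus r A * modulus r B"
proof -
  let ?i = "ind r 1 (0\<^sub>v r :: 'f vec)"
  have i: "test_fun r ?i" by (rule ind_test_fun) auto
  have "modulus r (A * B) = haar r (\<lambda>x. ?i (A *\<^sub>v (B *\<^sub>v x)))"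
    unfolding modulus_def
    by (rule haar_cong[OF test_fun_comp[OF GL_mult_closed[OF A B] i]])
      (simp add: assoc_mult_mat_vec[OF GL_carrier_mat[OF A] GL_carrier_mat[OF B]])
  also have "\<dots> = modulus r B * haar r (\<lambda>x. ?i (A *\<^sub>v x))"
    by (rule haar_comp[OF B test_fun_comp[OF A i]])
  finally show ?thesis by (simp add: modulus_def mult.commute)
qed

text \<open>An indicator of a set stable under A has the same nonzero integral before and after
  composition with A, so the factor cancels.\<close>

lemma modulus_eq_oneI:
  fixes A :: "'f::nonarch_local_field mat"
  assumes A: "A \<in> carrier (GL r)" and f: "test_fun r f" "\<And>x. f x \<in> {0, 1}" "f (0\<^sub>v r) = 1"
    and eq: "\<And>x. x \<in> carrier_vec r \<Longrightarrow> f (A *\<^sub>v x) = f x"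
  shows "modulus r A = 1"
proof -
  have "haar r (\<lambda>x. f (A *\<^sub>v x)) = haar r f"
    by (rule haar_cong[OF test_fun_comp[OF A f(1)] eq])
  then have "modulus r A * haar r f = haar r f" using haar_comp[OF A f(1)] by simp
  then show ?thesis using haar_indicator_nonzero[OF f] by simp
qed


lemma nabs_add_le_iff: "nabs d \<le> M \<Longrightarrow> nabs (x + d) \<le> M \<longleftrightarrow> nabs x \<le> M" for x d :: "'f::nonarch_local_field"
  using nabs_add_le[of x M d] nabs_diff_le[of "x + d" M d] by auto

text \<open>A separate radius for each coordinate is what allows a box stable under a given
  transvection.\<close>

definition wbox_ind :: "nat \<Rightarrow> (nat \<Rightarrow> real) \<Rightarrow> 'f::nonarch_local_field vec \<Rightarrow> complex" where
  "wbox_ind n b x = (if \<forall>i<n. nabs (x $ i) \<le> b i then 1 else 0)"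

lemma wbox_ind_test_fun:
  assumes "0 < \<rho>" "\<And>i. i < n \<Longrightarrow> \<rho> \<le> b i" "\<And>i. i < n \<Longrightarrow> b i \<le> M"
  shows "test_fun n (wbox_ind n b :: 'f::nonarch_local_field vec \<Rightarrow> complex)"
proof (rule test_funI[OF assms(1)])
  show "loc_const n \<rho> (wbox_ind n b :: 'f vec \<Rightarrow> complex)" unfolding loc_const_def
  proof (intro ballI)
    fix x d :: "'f vec" assume x: "x \<in> carrier_vec n" and d: "d \<in> box n \<rho>"
    have "nabs ((x + d) $ i) \<le> b i \<longleftrightarrow> nabs (x $ i) \<le> b i" if i: "i < n" for i
    proof -
      have "nabs (d $ i) \<le> b i" using d assms(2)[OF i] i by (force simp: box_def)
      then show ?thesis using nabs_add_le_iff[of "d $ i" "b i" "x $ i"] i box_carrier[OF d] by simp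
    qed
    then show "wbox_ind n b (x + d) = wbox_ind n b x" by (simp add: wbox_ind_def)
  qed
  show "supported n M 0 (wbox_ind n b :: 'f vec \<Rightarrow> complex)" unfolding supported_def
  proof (intro ballI impI)
    fix x :: "'f vec" assume x: "x \<in> carrier_vec n" "wbox_ind n b x \<noteq> 0"
    then have "nabs (x $ i) \<le> b i" if "i < n" for i using that by (auto simp: wbox_ind_def split: if_splits)
    then have "nabs (x $ i) \<le> M" if "i < n" for i using assms(3)[OF that] that by force
    then show "x \<in> box n M" using x by (simp add: box_def)
  qed
qed

text \<open>The transvection adds a times coordinate l to coordinate k. It preserves the box with
  radius \<delta> in coordinate l and radius 1 elsewhere as soon as \<open>nabs a * \<delta>\<close>
  is at most 1.\<close>

lemma modulus_addrow:
  fixes a :: "'f::nonarch_local_field"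
  assumes kl: "k < n" "l < n" "k \<noteq> l"
  shows "modulus n (addrow_mat n a k l) = 1"
proof -
  define \<delta> where "\<delta> = 1 / (1 + nabs a)"
  define b :: "nat \<Rightarrow> real" where "b = (\<lambda>i. if i = l then \<delta> else 1)"
  have pos: "0 < 1 + nabs a" using nabs_nonneg[of a] by linarith
  have \<delta>: "0 < \<delta>" "\<delta> \<le> 1" using pos by (auto simp: \<delta>_def)
  have a\<delta>: "nabs a * \<delta> \<le> 1" using pos by (simp add: \<delta>_def)
  show ?thesis
  proof (rule modulus_eq_oneI[OF addrow_mat_GL[OF kl(3)], where f="wbox_ind n b"])
    show "test_fun n (wbox_ind n b :: 'f vec \<Rightarrow> complex)"
      by (rule wbox_ind_test_fun[OF \<delta>(1), where M=1]) (use \<delta> in \<open>auto simp: b_def\<close>)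
    show "wbox_ind n b x \<in> {0, 1}" for x :: "'f vec" by (simp add: wbox_ind_def)
    show "wbox_ind n b (0\<^sub>v n :: 'f vec) = 1" using \<delta> by (simp add: wbox_ind_def b_def)
    fix x :: "'f vec" assume x: "x \<in> carrier_vec n"
    have ent: "(addrow_mat n a k l *\<^sub>v x) $ i = (if i = k then a * x $ l + x $ i else x $ i)" if "i < n" for i
      using addrow_mat_vec[OF kl(1,2) x that] .
    have "nabs ((addrow_mat n a k l *\<^sub>v x) $ i) \<le> b i \<longleftrightarrow> nabs (x $ i) \<le> b i"
      if i: "i < n" and l: "nabs (x $ l) \<le> \<delta>" for i
    proof (cases "i = k")
      case True
      have "nabs a * nabs (x $ l) \<le> nabs a * \<delta>" using l by (intro mult_left_mono) auto
      then have "nabs (a * x $ l) \<le> 1" using a\<delta> by (simp add: nabs_mult)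
      then show ?thesis using nabs_add_le_iff[of "a * x $ l" 1 "x $ k"] True kl ent[OF i]
        by (simp add: b_def add.commute)
    qed (use ent[OF i] in simp)
    moreover have "nabs (x $ l) \<le> \<delta>" if "\<forall>i<n. nabs (x $ i) \<le> b i"
      using that kl by (auto simp: b_def)
    moreover have "nabs (x $ l) \<le> \<delta>" if "\<forall>i<n. nabs ((addrow_mat n a k l *\<^sub>v x) $ i) \<le> b i"
      using that[rule_format, OF kl(2)] ent[OF kl(2)] kl by (simp add: b_def)
    ultimately have "(\<forall>i<n. nabs ((addrow_mat n a k l *\<^sub>v x) $ i) \<le> b i) \<longleftrightarrow> (\<forall>i<n. nabs (x $ i) \<le> b i)"
      by blast
    then show "wbox_ind n b (addrow_mat n a k l *\<^sub>v x) = wbox_ind n b x"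
      by (simp only: wbox_ind_def)
  qed
qed

lemma multrow_mat_mult:
  fixes a b :: "'f::field"
  assumes "k < n" shows "multrow_mat n k a * multrow_mat n k b = multrow_mat n k (a * b)"
proof -
  have "multrow_mat n k a * multrow_mat n k b = multrow k a (multrow_mat n k b)"
    by (rule multrow_mat[symmetric, where nc=n]) simp
  also have "\<dots> = multrow_mat n k (a * b)" by (intro eq_matI) auto
  finally show ?thesis .
qed

lemma modulus_multrow_unit:
  fixes u :: "'f::nonarch_local_field"
  assumes k: "k < n" and u: "nabs u = 1"
  shows "modulus n (multrow_mat n k u) = 1"
proof -
  have u0: "u \<noteq> 0" using u by auto
  show ?thesis
  proof (rule modulus_eq_oneI[OF multrow_mat_GL[OF k u0], where f="wbox_ind n (\<lambda>_. 1)"])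
    show "test_fun n (wbox_ind n (\<lambda>_. 1) :: 'f vec \<Rightarrow> complex)"
      by (rule wbox_ind_test_fun[OF real_zero_less_one, where M=1]) auto
    show "wbox_ind n (\<lambda>_. 1) x \<in> {0, 1}" for x :: "'f vec" by (simp add: wbox_ind_def)
    show "wbox_ind n (\<lambda>_. 1) (0\<^sub>v n :: 'f vec) = 1" by (simp add: wbox_ind_def)
    fix x :: "'f vec" assume x: "x \<in> carrier_vec n"
    have "nabs ((multrow_mat n k u *\<^sub>v x) $ i) = nabs (x $ i)" if "i < n" for i
      using multrow_mat_vec[OF k x that, of u] u by (simp add: nabs_mult)
    then show "wbox_ind n (\<lambda>_. 1) (multrow_mat n k u *\<^sub>v x) = wbox_ind n (\<lambda>_. 1) x"
      by (simp add: wbox_ind_def)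
  qed
qed

text \<open>Residue classes are open unit balls inside the ring of integers, and in an ultrametric
  space every point of a ball is a centre.\<close>

lemma residue_eq_iff:
  fixes c y :: "'f::nonarch_local_field"
  assumes C: "C \<in> residues_of TYPE('f)" and c: "c \<in> C" and y: "nabs y \<le> 1"
  shows "nabs c \<le> 1"
    and "nabs (y - c) < 1 \<longleftrightarrow> C = {z. nabs z \<le> 1 \<and> nabs (y - z) < 1}"
proof -
  let ?E = "{(x::'f, y). nabs x \<le> 1 \<and> nabs y \<le> 1 \<and> nabs (x - y) < 1}"
  have cls: "?E `` {x} = {z. nabs z \<le> 1 \<and> nabs (x - z) < 1}" if "nabs x \<le> 1" for x :: 'f
    using that by auto
  obtain x where x: "nabs x \<le> 1" "C = {z. nabs z \<le> 1 \<and> nabs (x - z) < 1}"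
    using C cls unfolding residues_of_def quotient_def by auto
  show "nabs c \<le> 1" using x c by simp
  have tri: "nabs (a - d) < 1" if "nabs (a - b) < 1" "nabs (b - d) < 1" for a b d :: 'f
    using nabs_ultrametric[of "a - b" "b - d"] that by simp
  show "nabs (y - c) < 1 \<longleftrightarrow> C = {z. nabs z \<le> 1 \<and> nabs (y - z) < 1}"
  proof
    assume yc: "nabs (y - c) < 1"
    have xc: "nabs (x - c) < 1" "nabs (c - x) < 1" "nabs (c - y) < 1"
      using c x yc nabs_minus_commute[of c x] nabs_minus_commute[of c y] by auto
    have xy: "nabs (x - y) < 1" "nabs (y - x) < 1" using tri xc yc by blast+
    show "C = {z. nabs z \<le> 1 \<and> nabs (y - z) < 1}" unfolding x(2) using tri xy by blast
  next
    assume "C = {z. nabs z \<le> 1 \<and> nabs (y - z) < 1}"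
    then show "nabs (y - c) < 1" using c by blast
  qed
qed

lemma residues_of_nonempty: "C \<in> residues_of TYPE('f::nonarch_local_field) \<Longrightarrow> C \<noteq> {}"
  by (auto simp: residues_of_def quotient_def)

text \<open>The preimage of the unit box under scaling coordinate k by p is a disjoint union of q
  translates of the unit box, one for each residue class: if c lies in the class of p x_k, then p
  x_k - c has absolute value at most that of p, so x_k differs from c / p by an integer of
  F.\<close>

lemma modulus_multrow_uniformizer:
  fixes p :: "'f::nonarch_local_field"
  assumes k: "k < n" and p: "\<forall>x::'f. nabs x < 1 \<longrightarrow> nabs x \<le> nabs p"
    "nabs p = 1 / real (res_card TYPE('f))" "0 < nabs p" "nabs p < 1"
  shows "modulus n (multrow_mat n k p) = inverse (of_real (nabs p))"
proof -
  let ?R = "residues_of TYPE('f)"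
  have p0: "p \<noteq> 0" using p(3) by simp
  have fin: "finite ?R"
    using p(2,3) card.infinite unfolding res_card_def by fastforce
  \<comment> \<open>The centre of the translate belonging to the residue class C; only coordinate k
    is shifted.\<close>
  define t where "t C = vec n (\<lambda>i. if i = k then (SOME c. c \<in> C) / p else 0)" for C :: "'f set"
  have tc: "t C \<in> carrier_vec n" for C by (simp add: t_def)
  have key: "ind n 1 (0\<^sub>v n :: 'f vec) (multrow_mat n k p *\<^sub>v x) = (\<Sum>C\<in>?R. 1 * ind n 1 (t C) x)"
    if x: "x \<in> carrier_vec n" for x :: "'f vec"
  proof -
    let ?Q = "\<forall>i<n. i \<noteq> k \<longrightarrow> nabs (x $ i) \<le> 1"
    have ent: "(multrow_mat n k p *\<^sub>v x) $ i = (if i = k then p * x $ i else x $ i)" if "i < n" for i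
      using multrow_mat_vec[OF k x that] .
    have L: "ind n 1 (0\<^sub>v n :: 'f vec) (multrow_mat n k p *\<^sub>v x) = (if ?Q \<and> nabs (p * x $ k) \<le> 1 then 1 else 0)"
    proof -
      have mc: "multrow_mat n k p *\<^sub>v x \<in> carrier_vec n"
        using x by (intro mult_mat_vec_carrier[of _ n n]) auto
      have "multrow_mat n k p *\<^sub>v x \<in> box n 1 \<longleftrightarrow> ?Q \<and> nabs (p * x $ k) \<le> 1"
        using mc ent k by (auto simp: box_def)
      then show ?thesis using ind_zero[OF mc] by simp
    qed
    have R: "ind n 1 (t C) x = (if ?Q \<and> nabs (p * x $ k) \<le> 1 \<and> C = {z. nabs z \<le> 1 \<and> nabs (p * x $ k - z) < 1} then 1 else 0)"
      if C: "C \<in> ?R" for C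
    proof -
      define c where "c = (SOME c. c \<in> C)"
      have c: "c \<in> C" unfolding c_def using residues_of_nonempty[OF C] some_in_eq by blast
      have c1: "nabs c \<le> 1" by (rule residue_eq_iff(1)[OF C c, of 0]) simp
      have ent': "(x - t C) $ i = (if i = k then x $ k - c / p else x $ i)" if "i < n" for i
        using that by (simp add: t_def c_def)
      have "nabs (x $ k - c / p) = nabs (p * x $ k - c) / nabs p"
        using p0 by (simp add: nabs_divide[symmetric] diff_divide_distrib)
      then have "nabs (x $ k - c / p) \<le> 1 \<longleftrightarrow> nabs (p * x $ k - c) \<le> nabs p"
        using p(3) by simp
      also have "\<dots> \<longleftrightarrow> nabs (p * x $ k - c) < 1" using p(1,4) by force
      also have "\<dots> \<longleftrightarrow> nabs (p * x $ k) \<le> 1 \<and> C = {z. nabs z \<le> 1 \<and> nabs (p * x $ k - z) < 1}"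
      proof (cases "nabs (p * x $ k) \<le> 1")
        case True
        then show ?thesis using residue_eq_iff(2)[OF C c True] by simp
      next
        case False
        then have "\<not> nabs (p * x $ k - c) \<le> 1"
          using nabs_add_le[of "p * x $ k - c" 1 c] c1 by auto
        then show ?thesis using False by linarith
      qed
      finally have e: "nabs (x $ k - c / p) \<le> 1 \<longleftrightarrow>
          nabs (p * x $ k) \<le> 1 \<and> C = {z. nabs z \<le> 1 \<and> nabs (p * x $ k - z) < 1}" .
      have "x - t C \<in> box n 1 \<longleftrightarrow> ?Q \<and> nabs (x $ k - c / p) \<le> 1"
        using ent' tc x k by (auto simp: box_def)
      then show ?thesis unfolding ind_def e by simp
    qed
    show ?thesis
    proof (cases "?Q \<and> nabs (p * x $ k) \<le> 1")
      case True
      let ?C0 = "{z. nabs z \<le> 1 \<and> nabs (p * x $ k - z) < 1}"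
      have "nabs (0::'f) \<le> 1" by simp
      have C0: "?C0 \<in> ?R"
      proof -
        let ?E = "{(x::'f, y). nabs x \<le> 1 \<and> nabs y \<le> 1 \<and> nabs (x - y) < 1}"
        have "?E `` {p * x $ k} \<in> ?R" unfolding residues_of_def by (rule quotientI) (use True in simp)
        moreover have "?E `` {p * x $ k} = ?C0" using True by auto
        ultimately show ?thesis by simp
      qed
      have "(\<Sum>C\<in>?R. 1 * ind n 1 (t C) x) = (\<Sum>C\<in>?R. if C = ?C0 then 1 else 0)"
        by (rule sum.cong[OF HOL.refl]) (use R True in simp)
      then show ?thesis using L True C0 fin by simp
    next
      case False
      have "(\<Sum>C\<in>?R. 1 * ind n 1 (t C) x) = 0"
        by (rule sum.neutral) (use R False in auto)
      then show ?thesis using L False by simp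
    qed
  qed
  have "modulus n (multrow_mat n k p) = haar n (\<lambda>x. \<Sum>C\<in>?R. 1 * ind n 1 (t C) x)"
    unfolding modulus_def
    by (rule haar_cong[OF test_fun_comp[OF multrow_mat_GL[OF k p0] ind_test_fun] key]) auto
  also have "\<dots> = (\<Sum>C\<in>?R. 1 * haar n (ind n 1 (t C)))"
    by (rule invariant_functional_sum[OF haar_invariant ind_test_fun[OF tc]]) simp
  also have "\<dots> = (\<Sum>C\<in>?R. 1)"
    by (simp add: invariant_functional_ind[OF haar_invariant tc] haar_unit_box)
  also have "\<dots> = inverse (of_real (nabs p))" using p(2) by (simp add: res_card_def)
  finally show ?thesis .
qed

text \<open>Every nonzero a is a unit times an integral power of the uniformiser. Units preserve the
  unit box, and powers follow from multiplicativity; for a negative exponent m, the element a p^(-m)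
  is a unit.\<close>

lemma modulus_multrow:
  fixes a :: "'f::nonarch_local_field"
  assumes k: "k < n" and a: "a \<noteq> 0"
  shows "modulus n (multrow_mat n k a) = inverse (of_real (nabs a))"
proof -
  obtain p :: 'f where p: "\<forall>x::'f. nabs x < 1 \<longrightarrow> nabs x \<le> nabs p"
    "nabs p = 1 / real (res_card TYPE('f))" "0 < nabs p" "nabs p < 1"
    using uniformizer_exists[where 'f='f] by blast
  have p0: "p \<noteq> 0" using p(3) by simp
  let ?h = "\<lambda>a. modulus n (multrow_mat n k a)"
  have h: "?h (a * b) = ?h a * ?h b" if "a \<noteq> 0" "b \<noteq> 0" for a b :: 'f
    using modulus_mult[OF multrow_mat_GL[OF k that(1)] multrow_mat_GL[OF k that(2)]] multrow_mat_mult[OF k, of a b]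
    by simp
  have hp: "?h (p ^ j) = inverse (of_real (nabs (p ^ j)))" for j
  proof (induction j)
    case 0
    show ?case using modulus_multrow_unit[OF k, of "1::'f"] by simp
  next
    case (Suc j)
    then show ?case using h[of p "p ^ j"] p0 modulus_multrow_uniformizer[OF k p]
      by (simp add: nabs_mult)
  qed
  obtain m :: int where m: "nabs a = nabs p powi m" using nabs_eq_power[OF p(1,3,4) a] by blast
  show ?thesis
  proof (cases "0 \<le> m")
    case True
    then have e: "nabs a = nabs (p ^ nat m)" using m by (simp add: power_int_def nabs_power)
    have "nabs (a / p ^ nat m) = 1" using e p(3) a by (simp add: nabs_divide)
    then have "?h (a / p ^ nat m) = 1" by (rule modulus_multrow_unit[OF k])
    moreover have "?h (a / p ^ nat m * p ^ nat m) = ?h (a / p ^ nat m) * ?h (p ^ nat m)"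
      using a p0 by (intro h) auto
    ultimately show ?thesis using hp[of "nat m"] e p0 by simp
  next
    case False
    then have e: "nabs a * nabs (p ^ nat (- m)) = 1"
      using m p(3) by (simp add: power_int_def nabs_power power_inverse)
    have "?h (a * p ^ nat (- m)) = 1"
      by (rule modulus_multrow_unit[OF k]) (use e in \<open>simp add: nabs_mult\<close>)
    then have "?h a * inverse (of_real (nabs (p ^ nat (- m)))) = 1"
      using h[of a "p ^ nat (- m)"] a p0 hp by simp
    moreover have "inverse (nabs (p ^ nat (- m))) = nabs a" using e by (simp add: inverse_unique mult.commute)
    ultimately have "?h a * of_real (nabs a) = 1" by (metis of_real_inverse)
    then show ?thesis by (metis inverse_unique mult.commute)
  qed
qed

text \<open>Both sides are multiplicative in A and agree on the elementary matrices of
  \<open>GL_reduce\<close>.\<close>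

lemma modulus_eq:
  fixes A :: "'f::nonarch_local_field mat"
  assumes A: "A \<in> carrier (GL n)"
  shows "modulus n A = inverse (of_real (nabs (det A)))"
proof (rule GL_reduce[OF _ _ _ A])
  show "modulus n (1\<^sub>m n :: 'f mat) = inverse (of_real (nabs (det (1\<^sub>m n :: 'f mat))))" by (simp add: modulus_one)
next
  fix A :: "'f mat" and a k l
  assume A: "A \<in> carrier (GL n)" and kl: "k < n" "l < n" "k \<noteq> l"
    and P: "modulus n (addrow_mat n a k l * A) = inverse (of_real (nabs (det (addrow_mat n a k l * A))))"
  then show "modulus n A = inverse (of_real (nabs (det A)))"
    using modulus_mult[OF addrow_mat_GL[OF kl(3)] A, of a] modulus_addrow[OF kl, of a]
      det_mult[OF addrow_mat_carrier GL_carrier_mat[OF A], of a k l] det_addrow_mat[OF kl(3), of n a]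
    by simp
next
  fix A :: "'f mat" and a k
  assume A: "A \<in> carrier (GL n)" and k: "k < n" "a \<noteq> 0"
    and P: "modulus n (multrow_mat n k a * A) = inverse (of_real (nabs (det (multrow_mat n k a * A))))"
  have "inverse (complex_of_real (nabs a)) * modulus n A = inverse (of_real (nabs a)) * inverse (of_real (nabs (det A)))"
    using P modulus_mult[OF multrow_mat_GL[OF k] A] modulus_multrow[OF k]
      det_mult[OF multrow_mat_carrier GL_carrier_mat[OF A], of k a] det_multrow_mat[OF k(1), of a]
    by (simp add: nabs_mult)
  then show "modulus n A = inverse (of_real (nabs (det A)))" using k(2) by simp
qed

lemma haar_comp_det:
  fixes f :: "'f::nonarch_local_field vec \<Rightarrow> complex"
  assumes "A \<in> carrier (GL r)" "test_fun r f"
  shows "haar r (\<lambda>x. f (A *\<^sub>v x)) = inverse (of_real (nabs (det A))) * haar r f"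
  using haar_comp[OF assms] modulus_eq[OF assms(1)] by simp

section \<open>Additive characters, their conductors and Fourier inversion\<close>

section \<open>The Fourier transform\<close>

definition add_char :: "('f::nonarch_local_field \<Rightarrow> complex) \<Rightarrow> bool" where
  "add_char \<chi> \<longleftrightarrow> (\<forall>x y. \<chi> (x + y) = \<chi> x * \<chi> y) \<and> (\<forall>x. \<chi> x \<noteq> 0) \<and> open {x. \<chi> x = 1}"

lemma nontrivial_add_char_iff: "nontrivial_add_char \<chi> \<longleftrightarrow> add_char \<chi> \<and> (\<exists>x. \<chi> x \<noteq> 1)"
  by (auto simp: nontrivial_add_char_def add_char_def)

lemma add_charD:
  assumes "add_char \<chi>"
  shows "\<chi> (x + y) = \<chi> x * \<chi> y" "\<chi> x \<noteq> 0" "open {x. \<chi> x = 1}"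
  using assms by (auto simp: add_char_def)

lemma add_char_0: "add_char \<chi> \<Longrightarrow> \<chi> 0 = 1"
  using add_charD(1)[of \<chi> 0 0] add_charD(2)[of \<chi> 0] by simp

lemma add_char_minus: "add_char \<chi> \<Longrightarrow> \<chi> (- x) = inverse (\<chi> x)"
  using add_charD(1)[of \<chi> "- x" x] add_charD(2)[of \<chi> x] add_char_0[of \<chi>]
  by (simp add: field_simps)

lemma add_char_trivial_near_0:
  fixes \<chi> :: "'f::nonarch_local_field \<Rightarrow> complex"
  assumes "add_char \<chi>"
  shows "\<exists>e>0. \<forall>x. nabs x \<le> e \<longrightarrow> \<chi> x = 1"
proof -
  obtain e where e: "e > 0" "\<forall>y. dist y 0 < e \<longrightarrow> y \<in> {x. \<chi> x = 1}"
    using add_charD(3)[OF assms] add_char_0[OF assms] unfolding open_dist by blast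
  then show ?thesis by (intro exI[of _ "e / 2"]) (auto simp: dist_nabs)
qed

lemma add_char_scaled:
  fixes \<chi> :: "'f::nonarch_local_field \<Rightarrow> complex"
  assumes \<chi>: "add_char \<chi>" shows "add_char (\<lambda>x. \<chi> (c * x))"
proof -
  obtain e where e: "e > 0" "\<forall>x. nabs x \<le> e \<longrightarrow> \<chi> x = 1" using add_char_trivial_near_0[OF \<chi>] by blast
  have pos: "0 < 1 + nabs c" using nabs_nonneg[of c] by linarith
  have "open {x. \<chi> (c * x) = 1}" unfolding open_dist
  proof (intro ballI exI[of _ "e / (1 + nabs c)"] conjI allI impI)
    fix x y assume x: "x \<in> {x. \<chi> (c * x) = 1}" and y: "dist y x < e / (1 + nabs c)"
    have "nabs (c * (y - x)) \<le> (1 + nabs c) * nabs (y - x)"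
      unfolding nabs_mult by (intro mult_right_mono) auto
    also have "\<dots> \<le> (1 + nabs c) * (e / (1 + nabs c))"
      using y pos by (intro mult_left_mono) (auto simp: dist_nabs)
    finally have "nabs (c * (y - x)) \<le> e" using pos by simp
    then have "\<chi> (c * (y - x)) = 1" using e by blast
    then have "\<chi> (c * x + c * (y - x)) = 1" using x add_charD(1)[OF \<chi>, of "c * x" "c * (y - x)"] by simp
    then show "y \<in> {x. \<chi> (c * x) = 1}" by (simp add: algebra_simps)
  qed (use e pos in simp)
  then show ?thesis using add_charD(1,2)[OF \<chi>] by (simp add: add_char_def distrib_left)
qed

text \<open>The absolute value of w is the radius of the largest ball around 0 on which \<chi> is
  trivial. Radii are given by field elements since real radii between two consecutive values define
  the same ball.\<close>

definition conductor :: "('f::nonarch_local_field \<Rightarrow> complex) \<Rightarrow> 'f \<Rightarrow> bool" where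
  "conductor \<chi> w \<longleftrightarrow> w \<noteq> 0 \<and> (\<forall>a::'f. (\<forall>x. nabs x \<le> nabs a \<longrightarrow> \<chi> x = 1) \<longleftrightarrow> nabs a \<le> nabs w)"

text \<open>Start from a point x1 with \<chi> x1 different from 1 and shrink the radius by powers of
  the uniformiser. The first radius at which \<chi> becomes trivial is the conductor, since the next
  larger value is the previous radius. It is reached because \<chi> is trivial near 0.\<close>

lemma conductor_exists:
  fixes \<chi> :: "'f::nonarch_local_field \<Rightarrow> complex"
  assumes \<chi>: "nontrivial_add_char \<chi>"
  shows "\<exists>w. conductor \<chi> w"
proof -
  obtain x1 where x1: "\<chi> x1 \<noteq> 1" using \<chi> by (auto simp: nontrivial_add_char_iff)
  have ac: "add_char \<chi>" using \<chi> by (simp add: nontrivial_add_char_iff)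
  have x10: "x1 \<noteq> 0" using x1 add_char_0[OF ac] by auto
  obtain p :: 'f where p: "\<forall>x::'f. nabs x < 1 \<longrightarrow> nabs x \<le> nabs p" "0 < nabs p" "nabs p < 1"
    using uniformizer_exists[where 'f='f] by blast
  have p0: "p \<noteq> 0" using p(2) by simp
  obtain e where e: "e > 0" "\<forall>x. nabs x \<le> e \<longrightarrow> \<chi> x = 1" using add_char_trivial_near_0[OF ac] by blast
  define Tr where "Tr k \<longleftrightarrow> (\<forall>x. nabs x \<le> nabs (x1 * p ^ k) \<longrightarrow> \<chi> x = 1)" for k
  obtain k0 where "nabs p ^ k0 < e / nabs x1"
    using real_arch_pow_inv[of "e / nabs x1" "nabs p"] e p x10 by auto
  then have "nabs (x1 * p ^ k0) \<le> e" using x10 by (simp add: nabs_mult nabs_power field_simps)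
  then have "Tr k0" using e unfolding Tr_def by (meson order_trans)
  define k where "k = (LEAST k. Tr k)"
  have k: "Tr k" "\<And>j. j < k \<Longrightarrow> \<not> Tr j" unfolding k_def using LeastI[of Tr, OF \<open>Tr k0\<close>] not_less_Least by blast+
  have "\<not> Tr 0" using x1 unfolding Tr_def by auto
  then obtain j where j: "k = Suc j" using k(1) by (cases k) auto
  have "conductor \<chi> (x1 * p ^ k)" unfolding conductor_def
  proof (intro conjI allI iffI)
    show "x1 * p ^ k \<noteq> 0" using x10 p0 by simp
    fix a :: 'f assume a: "\<forall>x. nabs x \<le> nabs a \<longrightarrow> \<chi> x = 1"
    show "nabs a \<le> nabs (x1 * p ^ k)"
    proof (rule ccontr)
      assume "\<not> ?thesis"
      then have lt: "nabs (x1 * p ^ k) < nabs a" by simp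
      have a0: "a \<noteq> 0"
      proof
        assume "a = 0"
        then have "nabs a = 0" by simp
        then show False using lt nabs_nonneg[of "x1 * p ^ k"] by linarith
      qed
      \<comment> \<open>Nothing lies strictly between \<open>nabs p\<close> and 1, so the ball of a
        already contains the previous ball in the sequence.\<close>
      have "nabs (x1 * p ^ k / a) < 1" using lt a0 by (simp add: nabs_divide)
      then have "nabs (x1 * p ^ k / a) \<le> nabs p" using p(1) by blast
      then have "nabs (x1 * p ^ j) * nabs p \<le> nabs a * nabs p"
        using a0 by (simp add: nabs_divide nabs_mult j field_simps)
      then have "nabs (x1 * p ^ j) \<le> nabs a" using p(2) by simp
      then have "Tr j" using a unfolding Tr_def by (meson order_trans)
      then show False using k(2)[of j] j by simp
    qed
  next
    fix a x :: 'f assume "nabs a \<le> nabs (x1 * p ^ k)"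
    then show "nabs x \<le> nabs a \<longrightarrow> \<chi> x = 1" using k(1) unfolding Tr_def by (meson order_trans)
  qed
  then show ?thesis by blast
qed

lemma conductorD:
  fixes \<chi> :: "'f::nonarch_local_field \<Rightarrow> complex" and a :: 'f
  assumes "conductor \<chi> w"
  shows "w \<noteq> 0" "nabs x \<le> nabs w \<Longrightarrow> \<chi> x = 1"
    "nabs w < nabs a \<Longrightarrow> \<exists>x. nabs x \<le> nabs a \<and> \<chi> x \<noteq> 1"
proof -
  have *: "(\<forall>x. nabs x \<le> nabs b \<longrightarrow> \<chi> x = 1) \<longleftrightarrow> nabs b \<le> nabs w" for b :: 'f
    using assms unfolding conductor_def by blast
  show "w \<noteq> 0" using assms unfolding conductor_def by blast
  show "nabs x \<le> nabs w \<Longrightarrow> \<chi> x = 1" using *[of w] by simp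
  show "nabs w < nabs a \<Longrightarrow> \<exists>x. nabs x \<le> nabs a \<and> \<chi> x \<noteq> 1" using *[of a] by auto
qed

lemma conductor_uminus:
  fixes \<chi> :: "'f::nonarch_local_field \<Rightarrow> complex"
  assumes "conductor \<chi> w"
  shows "conductor (\<lambda>x. \<chi> (- x)) w"
proof -
  have "(\<forall>x. nabs x \<le> nabs a \<longrightarrow> \<chi> (- x) = 1) \<longleftrightarrow> (\<forall>x. nabs x \<le> nabs a \<longrightarrow> \<chi> x = 1)" for a :: 'f
    by (metis nabs_minus minus_minus)
  then show ?thesis using assms unfolding conductor_def by simp
qed

lemma scalar_prod_bound:
  fixes x y :: "'f::nonarch_local_field vec"
  assumes x: "x \<in> box r \<rho>" and y: "y \<in> box r N" and "0 \<le> \<rho>" "0 \<le> N"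
  shows "nabs (x \<bullet> y) \<le> \<rho> * N"
proof -
  have "nabs (\<Sum>i\<in>{0..<r}. x $ i * y $ i) \<le> \<rho> * N"
  proof (rule nabs_sum_le)
    fix i assume i: "i \<in> {0..<r}"
    show "nabs (x $ i * y $ i) \<le> \<rho> * N"
      unfolding nabs_mult using x y i assms(3,4) by (intro mult_mono) (auto simp: box_def)
  qed (use assms in simp)
  then show ?thesis using box_carrier[OF y] by (simp add: scalar_prod_def)
qed

lemma vec_in_box:
  fixes x :: "'f::nonarch_local_field vec"
  assumes "x \<in> carrier_vec r" shows "\<exists>N>0. x \<in> box r N"
proof -
  have "0 \<le> (\<Sum>i<r. nabs (x $ i))" by (rule sum_nonneg) auto
  then show ?thesis
    using assms by (intro exI[of _ "1 + (\<Sum>i<r. nabs (x $ i))"])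
      (auto simp: box_def intro!: order_trans[OF member_le_sum[of _ "{..<r}" "\<lambda>i. nabs (x $ i)"]])
qed

lemma char_loc_const:
  fixes \<chi> :: "'f::nonarch_local_field \<Rightarrow> complex"
  assumes \<chi>: "add_char \<chi>" and y: "y \<in> carrier_vec r"
  shows "\<exists>\<sigma>>0. loc_const r \<sigma> (\<lambda>x. \<chi> (x \<bullet> y))"
proof -
  obtain e where e: "e > 0" "\<forall>x. nabs x \<le> e \<longrightarrow> \<chi> x = 1" using add_char_trivial_near_0[OF \<chi>] by blast
  obtain N where N: "N > 0" "y \<in> box r N" using vec_in_box[OF y] by blast
  have "loc_const r (e / N) (\<lambda>x. \<chi> (x \<bullet> y))" unfolding loc_const_def
  proof (intro ballI)
    fix x d :: "'f vec" assume x: "x \<in> carrier_vec r" and d: "d \<in> box r (e / N)"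
    have "nabs (d \<bullet> y) \<le> e" using scalar_prod_bound[OF d N(2)] e N by simp
    then have "\<chi> (d \<bullet> y) = 1" using e by blast
    then show "\<chi> ((x + d) \<bullet> y) = \<chi> (x \<bullet> y)"
      using add_scalar_prod_distrib[OF x box_carrier[OF d] y] add_charD(1)[OF \<chi>] by simp
  qed
  then show ?thesis using e N by (intro exI[of _ "e / N"]) auto
qed

lemma add_char_uminus: "add_char \<chi> \<Longrightarrow> add_char (\<lambda>x. \<chi> (- x))"
  using add_char_scaled[of \<chi> "-1"] by simp

lemma test_fun_char:
  fixes \<chi> :: "'f::nonarch_local_field \<Rightarrow> complex"
  assumes "add_char \<chi>" "y \<in> carrier_vec r" "test_fun r f"
  shows "test_fun r (\<lambda>x. f x * \<chi> (- (x \<bullet> y)))"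
  using char_loc_const[OF add_char_uminus[OF assms(1)] assms(2)] test_fun_mult[OF assms(3)] by blast

lemma test_fun_cong:
  fixes f g :: "'f::nonarch_local_field vec \<Rightarrow> complex"
  assumes f: "test_fun r f" and eq: "\<And>x. x \<in> carrier_vec r \<Longrightarrow> f x = g x"
  shows "test_fun r g"
proof -
  obtain \<rho> M where 1: "0 < \<rho>" "\<rho> \<le> 1" "loc_const r \<rho> f" "0 < M" "supported r M 0 f"
    by (rule test_fun_radius[OF f real_zero_less_one])
  show ?thesis
  proof (rule test_funI[OF 1(1)])
    show "loc_const r \<rho> g" unfolding loc_const_def
    proof (intro ballI)
      fix x d :: "'f vec" assume x: "x \<in> carrier_vec r" and d: "d \<in> box r \<rho>"
      have "x + d \<in> carrier_vec r" using x box_carrier[OF d] by simp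
      then show "g (x + d) = g x" using eq x d 1(3) unfolding loc_const_def by metis
    qed
    show "supported r M 0 g" using eq 1(5) unfolding supported_def by metis
  qed
qed

text \<open>Scaling by the inverse of a maps this box to the unit box, and the scalar matrix has
  determinant a^(-r).\<close>

lemma haar_box:
  fixes a :: "'f::nonarch_local_field"
  assumes a: "a \<noteq> 0"
  shows "haar r (ind r (nabs a) (0\<^sub>v r :: 'f vec)) = of_real (nabs a ^ r)"
proof -
  let ?A = "inverse a \<cdot>\<^sub>m 1\<^sub>m r"
  have det: "det ?A = inverse a ^ r" by simp
  have A: "?A \<in> carrier (GL r)" using a det by (simp add: carrier_GL)
  have i: "test_fun r (ind r 1 (0\<^sub>v r :: 'f vec))" by (rule ind_test_fun) auto
  have "haar r (\<lambda>x. ind r 1 (0\<^sub>v r :: 'f vec) (?A *\<^sub>v x)) = haar r (ind r (nabs a) (0\<^sub>v r :: 'f vec))"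
  proof (rule haar_cong[OF test_fun_comp[OF A i]])
    fix x :: "'f vec" assume x: "x \<in> carrier_vec r"
    have e: "?A *\<^sub>v x = inverse a \<cdot>\<^sub>v x" using x by (intro eq_vecI) auto
    have c: "inverse a \<cdot>\<^sub>v x \<in> carrier_vec r" using x by simp
    have "nabs (inverse a * z) \<le> 1 \<longleftrightarrow> nabs z \<le> nabs a" for z
    proof -
      have "nabs (inverse a * z) = nabs z / nabs a" by (simp add: nabs_mult nabs_inverse divide_inverse)
      then show ?thesis using a by (simp add: pos_divide_le_eq)
    qed
    then have "inverse a \<cdot>\<^sub>v x \<in> box r 1 \<longleftrightarrow> x \<in> box r (nabs a)" using x by (auto simp: box_def)
    then show "ind r 1 (0\<^sub>v r :: 'f vec) (?A *\<^sub>v x) = ind r (nabs a) (0\<^sub>v r :: 'f vec) x"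
      unfolding e ind_zero[OF c] ind_zero[OF x] by simp
  qed
  then show ?thesis using haar_comp_det[OF A i] haar_unit_box[of r, where 'f='f] det a
    by (simp add: nabs_power nabs_inverse power_inverse)
qed

text \<open>Translation by v preserves the box and multiplies the integrand by c, so the integral
  equals c times itself with c different from 1.\<close>

lemma haar_char_box_zero:
  fixes \<Theta> :: "'f::nonarch_local_field vec \<Rightarrow> complex"
  assumes \<rho>: "0 < \<rho>" and \<sigma>: "0 < \<sigma>" "loc_const r \<sigma> \<Theta>" and v: "v \<in> box r \<rho>"
    and \<Theta>: "\<And>x. x \<in> carrier_vec r \<Longrightarrow> \<Theta> (x + v) = \<Theta> x * c" and c: "c \<noteq> 1"
  shows "haar r (\<lambda>x. ind r \<rho> (0\<^sub>v r) x * \<Theta> x) = 0"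
proof -
  let ?g = "\<lambda>x. ind r \<rho> (0\<^sub>v r) x * \<Theta> x"
  have g: "test_fun r ?g" by (rule test_fun_mult[OF ind_test_fun \<sigma>(2,1)]) (use \<rho> in auto)
  have vc: "v \<in> carrier_vec r" using box_carrier[OF v] .
  have "haar r ?g = haar r (\<lambda>x. ?g (x + v))" using haar_translate[OF vc g] by simp
  also have "\<dots> = haar r (\<lambda>x. c * ?g x)"
  proof (rule haar_cong[OF test_fun_translate[OF g vc]])
    fix x :: "'f vec" assume x: "x \<in> carrier_vec r"
    then show "?g (x + v) = c * ?g x"
      using ind_zero[of x r \<rho>] ind_zero[of "x + v" r \<rho>] vc \<Theta>[OF x] box_add_iff[OF v x] by simp
  qed
  also have "\<dots> = c * haar r ?g" by (rule haar_scale[OF g])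
  finally have "(1 - c) * haar r ?g = 0" by (simp add: algebra_simps)
  then show ?thesis using c by simp
qed

definition fourier :: "nat \<Rightarrow> ('f::nonarch_local_field \<Rightarrow> complex) \<Rightarrow> ('f vec \<Rightarrow> complex) \<Rightarrow> 'f vec \<Rightarrow> complex" where
  "fourier r lam f y = haar r (\<lambda>x. f x * lam (- (x \<bullet> y)))"

lemma fourier_cong:
  fixes f g :: "'f::nonarch_local_field vec \<Rightarrow> complex"
  assumes "add_char lam" "test_fun r f" "y \<in> carrier_vec r" "\<And>x. x \<in> carrier_vec r \<Longrightarrow> f x = g x"
  shows "fourier r lam f y = fourier r lam g y"
  unfolding fourier_def by (rule haar_cong[OF test_fun_char[OF assms(1,3,2)]]) (simp add: assms(4))

text \<open>Together with \<open>fourier_modulate\<close> and \<open>fourier_GL\<close> this gives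
  the effect of the transform on the three kinds of operators from which the Weil representations
  are built: translations become modulations and modulations become translations.\<close>

lemma fourier_translate:
  fixes f :: "'f::nonarch_local_field vec \<Rightarrow> complex"
  assumes lam: "add_char lam" and f: "test_fun r f" and y: "y \<in> carrier_vec r" and v: "v \<in> carrier_vec r"
  shows "fourier r lam (\<lambda>x. f (x + v)) y = lam (v \<bullet> y) * fourier r lam f y"
proof -
  have g: "test_fun r (\<lambda>x. f x * lam (- (x \<bullet> y)))" by (rule test_fun_char[OF lam y f])
  have "fourier r lam (\<lambda>x. f (x + v)) y = haar r (\<lambda>x. lam (v \<bullet> y) * (f (x + v) * lam (- ((x + v) \<bullet> y))))"
    unfolding fourier_def
  proof (rule haar_cong[OF test_fun_char[OF lam y test_fun_translate[OF f v]]])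
    fix x :: "'f vec" assume x: "x \<in> carrier_vec r"
    have "- (x \<bullet> y) = v \<bullet> y + - ((x + v) \<bullet> y)" using add_scalar_prod_distrib[OF x v y] by simp
    then have "lam (- (x \<bullet> y)) = lam (v \<bullet> y) * lam (- ((x + v) \<bullet> y))" by (metis add_charD(1)[OF lam])
    then show "f (x + v) * lam (- (x \<bullet> y)) = lam (v \<bullet> y) * (f (x + v) * lam (- ((x + v) \<bullet> y)))" by simp
  qed
  also have "\<dots> = lam (v \<bullet> y) * haar r (\<lambda>x. f (x + v) * lam (- ((x + v) \<bullet> y)))"
    by (rule haar_scale[OF test_fun_translate[OF g v]])
  also have "\<dots> = lam (v \<bullet> y) * fourier r lam f y"
    unfolding fourier_def using haar_translate[OF v g] by simp
  finally show ?thesis .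
qed

lemma fourier_modulate:
  fixes f :: "'f::nonarch_local_field vec \<Rightarrow> complex"
  assumes lam: "add_char lam" and f: "test_fun r f" and y: "y \<in> carrier_vec r" and w: "w \<in> carrier_vec r"
  shows "fourier r lam (\<lambda>x. f x * lam (- (x \<bullet> w))) y = fourier r lam f (y + w)"
  unfolding fourier_def
proof (rule haar_cong[OF test_fun_char[OF lam y test_fun_char[OF lam w f]]])
  fix x :: "'f vec" assume x: "x \<in> carrier_vec r"
  have "- (x \<bullet> (y + w)) = - (x \<bullet> w) + - (x \<bullet> y)" using scalar_prod_add_distrib[OF x y w] by simp
  then have "lam (- (x \<bullet> (y + w))) = lam (- (x \<bullet> w)) * lam (- (x \<bullet> y))" by (metis add_charD(1)[OF lam])
  then show "f x * lam (- (x \<bullet> w)) * lam (- (x \<bullet> y)) = f x * lam (- (x \<bullet> (y + w)))" by simp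
qed

lemma fourier_scale:
  assumes "add_char lam" "test_fun r f" "y \<in> carrier_vec r"
  shows "fourier r lam (\<lambda>x. c * f x) y = c * fourier r lam f y"
  unfolding fourier_def using haar_scale[OF test_fun_char[OF assms(1,3,2)], of c] by (simp add: mult.assoc)

lemma fourier_add:
  assumes "add_char lam" "test_fun r f" "test_fun r g" "y \<in> carrier_vec r"
  shows "fourier r lam (\<lambda>x. f x + g x) y = fourier r lam f y + fourier r lam g y"
  unfolding fourier_def
  using haar_add[OF test_fun_char[OF assms(1,4,2)] test_fun_char[OF assms(1,4,3)]] by (simp add: distrib_right)

text \<open>Substituting x = g z moves g to the other side of the pairing as its transpose, and the
  change of variables produces |det g|. This Jacobian is the source of the exponents -1/2 and 1/2 in
  the two Weil representations.\<close>

lemma fourier_GL: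
  fixes f :: "'f::nonarch_local_field vec \<Rightarrow> complex"
  assumes lam: "add_char lam" and f: "test_fun r f" and y: "y \<in> carrier_vec r" and g: "g \<in> carrier (GL r)"
  shows "fourier r lam (\<lambda>x. f (inv\<^bsub>GL r\<^esub> g *\<^sub>v x)) y = of_real (nabs (det g)) * fourier r lam f (transpose_mat g *\<^sub>v y)"
proof -
  have gi: "inv\<^bsub>GL r\<^esub> g \<in> carrier (GL r)" using g by blast
  have gc: "g \<in> carrier_mat r r" "inv\<^bsub>GL r\<^esub> g \<in> carrier_mat r r" using g gi GL_carrier_mat by blast+
  have ty: "transpose_mat g *\<^sub>v y \<in> carrier_vec r" using gc y by simp
  have h: "test_fun r (\<lambda>x. f x * lam (- (x \<bullet> (transpose_mat g *\<^sub>v y))))" by (rule test_fun_char[OF lam ty f])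
  have "fourier r lam (\<lambda>x. f (inv\<^bsub>GL r\<^esub> g *\<^sub>v x)) y =
      haar r (\<lambda>x. f (inv\<^bsub>GL r\<^esub> g *\<^sub>v x) * lam (- ((inv\<^bsub>GL r\<^esub> g *\<^sub>v x) \<bullet> (transpose_mat g *\<^sub>v y))))"
    unfolding fourier_def
  proof (rule haar_cong[OF test_fun_char[OF lam y test_fun_comp[OF gi f]]])
    fix x :: "'f vec" assume x: "x \<in> carrier_vec r"
    let ?z = "inv\<^bsub>GL r\<^esub> g *\<^sub>v x"
    have z: "?z \<in> carrier_vec r" using gc x by simp
    have "g *\<^sub>v ?z = x" using assoc_mult_mat_vec[OF gc(1,2) x] GL_r_inv[OF g] x by simp
    moreover have "?z \<bullet> (transpose_mat g *\<^sub>v y) = (transpose_mat g *\<^sub>v y) \<bullet> ?z"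
      by (rule comm_scalar_prod[OF z ty])
    moreover have "(transpose_mat g *\<^sub>v y) \<bullet> ?z = y \<bullet> (g *\<^sub>v ?z)"
      by (rule transpose_vec_mult_scalar[OF gc(1) z y])
    moreover have "y \<bullet> x = x \<bullet> y" by (rule comm_scalar_prod[OF y x])
    ultimately show "f ?z * lam (- (x \<bullet> y)) = f ?z * lam (- (?z \<bullet> (transpose_mat g *\<^sub>v y)))" by simp
  qed
  also have "\<dots> = inverse (of_real (nabs (det (inv\<^bsub>GL r\<^esub> g)))) * fourier r lam f (transpose_mat g *\<^sub>v y)"
    unfolding fourier_def by (rule haar_comp_det[OF gi h])
  also have "nabs (det (inv\<^bsub>GL r\<^esub> g)) * nabs (det g) = 1"
    using det_mult[OF gc(2,1)] GL_l_inv[OF g] by (simp add: nabs_mult[symmetric])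
  then have "inverse (complex_of_real (nabs (det (inv\<^bsub>GL r\<^esub> g)))) = of_real (nabs (det g))"
    by (metis inverse_unique of_real_inverse)
  finally show ?thesis .
qed

text \<open>With respect to \<open>lam\<close> the annihilator of the box of radius |a| is the box
  of radius |w / a|. For y in it the integrand is constant on the box; for other y some translation
  inside the box acts by a nontrivial scalar and the integral vanishes. Moving the centre to x0 only
  contributes a character.\<close>

lemma fourier_ind:
  fixes a w :: "'f::nonarch_local_field"
  assumes lam: "add_char lam" and w: "conductor lam w" and a: "a \<noteq> 0"
    and x0: "x0 \<in> carrier_vec r" and y: "y \<in> carrier_vec r"
  shows "fourier r lam (ind r (nabs a) x0) y =
     of_real (nabs a ^ r) * (ind r (nabs (w / a)) (0\<^sub>v r) y * lam (- (x0 \<bullet> y)))"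
proof -
  have na: "0 < nabs a" using a by simp
  let ?i = "ind r (nabs a) (0\<^sub>v r :: 'f vec)"
  have i: "test_fun r ?i" by (rule ind_test_fun[OF _ na]) simp
  have mx: "- x0 \<in> carrier_vec r" using x0 by simp
  have "fourier r lam (ind r (nabs a) x0) y = fourier r lam (\<lambda>x. ?i (x + - x0)) y"
  proof (rule fourier_cong[OF lam ind_test_fun[OF x0 na] y])
    fix x :: "'f vec" assume x: "x \<in> carrier_vec r"
    have "x + - x0 - 0\<^sub>v r = x - x0" using x x0 by (intro eq_vecI) auto
    then show "ind r (nabs a) x0 x = ?i (x + - x0)" by (simp only: ind_def)
  qed
  also have "\<dots> = lam (- (x0 \<bullet> y)) * fourier r lam ?i y"
    using fourier_translate[OF lam i y mx] by (simp only: uminus_scalar_prod[OF x0 y])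
  also have "fourier r lam ?i y = of_real (nabs a ^ r) * ind r (nabs (w / a)) (0\<^sub>v r) y"
  proof (cases "y \<in> box r (nabs (w / a))")
    case True
    have "fourier r lam ?i y = haar r ?i" unfolding fourier_def
    proof (rule haar_cong[OF test_fun_char[OF lam y i]])
      fix x :: "'f vec" assume x: "x \<in> carrier_vec r"
      have "lam (- (x \<bullet> y)) = 1" if "x \<in> box r (nabs a)"
      proof -
        have "nabs (x \<bullet> y) \<le> nabs a * nabs (w / a)" by (rule scalar_prod_bound[OF that True]) auto
        then have "nabs (- (x \<bullet> y)) \<le> nabs w" using a by (simp add: nabs_divide)
        then show ?thesis by (rule conductorD(2)[OF w])
      qed
      then show "?i x * lam (- (x \<bullet> y)) = ?i x" using ind_zero[OF x] by simp
    qed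
    then show ?thesis using haar_box[OF a, of r] True ind_zero[OF y] by simp
  next
    case False
    then obtain i where i: "i < r" "nabs (w / a) < nabs (y $ i)" using y by (auto simp: box_def not_le)
    then have "nabs w < nabs (a * y $ i)" using na by (simp add: nabs_divide nabs_mult field_simps)
    then obtain z where z: "nabs z \<le> nabs (a * y $ i)" "lam z \<noteq> 1" using conductorD(3)[OF w] by blast
    have yi: "y $ i \<noteq> 0" using i(2) nabs_nonneg[of "w / a"] by (metis nabs_zero not_less)
    \<comment> \<open>Chosen inside the box so that its pairing with y is the point z at which
      \<open>lam\<close> is nontrivial.\<close>
    define v where "v = (z / y $ i) \<cdot>\<^sub>v unit_vec r i"
    have vc: "v \<in> carrier_vec r" by (simp add: v_def)
    have "nabs (z / y $ i) \<le> nabs a" using z(1) yi by (simp add: nabs_divide nabs_mult field_simps)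
    then have v: "v \<in> box r (nabs a)" using i(1) by (auto simp: box_def v_def unit_vec_def)
    have vy: "v \<bullet> y = z" using i(1) y yi by (simp add: v_def)
    obtain \<sigma> where \<sigma>: "\<sigma> > 0" "loc_const r \<sigma> (\<lambda>x. lam (- (x \<bullet> y)))"
      using char_loc_const[OF add_char_uminus[OF lam] y] by blast
    have "haar r (\<lambda>x. ?i x * lam (- (x \<bullet> y))) = 0"
    proof (rule haar_char_box_zero[OF na \<sigma> v, where c="lam (- z)"])
      fix x :: "'f vec" assume x: "x \<in> carrier_vec r"
      have "- ((x + v) \<bullet> y) = - (x \<bullet> y) + - z" using add_scalar_prod_distrib[OF x vc y] vy by simp
      then show "lam (- ((x + v) \<bullet> y)) = lam (- (x \<bullet> y)) * lam (- z)" by (metis add_charD(1)[OF lam])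
    next
      show "lam (- z) \<noteq> 1" using z(2) add_char_minus[OF lam, of z] by simp
    qed
    then show ?thesis unfolding fourier_def using False ind_zero[OF y] by simp
  qed
  finally show ?thesis by (simp add: mult_ac)
qed


text \<open>The radius of local constancy is taken to be the absolute value of a field element, so
  that \<open>fourier_ind\<close> applies to each term of the coset decomposition.\<close>

lemma fourier_decomp:
  fixes f :: "'f::nonarch_local_field vec \<Rightarrow> complex"
  assumes lam: "add_char lam" and w: "conductor lam w" and f: "test_fun r f"
  shows "\<exists>a B. a \<noteq> 0 \<and> finite B \<and> B \<subseteq> carrier_vec r \<and>
    (\<forall>x\<in>carrier_vec r. f x = (\<Sum>b\<in>B. f b * ind r (nabs a) b x)) \<and>
    (\<forall>y\<in>carrier_vec r. fourier r lam f y =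
      (\<Sum>b\<in>B. f b * of_real (nabs a ^ r) * (ind r (nabs (w / a)) (0\<^sub>v r) y * lam (- (y \<bullet> b)))))"
proof -
  obtain \<rho> M where 1: "0 < \<rho>" "\<rho> \<le> 1" "loc_const r \<rho> f" "0 < M" "supported r M 0 f"
    by (rule test_fun_radius[OF f real_zero_less_one])
  obtain a :: 'f where a: "a \<noteq> 0" "nabs a \<le> \<rho>" using ex_small[OF 1(1), where 'f='f] by blast
  have na: "0 < nabs a" using a by simp
  have lc: "loc_const r (nabs a) f" by (rule loc_const_mono[OF 1(3) a(2)])
  let ?B = "creps r (nabs a) \<inter> box r M :: 'f vec set"
  have B: "finite ?B" by (rule finite_creps_box[OF na])
  have Bc: "?B \<subseteq> carrier_vec r" using creps_carrier[OF na, where 'a='f] by blast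
  have dec: "f x = (\<Sum>b\<in>?B. f b * ind r (nabs a) b x)" if "x \<in> carrier_vec r" for x
    by (rule loc_const_decomp[OF na lc 1(5) that])
  have "fourier r lam f y =
      (\<Sum>b\<in>?B. f b * of_real (nabs a ^ r) * (ind r (nabs (w / a)) (0\<^sub>v r) y * lam (- (y \<bullet> b))))"
    if y: "y \<in> carrier_vec r" for y
  proof -
    have "fourier r lam f y = haar r (\<lambda>x. \<Sum>b\<in>?B. f b * (ind r (nabs a) b x * lam (- (x \<bullet> y))))"
      unfolding fourier_def
    proof (rule haar_cong[OF test_fun_char[OF lam y f]])
      fix x :: "'f vec" assume "x \<in> carrier_vec r"
      from dec[OF this] show "f x * lam (- (x \<bullet> y)) = (\<Sum>b\<in>?B. f b * (ind r (nabs a) b x * lam (- (x \<bullet> y))))"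
        by (simp add: sum_distrib_right mult.assoc)
    qed
    also have "\<dots> = (\<Sum>b\<in>?B. f b * fourier r lam (ind r (nabs a) b) y)"
      unfolding fourier_def
      using Bc by (intro invariant_functional_sum[OF haar_invariant] test_fun_char[OF lam y] ind_test_fun[OF _ na]) auto
    also have "\<dots> = (\<Sum>b\<in>?B. f b * of_real (nabs a ^ r) * (ind r (nabs (w / a)) (0\<^sub>v r) y * lam (- (y \<bullet> b))))"
    proof (rule sum.cong[OF HOL.refl])
      fix b :: "'f vec" assume "b \<in> ?B"
      then have b: "b \<in> carrier_vec r" using Bc by blast
      show "f b * fourier r lam (ind r (nabs a) b) y =
          f b * of_real (nabs a ^ r) * (ind r (nabs (w / a)) (0\<^sub>v r) y * lam (- (y \<bullet> b)))"
        using fourier_ind[OF lam w a(1) b y] comm_scalar_prod[OF b y] by simp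
    qed
    finally show ?thesis .
  qed
  then show ?thesis using a(1) B Bc dec by (intro exI[of _ a] exI[of _ ?B]) blast
qed

lemma fourier_test_fun:
  fixes f :: "'f::nonarch_local_field vec \<Rightarrow> complex"
  assumes lam: "nontrivial_add_char lam" and f: "test_fun r f"
  shows "test_fun r (fourier r lam f)"
proof -
  have ac: "add_char lam" using lam by (simp add: nontrivial_add_char_iff)
  obtain w where w: "conductor lam w" using conductor_exists[OF lam] by blast
  obtain a :: 'f and B where aB: "a \<noteq> 0" "finite B" "B \<subseteq> carrier_vec r"
    "\<forall>y\<in>carrier_vec r. fourier r lam f y =
      (\<Sum>b\<in>B. f b * of_real (nabs a ^ r) * (ind r (nabs (w / a)) (0\<^sub>v r) y * lam (- (y \<bullet> b))))"
    using fourier_decomp[OF ac w f] by blast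
  have na: "0 < nabs (w / a)" using aB(1) conductorD(1)[OF w] by simp
  have "test_fun r (\<lambda>y. \<Sum>b\<in>B. f b * of_real (nabs a ^ r) * (ind r (nabs (w / a)) (0\<^sub>v r) y * lam (- (y \<bullet> b))))"
    using aB(3) by (intro test_fun_sum test_fun_scale test_fun_char[OF ac] ind_test_fun[OF _ na]) auto
  then show ?thesis by (rule test_fun_cong) (use aB(4) in simp)
qed

text \<open>On a coset indicator the double transform goes from radius |a| to |w / a| and back,
  collecting the factors |a|^r and |w / a|^r. Their product |w|^r depends only on
  \<open>lam\<close>; it appears because the Haar functional is normalised by the unit box and not
  to be self-dual.\<close>

lemma fourier_inversion:
  fixes f :: "'f::nonarch_local_field vec \<Rightarrow> complex"
  assumes lam: "nontrivial_add_char lam" and w: "conductor lam w" and f: "test_fun r f" and x: "x \<in> carrier_vec r"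
  shows "fourier r (\<lambda>z. lam (- z)) (fourier r lam f) x = of_real (nabs w ^ r) * f x"
proof -
  have ac: "add_char lam" using lam by (simp add: nontrivial_add_char_iff)
  have w0: "w \<noteq> 0" using conductorD(1)[OF w] .
  obtain a :: 'f and B where aB: "a \<noteq> 0" "finite B" "B \<subseteq> carrier_vec r"
    "\<forall>x\<in>carrier_vec r. f x = (\<Sum>b\<in>B. f b * ind r (nabs a) b x)"
    "\<forall>y\<in>carrier_vec r. fourier r lam f y =
      (\<Sum>b\<in>B. f b * of_real (nabs a ^ r) * (ind r (nabs (w / a)) (0\<^sub>v r) y * lam (- (y \<bullet> b))))"
    using fourier_decomp[OF ac w f] by blast
  have wa: "w / a \<noteq> 0" using aB(1) w0 by simp
  have na: "0 < nabs (w / a)" using wa by simp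
  let ?i = "ind r (nabs (w / a)) (0\<^sub>v r :: 'f vec)"
  have i: "test_fun r ?i" by (rule ind_test_fun[OF _ na]) simp
  have acm: "add_char (\<lambda>z. lam (- z))" by (rule add_char_uminus[OF ac])
  have "fourier r (\<lambda>z. lam (- z)) (fourier r lam f) x =
      haar r (\<lambda>y. \<Sum>b\<in>B. (f b * of_real (nabs a ^ r)) * (?i y * lam (- (y \<bullet> (b - x)))))"
    unfolding fourier_def[of r "\<lambda>z. lam (- z)"]
  proof (rule haar_cong[OF test_fun_char[OF acm x fourier_test_fun[OF lam f]]])
    fix y :: "'f vec" assume y: "y \<in> carrier_vec r"
    have "lam (- (y \<bullet> b)) * lam (y \<bullet> x) = lam (- (y \<bullet> (b - x)))" if "b \<in> B" for b
    proof -
      have b: "b \<in> carrier_vec r" using that aB(3) by blast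
      have "- (y \<bullet> (b - x)) = - (y \<bullet> b) + y \<bullet> x" using scalar_prod_minus_distrib[OF y b x] by simp
      then show ?thesis by (metis add_charD(1)[OF ac])
    qed
    then show "fourier r lam f y * lam (- (- (y \<bullet> x))) =
        (\<Sum>b\<in>B. (f b * of_real (nabs a ^ r)) * (?i y * lam (- (y \<bullet> (b - x)))))"
      unfolding aB(5)[rule_format, OF y] sum_distrib_right
      by (intro sum.cong HOL.refl) (simp add: mult.assoc)
  qed
  also have "\<dots> = (\<Sum>b\<in>B. (f b * of_real (nabs a ^ r)) * fourier r lam ?i (b - x))"
    unfolding fourier_def
    using aB(3) x by (intro invariant_functional_sum[OF haar_invariant] test_fun_char[OF ac _ i]) auto
  also have "\<dots> = (\<Sum>b\<in>B. of_real (nabs w ^ r) * (f b * ind r (nabs a) b x))"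
  proof (rule sum.cong[OF HOL.refl])
    fix b assume "b \<in> B"
    then have b: "b \<in> carrier_vec r" using aB(3) by blast
    have bx: "b - x \<in> carrier_vec r" using b x by simp
    have z: "0\<^sub>v r \<bullet> (b - x) = 0" using bx by simp
    have "w / (w / a) = a" using w0 by simp
    then have "fourier r lam ?i (b - x) = of_real (nabs (w / a) ^ r) * ind r (nabs a) (0\<^sub>v r) (b - x)"
      using fourier_ind[OF ac w wa _ bx, of "0\<^sub>v r"] z add_char_0[OF ac] by simp
    also have "ind r (nabs a) (0\<^sub>v r) (b - x) = ind r (nabs a) b x"
    proof -
      have "b - x = - (x - b)" using b x by (intro eq_vecI) auto
      then have "b - x \<in> box r (nabs a) \<longleftrightarrow> x - b \<in> box r (nabs a)" using b x by simp
      then show ?thesis unfolding ind_zero[OF bx] by (simp add: ind_def)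
    qed
    finally have "fourier r lam ?i (b - x) = of_real (nabs (w / a) ^ r) * ind r (nabs a) b x" .
    moreover have "nabs a ^ r * nabs (w / a) ^ r = nabs w ^ r"
      using aB(1) by (simp add: nabs_divide power_mult_distrib[symmetric])
    then have "complex_of_real (nabs a ^ r) * of_real (nabs (w / a) ^ r) = of_real (nabs w ^ r)"
      by (metis of_real_mult)
    ultimately show "(f b * of_real (nabs a ^ r)) * fourier r lam ?i (b - x) =
        of_real (nabs w ^ r) * (f b * ind r (nabs a) b x)"
      by (metis mult.assoc mult.commute)
  qed
  also have "\<dots> = of_real (nabs w ^ r) * f x"
    using aB(4) x by (simp add: sum_distrib_left)
  finally show ?thesis .
qed

definition fourier_map :: "nat \<Rightarrow> ('f::nonarch_local_field \<Rightarrow> complex) \<Rightarrow> ('f vec \<Rightarrow> complex) \<Rightarrow> 'f vec \<Rightarrow> complex" where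
  "fourier_map r lam f = (\<lambda>y\<in>carrier_vec r. fourier r lam f y)"

lemma fourier_map_schwartz:
  fixes f :: "'f::nonarch_local_field vec \<Rightarrow> complex"
  assumes "nontrivial_add_char lam" "f \<in> schwartz r" shows "fourier_map r lam f \<in> schwartz r"
proof -
  have "test_fun r (fourier_map r lam f)"
    by (rule test_fun_cong[OF fourier_test_fun[OF assms(1)]])
      (use assms(2) in \<open>auto simp: fourier_map_def schwartz_iff_test_fun\<close>)
  then show ?thesis by (simp add: schwartz_iff_test_fun fourier_map_def)
qed

lemma fourier_map_inverse:
  fixes f :: "'f::nonarch_local_field vec \<Rightarrow> complex"
  assumes lam: "nontrivial_add_char lam" and w: "conductor lam w" and f: "f \<in> schwartz r"
  shows "(\<lambda>x\<in>carrier_vec r. of_real (nabs w ^ r) * f x) = fourier_map r (\<lambda>z. lam (- z)) (fourier_map r lam f)"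
proof
  fix x :: "'f vec"
  have ac: "add_char (\<lambda>z. lam (- z))" using lam by (simp add: nontrivial_add_char_iff add_char_uminus)
  have tf: "test_fun r f" using f by (simp add: schwartz_iff_test_fun)
  show "(\<lambda>x\<in>carrier_vec r. of_real (nabs w ^ r) * f x) x = fourier_map r (\<lambda>z. lam (- z)) (fourier_map r lam f) x"
  proof (cases "x \<in> carrier_vec r")
    case True
    have "fourier r (\<lambda>z. lam (- z)) (fourier r lam f) x = fourier r (\<lambda>z. lam (- z)) (fourier_map r lam f) x"
      by (rule fourier_cong[OF ac fourier_test_fun[OF lam tf] True]) (simp add: fourier_map_def)
    then show ?thesis using fourier_inversion[OF lam w tf True] True
      by (simp add: fourier_map_def[of r "\<lambda>z. lam (- z)"])
  qed (simp add: fourier_map_def)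
qed

text \<open>Inversion for \<open>lam\<close> gives injectivity and inversion for its inverse
  character gives surjectivity. Both characters have the same conductor, so the same nonzero
  constant occurs.\<close>

lemma fourier_map_bij:
  fixes lam :: "'f::nonarch_local_field \<Rightarrow> complex"
  assumes lam: "nontrivial_add_char lam"
  shows "bij_betw (fourier_map r lam) (schwartz r) (schwartz r)"
proof -
  obtain w where w: "conductor lam w" using conductor_exists[OF lam] by blast
  let ?lm = "\<lambda>z. lam (- z)"
  have w0: "complex_of_real (nabs w ^ r) \<noteq> 0" using conductorD(1)[OF w] by simp
  have lm: "nontrivial_add_char ?lm"
    using lam add_char_uminus[of lam] by (auto simp: nontrivial_add_char_iff) (metis minus_minus)
  have wm: "conductor ?lm w" by (rule conductor_uminus[OF w])
  have scale: "(\<lambda>x\<in>carrier_vec r. c * f x) \<in> schwartz r" if "f \<in> schwartz r" for c and f :: "'f vec \<Rightarrow> complex"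
  proof -
    have "test_fun r (\<lambda>x\<in>carrier_vec r. c * f x)"
      by (rule test_fun_cong[OF test_fun_scale, of r f c]) (use that in \<open>auto simp: schwartz_iff_test_fun\<close>)
    then show ?thesis by (simp add: schwartz_iff_test_fun)
  qed
  show ?thesis
  proof (rule bij_betw_imageI)
    show "inj_on (fourier_map r lam) (schwartz r)"
    proof (rule inj_onI)
      fix f g :: "'f vec \<Rightarrow> complex"
      assume fg: "f \<in> schwartz r" "g \<in> schwartz r" "fourier_map r lam f = fourier_map r lam g"
      then have eq: "(\<lambda>x\<in>carrier_vec r. complex_of_real (nabs w ^ r) * f x) = (\<lambda>x\<in>carrier_vec r. complex_of_real (nabs w ^ r) * g x)"
        using fourier_map_inverse[OF lam w fg(1)] fourier_map_inverse[OF lam w fg(2)] by simp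
      show "f = g"
      proof (rule extensionalityI[of _ "carrier_vec r"])
        fix x :: "'f vec" assume "x \<in> carrier_vec r"
        then show "f x = g x" using fun_cong[OF eq, of x] conductorD(1)[OF w] by auto
      qed (use fg in \<open>auto simp: schwartz_iff_test_fun\<close>)
    qed
    show "fourier_map r lam ` schwartz r = schwartz r"
    proof (intro Set.equalityI subsetI)
      fix f :: "'f vec \<Rightarrow> complex" assume f: "f \<in> schwartz r"
      let ?g = "\<lambda>x\<in>carrier_vec r. inverse (complex_of_real (nabs w ^ r)) * f x"
      have g: "?g \<in> schwartz r" by (rule scale[OF f])
      have "fourier_map r lam (fourier_map r ?lm ?g) = (\<lambda>x\<in>carrier_vec r. complex_of_real (nabs w ^ r) * ?g x)"
        using fourier_map_inverse[OF lm wm g] by simp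
      also have "\<dots> = f"
      proof (rule extensionalityI[of _ "carrier_vec r"])
        fix x :: "'f vec" assume "x \<in> carrier_vec r"
        then show "(\<lambda>x\<in>carrier_vec r. complex_of_real (nabs w ^ r) * ?g x) x = f x" using conductorD(1)[OF w] by (simp add: field_simps)
      qed (use f in \<open>auto simp: schwartz_iff_test_fun\<close>)
      finally show "f \<in> fourier_map r lam ` schwartz r"
        using fourier_map_schwartz[OF lm g] by (metis imageI)
    qed (use fourier_map_schwartz[OF lam] in blast)
  qed
qed

text \<open>Let \<open>Y N\<close> be the set of c for which \<chi> agrees with
  \<open>lam (c * x)\<close> on the ball of radius |N|. If it were empty, the Fourier transform of
  \<chi> cut off to that ball would vanish identically, against inversion. Each \<open>Y N\<close>
  is a closed ball, hence compact, and these sets decrease as |N| grows, so a common element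
  exists.\<close>

lemma add_char_self_dual:
  fixes lam \<chi> :: "'f::nonarch_local_field \<Rightarrow> complex"
  assumes lam: "nontrivial_add_char lam" and \<chi>: "add_char \<chi>"
  shows "\<exists>c. \<forall>x. \<chi> x = lam (c * x)"
proof -
  have ac: "add_char lam" using lam by (simp add: nontrivial_add_char_iff)
  obtain w where w: "conductor lam w" using conductor_exists[OF lam] by blast
  have w0: "w \<noteq> 0" using conductorD(1)[OF w] .
  define Y where "Y N = {c. \<forall>x. nabs x \<le> nabs N \<longrightarrow> \<chi> x = lam (c * x)}" for N :: 'f
  have nonempty: "\<exists>c. c \<in> Y N" if N: "N \<noteq> 0" for N :: 'f
  proof (rule ccontr)
    assume no: "\<not> ?thesis"
    have na: "0 < nabs N" using N by simp
    let ?e = "unit_vec 1 0 :: 'f vec"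
    have e: "?e \<in> carrier_vec 1" by simp
    have xe: "x \<bullet> ?e = x $ 0" if "x \<in> carrier_vec 1" for x :: "'f vec" using that by simp
    obtain \<sigma> where \<sigma>: "\<sigma> > 0" "loc_const 1 \<sigma> (\<lambda>x. \<chi> (x \<bullet> ?e))" using char_loc_const[OF \<chi> e] by blast
    let ?f = "\<lambda>x. ind 1 (nabs N) (0\<^sub>v 1) x * \<chi> (x \<bullet> ?e)"
    have f: "test_fun 1 ?f" by (rule test_fun_mult[OF ind_test_fun[OF _ na] \<sigma>(2,1)]) simp
    \<comment> \<open>As no y belongs to \<open>Y N\<close>, the character obtained from \<chi> by
      dividing out \<open>lam (y * x)\<close> is nontrivial on the ball and integrates to 0
      there.\<close>
    have zero: "fourier 1 lam ?f y = 0" if y: "y \<in> carrier_vec 1" for y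
    proof -
      have "y $ 0 \<notin> Y N" using no by blast
      then obtain z where z: "nabs z \<le> nabs N" "\<chi> z \<noteq> lam (y $ 0 * z)" unfolding Y_def by blast
      let ?\<Theta> = "\<lambda>x. \<chi> (x \<bullet> ?e) * lam (- (x \<bullet> y))"
      obtain \<tau> where \<tau>: "\<tau> > 0" "loc_const 1 \<tau> (\<lambda>x. lam (- (x \<bullet> y)))"
        using char_loc_const[OF add_char_uminus[OF ac] y] by blast
      have \<Theta>: "0 < min \<sigma> \<tau>" "loc_const 1 (min \<sigma> \<tau>) ?\<Theta>"
        using \<sigma>(1) \<tau>(1) loc_const_mono[OF \<sigma>(2), of "min \<sigma> \<tau>"] loc_const_mono[OF \<tau>(2), of "min \<sigma> \<tau>"]
        by (auto simp: loc_const_def)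
      let ?v = "z \<cdot>\<^sub>v ?e"
      have vc: "?v \<in> carrier_vec 1" by simp
      have v: "?v \<in> box 1 (nabs N)" using z(1) by (simp add: box_def)
      have vs: "?v \<bullet> ?e = z" "?v \<bullet> y = z * y $ 0" using y by (auto simp: scalar_prod_def)
      have "haar 1 (\<lambda>x. ind 1 (nabs N) (0\<^sub>v 1) x * ?\<Theta> x) = 0"
      proof (rule haar_char_box_zero[OF na \<Theta> v, where c="\<chi> z * lam (- (z * y $ 0))"])
        fix x :: "'f vec" assume x: "x \<in> carrier_vec 1"
        have 1: "(x + ?v) \<bullet> ?e = x \<bullet> ?e + z" using add_scalar_prod_distrib[OF x vc e] vs(1) by simp
        have 2: "- ((x + ?v) \<bullet> y) = - (x \<bullet> y) + - (z * y $ 0)"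
          using add_scalar_prod_distrib[OF x vc y] vs(2) by simp
        show "?\<Theta> (x + ?v) = ?\<Theta> x * (\<chi> z * lam (- (z * y $ 0)))"
          unfolding 1 2 add_charD(1)[OF \<chi>] add_charD(1)[OF ac] by simp
      next
        show "\<chi> z * lam (- (z * y $ 0)) \<noteq> 1"
          using z(2) add_char_minus[OF ac, of "z * y $ 0"] add_charD(2)[OF ac, of "z * y $ 0"]
          by (simp add: divide_inverse[symmetric] mult.commute)
      qed
      then show ?thesis unfolding fourier_def by (simp add: mult.assoc)
    qed
    have z1: "0\<^sub>v 1 \<in> carrier_vec 1" by simp
    have "fourier 1 (\<lambda>z. lam (- z)) (fourier 1 lam ?f) (0\<^sub>v 1) = haar 1 (\<lambda>x::'f vec. 0 * 0)"
      unfolding fourier_def[of 1 "\<lambda>z. lam (- z)"]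
      by (rule haar_cong[OF test_fun_char[OF add_char_uminus[OF ac] z1 fourier_test_fun[OF lam f]]])
        (simp only: zero mult_zero_left)
    also have "\<dots> = 0" using haar_scale[OF f, of 0] by simp
    finally have "?f (0\<^sub>v 1) = 0" using fourier_inversion[OF lam w f z1] w0 by simp
    moreover have "?f (0\<^sub>v 1) = 1" using ind_zero[OF z1, of "nabs N"] add_char_0[OF \<chi>] na by simp
    ultimately show False by auto
  qed
  \<comment> \<open>Two elements of \<open>Y N\<close> differ by c - d exactly when
    \<open>lam\<close> is trivial on the ball of radius |(c - d) N|, which the conductor w
    decides.\<close>
  have coset: "Y N = {c. nabs (c - d) \<le> nabs (w / N)}" if N: "N \<noteq> 0" and d: "d \<in> Y N" for N d :: 'f
  proof -
    have "c \<in> Y N \<longleftrightarrow> nabs (c - d) \<le> nabs (w / N)" for c :: 'f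
    proof -
      have "c \<in> Y N \<longleftrightarrow> (\<forall>x. nabs x \<le> nabs N \<longrightarrow> lam (d * x) = lam (c * x))"
        using d unfolding Y_def by auto
      also have "\<dots> \<longleftrightarrow> (\<forall>x. nabs x \<le> nabs N \<longrightarrow> lam ((c - d) * x) = 1)"
      proof -
        have "lam (c * x) = lam ((c - d) * x) * lam (d * x)" for x
          using add_charD(1)[OF ac, of "(c - d) * x" "d * x"] by (simp add: algebra_simps)
        then have "lam (d * x) = lam (c * x) \<longleftrightarrow> lam ((c - d) * x) = 1" for x
          using add_charD(2)[OF ac, of "d * x"] by auto
        then show ?thesis by blast
      qed
      also have "\<dots> \<longleftrightarrow> (\<forall>x. nabs x \<le> nabs ((c - d) * N) \<longrightarrow> lam x = 1)"
      proof (cases "c = d")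
        case True
        have "nabs x \<le> 0 \<longleftrightarrow> x = 0" for x :: 'f
          using nabs_nonneg[of x] nabs_eq_0_iff[of x] by (metis order_antisym order_refl)
        then show ?thesis using True add_char_0[OF ac] by auto
      next
        case False
        show ?thesis
        proof (intro iffI allI impI)
          fix x :: 'f assume L: "\<forall>x. nabs x \<le> nabs N \<longrightarrow> lam ((c - d) * x) = 1" and x: "nabs x \<le> nabs ((c - d) * N)"
          have "nabs (x / (c - d)) \<le> nabs N" using x False by (simp add: nabs_divide nabs_mult pos_divide_le_eq mult.commute)
          then have "lam ((c - d) * (x / (c - d))) = 1" using L by blast
          then show "lam x = 1" using False by simp
        next
          fix x :: 'f assume R: "\<forall>x. nabs x \<le> nabs ((c - d) * N) \<longrightarrow> lam x = 1" and x: "nabs x \<le> nabs N"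
          have "nabs ((c - d) * x) \<le> nabs ((c - d) * N)" unfolding nabs_mult using x by (intro mult_left_mono) auto
          then show "lam ((c - d) * x) = 1" using R by blast
        qed
      qed
      also have "\<dots> \<longleftrightarrow> nabs ((c - d) * N) \<le> nabs w" by (rule spec[OF conjunct2[OF w[unfolded conductor_def]]])
      also have "\<dots> \<longleftrightarrow> nabs (c - d) \<le> nabs (w / N)" using N by (simp add: nabs_mult nabs_divide pos_le_divide_eq)
      finally show ?thesis .
    qed
    then show ?thesis by blast
  qed
  \<comment> \<open>The radii |b|^k tend to infinity, so countably many conditions already cover all
    of F.\<close>
  obtain b :: 'f where b: "b \<noteq> 0" "2 \<le> nabs b" using ex_large[of 2, where 'f='f] by blast
  have ne: "Y (b ^ k) \<noteq> {}" for k using nonempty[of "b ^ k"] b(1) by auto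
  have cl: "closed (Y (b ^ k))" and bd: "\<exists>M. Y (b ^ k) \<subseteq> {c. nabs c \<le> M}" for k
  proof -
    obtain d where d: "d \<in> Y (b ^ k)" using ne[of k] by blast
    have bk: "b ^ k \<noteq> 0" using b(1) by simp
    have e: "Y (b ^ k) = cball d (nabs (w / b ^ k))"
      unfolding coset[OF bk d] cball_def dist_nabs by (simp only: nabs_minus_commute)
    show "closed (Y (b ^ k))" unfolding e by simp
    have "nabs c \<le> max (nabs (w / b ^ k)) (nabs d)" if "c \<in> Y (b ^ k)" for c
      using nabs_ultrametric[of "c - d" d] that unfolding e by (auto simp: dist_nabs nabs_minus_commute)
    then show "\<exists>M. Y (b ^ k) \<subseteq> {c. nabs c \<le> M}" by blast
  qed
  have cmp: "compact (Y (b ^ k))" for k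
  proof -
    obtain M where "Y (b ^ k) \<subseteq> {c. nabs c \<le> M}" using bd by blast
    then have "{c. nabs c \<le> M} \<inter> Y (b ^ k) = Y (b ^ k)" by blast
    then show ?thesis using compact_Int_closed[OF compact_nabs_le[of M] cl[of k]] by simp
  qed
  have pw: "nabs (b ^ k) = nabs b ^ k" for k by (simp add: nabs_power)
  have dec: "Y (b ^ m) \<subseteq> Y (b ^ k)" if "k \<le> m" for k m
  proof -
    have "nabs (b ^ k) \<le> nabs (b ^ m)" unfolding pw using that b(2) by (intro power_increasing) auto
    then show ?thesis unfolding Y_def by (auto intro: order_trans)
  qed
  have "Y (b ^ 0) \<inter> \<Inter>(range (\<lambda>k. Y (b ^ k))) \<noteq> {}"
  proof (rule compact_imp_fip[OF cmp])
    fix F assume F: "finite F" "F \<subseteq> range (\<lambda>k. Y (b ^ k))"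
    then obtain K where K: "finite K" "F = (\<lambda>k. Y (b ^ k)) ` K"
      using finite_subset_image[OF F(1), of "\<lambda>k. Y (b ^ k)" UNIV] by blast
    have "Y (b ^ Max (insert 0 K)) \<subseteq> Y (b ^ k)" if "k \<in> insert 0 K" for k
      using K(1) that by (intro dec Max_ge) auto
    then have "Y (b ^ Max (insert 0 K)) \<subseteq> Y (b ^ 0) \<inter> \<Inter>F" unfolding K(2) by blast
    then show "Y (b ^ 0) \<inter> \<Inter>F \<noteq> {}" using ne by blast
  qed (use cl in auto)
  then obtain c where c: "\<And>k. c \<in> Y (b ^ k)" by blast
  have "\<chi> x = lam (c * x)" for x
  proof -
    obtain k where "nabs x < nabs b ^ k" using real_arch_pow[of "nabs b" "nabs x"] b(2) by auto
    then show ?thesis using c[of k] unfolding Y_def pw by auto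
  qed
  then show ?thesis by blast
qed

section \<open>Linear maps on tensor products given by formal sums\<close>

section \<open>Tensor products\<close>

text \<open>The module laws with the operations of \<open>class_ring\<close> replaced by those of
  the complex numbers, so that they serve as rewrite rules.\<close>

lemma module_rules:
  fixes A :: "(complex, 'a, 'r) module_scheme"
  assumes "module class_ring A"
  shows "\<zero>\<^bsub>A\<^esub> \<in> carrier A"
    "x \<in> carrier A \<Longrightarrow> y \<in> carrier A \<Longrightarrow> x \<oplus>\<^bsub>A\<^esub> y \<in> carrier A"
    "x \<in> carrier A \<Longrightarrow> c \<odot>\<^bsub>A\<^esub> x \<in> carrier A"
    "x \<in> carrier A \<Longrightarrow> y \<in> carrier A \<Longrightarrow> z \<in> carrier A \<Longrightarrow> (x \<oplus>\<^bsub>A\<^esub> y) \<oplus>\<^bsub>A\<^esub> z = x \<oplus>\<^bsub>A\<^esub> (y \<oplus>\<^bsub>A\<^esub> z)"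
    "x \<in> carrier A \<Longrightarrow> y \<in> carrier A \<Longrightarrow> x \<oplus>\<^bsub>A\<^esub> y = y \<oplus>\<^bsub>A\<^esub> x"
    "x \<in> carrier A \<Longrightarrow> \<zero>\<^bsub>A\<^esub> \<oplus>\<^bsub>A\<^esub> x = x"
    "x \<in> carrier A \<Longrightarrow> x \<oplus>\<^bsub>A\<^esub> \<zero>\<^bsub>A\<^esub> = x"
    "x \<in> carrier A \<Longrightarrow> y \<in> carrier A \<Longrightarrow> c \<odot>\<^bsub>A\<^esub> (x \<oplus>\<^bsub>A\<^esub> y) = c \<odot>\<^bsub>A\<^esub> x \<oplus>\<^bsub>A\<^esub> c \<odot>\<^bsub>A\<^esub> y"
    "x \<in> carrier A \<Longrightarrow> (c + d) \<odot>\<^bsub>A\<^esub> x = c \<odot>\<^bsub>A\<^esub> x \<oplus>\<^bsub>A\<^esub> d \<odot>\<^bsub>A\<^esub> x"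
    "x \<in> carrier A \<Longrightarrow> (c * d) \<odot>\<^bsub>A\<^esub> x = c \<odot>\<^bsub>A\<^esub> (d \<odot>\<^bsub>A\<^esub> x)"
    "x \<in> carrier A \<Longrightarrow> 1 \<odot>\<^bsub>A\<^esub> x = x"
    "x \<in> carrier A \<Longrightarrow> 0 \<odot>\<^bsub>A\<^esub> x = \<zero>\<^bsub>A\<^esub>"
    "c \<odot>\<^bsub>A\<^esub> \<zero>\<^bsub>A\<^esub> = \<zero>\<^bsub>A\<^esub>"
proof -
  interpret M: module "class_ring :: complex ring" A by (rule assms)
  show "\<zero>\<^bsub>A\<^esub> \<in> carrier A" by simp
  show "x \<in> carrier A \<Longrightarrow> y \<in> carrier A \<Longrightarrow> x \<oplus>\<^bsub>A\<^esub> y \<in> carrier A" by simp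
  show "x \<in> carrier A \<Longrightarrow> c \<odot>\<^bsub>A\<^esub> x \<in> carrier A" by simp
  show "x \<in> carrier A \<Longrightarrow> y \<in> carrier A \<Longrightarrow> z \<in> carrier A \<Longrightarrow> (x \<oplus>\<^bsub>A\<^esub> y) \<oplus>\<^bsub>A\<^esub> z = x \<oplus>\<^bsub>A\<^esub> (y \<oplus>\<^bsub>A\<^esub> z)"
    by (rule M.a_assoc)
  show "x \<in> carrier A \<Longrightarrow> y \<in> carrier A \<Longrightarrow> x \<oplus>\<^bsub>A\<^esub> y = y \<oplus>\<^bsub>A\<^esub> x" by (rule M.a_comm)
  show "x \<in> carrier A \<Longrightarrow> \<zero>\<^bsub>A\<^esub> \<oplus>\<^bsub>A\<^esub> x = x" by simp
  show "x \<in> carrier A \<Longrightarrow> x \<oplus>\<^bsub>A\<^esub> \<zero>\<^bsub>A\<^esub> = x" by simp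
  show "x \<in> carrier A \<Longrightarrow> y \<in> carrier A \<Longrightarrow> c \<odot>\<^bsub>A\<^esub> (x \<oplus>\<^bsub>A\<^esub> y) = c \<odot>\<^bsub>A\<^esub> x \<oplus>\<^bsub>A\<^esub> c \<odot>\<^bsub>A\<^esub> y"
    by (rule M.smult_r_distr) simp_all
  show "x \<in> carrier A \<Longrightarrow> (c + d) \<odot>\<^bsub>A\<^esub> x = c \<odot>\<^bsub>A\<^esub> x \<oplus>\<^bsub>A\<^esub> d \<odot>\<^bsub>A\<^esub> x"
    using M.smult_l_distr[of c d x] by simp
  show "x \<in> carrier A \<Longrightarrow> (c * d) \<odot>\<^bsub>A\<^esub> x = c \<odot>\<^bsub>A\<^esub> (d \<odot>\<^bsub>A\<^esub> x)"
    using M.smult_assoc1[of c d x] by simp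
  show "x \<in> carrier A \<Longrightarrow> 1 \<odot>\<^bsub>A\<^esub> x = x" using M.smult_one[of x] by simp
  show "x \<in> carrier A \<Longrightarrow> 0 \<odot>\<^bsub>A\<^esub> x = \<zero>\<^bsub>A\<^esub>" using M.smult_l_null[of x] by simp
  show "c \<odot>\<^bsub>A\<^esub> \<zero>\<^bsub>A\<^esub> = \<zero>\<^bsub>A\<^esub>" using M.smult_r_null[of c] by simp
qed

text \<open>Preservation of zero is listed separately so that the notion applies to records such as
  \<open>tensor A B\<close> without first proving the module axioms for them.\<close>

definition lin_map :: "(complex, 'a, 'r) module_scheme \<Rightarrow> (complex, 'b, 's) module_scheme \<Rightarrow> ('a \<Rightarrow> 'b) \<Rightarrow> bool" where
  "lin_map A B \<alpha> \<longleftrightarrow> \<alpha> \<in> carrier A \<rightarrow> carrier B \<and>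
     (\<forall>x\<in>carrier A. \<forall>y\<in>carrier A. \<alpha> (x \<oplus>\<^bsub>A\<^esub> y) = \<alpha> x \<oplus>\<^bsub>B\<^esub> \<alpha> y) \<and>
     (\<forall>c. \<forall>x\<in>carrier A. \<alpha> (c \<odot>\<^bsub>A\<^esub> x) = c \<odot>\<^bsub>B\<^esub> \<alpha> x) \<and> \<alpha> \<zero>\<^bsub>A\<^esub> = \<zero>\<^bsub>B\<^esub>"

lemma lin_map_closed: "lin_map A B \<alpha> \<Longrightarrow> x \<in> carrier A \<Longrightarrow> \<alpha> x \<in> carrier B"
  unfolding lin_map_def by blast

lemma lin_map_module_hom:
  fixes A :: "(complex, 'a, 'r) module_scheme" and B :: "(complex, 'b, 's) module_scheme"
  assumes "module class_ring A" "module class_ring B" "\<alpha> \<in> module_hom class_ring A B"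
  shows "lin_map A B \<alpha>"
proof -
  have "\<alpha> (0 \<odot>\<^bsub>A\<^esub> \<zero>\<^bsub>A\<^esub>) = 0 \<odot>\<^bsub>B\<^esub> \<alpha> \<zero>\<^bsub>A\<^esub>" "\<alpha> \<zero>\<^bsub>A\<^esub> \<in> carrier B"
    using assms(3) module_rules(1)[OF assms(1)] unfolding module_hom_def by auto
  then have "\<alpha> \<zero>\<^bsub>A\<^esub> = \<zero>\<^bsub>B\<^esub>"
    by (simp add: module_rules(13)[OF assms(1)] module_rules(12)[OF assms(2)])
  then show ?thesis using assms(3) unfolding lin_map_def module_hom_def by auto
qed

abbreviation tcls :: "(complex, 'a, 'r) module_scheme \<Rightarrow> (complex, 'b, 's) module_scheme
    \<Rightarrow> ('a \<times> 'b) multiset \<Rightarrow> ('a \<times> 'b) multiset set" where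
  "tcls A B X \<equiv> tensor_rel A B `` {X}"

text \<open>A pair of linear maps carries each generating relation to one of the same kind, hence
  acts on congruence classes.\<close>

lemma tensor_rel_map:
  assumes \<alpha>: "lin_map A A' \<alpha>" and \<beta>: "lin_map B B' \<beta>" and XY: "(X, Y) \<in> tensor_rel A B"
  shows "(image_mset (\<lambda>(a, b). (\<alpha> a, \<beta> b)) X, image_mset (\<lambda>(a, b). (\<alpha> a, \<beta> b)) Y) \<in> tensor_rel A' B'"
proof -
  let ?h = "image_mset (\<lambda>(a, b). (\<alpha> a, \<beta> b))"
  have fs: "?h Z \<in> formal_sums A' B'" if "Z \<in> formal_sums A B" for Z
    using that lin_map_closed[OF \<alpha>] lin_map_closed[OF \<beta>] unfolding formal_sums_def by fastforce
  from XY show ?thesis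
  proof (induction rule: tensor_rel.induct)
    case (plus X Y Z)
    then show ?case using tensor_rel.plus[OF plus.IH fs[OF plus.hyps(2)]] by simp
  next
    case (add_left a a' b)
    then show ?case using tensor_rel.add_left[of "\<alpha> a" A' "\<alpha> a'" "\<beta> b" B'] \<alpha> \<beta> by (auto simp: lin_map_def)
  next
    case (add_right a b b')
    then show ?case using tensor_rel.add_right[of "\<alpha> a" A' "\<beta> b" B' "\<beta> b'"] \<alpha> \<beta> by (auto simp: lin_map_def)
  next
    case (scale a b c)
    then show ?case using tensor_rel.scale[of "\<alpha> a" A' "\<beta> b" B' c] \<alpha> \<beta> by (auto simp: lin_map_def)
  next
    case (zero b)
    then show ?case using tensor_rel.zero[of "\<beta> b" B' A'] \<alpha> \<beta> by (auto simp: lin_map_def)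
  qed (use fs in \<open>auto intro: tensor_rel.intros\<close>)
qed

lemma lin_map_id: "lin_map A A (\<lambda>x. x)"
  by (simp add: lin_map_def)

lemma tcls_eq_iff:
  assumes "X \<in> formal_sums A B"
  shows "tcls A B X = tcls A B Y \<longleftrightarrow> (X, Y) \<in> tensor_rel A B"
  using tensor_rel.refl[OF assms] by (blast intro: tensor_rel.sym tensor_rel.trans)

lemma tcls_union_eq:
  assumes "X \<in> formal_sums A B" and "\<And>Y. (X, Y) \<in> tensor_rel A B \<Longrightarrow> g Y = g X"
  shows "(\<Union>Y\<in>tcls A B X. g Y) = g X"
  using tensor_rel.refl[OF assms(1)] assms(2) by blast

definition tensor_map :: "(complex, 'a, 'r) module_scheme \<Rightarrow> (complex, 'b, 's) module_scheme
    \<Rightarrow> ('c \<Rightarrow> 'a) \<Rightarrow> ('d \<Rightarrow> 'b) \<Rightarrow> ('c \<times> 'd) multiset set \<Rightarrow> ('a \<times> 'b) multiset set" where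
  "tensor_map A B \<alpha> \<beta> P = (\<Union>X\<in>P. tcls A B (image_mset (\<lambda>(a, b). (\<alpha> a, \<beta> b)) X))"

lemma tensor_map_cls:
  assumes \<alpha>: "lin_map A A' \<alpha>" and \<beta>: "lin_map B B' \<beta>" and X: "X \<in> formal_sums A B"
  shows "tensor_map A' B' \<alpha> \<beta> (tcls A B X) = tcls A' B' (image_mset (\<lambda>(a, b). (\<alpha> a, \<beta> b)) X)"
  unfolding tensor_map_def
proof (rule tcls_union_eq[OF X])
  let ?h = "image_mset (\<lambda>(a, b). (\<alpha> a, \<beta> b))"
  fix Y assume "(X, Y) \<in> tensor_rel A B"
  then have "(?h X, ?h Y) \<in> tensor_rel A' B'" by (rule tensor_rel_map[OF \<alpha> \<beta>])
  then show "tcls A' B' (?h Y) = tcls A' B' (?h X)"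
    by (blast intro: tensor_rel.sym tensor_rel.trans)
qed

lemma formal_sums_image:
  assumes "lin_map A A' \<alpha>" "lin_map B B' \<beta>" "X \<in> formal_sums A B"
  shows "image_mset (\<lambda>(a, b). (\<alpha> a, \<beta> b)) X \<in> formal_sums A' B'"
  using assms(3) lin_map_closed[OF assms(1)] lin_map_closed[OF assms(2)] unfolding formal_sums_def by fastforce

lemma formal_sums_simps [simp]:
  "{#} \<in> formal_sums A B" "X + Y \<in> formal_sums A B \<longleftrightarrow> X \<in> formal_sums A B \<and> Y \<in> formal_sums A B"
  "add_mset (a, b) X \<in> formal_sums A B \<longleftrightarrow> a \<in> carrier A \<and> b \<in> carrier B \<and> X \<in> formal_sums A B"
  unfolding formal_sums_def by auto

lemma tensor_rel_formal_sums:
  assumes A: "module class_ring A" and B: "module class_ring B" and "(X, Y) \<in> tensor_rel A B"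
  shows "X \<in> formal_sums A B \<and> Y \<in> formal_sums A B"
  using assms(3) by (induction rule: tensor_rel.induct) (auto simp: module_rules[OF A] module_rules[OF B])

lemma tensor_rel_plus:
  assumes A: "module class_ring A" and B: "module class_ring B"
    and "(X, X') \<in> tensor_rel A B" "(Y, Y') \<in> tensor_rel A B"
  shows "(X + Y, X' + Y') \<in> tensor_rel A B"
proof -
  have fs: "X' \<in> formal_sums A B" "Y \<in> formal_sums A B" using tensor_rel_formal_sums[OF A B] assms(3,4) by blast+
  have "(X + Y, X' + Y) \<in> tensor_rel A B" by (rule tensor_rel.plus[OF assms(3) fs(2)])
  moreover have "(X' + Y, X' + Y') \<in> tensor_rel A B"
    using tensor_rel.plus[OF assms(4) fs(1)] by (simp add: add.commute)
  ultimately show ?thesis by (rule tensor_rel.trans)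
qed

lemma tensor_carrier: "carrier (tensor A B) = {tcls A B X | X. X \<in> formal_sums A B}"
  unfolding tensor_def quotient_def by auto

lemma tensor_add_cls:
  assumes A: "module class_ring A" and B: "module class_ring B"
    and X: "X \<in> formal_sums A B" and Y: "Y \<in> formal_sums A B"
  shows "tcls A B X \<oplus>\<^bsub>tensor A B\<^esub> tcls A B Y = tcls A B (X + Y)"
proof -
  have "tcls A B (X' + Y') = tcls A B (X + Y)" if "(X, X') \<in> tensor_rel A B" "(Y, Y') \<in> tensor_rel A B" for X' Y'
    using tensor_rel_plus[OF A B that] by (blast intro: tensor_rel.sym tensor_rel.trans)
  then have "(\<Union>X'\<in>tcls A B X. \<Union>Y'\<in>tcls A B Y. tcls A B (X' + Y')) = tcls A B (X + Y)"
    using tensor_rel.refl[OF X] tensor_rel.refl[OF Y] by blast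
  then show ?thesis by (simp add: tensor_def)
qed

lemma tensor_zero: "\<zero>\<^bsub>tensor A B\<^esub> = tcls A B {#}"
  by (simp add: tensor_def)

lemma lin_map_smult:
  fixes A :: "(complex, 'a, 'r) module_scheme"
  assumes "module class_ring A" shows "lin_map A A (\<lambda>x. c \<odot>\<^bsub>A\<^esub> x)"
proof -
  have "c \<odot>\<^bsub>A\<^esub> (d \<odot>\<^bsub>A\<^esub> x) = d \<odot>\<^bsub>A\<^esub> (c \<odot>\<^bsub>A\<^esub> x)" if "x \<in> carrier A" for d x
    using module_rules(10)[OF assms that, of c d] module_rules(10)[OF assms that, of d c] by (simp add: mult.commute)
  then show ?thesis by (simp add: lin_map_def module_rules[OF assms])
qed

lemma tensor_smult_cls:
  assumes A: "module class_ring A" and X: "X \<in> formal_sums A B"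
  shows "c \<odot>\<^bsub>tensor A B\<^esub> tcls A B X = tcls A B (image_mset (\<lambda>(a, b). (c \<odot>\<^bsub>A\<^esub> a, b)) X)"
  using tensor_map_cls[OF lin_map_smult[OF A, of c] lin_map_id X] by (simp add: tensor_def tensor_map_def)

lemma tensor_act: "act (tensor A B) g = tensor_map A B (act A g) (act B g)"
  by (simp add: tensor_def tensor_map_def fun_eq_iff)

lemma tensor_map_lin:
  fixes A :: "('g, 'a) rep" and A' :: "('g, 'a') rep" and B :: "('g, 'b) rep" and B' :: "('g, 'b') rep"
  assumes A: "module class_ring A" and B: "module class_ring B" and A': "module class_ring A'" and B': "module class_ring B'"
    and \<alpha>: "lin_map A A' \<alpha>" and \<beta>: "lin_map B B' \<beta>"
  shows "lin_map (tensor A B) (tensor A' B') (tensor_map A' B' \<alpha> \<beta>)"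
proof -
  let ?h = "image_mset (\<lambda>(a, b). (\<alpha> a, \<beta> b))"
  note cls = tensor_map_cls[OF \<alpha> \<beta>] and im = formal_sums_image[OF \<alpha> \<beta>]
  have "tensor_map A' B' \<alpha> \<beta> (c \<odot>\<^bsub>tensor A B\<^esub> tcls A B X) = c \<odot>\<^bsub>tensor A' B'\<^esub> tensor_map A' B' \<alpha> \<beta> (tcls A B X)"
    if X: "X \<in> formal_sums A B" for c X
  proof -
    have sX: "image_mset (\<lambda>(a, b). (c \<odot>\<^bsub>A\<^esub> a, b)) X \<in> formal_sums A B"
      using formal_sums_image[OF lin_map_smult[OF A, of c] lin_map_id X] by simp
    have "?h (image_mset (\<lambda>(a, b). (c \<odot>\<^bsub>A\<^esub> a, b)) X) = image_mset (\<lambda>(a, b). (c \<odot>\<^bsub>A'\<^esub> a, b)) (?h X)"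
      using X \<alpha> unfolding formal_sums_def lin_map_def
      by (auto simp: multiset.map_comp comp_def split_def intro!: image_mset_cong)
    then show ?thesis
      by (simp add: tensor_smult_cls[OF A X] cls[OF sX] cls[OF X] tensor_smult_cls[OF A' im[OF X]])
  qed
  moreover have "tensor_map A' B' \<alpha> \<beta> (tcls A B X \<oplus>\<^bsub>tensor A B\<^esub> tcls A B Y) =
      tensor_map A' B' \<alpha> \<beta> (tcls A B X) \<oplus>\<^bsub>tensor A' B'\<^esub> tensor_map A' B' \<alpha> \<beta> (tcls A B Y)"
    if X: "X \<in> formal_sums A B" and Y: "Y \<in> formal_sums A B" for X Y
    using cls[of "X + Y"] X Y
    by (simp add: tensor_add_cls[OF A B X Y] cls[OF X] cls[OF Y] tensor_add_cls[OF A' B' im[OF X] im[OF Y]])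
  moreover have "tensor_map A' B' \<alpha> \<beta> \<zero>\<^bsub>tensor A B\<^esub> = \<zero>\<^bsub>tensor A' B'\<^esub>"
    using cls[of "{#}"] by (simp add: tensor_zero)
  ultimately show ?thesis
    using cls im by (auto simp: lin_map_def tensor_carrier)
qed

text \<open>The inverse of a linear bijection is linear, and the two induced maps are already
  mutually inverse on formal sums.\<close>

lemma tensor_map_bij:
  fixes A :: "('g, 'a) rep" and B :: "('g, 'b) rep" and B' :: "('g, 'c) rep"
  assumes A: "module class_ring A" and B: "module class_ring B" and B': "module class_ring B'"
    and \<beta>: "lin_map B B' \<beta>" and bij: "bij_betw \<beta> (carrier B) (carrier B')"
  shows "bij_betw (tensor_map A B' (\<lambda>x. x) \<beta>) (carrier (tensor A B)) (carrier (tensor A B'))"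
proof -
  let ?\<gamma> = "inv_into (carrier B) \<beta>"
  have g: "?\<gamma> y \<in> carrier B" "\<beta> (?\<gamma> y) = y" if "y \<in> carrier B'" for y
    using bij that by (auto simp: bij_betw_def inv_into_into f_inv_into_f)
  have g2: "?\<gamma> (\<beta> x) = x" if "x \<in> carrier B" for x using bij that by (simp add: bij_betw_def inv_into_f_f)
  have \<gamma>: "lin_map B' B ?\<gamma>"
  proof -
    have "?\<gamma> (x \<oplus>\<^bsub>B'\<^esub> y) = ?\<gamma> x \<oplus>\<^bsub>B\<^esub> ?\<gamma> y" if "x \<in> carrier B'" "y \<in> carrier B'" for x y
    proof -
      have "\<beta> (?\<gamma> x \<oplus>\<^bsub>B\<^esub> ?\<gamma> y) = x \<oplus>\<^bsub>B'\<^esub> y" using \<beta> g that by (simp add: lin_map_def)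
      then show ?thesis using g2[of "?\<gamma> x \<oplus>\<^bsub>B\<^esub> ?\<gamma> y"] g that by (simp add: module_rules[OF B])
    qed
    moreover have "?\<gamma> (c \<odot>\<^bsub>B'\<^esub> x) = c \<odot>\<^bsub>B\<^esub> ?\<gamma> x" if "x \<in> carrier B'" for c x
    proof -
      have "\<beta> (c \<odot>\<^bsub>B\<^esub> ?\<gamma> x) = c \<odot>\<^bsub>B'\<^esub> x" using \<beta> g that by (simp add: lin_map_def)
      then show ?thesis using g2[of "c \<odot>\<^bsub>B\<^esub> ?\<gamma> x"] g that by (simp add: module_rules[OF B])
    qed
    moreover have "?\<gamma> \<zero>\<^bsub>B'\<^esub> = \<zero>\<^bsub>B\<^esub>" using g2[of "\<zero>\<^bsub>B\<^esub>"] \<beta> by (simp add: lin_map_def module_rules[OF B])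
    ultimately show ?thesis using g by (auto simp: lin_map_def)
  qed
  note cls = tensor_map_cls[OF lin_map_id[of A] \<beta>] and cls' = tensor_map_cls[OF lin_map_id[of A] \<gamma>]
  note im = formal_sums_image[OF lin_map_id[of A] \<beta>] and im' = formal_sums_image[OF lin_map_id[of A] \<gamma>]
  show ?thesis
  proof (rule bij_betw_byWitness[where f'="tensor_map A B (\<lambda>x. x) ?\<gamma>"])
    show "\<forall>P\<in>carrier (tensor A B). tensor_map A B (\<lambda>x. x) ?\<gamma> (tensor_map A B' (\<lambda>x. x) \<beta> P) = P"
    proof
      fix P assume "P \<in> carrier (tensor A B)"
      then obtain X where X: "X \<in> formal_sums A B" "P = tcls A B X" by (auto simp: tensor_carrier)
      have "image_mset (\<lambda>(a, b). (a, ?\<gamma> b)) (image_mset (\<lambda>(a, b). (a, \<beta> b)) X) = image_mset (\<lambda>x. x) X"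
        unfolding multiset.map_comp using X(1) g2
        by (intro image_mset_cong) (auto simp: formal_sums_def)
      then show "tensor_map A B (\<lambda>x. x) ?\<gamma> (tensor_map A B' (\<lambda>x. x) \<beta> P) = P"
        using cls[OF X(1)] cls'[OF im[OF X(1)]] X(2) by simp
    qed
    show "\<forall>P\<in>carrier (tensor A B'). tensor_map A B' (\<lambda>x. x) \<beta> (tensor_map A B (\<lambda>x. x) ?\<gamma> P) = P"
    proof
      fix P assume "P \<in> carrier (tensor A B')"
      then obtain X where X: "X \<in> formal_sums A B'" "P = tcls A B' X" by (auto simp: tensor_carrier)
      have "image_mset (\<lambda>(a, b). (a, \<beta> b)) (image_mset (\<lambda>(a, b). (a, ?\<gamma> b)) X) = image_mset (\<lambda>x. x) X"
        unfolding multiset.map_comp using X(1) g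
        by (intro image_mset_cong) (auto simp: formal_sums_def)
      then show "tensor_map A B' (\<lambda>x. x) \<beta> (tensor_map A B (\<lambda>x. x) ?\<gamma> P) = P"
        using cls'[OF X(1)] cls[OF im'[OF X(1)]] X(2) by simp
    qed
    show "tensor_map A B' (\<lambda>x. x) \<beta> ` carrier (tensor A B) \<subseteq> carrier (tensor A B')"
      using cls im by (auto simp: tensor_carrier)
    show "tensor_map A B (\<lambda>x. x) ?\<gamma> ` carrier (tensor A B') \<subseteq> carrier (tensor A B)"
      using cls' im' by (auto simp: tensor_carrier)
  qed
qed

lemmas module_simps = module_rules(1-4,6-13)

section \<open>The tensor product with S(F^r) as vector-valued Schwartz functions\<close>

definition is_schwartz :: "nat \<Rightarrow> (complex, 'f::nonarch_local_field vec \<Rightarrow> complex, 's) module_scheme \<Rightarrow> bool" where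
  "is_schwartz r B \<longleftrightarrow> carrier B = schwartz r \<and> zero B = (\<lambda>x\<in>carrier_vec r. 0) \<and>
     add B = (\<lambda>f f'. \<lambda>x\<in>carrier_vec r. f x + f' x) \<and> smult B = (\<lambda>c f. \<lambda>x\<in>carrier_vec r. c * f x)"

lemma is_schwartzD:
  assumes "is_schwartz r B"
  shows "carrier B = schwartz r" "\<zero>\<^bsub>B\<^esub> = (\<lambda>x\<in>carrier_vec r. 0)"
    "f \<oplus>\<^bsub>B\<^esub> g = (\<lambda>x\<in>carrier_vec r. f x + g x)" "c \<odot>\<^bsub>B\<^esub> f = (\<lambda>x\<in>carrier_vec r. c * f x)"
  using assms by (auto simp: is_schwartz_def)

lemma schwartz_restrict:
  fixes f :: "'f::nonarch_local_field vec \<Rightarrow> complex"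
  assumes "test_fun r f" shows "(\<lambda>x\<in>carrier_vec r. f x) \<in> schwartz r"
  using test_fun_cong[OF assms, of "\<lambda>x\<in>carrier_vec r. f x"] by (simp add: schwartz_iff_test_fun)

lemma schwartz_test_fun: "f \<in> schwartz r \<Longrightarrow> test_fun r f"
  by (simp add: schwartz_iff_test_fun)

lemma schwartz_module:
  fixes B :: "(complex, 'f::nonarch_local_field vec \<Rightarrow> complex, 's) module_scheme"
  assumes B: "is_schwartz r B"
  shows "module class_ring B"
proof -
  note s = is_schwartzD[OF B]
  have ext: "f = (\<lambda>x\<in>carrier_vec r. f x)" if "f \<in> schwartz r" for f :: "'f vec \<Rightarrow> complex"
    using that by (simp add: schwartz_iff_test_fun extensional_restrict)
  have tz: "test_fun r (\<lambda>x::'f vec. 0 :: complex)" using test_fun_sum[of "{}" r "\<lambda>_ _. 0"] by simp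
  have cl: "((\<lambda>x\<in>carrier_vec r. 0) :: 'f vec \<Rightarrow> complex) \<in> schwartz r" by (rule schwartz_restrict[OF tz])
  have cl_add: "(\<lambda>x\<in>carrier_vec r. f x + g x) \<in> schwartz r" if "f \<in> schwartz r" "g \<in> schwartz r" for f g :: "'f vec \<Rightarrow> complex"
    by (rule schwartz_restrict[OF test_fun_add[OF that[THEN schwartz_test_fun]]])
  have cl_scale: "(\<lambda>x\<in>carrier_vec r. c * f x) \<in> schwartz r" if "f \<in> schwartz r" for c and f :: "'f vec \<Rightarrow> complex"
    by (rule schwartz_restrict[OF test_fun_scale[OF that[THEN schwartz_test_fun]]])
  have "abelian_group B"
  proof (rule abelian_groupI)
    fix f g h assume f: "f \<in> carrier B" and g: "g \<in> carrier B" and h: "h \<in> carrier B"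
    show "f \<oplus>\<^bsub>B\<^esub> g \<in> carrier B" using f g cl_add by (simp add: s)
    show "(f \<oplus>\<^bsub>B\<^esub> g) \<oplus>\<^bsub>B\<^esub> h = f \<oplus>\<^bsub>B\<^esub> (g \<oplus>\<^bsub>B\<^esub> h)" by (auto simp: s fun_eq_iff add.assoc)
    show "f \<oplus>\<^bsub>B\<^esub> g = g \<oplus>\<^bsub>B\<^esub> f" by (auto simp: s fun_eq_iff add.commute)
    show "\<zero>\<^bsub>B\<^esub> \<oplus>\<^bsub>B\<^esub> f = f" using f ext[of f] by (simp add: s cong: restrict_cong)
    show "\<exists>y\<in>carrier B. y \<oplus>\<^bsub>B\<^esub> f = \<zero>\<^bsub>B\<^esub>"
      by (rule bexI[of _ "\<lambda>x\<in>carrier_vec r. -1 * f x"]) (use f cl_scale[of f "-1"] in \<open>auto simp: s fun_eq_iff\<close>)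
  qed (use cl in \<open>simp add: s\<close>)
  moreover have "cring (class_ring :: complex ring)"
    by (rule domain.axioms(1)[OF field.axioms(1)[OF class_field]])
  ultimately show ?thesis
    unfolding module_def module_axioms_def
    using cl_scale ext by (auto simp: s fun_eq_iff algebra_simps extensional_def schwartz_iff_test_fun cong: restrict_cong)
qed

text \<open>One summand of the sum of f(x) a. The guard makes steps commute on all inputs, also
  those outside the carrier, as folding over a multiset requires.\<close>

definition eval_step :: "(complex, 'a, 'r) module_scheme \<Rightarrow> 'x \<Rightarrow> 'a \<times> ('x \<Rightarrow> complex) \<Rightarrow> 'a \<Rightarrow> 'a" where
  "eval_step A x = (\<lambda>(a, f) s. if a \<in> carrier A \<and> s \<in> carrier A then f x \<odot>\<^bsub>A\<^esub> a \<oplus>\<^bsub>A\<^esub> s else s)"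

definition eval_sum :: "(complex, 'a, 'r) module_scheme \<Rightarrow> 'x \<Rightarrow> ('a \<times> ('x \<Rightarrow> complex)) multiset \<Rightarrow> 'a" where
  "eval_sum A x X = fold_mset (eval_step A x) \<zero>\<^bsub>A\<^esub> X"

context
  fixes A :: "('g, 'a) rep"
  assumes A: "module class_ring A"
begin

lemma eval_sum_empty [simp]: "eval_sum A x {#} = \<zero>\<^bsub>A\<^esub>"
  by (simp add: eval_sum_def)

lemma eval_step_commute: "comp_fun_commute (eval_step A x)"
proof
  fix p q :: "'a \<times> ('b \<Rightarrow> complex)"
  obtain a f b g where pq: "p = (a, f)" "q = (b, g)" by (cases p, cases q)
  have "eval_step A x q (eval_step A x p s) = eval_step A x p (eval_step A x q s)" for s
  proof (cases "a \<in> carrier A \<and> b \<in> carrier A \<and> s \<in> carrier A")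
    case True
    then have c: "f x \<odot>\<^bsub>A\<^esub> a \<in> carrier A" "g x \<odot>\<^bsub>A\<^esub> b \<in> carrier A" "s \<in> carrier A"
      by (auto simp: module_simps[OF A])
    have "g x \<odot>\<^bsub>A\<^esub> b \<oplus>\<^bsub>A\<^esub> (f x \<odot>\<^bsub>A\<^esub> a \<oplus>\<^bsub>A\<^esub> s) = f x \<odot>\<^bsub>A\<^esub> a \<oplus>\<^bsub>A\<^esub> (g x \<odot>\<^bsub>A\<^esub> b \<oplus>\<^bsub>A\<^esub> s)"
      using module_rules(4)[OF A c(2,1,3)] module_rules(4)[OF A c(1,2,3)] module_rules(5)[OF A c(1,2)] by simp
    then show ?thesis using True c by (simp add: eval_step_def pq module_simps[OF A])
  next
    case False
    then show ?thesis by (auto simp: eval_step_def pq module_simps[OF A])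
  qed
  then show "eval_step A x q \<circ> eval_step A x p = eval_step A x p \<circ> eval_step A x q" by auto
qed

lemma eval_sum_closed [simp]: "eval_sum A x X \<in> carrier A"
proof (induction X)
  case (add p X)
  interpret comp_fun_commute "eval_step A x" by (rule eval_step_commute)
  have "eval_sum A x (add_mset p X) = eval_step A x p (eval_sum A x X)" by (simp add: eval_sum_def)
  then show ?case using add by (auto simp: eval_step_def module_simps[OF A] split: prod.splits)
qed (simp add: module_simps[OF A])

lemma eval_sum_add_mset:
  assumes "a \<in> carrier A"
  shows "eval_sum A x (add_mset (a, f) X) = f x \<odot>\<^bsub>A\<^esub> a \<oplus>\<^bsub>A\<^esub> eval_sum A x X"
proof -
  interpret comp_fun_commute "eval_step A x" by (rule eval_step_commute)
  have "eval_sum A x (add_mset (a, f) X) = eval_step A x (a, f) (eval_sum A x X)" by (simp add: eval_sum_def)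
  then show ?thesis using assms by (simp add: eval_step_def)
qed

lemma eval_sum_union:
  assumes "fst ` set_mset X \<subseteq> carrier A"
  shows "eval_sum A x (X + Y) = eval_sum A x X \<oplus>\<^bsub>A\<^esub> eval_sum A x Y"
  using assms
proof (induction X)
  case (add p X)
  then show ?case
    by (cases p) (simp add: eval_sum_add_mset module_simps[OF A])
qed (simp add: module_simps[OF A])

lemma eval_sum_single: "a \<in> carrier A \<Longrightarrow> eval_sum A x {#(a, f)#} = f x \<odot>\<^bsub>A\<^esub> a"
  by (simp add: eval_sum_add_mset module_simps[OF A])

lemma formal_sums_fst: "X \<in> formal_sums A B \<Longrightarrow> fst ` set_mset X \<subseteq> carrier A"
  by (auto simp: formal_sums_def)

lemma eval_sum_image:
  assumes X: "X \<in> formal_sums A B" and \<alpha>: "lin_map A A \<alpha>"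
    and \<beta>: "\<And>f. f \<in> carrier B \<Longrightarrow> \<beta> f x = c * f y"
  shows "eval_sum A x (image_mset (\<lambda>(a, f). (\<alpha> a, \<beta> f)) X) = c \<odot>\<^bsub>A\<^esub> \<alpha> (eval_sum A y X)"
  using X
proof (induction X)
  case empty
  then show ?case using \<alpha> by (simp add: lin_map_def module_simps[OF A])
next
  case (add p X)
  obtain a f where p: "p = (a, f)" by (cases p)
  have af: "a \<in> carrier A" "f \<in> carrier B" "X \<in> formal_sums A B" using add.prems p by auto
  have \<alpha>a: "\<alpha> a \<in> carrier A" using lin_map_closed[OF \<alpha> af(1)] .
  have "\<beta> f x \<odot>\<^bsub>A\<^esub> \<alpha> a = c \<odot>\<^bsub>A\<^esub> \<alpha> (f y \<odot>\<^bsub>A\<^esub> a)"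
    using \<alpha> af(1) module_rules(10)[OF A \<alpha>a] by (simp add: \<beta>[OF af(2)] lin_map_def)
  moreover have "\<alpha> (f y \<odot>\<^bsub>A\<^esub> a \<oplus>\<^bsub>A\<^esub> eval_sum A y X) = \<alpha> (f y \<odot>\<^bsub>A\<^esub> a) \<oplus>\<^bsub>A\<^esub> \<alpha> (eval_sum A y X)"
    using \<alpha> af(1) by (simp add: lin_map_def module_simps[OF A])
  ultimately show ?case
    using add.IH[OF af(3)] af(1) \<alpha>a lin_map_closed[OF \<alpha>]
    by (simp add: p eval_sum_add_mset module_simps[OF A])
qed

context
  fixes B :: "('g, 'f::nonarch_local_field vec \<Rightarrow> complex) rep" and r :: nat
  assumes B: "is_schwartz r B"
begin

text \<open>Evaluation at x is bilinear in a and f, so it respects every generating relation and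
  descends to the tensor product.\<close>

lemma eval_sum_rel:
  assumes "(X, Y) \<in> tensor_rel A B" and x: "x \<in> carrier_vec r"
  shows "eval_sum A x X = eval_sum A x Y"
  using assms(1)
proof (induction rule: tensor_rel.induct)
  case (plus X Y Z)
  then show ?case
    using tensor_rel_formal_sums[OF A schwartz_module[OF B] plus.hyps(1)]
    by (simp add: eval_sum_union[OF formal_sums_fst[of _ B]])
next
  case (add_left a a' b)
  then show ?case
    by (simp add: eval_sum_add_mset module_simps[OF A])
next
  case (add_right a b b')
  then show ?case using x
    by (simp add: eval_sum_add_mset module_simps[OF A] is_schwartzD[OF B])
next
  case (scale a b c)
  have "(b x * c) \<odot>\<^bsub>A\<^esub> a = b x \<odot>\<^bsub>A\<^esub> (c \<odot>\<^bsub>A\<^esub> a)" by (rule module_rules(10)[OF A scale(1)])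
  then have "b x \<odot>\<^bsub>A\<^esub> (c \<odot>\<^bsub>A\<^esub> a) = (c * b x) \<odot>\<^bsub>A\<^esub> a" by (simp only: mult.commute)
  then show ?case using x
    by (simp only: eval_sum_single[OF scale(1)] eval_sum_single[OF module_rules(3)[OF A scale(1)]]
        is_schwartzD[OF B] restrict_apply' HOL.refl)
next
  case (zero b)
  then show ?case by (simp add: eval_sum_add_mset module_simps[OF A])
qed auto

text \<open>The identification of a tensor with an A-valued function on F^r: the sum of a \<otimes>
  f becomes the function with value the sum of f(x) a at x. By \<open>eval_sum_rel\<close> the
  choice of a representative has no effect.\<close>

definition theta :: "('a \<times> ('f vec \<Rightarrow> complex)) multiset set \<Rightarrow> 'f vec \<Rightarrow> 'a" where
  "theta P x = eval_sum A x (SOME X. X \<in> P)"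

lemma theta_cls:
  assumes X: "X \<in> formal_sums A B" and x: "x \<in> carrier_vec r"
  shows "theta (tcls A B X) x = eval_sum A x X"
proof -
  have "(SOME Y. Y \<in> tcls A B X) \<in> tcls A B X"
    using tensor_rel.refl[OF X] by (intro someI_ex[of "\<lambda>Y. Y \<in> tcls A B X"]) blast
  then have "(X, SOME Y. Y \<in> tcls A B X) \<in> tensor_rel A B" by blast
  from eval_sum_rel[OF this x] show ?thesis by (simp add: theta_def)
qed

lemma theta_closed: "theta P x \<in> carrier A"
  by (simp add: theta_def)

text \<open>A coset indicator as an element of the Schwartz space; it has nothing to do with the
  compact induction \<open>cind\<close>.\<close>

definition cind_fun :: "real \<Rightarrow> 'f vec \<Rightarrow> 'f vec \<Rightarrow> complex" where
  "cind_fun \<rho> b = (\<lambda>x\<in>carrier_vec r. ind r \<rho> b x)"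

lemma cind_fun_carrier: "b \<in> carrier_vec r \<Longrightarrow> 0 < \<rho> \<Longrightarrow> cind_fun \<rho> b \<in> carrier B"
  unfolding cind_fun_def is_schwartzD[OF B] by (intro schwartz_restrict ind_test_fun)

lemma tensor_rel_sum:
  assumes "finite S" "\<And>b. b \<in> S \<Longrightarrow> (U b, W b) \<in> tensor_rel A B"
  shows "(\<Sum>b\<in>S. U b, \<Sum>b\<in>S. W b) \<in> tensor_rel A B"
  using assms
proof (induction S rule: finite_induct)
  case (insert b S)
  then show ?case using tensor_rel_plus[OF A schwartz_module[OF B], of "U b" "W b" "\<Sum>b\<in>S. U b" "\<Sum>b\<in>S. W b"] by simp
qed (simp add: tensor_rel.refl)

lemma tensor_rel_right_zero: "a \<in> carrier A \<Longrightarrow> ({#(a, \<zero>\<^bsub>B\<^esub>)#}, {#}) \<in> tensor_rel A B"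
proof -
  assume a: "a \<in> carrier A"
  note mB = schwartz_module[OF B]
  have z: "\<zero>\<^bsub>B\<^esub> \<in> carrier B" by (rule module_rules(1)[OF mB])
  have "({#(0 \<odot>\<^bsub>A\<^esub> a, \<zero>\<^bsub>B\<^esub>)#}, {#(a, 0 \<odot>\<^bsub>B\<^esub> \<zero>\<^bsub>B\<^esub>)#}) \<in> tensor_rel A B" by (rule tensor_rel.scale[OF a z])
  then have "({#(a, \<zero>\<^bsub>B\<^esub>)#}, {#(\<zero>\<^bsub>A\<^esub>, \<zero>\<^bsub>B\<^esub>)#}) \<in> tensor_rel A B"
    using module_rules(12)[OF A a] module_rules(13)[OF mB] tensor_rel.sym by fastforce
  then show ?thesis using tensor_rel.zero[OF z] by (rule tensor_rel.trans)
qed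

text \<open>The second factor is expanded by bilinearity and the scalars are moved to the first
  factor.\<close>

lemma tensor_rel_linear_combination:
  assumes \<rho>: "0 < \<rho>" and a: "a \<in> carrier A" and S: "finite S" "S \<subseteq> carrier_vec r"
  shows "({#(a, \<lambda>x\<in>carrier_vec r. \<Sum>b\<in>S. c b * ind r \<rho> b x)#}, \<Sum>b\<in>S. {#(c b \<odot>\<^bsub>A\<^esub> a, cind_fun \<rho> b)#}) \<in> tensor_rel A B"
  using S
proof (induction S rule: finite_induct)
  case empty
  then show ?case using tensor_rel_right_zero[OF a] by (simp add: is_schwartzD[OF B] restrict_def)
next
  case (insert b S)
  note mB = schwartz_module[OF B]
  let ?g = "\<lambda>x\<in>carrier_vec r. \<Sum>b\<in>S. c b * ind r \<rho> b x"
  have b: "b \<in> carrier_vec r" and Sc: "S \<subseteq> carrier_vec r" using insert.prems by auto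
  have cb: "cind_fun \<rho> b \<in> carrier B" by (rule cind_fun_carrier[OF b \<rho>])
  have g: "?g \<in> carrier B" unfolding is_schwartzD[OF B]
    using Sc by (intro schwartz_restrict test_fun_sum test_fun_scale ind_test_fun[OF _ \<rho>]) auto
  have e: "(\<lambda>x\<in>carrier_vec r. \<Sum>b\<in>insert b S. c b * ind r \<rho> b x) = (c b \<odot>\<^bsub>B\<^esub> cind_fun \<rho> b) \<oplus>\<^bsub>B\<^esub> ?g"
    using insert.hyps by (auto simp: is_schwartzD[OF B] cind_fun_def fun_eq_iff)
  have scb: "c b \<odot>\<^bsub>B\<^esub> cind_fun \<rho> b \<in> carrier B" by (rule module_rules(3)[OF mB cb])
  have "({#(a, (c b \<odot>\<^bsub>B\<^esub> cind_fun \<rho> b) \<oplus>\<^bsub>B\<^esub> ?g)#}, {#(a, c b \<odot>\<^bsub>B\<^esub> cind_fun \<rho> b), (a, ?g)#}) \<in> tensor_rel A B"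
    by (rule tensor_rel.add_right[OF a scb g])
  moreover have "({#(a, c b \<odot>\<^bsub>B\<^esub> cind_fun \<rho> b)#} + {#(a, ?g)#},
      {#(c b \<odot>\<^bsub>A\<^esub> a, cind_fun \<rho> b)#} + (\<Sum>b\<in>S. {#(c b \<odot>\<^bsub>A\<^esub> a, cind_fun \<rho> b)#})) \<in> tensor_rel A B"
    by (rule tensor_rel_plus[OF A mB tensor_rel.sym[OF tensor_rel.scale[OF a cb]] insert.IH[OF Sc]])
  ultimately show ?case unfolding e using insert.hyps
    by (simp add: add_mset_commute) (rule tensor_rel.trans, assumption, simp add: add_mset_commute)
qed

text \<open>At a radius common to all functions in X, each function is expanded into coset
  indicators and the first factors belonging to one coset are added up. The coefficient at b is the
  evaluation at b, so the normal form depends only on the values of the associated function.\<close>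

lemma tensor_rel_normal_form:
  assumes \<rho>: "0 < \<rho>" and X: "X \<in> formal_sums A B"
    and lc: "\<And>a f. (a, f) \<in># X \<Longrightarrow> loc_const r \<rho> f \<and> supported r M 0 f"
  shows "(X, \<Sum>b\<in>creps r \<rho> \<inter> box r M. {#(eval_sum A b X, cind_fun \<rho> b)#}) \<in> tensor_rel A B"
  using X lc
proof (induction X)
  case empty
  let ?S = "creps r \<rho> \<inter> box r M :: 'f vec set"
  have "(\<Sum>b\<in>?S. {#}, \<Sum>b\<in>?S. {#(\<zero>\<^bsub>A\<^esub>, cind_fun \<rho> b)#}) \<in> tensor_rel A B"
    by (rule tensor_rel_sum[OF finite_creps_box[OF \<rho>]], rule tensor_rel.sym, rule tensor_rel.zero)
      (auto intro: cind_fun_carrier[OF _ \<rho>] dest: creps_carrier[OF \<rho>])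
  then show ?case by simp
next
  case (add p X)
  let ?S = "creps r \<rho> \<inter> box r M :: 'f vec set"
  note mB = schwartz_module[OF B]
  obtain a f where p: "p = (a, f)" by (cases p)
  have af: "a \<in> carrier A" "f \<in> carrier B" "X \<in> formal_sums A B" using add.prems(1) p by auto
  have f: "loc_const r \<rho> f" "supported r M 0 f" "f \<in> schwartz r"
    using add.prems(2)[of a f] af(2) p by (auto simp: is_schwartzD[OF B])
  have Sc: "?S \<subseteq> carrier_vec r" using creps_carrier[OF \<rho>, where 'a='f] by blast
  have fe: "f = (\<lambda>x\<in>carrier_vec r. \<Sum>b\<in>?S. f b * ind r \<rho> b x)"
  proof (rule extensionalityI[of _ "carrier_vec r"])
    show "f \<in> extensional (carrier_vec r)" using f(3) by (simp add: schwartz_iff_test_fun)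
    fix x :: "'f vec" assume x: "x \<in> carrier_vec r"
    show "f x = (\<lambda>x\<in>carrier_vec r. \<Sum>b\<in>?S. f b * ind r \<rho> b x) x"
      using loc_const_decomp[OF \<rho> f(1,2) x] x by simp
  qed simp
  have "({#(a, f)#}, \<Sum>b\<in>?S. {#(f b \<odot>\<^bsub>A\<^esub> a, cind_fun \<rho> b)#}) \<in> tensor_rel A B"
    using tensor_rel_linear_combination[OF \<rho> af(1) finite_creps_box[OF \<rho>] Sc, of f] fe[symmetric] by simp
  moreover have "(X, \<Sum>b\<in>?S. {#(eval_sum A b X, cind_fun \<rho> b)#}) \<in> tensor_rel A B"
  proof (rule add.IH[OF af(3)])
    fix a' g assume "(a', g) \<in># X"
    then show "loc_const r \<rho> g \<and> supported r M 0 g" using add.prems(2)[of a' g] by simp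
  qed
  ultimately have "({#(a, f)#} + X, (\<Sum>b\<in>?S. {#(f b \<odot>\<^bsub>A\<^esub> a, cind_fun \<rho> b)#}) + (\<Sum>b\<in>?S. {#(eval_sum A b X, cind_fun \<rho> b)#})) \<in> tensor_rel A B"
    by (rule tensor_rel_plus[OF A mB])
  moreover have "((\<Sum>b\<in>?S. {#(f b \<odot>\<^bsub>A\<^esub> a, cind_fun \<rho> b)#} + {#(eval_sum A b X, cind_fun \<rho> b)#}),
      (\<Sum>b\<in>?S. {#(eval_sum A b (add_mset p X), cind_fun \<rho> b)#})) \<in> tensor_rel A B"
  proof (rule tensor_rel_sum[OF finite_creps_box[OF \<rho>]], rule tensor_rel.sym)
    fix b :: "'f vec" assume "b \<in> ?S"
    then have b: "b \<in> carrier_vec r" using Sc by blast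
    show "({#(eval_sum A b (add_mset p X), cind_fun \<rho> b)#}, {#(f b \<odot>\<^bsub>A\<^esub> a, cind_fun \<rho> b)#} + {#(eval_sum A b X, cind_fun \<rho> b)#}) \<in> tensor_rel A B"
      using tensor_rel.add_left[OF module_rules(3)[OF A af(1), of "f b"] eval_sum_closed cind_fun_carrier[OF b \<rho>], of b X]
      by (simp add: p eval_sum_add_mset[OF af(1)] add_mset_commute)
  qed
  ultimately have "({#(a, f)#} + X, \<Sum>b\<in>?S. {#(eval_sum A b (add_mset p X), cind_fun \<rho> b)#}) \<in> tensor_rel A B"
    unfolding sum.distrib by (rule tensor_rel.trans)
  then show ?case by (simp add: p)
qed

lemma formal_sums_common_radius:
  assumes "X \<in> formal_sums A B"
  shows "\<exists>\<rho>>0. \<exists>M. \<forall>(a, f)\<in>set_mset X. loc_const r \<rho> f \<and> supported r M 0 f"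
  using assms
proof (induction X)
  case (add p X)
  obtain a f where p: "p = (a, f)" by (cases p)
  obtain \<rho> M where 1: "\<rho> > 0" "\<forall>(a, f)\<in>set_mset X. loc_const r \<rho> f \<and> supported r M 0 f"
    using add p by auto
  have "test_fun r f" using add.prems p by (simp add: is_schwartzD[OF B] schwartz_iff_test_fun)
  then obtain \<sigma> N where 2: "0 < \<sigma>" "\<sigma> \<le> \<rho>" "loc_const r \<sigma> f" "0 < N" "supported r N 0 f"
    using test_fun_radius[OF _ 1(1)] by blast
  have "loc_const r \<sigma> g \<and> supported r (max M N) 0 g" if "(b, g) \<in># add_mset p X" for b g
    using that 1(2) 2 p by (auto intro: loc_const_mono[of r \<rho>] supported_mono)
  then show ?case using 2(1) by blast
qed (auto intro: exI[of _ 1])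

text \<open>At a common radius and support bound for two formal sums, equal values give equal normal
  forms.\<close>

lemma theta_inj:
  assumes P: "P \<in> carrier (tensor A B)" and Q: "Q \<in> carrier (tensor A B)"
    and eq: "\<And>x. x \<in> carrier_vec r \<Longrightarrow> theta P x = theta Q x"
  shows "P = Q"
proof -
  obtain X Y where X: "X \<in> formal_sums A B" "P = tcls A B X" and Y: "Y \<in> formal_sums A B" "Q = tcls A B Y"
    using P Q by (auto simp: tensor_carrier)
  have XY: "X + Y \<in> formal_sums A B" using X Y by simp
  obtain \<rho> M where 1: "\<rho> > 0" "\<forall>(a, f)\<in>set_mset (X + Y). loc_const r \<rho> f \<and> supported r M 0 f"
    using formal_sums_common_radius[OF XY] by blast
  have nX: "(X, \<Sum>b\<in>creps r \<rho> \<inter> box r M. {#(eval_sum A b X, cind_fun \<rho> b)#}) \<in> tensor_rel A B"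
    by (rule tensor_rel_normal_form[OF 1(1) X(1)]) (use 1(2) in auto)
  have nY: "(Y, \<Sum>b\<in>creps r \<rho> \<inter> box r M. {#(eval_sum A b Y, cind_fun \<rho> b)#}) \<in> tensor_rel A B"
    by (rule tensor_rel_normal_form[OF 1(1) Y(1)]) (use 1(2) in auto)
  have "eval_sum A b X = eval_sum A b Y" if "b \<in> creps r \<rho> \<inter> box r M" for b :: "'f vec"
  proof -
    have b: "b \<in> carrier_vec r" using creps_carrier[OF 1(1)] that by blast
    show ?thesis using eq[OF b] theta_cls[OF X(1) b] theta_cls[OF Y(1) b] X(2) Y(2) by simp
  qed
  then have eqs: "(\<Sum>b\<in>creps r \<rho> \<inter> box r M. {#(eval_sum A b X, cind_fun \<rho> b)#}) =
      (\<Sum>b\<in>creps r \<rho> \<inter> box r M. {#(eval_sum A b Y, cind_fun \<rho> b)#})"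
    by (intro sum.cong) auto
  have "(X, Y) \<in> tensor_rel A B"
    by (rule tensor_rel.trans[OF nX[unfolded eqs] tensor_rel.sym[OF nY]])
  then show ?thesis using tcls_eq_iff[OF X(1)] X(2) Y(2) by blast
qed

text \<open>The preimage is the finite sum of \<Phi>(b) tensored with the indicator of the coset of
  b, over the representatives b in the supporting box.\<close>

lemma theta_surj:
  fixes \<Phi> :: "'f vec \<Rightarrow> 'a"
  assumes \<Phi>: "\<And>x. x \<in> carrier_vec r \<Longrightarrow> \<Phi> x \<in> carrier A"
    and \<rho>: "0 < \<rho>" "loc_const r \<rho> \<Phi>" and M: "supported r M \<zero>\<^bsub>A\<^esub> \<Phi>"
  shows "\<exists>P\<in>carrier (tensor A B). \<forall>x\<in>carrier_vec r. theta P x = \<Phi> x"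
proof -
  let ?S = "creps r \<rho> \<inter> box r M :: 'f vec set"
  have Sc: "?S \<subseteq> carrier_vec r" using creps_carrier[OF \<rho>(1), where 'a='f] by blast
  let ?X = "\<lambda>S. \<Sum>b\<in>S. {#(\<Phi> b, cind_fun \<rho> b)#}"
  have fs: "?X S \<in> formal_sums A B \<and>
      (\<forall>x\<in>carrier_vec r. eval_sum A x (?X S) = (if crep r \<rho> x \<in> S then \<Phi> (crep r \<rho> x) else \<zero>\<^bsub>A\<^esub>))"
    if "finite S" "S \<subseteq> ?S" for S
    using that
  proof (induction S rule: finite_induct)
    case (insert b S)
    have b: "b \<in> creps r \<rho>" "b \<in> carrier_vec r" using insert.prems Sc by auto
    have IH: "?X S \<in> formal_sums A B"
      "\<And>x. x \<in> carrier_vec r \<Longrightarrow> eval_sum A x (?X S) = (if crep r \<rho> x \<in> S then \<Phi> (crep r \<rho> x) else \<zero>\<^bsub>A\<^esub>)"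
      using insert by auto
    have "eval_sum A x (?X (insert b S)) = (if crep r \<rho> x \<in> insert b S then \<Phi> (crep r \<rho> x) else \<zero>\<^bsub>A\<^esub>)"
      if x: "x \<in> carrier_vec r" for x
    proof -
      have e: "cind_fun \<rho> b x = (if crep r \<rho> x = b then 1 else 0)"
      proof (cases "x - b \<in> box r \<rho>")
        case True
        then show ?thesis using crep_eq[OF b(2) x True] crep_creps[OF \<rho>(1) b(1)] x by (simp add: cind_fun_def ind_def)
      next
        case False
        then have "crep r \<rho> x \<noteq> b" using crep(3)[OF x \<rho>(1)] by auto
        then show ?thesis using False x by (simp add: cind_fun_def ind_def)
      qed
      have "crep r \<rho> x \<noteq> b \<or> crep r \<rho> x \<notin> S" using insert.hyps by auto
      then show ?thesis
        using insert.hyps \<Phi>[OF b(2)] IH(2)[OF x] \<Phi>[OF crep(1)[OF x \<rho>(1)]]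
        by (auto simp: eval_sum_add_mset e module_simps[OF A])
    qed
    then show ?case using insert.hyps IH(1) \<Phi>[OF b(2)] cind_fun_carrier[OF b(2) \<rho>(1)] by simp
  qed simp
  have S: "?X ?S \<in> formal_sums A B"
    "\<And>x. x \<in> carrier_vec r \<Longrightarrow> eval_sum A x (?X ?S) = (if crep r \<rho> x \<in> ?S then \<Phi> (crep r \<rho> x) else \<zero>\<^bsub>A\<^esub>)"
    using fs[OF finite_creps_box[OF \<rho>(1)]] by blast+
  have "theta (tcls A B (?X ?S)) x = \<Phi> x" if x: "x \<in> carrier_vec r" for x
  proof -
    have c: "\<Phi> (crep r \<rho> x) = \<Phi> x"
      using \<rho>(2) x crep[OF x \<rho>(1)] vec_minus_plus[OF x crep(1)[OF x \<rho>(1)]] unfolding loc_const_def by metis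
    have "crep r \<rho> x \<in> creps r \<rho>" using x by (simp add: creps_def)
    then show ?thesis
      using theta_cls[OF S(1) x] S(2)[OF x] c M crep(1)[OF x \<rho>(1)] unfolding supported_def by auto
  qed
  then show ?thesis using S(1) by (auto simp: tensor_carrier)
qed

text \<open>Outside a box supporting all functions that occur in one formal sum, every summand
  vanishes.\<close>

lemma theta_lc:
  assumes P: "P \<in> carrier (tensor A B)"
  shows "\<exists>M. supported r M \<zero>\<^bsub>A\<^esub> (theta P)"
proof -
  obtain X where X: "X \<in> formal_sums A B" "P = tcls A B X" using P by (auto simp: tensor_carrier)
  obtain \<rho> M where 1: "\<rho> > 0" "\<forall>(a, f)\<in>set_mset X. loc_const r \<rho> f \<and> supported r M 0 f"
    using formal_sums_common_radius[OF X(1)] by blast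
  have zero: "eval_sum A x X = \<zero>\<^bsub>A\<^esub>" if x: "x \<in> carrier_vec r" "x \<notin> box r M" for x :: "'f vec"
    using X(1) 1(2)
  proof (induction X)
    case (add p X)
    obtain a f where p: "p = (a, f)" by (cases p)
    have "f x = 0" using add.prems(2) x p by (auto simp: supported_def)
    then show ?case using add p by (simp add: eval_sum_add_mset module_simps[OF A])
  qed simp
  have "x \<in> box r M" if "x \<in> carrier_vec r" "theta P x \<noteq> \<zero>\<^bsub>A\<^esub>" for x
    using zero[OF that(1)] theta_cls[OF X(1) that(1)] X(2) that(2) by auto
  then show ?thesis unfolding supported_def by blast
qed

lemma theta_add:
  assumes "P \<in> carrier (tensor A B)" "Q \<in> carrier (tensor A B)" "x \<in> carrier_vec r"
  shows "theta (P \<oplus>\<^bsub>tensor A B\<^esub> Q) x = theta P x \<oplus>\<^bsub>A\<^esub> theta Q x"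
proof -
  obtain X Y where X: "X \<in> formal_sums A B" "P = tcls A B X" and Y: "Y \<in> formal_sums A B" "Q = tcls A B Y"
    using assms(1,2) by (auto simp: tensor_carrier)
  have "X + Y \<in> formal_sums A B" using X Y by simp
  from theta_cls[OF this assms(3)] show ?thesis
    using theta_cls[OF X(1) assms(3)] theta_cls[OF Y(1) assms(3)] X Y
    by (simp add: tensor_add_cls[OF A schwartz_module[OF B]] eval_sum_union[OF formal_sums_fst[of _ B]])
qed

text \<open>This is how a weighted substitution operator on S(F^r), combined with an operator on A,
  is read on A-valued functions.\<close>

lemma theta_map:
  assumes P: "P \<in> carrier (tensor A B)" and x: "x \<in> carrier_vec r"
    and \<alpha>: "lin_map A A \<alpha>" and \<beta>: "lin_map B B \<beta>"
    and e: "\<And>f. f \<in> carrier B \<Longrightarrow> \<beta> f x = c * f y" and y: "y \<in> carrier_vec r"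
  shows "theta (tensor_map A B \<alpha> \<beta> P) x = c \<odot>\<^bsub>A\<^esub> \<alpha> (theta P y)"
proof -
  obtain X where X: "X \<in> formal_sums A B" "P = tcls A B X" using P by (auto simp: tensor_carrier)
  show ?thesis
    using tensor_map_cls[OF \<alpha> \<beta> X(1)] theta_cls[OF formal_sums_image[OF \<alpha> \<beta> X(1)] x]
      theta_cls[OF X(1) y] eval_sum_image[where \<beta>=\<beta> and c=c and x=x and y=y, OF X(1) \<alpha> e] X(2) by simp
qed

lemma theta_smult:
  assumes P: "P \<in> carrier (tensor A B)" and x: "x \<in> carrier_vec r"
  shows "theta (c \<odot>\<^bsub>tensor A B\<^esub> P) x = c \<odot>\<^bsub>A\<^esub> theta P x"
proof -
  have "c \<odot>\<^bsub>tensor A B\<^esub> P = tensor_map A B (\<lambda>a. c \<odot>\<^bsub>A\<^esub> a) (\<lambda>f. f) P"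
    by (simp add: tensor_def tensor_map_def)
  then show ?thesis
    using theta_map[OF P x lin_map_smult[OF A, of c] lin_map_id, of 1 x] x theta_closed
    by (simp add: module_simps[OF A])
qed

end

end

section \<open>Compact induction: conjugation, closure and stages\<close>

section \<open>Compact induction\<close>

lemma rep_iso_trans:
  assumes "rep_iso G \<rho> \<sigma>" "rep_iso G \<sigma> \<tau>"
  shows "rep_iso G \<rho> \<tau>"
proof -
  obtain T S where T: "T \<in> module_hom class_ring \<rho> \<sigma>" "bij_betw T (carrier \<rho>) (carrier \<sigma>)"
      "\<forall>g\<in>G. \<forall>v\<in>carrier \<rho>. T (act \<rho> g v) = act \<sigma> g (T v)"
    and S: "S \<in> module_hom class_ring \<sigma> \<tau>" "bij_betw S (carrier \<sigma>) (carrier \<tau>)"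
      "\<forall>g\<in>G. \<forall>v\<in>carrier \<sigma>. S (act \<sigma> g v) = act \<tau> g (S v)"
    using assms unfolding rep_iso_def by blast
  have c: "T v \<in> carrier \<sigma>" if "v \<in> carrier \<rho>" for v using T(1) that unfolding module_hom_def by auto
  have "S \<circ> T \<in> module_hom class_ring \<rho> \<tau>"
    using T(1) S(1) c unfolding module_hom_def by auto
  moreover have "bij_betw (S \<circ> T) (carrier \<rho>) (carrier \<tau>)" by (rule bij_betw_trans[OF T(2) S(2)])
  ultimately show ?thesis using T(3) S(3) c unfolding rep_iso_def by (intro bexI[of _ "S \<circ> T"]) auto
qed

text \<open>What the source of an isomorphism must satisfy for the inverse bijection to be an
  isomorphism again; \<open>rep_iso\<close> speaks about bare records and does not include
  it.\<close>

definition rep_closed :: "'g set \<Rightarrow> ('g, 'w) rep \<Rightarrow> bool" where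
  "rep_closed G \<rho> \<longleftrightarrow> (\<forall>x\<in>carrier \<rho>. \<forall>y\<in>carrier \<rho>. x \<oplus>\<^bsub>\<rho>\<^esub> y \<in> carrier \<rho>) \<and>
     (\<forall>c. \<forall>x\<in>carrier \<rho>. c \<odot>\<^bsub>\<rho>\<^esub> x \<in> carrier \<rho>) \<and> (\<forall>g\<in>G. \<forall>x\<in>carrier \<rho>. act \<rho> g x \<in> carrier \<rho>)"

lemma rep_iso_sym:
  assumes "rep_iso G \<rho> \<sigma>" and cl: "rep_closed G \<rho>"
  shows "rep_iso G \<sigma> \<rho>"
proof -
  obtain T where T: "T \<in> module_hom class_ring \<rho> \<sigma>" "bij_betw T (carrier \<rho>) (carrier \<sigma>)"
      "\<forall>g\<in>G. \<forall>v\<in>carrier \<rho>. T (act \<rho> g v) = act \<sigma> g (T v)"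
    using assms unfolding rep_iso_def by blast
  let ?S = "inv_into (carrier \<rho>) T"
  have S: "?S y \<in> carrier \<rho>" "T (?S y) = y" if "y \<in> carrier \<sigma>" for y
    using T(2) that by (auto simp: bij_betw_def inv_into_into f_inv_into_f)
  have S2: "?S (T x) = x" if "x \<in> carrier \<rho>" for x using T(2) that by (simp add: bij_betw_def inv_into_f_f)
  have add: "T (x \<oplus>\<^bsub>\<rho>\<^esub> y) = T x \<oplus>\<^bsub>\<sigma>\<^esub> T y" if "x \<in> carrier \<rho>" "y \<in> carrier \<rho>" for x y
    using T(1) that unfolding module_hom_def by auto
  have sm: "T (c \<odot>\<^bsub>\<rho>\<^esub> x) = c \<odot>\<^bsub>\<sigma>\<^esub> T x" if "x \<in> carrier \<rho>" for c x
    using T(1) that unfolding module_hom_def by auto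
  have clo: "\<And>x y. x \<in> carrier \<rho> \<Longrightarrow> y \<in> carrier \<rho> \<Longrightarrow> x \<oplus>\<^bsub>\<rho>\<^esub> y \<in> carrier \<rho>"
    "\<And>c x. x \<in> carrier \<rho> \<Longrightarrow> c \<odot>\<^bsub>\<rho>\<^esub> x \<in> carrier \<rho>"
    "\<And>g x. g \<in> G \<Longrightarrow> x \<in> carrier \<rho> \<Longrightarrow> act \<rho> g x \<in> carrier \<rho>"
    using cl unfolding rep_closed_def by blast+
  have 1: "?S (x \<oplus>\<^bsub>\<sigma>\<^esub> y) = ?S x \<oplus>\<^bsub>\<rho>\<^esub> ?S y" if "x \<in> carrier \<sigma>" "y \<in> carrier \<sigma>" for x y
    using S2[OF clo(1)[OF S(1)[OF that(1)] S(1)[OF that(2)]]] add[OF S(1)[OF that(1)] S(1)[OF that(2)]] S(2) that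
    by simp
  have 2: "?S (c \<odot>\<^bsub>\<sigma>\<^esub> x) = c \<odot>\<^bsub>\<rho>\<^esub> ?S x" if "x \<in> carrier \<sigma>" for c x
    using S2[OF clo(2)[OF S(1)[OF that], of c]] sm[OF S(1)[OF that], of c] S(2)[OF that] by simp
  have 3: "?S (act \<sigma> g v) = act \<rho> g (?S v)" if "g \<in> G" "v \<in> carrier \<sigma>" for g v
    using S2[OF clo(3)[OF that(1) S(1)[OF that(2)]]] T(3) that S by simp
  have "?S \<in> module_hom class_ring \<sigma> \<rho>" using S 1 2 unfolding module_hom_def by auto
  moreover have "bij_betw ?S (carrier \<sigma>) (carrier \<rho>)" by (rule bij_betw_inv_into[OF T(2)])
  ultimately show ?thesis using 3 unfolding rep_iso_def by (intro bexI[of _ ?S]) auto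
qed

lemma cind_carrierI:
  assumes "\<And>g. g \<in> carrier (GL n) \<Longrightarrow> f g \<in> carrier \<sigma>" "f \<in> extensional (carrier (GL n))"
    "\<And>h g. h \<in> H \<Longrightarrow> g \<in> carrier (GL n) \<Longrightarrow> f (h * g) = act \<sigma> h (f g)"
    "subgroup K (GL n)" "openin (GL_top n) K" "\<And>g k. g \<in> carrier (GL n) \<Longrightarrow> k \<in> K \<Longrightarrow> f (g * k) = f g"
    "compactin (GL_top n) C" "\<And>g. g \<in> carrier (GL n) \<Longrightarrow> f g \<noteq> \<zero>\<^bsub>\<sigma>\<^esub> \<Longrightarrow> \<exists>h\<in>H. \<exists>c\<in>C. g = h * c"
  shows "f \<in> carrier (cind n H \<sigma>)"
proof -
  have "f \<in> carrier (GL n) \<rightarrow>\<^sub>E carrier \<sigma>" using assms(1,2) by (auto simp: PiE_def)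
  moreover have "\<exists>K. subgroup K (GL n) \<and> openin (GL_top n) K \<and> (\<forall>g\<in>carrier (GL n). \<forall>k\<in>K. f (g * k) = f g)"
    using assms(4-6) by blast
  moreover have "\<exists>C. compactin (GL_top n) C \<and> (\<forall>g\<in>carrier (GL n). f g \<noteq> \<zero>\<^bsub>\<sigma>\<^esub> \<longrightarrow> (\<exists>h\<in>H. \<exists>c\<in>C. g = h * c))"
    using assms(7,8) by blast
  ultimately show ?thesis using assms(3) unfolding cind_def by simp
qed

lemma cind_carrierD:
  fixes f :: "'f::nonarch_local_field mat \<Rightarrow> 'w"
  assumes "f \<in> carrier (cind n H \<sigma>)"
  shows "g \<in> carrier (GL n) \<Longrightarrow> f g \<in> carrier \<sigma>" "f \<in> extensional (carrier (GL n))"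
    "h \<in> H \<Longrightarrow> g \<in> carrier (GL n) \<Longrightarrow> f (h * g) = act \<sigma> h (f g)"
    "\<exists>K. subgroup K (GL n) \<and> openin (GL_top n) K \<and> (\<forall>g\<in>carrier (GL n). \<forall>k\<in>K. f (g * k) = f g)"
    "\<exists>C. compactin (GL_top n) C \<and> (\<forall>g\<in>carrier (GL n). f g \<noteq> \<zero>\<^bsub>\<sigma>\<^esub> \<longrightarrow> (\<exists>h\<in>H. \<exists>c\<in>C. g = h * c))"
  using assms unfolding cind_def by (auto simp: PiE_def)

lemma cind_simps:
  "f \<oplus>\<^bsub>cind n H \<sigma>\<^esub> f' = (\<lambda>g\<in>carrier (GL n). f g \<oplus>\<^bsub>\<sigma>\<^esub> f' g)"
  "c \<odot>\<^bsub>cind n H \<sigma>\<^esub> f = (\<lambda>g\<in>carrier (GL n). c \<odot>\<^bsub>\<sigma>\<^esub> f g)"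
  "act (cind n H \<sigma>) x f = (\<lambda>g\<in>carrier (GL n). f (g * x))"
  by (simp_all add: cind_def)

lemma compactin_GL_translate:
  fixes a b :: "'f::nonarch_local_field mat"
  assumes "compactin (GL_top n) C" "a \<in> carrier (GL n)" "b \<in> carrier (GL n)"
  shows "compactin (GL_top n) ((\<lambda>c. a * c * b) ` C)"
  using image_compactin[OF assms(1) continuous_map_GL_translate[OF assms(2,3)]] .

lemma openin_GL_translate:
  fixes a b :: "'f::nonarch_local_field mat"
  assumes "openin (GL_top n) K" "a \<in> carrier (GL n)" "b \<in> carrier (GL n)"
  shows "openin (GL_top n) {g \<in> carrier (GL n). a * g * b \<in> K}"
  using openin_continuous_map_preimage[OF continuous_map_GL_translate[OF assms(2,3)] assms(1)] by simp

lemma compactin_GL_carrier: "compactin (GL_top n) C \<Longrightarrow> c \<in> C \<Longrightarrow> c \<in> carrier (GL n)"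
  using compactin_subset_topspace by fastforce

text \<open>The map sends f to the function with value T(f(t g)) at g. Left translation by t changes
  the equivariance group from H to its conjugate by t^(-1) and commutes with right translation; a
  support H C becomes H' (t^(-1) C). It is applied with t = 1 for the Fourier transform, and with T
  the identity for diagonal and permutation matrices.\<close>

lemma cind_iso_conj:
  fixes \<sigma> :: "('f::nonarch_local_field mat, 'v) rep" and \<sigma>' :: "('f mat, 'w) rep"
  assumes H: "H \<subseteq> carrier (GL n)" and H': "H' \<subseteq> carrier (GL n)" and t: "t \<in> carrier (GL n)"
    and HH': "\<And>h. h \<in> H' \<Longrightarrow> t * h * inv\<^bsub>GL n\<^esub> t \<in> H" and H'H: "\<And>h. h \<in> H \<Longrightarrow> inv\<^bsub>GL n\<^esub> t * h * t \<in> H'"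
    and T: "lin_map \<sigma> \<sigma>' T" "bij_betw T (carrier \<sigma>) (carrier \<sigma>')"
    and cl: "\<And>h v. h \<in> H \<Longrightarrow> v \<in> carrier \<sigma> \<Longrightarrow> act \<sigma> h v \<in> carrier \<sigma>"
    and eq: "\<And>h v. h \<in> H' \<Longrightarrow> v \<in> carrier \<sigma> \<Longrightarrow> T (act \<sigma> (t * h * inv\<^bsub>GL n\<^esub> t) v) = act \<sigma>' h (T v)"
    and z: "\<zero>\<^bsub>\<sigma>\<^esub> \<in> carrier \<sigma>"
  shows "rep_iso (carrier (GL n)) (cind n H \<sigma>) (cind n H' \<sigma>')"
proof -
  let ?G = "carrier (GL n)" and ?i = "inv\<^bsub>GL n\<^esub> t" and ?S = "inv_into (carrier \<sigma>) T"
  have i: "?i \<in> ?G" using t by blast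
  have Tc: "T v \<in> carrier \<sigma>'" if "v \<in> carrier \<sigma>" for v using lin_map_closed[OF T(1) that] .
  have S: "?S y \<in> carrier \<sigma>" "T (?S y) = y" if "y \<in> carrier \<sigma>'" for y
    using T(2) that by (auto simp: bij_betw_def inv_into_into f_inv_into_f)
  have S2: "?S (T x) = x" if "x \<in> carrier \<sigma>" for x using T(2) that by (simp add: bij_betw_def inv_into_f_f)
  have Tz: "T \<zero>\<^bsub>\<sigma>\<^esub> = \<zero>\<^bsub>\<sigma>'\<^esub>" using T(1) by (simp add: lin_map_def)
  define U where "U f = (\<lambda>g\<in>?G. T (f (t * g)))" for f
  define W where "W f = (\<lambda>g\<in>?G. ?S (f (?i * g)))" for f
  have U: "U f \<in> carrier (cind n H' \<sigma>')" if f: "f \<in> carrier (cind n H \<sigma>)" for f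
  proof -
    note D = cind_carrierD[OF f]
    obtain K where K: "subgroup K (GL n)" "openin (GL_top n) K" "\<And>g k. g \<in> ?G \<Longrightarrow> k \<in> K \<Longrightarrow> f (g * k) = f g"
      using D(4) by blast
    obtain C where C: "compactin (GL_top n) C" "\<And>g. g \<in> ?G \<Longrightarrow> f g \<noteq> \<zero>\<^bsub>\<sigma>\<^esub> \<Longrightarrow> \<exists>h\<in>H. \<exists>c\<in>C. g = h * c"
      using D(5) by blast
    have KG: "k \<in> ?G" if "k \<in> K" for k using K(1) that subgroup.mem_carrier by metis
    show ?thesis
    proof (rule cind_carrierI[OF _ _ _ K(1,2) _ compactin_GL_translate[OF C(1) i GL_one_closed]])
      show "U f g \<in> carrier \<sigma>'" if "g \<in> ?G" for g using D(1) t that Tc by (simp add: U_def GL_mult_closed)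
      show "U f (h * g) = act \<sigma>' h (U f g)" if h: "h \<in> H'" and g: "g \<in> ?G" for h g
      proof -
        have hG: "h \<in> ?G" using h H' by blast
        have "t * (h * g) = (t * h * ?i) * (t * g)"
          using t hG g i by (simp add: GL_assoc GL_mult_closed GL_inv_cancel)
        then have "f (t * (h * g)) = act \<sigma> (t * h * ?i) (f (t * g))"
          using D(3)[OF HH'[OF h], of "t * g"] t g by (simp add: GL_mult_closed)
        then show ?thesis using eq[OF h D(1)[of "t * g"]] t g hG by (simp add: U_def GL_mult_closed)
      qed
      show "U f (g * k) = U f g" if "g \<in> ?G" "k \<in> K" for g k
        using K(3)[of "t * g" k] that KG[OF that(2)] t by (simp add: U_def GL_mult_closed GL_assoc)
      show "\<exists>h\<in>H'. \<exists>c\<in>(\<lambda>c. ?i * c * 1\<^sub>m n) ` C. g = h * c" if g: "g \<in> ?G" and nz: "U f g \<noteq> \<zero>\<^bsub>\<sigma>'\<^esub>" for g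
      proof -
        have "f (t * g) \<noteq> \<zero>\<^bsub>\<sigma>\<^esub>" using nz g Tz by (auto simp: U_def)
        then obtain h c where hc: "h \<in> H" "c \<in> C" "t * g = h * c" using C(2)[of "t * g"] t g by blast
        have hG: "h \<in> ?G" and cG: "c \<in> ?G" using hc(1) H compactin_GL_carrier[OF C(1) hc(2)] by blast+
        have "g = ?i * (t * g)" using t g by (simp add: GL_inv_cancel)
        also have "\<dots> = (?i * h * t) * (?i * c * 1\<^sub>m n)"
          unfolding hc(3) using t hG cG i by (simp add: GL_assoc GL_mult_closed GL_inv_cancel)
        finally show ?thesis using H'H[OF hc(1)] hc(2) by blast
      qed
    qed (simp add: U_def)
  qed
  have W: "W f \<in> carrier (cind n H \<sigma>)" if f: "f \<in> carrier (cind n H' \<sigma>')" for f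
  proof -
    note D = cind_carrierD[OF f]
    obtain K where K: "subgroup K (GL n)" "openin (GL_top n) K" "\<And>g k. g \<in> ?G \<Longrightarrow> k \<in> K \<Longrightarrow> f (g * k) = f g"
      using D(4) by blast
    obtain C where C: "compactin (GL_top n) C" "\<And>g. g \<in> ?G \<Longrightarrow> f g \<noteq> \<zero>\<^bsub>\<sigma>'\<^esub> \<Longrightarrow> \<exists>h\<in>H'. \<exists>c\<in>C. g = h * c"
      using D(5) by blast
    have KG: "k \<in> ?G" if "k \<in> K" for k using K(1) that subgroup.mem_carrier by metis
    show ?thesis
    proof (rule cind_carrierI[OF _ _ _ K(1,2) _ compactin_GL_translate[OF C(1) t GL_one_closed]])
      show "W f g \<in> carrier \<sigma>" if "g \<in> ?G" for g using D(1) i that S(1) by (simp add: W_def GL_mult_closed)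
      show "W f (h * g) = act \<sigma> h (W f g)" if h: "h \<in> H" and g: "g \<in> ?G" for h g
      proof -
        have hG: "h \<in> ?G" using h H by blast
        let ?h = "?i * h * t"
        have fc: "f (?i * g) \<in> carrier \<sigma>'" using D(1) i g by blast
        have th: "t * ?h * ?i = h" using t hG i by (simp add: GL_assoc GL_mult_closed GL_inv_cancel GL_r_inv)
        have "?i * (h * g) = ?h * (?i * g)"
          using t hG g i by (simp add: GL_assoc GL_mult_closed GL_inv_cancel)
        then have "f (?i * (h * g)) = act \<sigma>' ?h (f (?i * g))"
          using D(3)[OF H'H[OF h], of "?i * g"] i g by (simp add: GL_mult_closed)
        also have "\<dots> = T (act \<sigma> h (?S (f (?i * g))))"
          using eq[OF H'H[OF h] S(1)[OF fc]] S(2)[OF fc] th by simp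
        finally show ?thesis using S2[OF cl[OF h S(1)[OF fc]]] g hG by (simp add: W_def GL_mult_closed)
      qed
      show "W f (g * k) = W f g" if "g \<in> ?G" "k \<in> K" for g k
        using K(3)[of "?i * g" k] that KG[OF that(2)] i by (simp add: W_def GL_mult_closed GL_assoc)
      show "\<exists>h\<in>H. \<exists>c\<in>(\<lambda>c. t * c * 1\<^sub>m n) ` C. g = h * c" if g: "g \<in> ?G" and nz: "W f g \<noteq> \<zero>\<^bsub>\<sigma>\<^esub>" for g
      proof -
        have "f (?i * g) \<noteq> \<zero>\<^bsub>\<sigma>'\<^esub>" using nz g Tz S2[OF z] by (auto simp: W_def)
        then obtain h c where hc: "h \<in> H'" "c \<in> C" "?i * g = h * c" using C(2)[of "?i * g"] i g by blast
        have hG: "h \<in> ?G" and cG: "c \<in> ?G" using hc(1) H' compactin_GL_carrier[OF C(1) hc(2)] by blast+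
        have "g = t * (?i * g)" using t g by (simp add: GL_inv_cancel)
        also have "\<dots> = (t * h * ?i) * (t * c * 1\<^sub>m n)"
          unfolding hc(3) using t hG cG i by (simp add: GL_assoc GL_mult_closed GL_inv_cancel)
        finally show ?thesis using HH'[OF hc(1)] hc(2) by blast
      qed
    qed (simp add: W_def)
  qed
  have "U \<in> module_hom class_ring (cind n H \<sigma>) (cind n H' \<sigma>')"
    unfolding module_hom_def
  proof (intro CollectI conjI allI impI)
    show "U \<in> carrier (cind n H \<sigma>) \<rightarrow> carrier (cind n H' \<sigma>')" using U by blast
    fix f f' assume "f \<in> carrier (cind n H \<sigma>) \<and> f' \<in> carrier (cind n H \<sigma>)"
    then have "f g \<in> carrier \<sigma>" "f' g \<in> carrier \<sigma>" if "g \<in> ?G" for g using cind_carrierD(1) that by blast+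
    then show "U (f \<oplus>\<^bsub>cind n H \<sigma>\<^esub> f') = U f \<oplus>\<^bsub>cind n H' \<sigma>'\<^esub> U f'"
      using T(1) t by (auto simp: U_def cind_simps fun_eq_iff lin_map_def GL_mult_closed)
  next
    fix c f assume "c \<in> carrier (class_ring :: complex ring) \<and> f \<in> carrier (cind n H \<sigma>)"
    then have "f g \<in> carrier \<sigma>" if "g \<in> ?G" for g using cind_carrierD(1) that by blast
    then show "U (c \<odot>\<^bsub>cind n H \<sigma>\<^esub> f) = c \<odot>\<^bsub>cind n H' \<sigma>'\<^esub> U f"
      using T(1) t by (auto simp: U_def cind_simps fun_eq_iff lin_map_def GL_mult_closed)
  qed
  moreover have "bij_betw U (carrier (cind n H \<sigma>)) (carrier (cind n H' \<sigma>'))"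
  proof (rule bij_betw_byWitness[where f'=W])
    show "\<forall>f\<in>carrier (cind n H \<sigma>). W (U f) = f"
    proof
      fix f assume f: "f \<in> carrier (cind n H \<sigma>)"
      show "W (U f) = f"
        by (rule extensionalityI[of _ ?G])
          (use cind_carrierD(1,2)[OF f] i t in \<open>auto simp: W_def U_def GL_mult_closed GL_inv_cancel S2\<close>)
    qed
    show "\<forall>f\<in>carrier (cind n H' \<sigma>'). U (W f) = f"
    proof
      fix f assume f: "f \<in> carrier (cind n H' \<sigma>')"
      show "U (W f) = f"
        by (rule extensionalityI[of _ ?G])
          (use cind_carrierD(1,2)[OF f] i t in \<open>auto simp: W_def U_def GL_mult_closed GL_inv_cancel S\<close>)
    qed
  qed (use U W in auto)
  moreover have "U (act (cind n H \<sigma>) x f) = act (cind n H' \<sigma>') x (U f)" if "x \<in> ?G" for x f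
    using that t by (auto simp: U_def cind_simps fun_eq_iff GL_mult_closed GL_assoc)
  ultimately show ?thesis unfolding rep_iso_def by blast
qed

text \<open>For sums, the invariance groups are intersected and the compact sets united. Right
  translation by x conjugates the invariance group K and replaces C by C x^(-1).\<close>

lemma cind_rep_closed:
  fixes \<sigma> :: "('f::nonarch_local_field mat, 'w) rep"
  assumes H: "H \<subseteq> carrier (GL n)"
    and act: "\<And>h. h \<in> H \<Longrightarrow> lin_map \<sigma> \<sigma> (act \<sigma> h)"
    and cl: "\<And>x y. x \<in> carrier \<sigma> \<Longrightarrow> y \<in> carrier \<sigma> \<Longrightarrow> x \<oplus>\<^bsub>\<sigma>\<^esub> y \<in> carrier \<sigma>"
      "\<And>c x. x \<in> carrier \<sigma> \<Longrightarrow> c \<odot>\<^bsub>\<sigma>\<^esub> x \<in> carrier \<sigma>"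
    and zero: "\<zero>\<^bsub>\<sigma>\<^esub> \<oplus>\<^bsub>\<sigma>\<^esub> \<zero>\<^bsub>\<sigma>\<^esub> = \<zero>\<^bsub>\<sigma>\<^esub>" "\<And>c. c \<odot>\<^bsub>\<sigma>\<^esub> \<zero>\<^bsub>\<sigma>\<^esub> = \<zero>\<^bsub>\<sigma>\<^esub>"
  shows "rep_closed (carrier (GL n)) (cind n H \<sigma>)"
  unfolding rep_closed_def
proof (intro conjI ballI allI)
  let ?G = "carrier (GL n)"
  fix f assume f: "f \<in> carrier (cind n H \<sigma>)"
  note D = cind_carrierD[OF f]
  obtain K where K: "subgroup K (GL n)" "openin (GL_top n) K" "\<And>g k. g \<in> ?G \<Longrightarrow> k \<in> K \<Longrightarrow> f (g * k) = f g"
    using D(4) by blast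
  obtain C where C: "compactin (GL_top n) C" "\<And>g. g \<in> ?G \<Longrightarrow> f g \<noteq> \<zero>\<^bsub>\<sigma>\<^esub> \<Longrightarrow> \<exists>h\<in>H. \<exists>c\<in>C. g = h * c"
    using D(5) by blast
  have KG: "k \<in> ?G" if "k \<in> K" for k using K(1) that subgroup.mem_carrier by metis
  have HG: "h \<in> ?G" if "h \<in> H" for h using that H by blast
  {
    fix f' assume f': "f' \<in> carrier (cind n H \<sigma>)"
    note D' = cind_carrierD[OF f']
    obtain K' where K': "subgroup K' (GL n)" "openin (GL_top n) K'" "\<And>g k. g \<in> ?G \<Longrightarrow> k \<in> K' \<Longrightarrow> f' (g * k) = f' g"
      using D'(4) by blast
    obtain C' where C': "compactin (GL_top n) C'" "\<And>g. g \<in> ?G \<Longrightarrow> f' g \<noteq> \<zero>\<^bsub>\<sigma>\<^esub> \<Longrightarrow> \<exists>h\<in>H. \<exists>c\<in>C'. g = h * c"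
      using D'(5) by blast
    show "f \<oplus>\<^bsub>cind n H \<sigma>\<^esub> f' \<in> carrier (cind n H \<sigma>)"
      unfolding cind_simps
    proof (rule cind_carrierI[where K="K \<inter> K'" and C="C \<union> C'"])
      show "subgroup (K \<inter> K') (GL n)" using group.subgroups_Inter_pair[OF GL_group K(1) K'(1)] .
      show "openin (GL_top n) (K \<inter> K')" using K(2) K'(2) by blast
      show "compactin (GL_top n) (C \<union> C')" using C(1) C'(1) by (rule compactin_Un)
      show "\<exists>h\<in>H. \<exists>c\<in>C \<union> C'. g = h * c" if "g \<in> ?G" "(\<lambda>g\<in>?G. f g \<oplus>\<^bsub>\<sigma>\<^esub> f' g) g \<noteq> \<zero>\<^bsub>\<sigma>\<^esub>" for g
      proof (cases "f g = \<zero>\<^bsub>\<sigma>\<^esub>")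
        case True
        then have "f' g \<noteq> \<zero>\<^bsub>\<sigma>\<^esub>" using that zero by auto
        then show ?thesis using C'(2)[OF that(1)] by blast
      qed (use C(2)[OF that(1)] in blast)
      show "(\<lambda>g\<in>?G. f g \<oplus>\<^bsub>\<sigma>\<^esub> f' g) (h * g) = act \<sigma> h ((\<lambda>g\<in>?G. f g \<oplus>\<^bsub>\<sigma>\<^esub> f' g) g)"
        if "h \<in> H" "g \<in> ?G" for h g
        using act[OF that(1)] D(1,3) D'(1,3) that HG[OF that(1)] by (simp add: lin_map_def GL_mult_closed)
    qed (use D(1) D'(1) cl K(3) K'(3) KG in \<open>auto simp: GL_mult_closed\<close>)
  }
  fix c
  show "c \<odot>\<^bsub>cind n H \<sigma>\<^esub> f \<in> carrier (cind n H \<sigma>)"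
    unfolding cind_simps
  proof (rule cind_carrierI[OF _ _ _ K(1,2) _ C(1)])
    show "\<exists>h\<in>H. \<exists>c\<in>C. g = h * c" if "g \<in> ?G" "(\<lambda>g\<in>?G. c \<odot>\<^bsub>\<sigma>\<^esub> f g) g \<noteq> \<zero>\<^bsub>\<sigma>\<^esub>" for g
      using C(2)[OF that(1)] that zero(2) by fastforce
    show "(\<lambda>g\<in>?G. c \<odot>\<^bsub>\<sigma>\<^esub> f g) (h * g) = act \<sigma> h ((\<lambda>g\<in>?G. c \<odot>\<^bsub>\<sigma>\<^esub> f g) g)" if "h \<in> H" "g \<in> ?G" for h g
      using act[OF that(1)] D(1,3) that HG[OF that(1)] by (simp add: lin_map_def GL_mult_closed)
  qed (use D(1) cl K(3) KG in \<open>auto simp: GL_mult_closed\<close>)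
next
  let ?G = "carrier (GL n)"
  fix x :: "'f mat" and f assume x: "x \<in> ?G" and f: "f \<in> carrier (cind n H \<sigma>)"
  note D = cind_carrierD[OF f]
  obtain K where K: "subgroup K (GL n)" "openin (GL_top n) K" "\<And>g k. g \<in> ?G \<Longrightarrow> k \<in> K \<Longrightarrow> f (g * k) = f g"
    using D(4) by blast
  obtain C where C: "compactin (GL_top n) C" "\<And>g. g \<in> ?G \<Longrightarrow> f g \<noteq> \<zero>\<^bsub>\<sigma>\<^esub> \<Longrightarrow> \<exists>h\<in>H. \<exists>c\<in>C. g = h * c"
    using D(5) by blast
  have HG: "h \<in> ?G" if "h \<in> H" for h using that H by blast
  let ?i = "inv\<^bsub>GL n\<^esub> x"
  have i: "?i \<in> ?G" using x by blast
  show "act (cind n H \<sigma>) x f \<in> carrier (cind n H \<sigma>)"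
    unfolding cind_simps
  proof (rule cind_carrierI[OF _ _ _ _ openin_GL_translate[OF K(2) i x] _ compactin_GL_translate[OF C(1) GL_one_closed i]])
    show "subgroup {k \<in> ?G. ?i * k * x \<in> K} (GL n)"
    proof (rule group.subgroupI[OF GL_group])
      have "1\<^sub>m n \<in> {k \<in> ?G. ?i * k * x \<in> K}"
        using x i subgroup.one_closed[OF K(1)] by (simp add: GL_l_inv)
      then show "{k \<in> ?G. ?i * k * x \<in> K} \<noteq> {}" by blast
      fix a assume a: "a \<in> {k \<in> ?G. ?i * k * x \<in> K}"
      have aG: "a \<in> ?G" "inv\<^bsub>GL n\<^esub> a \<in> ?G" using a by auto
      have "(?i * a * x) * (?i * inv\<^bsub>GL n\<^esub> a * x) = ?i * (a * (inv\<^bsub>GL n\<^esub> a * x))"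
        using aG x i by (simp add: GL_assoc GL_mult_closed GL_inv_cancel(2)[OF x])
      also have "\<dots> = 1\<^sub>m n" using aG x by (simp add: GL_inv_cancel(2) GL_l_inv)
      finally have "inv\<^bsub>GL n\<^esub> (?i * a * x) = ?i * inv\<^bsub>GL n\<^esub> a * x"
        using aG x i by (intro GL_inv_eq GL_mult_closed)
      then show "inv\<^bsub>GL n\<^esub> a \<in> {k \<in> ?G. ?i * k * x \<in> K}"
        using a subgroup.m_inv_closed[OF K(1), of "?i * a * x"] by (auto simp: GL_inv_closed)
      fix b assume b: "b \<in> {k \<in> ?G. ?i * k * x \<in> K}"
      have "(?i * a * x) * (?i * b * x) = ?i * (a * b) * x"
        using a b x i by (auto simp: GL_assoc GL_mult_closed GL_inv_cancel)
      then show "a \<otimes>\<^bsub>GL n\<^esub> b \<in> {k \<in> ?G. ?i * k * x \<in> K}"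
        using a b subgroup.m_closed[OF K(1), of "?i * a * x" "?i * b * x"] by (auto simp: GL_mult_closed)
    qed auto
    show "(\<lambda>g\<in>?G. f (g * x)) (g * k) = (\<lambda>g\<in>?G. f (g * x)) g"
      if "g \<in> ?G" "k \<in> {k \<in> ?G. ?i * k * x \<in> K}" for g k
    proof -
      have k: "k \<in> ?G" "?i * k * x \<in> K" using that(2) by auto
      have "g * k * x = (g * x) * (?i * k * x)" using that(1) k(1) x i by (simp add: GL_assoc GL_mult_closed GL_inv_cancel)
      then show ?thesis using K(3)[OF _ k(2), of "g * x"] that(1) k x by (simp add: GL_mult_closed)
    qed
    show "\<exists>h\<in>H. \<exists>c\<in>(\<lambda>c. 1\<^sub>m n * c * ?i) ` C. g = h * c" if g: "g \<in> ?G" and nz: "(\<lambda>g\<in>?G. f (g * x)) g \<noteq> \<zero>\<^bsub>\<sigma>\<^esub>" for g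
    proof -
      obtain h c where hc: "h \<in> H" "c \<in> C" "g * x = h * c" using C(2)[of "g * x"] nz g x by auto
      have hG: "h \<in> ?G" and cG: "c \<in> ?G" using HG hc(1) compactin_GL_carrier[OF C(1) hc(2)] by blast+
      have "g = g * x * ?i" using g x i by (simp add: GL_assoc GL_mult_closed GL_r_inv)
      also have "\<dots> = h * (1\<^sub>m n * c * ?i)" unfolding hc(3) using hG cG i by (simp add: GL_assoc GL_mult_closed)
      finally show ?thesis using hc by blast
    qed
    show "(\<lambda>g\<in>?G. f (g * x)) (h * g) = act \<sigma> h ((\<lambda>g\<in>?G. f (g * x)) g)" if "h \<in> H" "g \<in> ?G" for h g
      using D(3)[OF that(1), of "g * x"] that x HG[OF that(1)] by (simp add: GL_mult_closed GL_assoc)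
  qed (use D(1) x in \<open>auto simp: GL_mult_closed\<close>)
qed

text \<open>A right K-invariant function is constant on the open cosets c K, and finitely many of
  these cover C.\<close>

lemma compactin_finite_image:
  fixes f :: "'f::nonarch_local_field mat \<Rightarrow> 'w"
  assumes C: "compactin (GL_top n) C" and K: "subgroup K (GL n)" "openin (GL_top n) K"
    and inv: "\<And>g k. g \<in> carrier (GL n) \<Longrightarrow> k \<in> K \<Longrightarrow> f (g * k) = f g"
  shows "finite (f ` C)"
proof -
  let ?G = "carrier (GL n)"
  let ?U = "\<lambda>c. {g \<in> ?G. inv\<^bsub>GL n\<^esub> c * g * 1\<^sub>m n \<in> K}"
  have op: "openin (GL_top n) (?U c)" if "c \<in> C" for c
    by (rule openin_GL_translate[OF K(2) GL_inv_closed[OF compactin_GL_carrier[OF C that]] GL_one_closed])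
  have mem: "c \<in> ?U c" if "c \<in> C" for c
    using compactin_GL_carrier[OF C that] subgroup.one_closed[OF K(1)] by (simp add: GL_l_inv)
  have "C \<subseteq> \<Union>(?U ` C)" using mem by blast
  then obtain \<F> where F: "finite \<F>" "\<F> \<subseteq> ?U ` C" "C \<subseteq> \<Union>\<F>"
    using compactinD[OF C, of "?U ` C"] op by auto
  obtain D where D: "D \<subseteq> C" "finite D" "\<F> = ?U ` D" using finite_subset_image[OF F(1,2)] by blast
  have "f ` C \<subseteq> f ` D"
  proof
    fix w assume "w \<in> f ` C"
    then obtain g where g: "g \<in> C" "w = f g" by blast
    then obtain c where c: "c \<in> D" "g \<in> ?U c" using F(3) D(3) by blast
    have cG: "c \<in> ?G" using c(1) D(1) compactin_GL_carrier[OF C] by blast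
    have gG: "g \<in> ?G" using c(2) by simp
    have k: "inv\<^bsub>GL n\<^esub> c * g \<in> K" using c(2) cG gG GL_inv_closed[OF cG] by (simp add: GL_mult_closed)
    have "f g = f c" using inv[OF cG k] cG gG by (simp add: GL_inv_cancel)
    then show "w \<in> f ` D" using g c(1) by simp
  qed
  then show ?thesis using D(2) finite_subset by blast
qed

text \<open>Induction in stages in concrete form. The map s is a continuous section that represents
  the cosets of H0 in H by points of F^r, with s 0 = 1; \<open>E\<close> says that every s y h lies
  in some H0 s y', and \<open>I\<close> says that \<sigma> acts on A-valued functions on F^r as on
  functions induced from \<sigma>0. Evaluation at 0 then maps functions induced from H to functions
  induced from H0, and the value at g is recovered from the function y \<mapsto> F(s y g). The
  properness condition \<open>Pr\<close> ensures that this function has bounded support.\<close>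

lemma cind_stages:
  fixes \<sigma> :: "('f::nonarch_local_field mat, ('a \<times> ('f vec \<Rightarrow> complex)) multiset set) rep"
    and \<sigma>0 :: "('f mat, 'a) rep" and A :: "('f mat, 'a) rep" and B :: "('f mat, 'f vec \<Rightarrow> complex) rep"
    and s :: "'f vec \<Rightarrow> 'f mat"
  assumes A: "module class_ring A" and B: "is_schwartz r B"
    and \<sigma>: "carrier \<sigma> = carrier (tensor A B)" "zero \<sigma> = zero (tensor A B)" "add \<sigma> = add (tensor A B)" "smult \<sigma> = smult (tensor A B)"
    and \<sigma>0: "carrier \<sigma>0 = carrier A" "zero \<sigma>0 = zero A" "add \<sigma>0 = add A" "smult \<sigma>0 = smult A"
    and H: "H \<subseteq> carrier (GL n)" and H0: "H0 \<subseteq> H" "1\<^sub>m n \<in> H0"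
    and s: "\<And>y. y \<in> carrier_vec r \<Longrightarrow> s y \<in> H" "continuous_map (vec_top r) (GL_top n) s" "s (0\<^sub>v r) = 1\<^sub>m n"
    and Q: "\<And>y h. y \<in> carrier_vec r \<Longrightarrow> h \<in> H0 \<Longrightarrow> inv\<^bsub>GL n\<^esub> (s y) * h \<in> H"
    and E: "\<And>h y. h \<in> H \<Longrightarrow> y \<in> carrier_vec r \<Longrightarrow> \<exists>h0\<in>H0. \<exists>y'\<in>carrier_vec r. s y * h = h0 * s y'"
    and I: "\<And>h y h0 y' P. h \<in> H \<Longrightarrow> y \<in> carrier_vec r \<Longrightarrow> h0 \<in> H0 \<Longrightarrow> y' \<in> carrier_vec r \<Longrightarrow> s y * h = h0 * s y' \<Longrightarrow>
      P \<in> carrier (tensor A B) \<Longrightarrow> theta A (act \<sigma> h P) y = act \<sigma>0 h0 (theta A P y')"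
    and cl: "\<And>h P. h \<in> H \<Longrightarrow> P \<in> carrier (tensor A B) \<Longrightarrow> act \<sigma> h P \<in> carrier (tensor A B)"
    and Pr: "\<And>C. compactin (GL_top n) C \<Longrightarrow> \<exists>M. \<forall>y\<in>carrier_vec r. \<forall>h\<in>H0. \<forall>c\<in>C. s y = h * c \<longrightarrow> y \<in> box r M"
    and act0: "\<And>a. a \<in> carrier A \<Longrightarrow> act \<sigma>0 (1\<^sub>m n) a = a" "\<And>h. h \<in> H0 \<Longrightarrow> act \<sigma>0 h \<zero>\<^bsub>A\<^esub> = \<zero>\<^bsub>A\<^esub>"
  shows "rep_iso (carrier (GL n)) (cind n H \<sigma>) (cind n H0 \<sigma>0)"
proof -
  let ?G = "carrier (GL n) :: 'f mat set" and ?V = "carrier_vec r :: 'f vec set"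
  note th_closed = theta_closed[OF A B] and th_inj = theta_inj[OF A B]
  have HG: "h \<in> ?G" if "h \<in> H" for h using that H by blast
  have H0G: "h \<in> ?G" if "h \<in> H0" for h using that H H0 by blast
  have sG: "s y \<in> ?G" if "y \<in> ?V" for y using s(1)[OF that] H by blast
  have z: "0\<^sub>v r \<in> ?V" by simp
  \<comment> \<open>\<open>I\<close> with h = s y, base point 0 and h0 = 1: evaluation at y is
    evaluation at 0 after acting by s y.\<close>
  have th_s: "theta A (act \<sigma> (s y) P) (0\<^sub>v r) = theta A P y" if "y \<in> ?V" "P \<in> carrier (tensor A B)" for y P
    using I[OF s(1)[OF that(1)] z H0(2) that(1) _ that(2)] s(3) sG[OF that(1)] act0(1)[OF th_closed] by simp
  have th_h: "theta A (act \<sigma> h P) (0\<^sub>v r) = act \<sigma>0 h (theta A P (0\<^sub>v r))" if "h \<in> H0" "P \<in> carrier (tensor A B)" for h P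
    using I[OF _ z that(1) z _ that(2), of h] H0 that s(3) H0G[OF that(1)] by auto
  \<comment> \<open>\<open>U\<close> evaluates at the base point. \<open>W\<close> chooses the
    tensor whose associated function is y \<mapsto> F(s y g); it is unique by
    \<open>theta_inj\<close>.\<close>
  define U where "U f = (\<lambda>g\<in>?G. theta A (f g) (0\<^sub>v r))" for f :: "'f mat \<Rightarrow> ('a \<times> ('f vec \<Rightarrow> complex)) multiset set"
  define W where "W F = (\<lambda>g\<in>?G. SOME P. P \<in> carrier (tensor A B) \<and> (\<forall>y\<in>?V. theta A P y = F (s y * g)))" for F :: "'f mat \<Rightarrow> 'a"
  have fs: "theta A (f (s y * g)) (0\<^sub>v r) = theta A (f g) y"
    if f: "f \<in> carrier (cind n H \<sigma>)" and "g \<in> ?G" "y \<in> ?V" for f g y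
    using th_s[OF that(3), of "f g"] cind_carrierD(1,3)[OF f] that s(1) \<sigma>(1) by metis
  have U: "U f \<in> carrier (cind n H0 \<sigma>0)" if f: "f \<in> carrier (cind n H \<sigma>)" for f
  proof -
    note D = cind_carrierD[OF f, unfolded \<sigma>]
    obtain K where K: "subgroup K (GL n)" "openin (GL_top n) K" "\<And>g k. g \<in> ?G \<Longrightarrow> k \<in> K \<Longrightarrow> f (g * k) = f g"
      using D(4) by blast
    obtain C where C: "compactin (GL_top n) C" "\<And>g. g \<in> ?G \<Longrightarrow> f g \<noteq> \<zero>\<^bsub>tensor A B\<^esub> \<Longrightarrow> \<exists>h\<in>H. \<exists>c\<in>C. g = h * c"
      using D(5) by blast
    have KG: "k \<in> ?G" if "k \<in> K" for k using K(1) that subgroup.mem_carrier by metis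
    have CG: "c \<in> ?G" if "c \<in> C" for c using compactin_GL_carrier[OF C(1) that] .
    \<comment> \<open>Only finitely many tensors occur on C, so a single bound N contains the
      supports of all their associated functions.\<close>
    have fin: "finite (f ` C)" by (rule compactin_finite_image[OF C(1) K(1,2)]) (rule K(3))
    have "\<forall>P\<in>f ` C. \<exists>M. supported r M \<zero>\<^bsub>A\<^esub> (theta A P)"
      using theta_lc[OF A B] D(1) CG by blast
    then obtain M where M: "\<And>P. P \<in> f ` C \<Longrightarrow> supported r (M P) \<zero>\<^bsub>A\<^esub> (theta A P)" by metis
    define N where "N = Max (insert 0 (M ` f ` C))"
    have N: "supported r N \<zero>\<^bsub>A\<^esub> (theta A (f c))" if "c \<in> C" for c
    proof (rule supported_mono[OF M[OF imageI[OF that]]])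
      show "M (f c) \<le> N" unfolding N_def using fin that by (intro Max_ge) auto
    qed
    \<comment> \<open>A compact set supporting \<open>U f\<close> modulo H0: the directions of H not
      in H0 contribute only the image of a box under s.\<close>
    let ?C = "{a * b | a b. a \<in> s ` box r N \<and> b \<in> C}"
    have C': "compactin (GL_top n) ?C"
      by (rule compactin_GL_mult[OF image_compactin[OF compactin_box s(2)] C(1)])
    show ?thesis
    proof (rule cind_carrierI[OF _ _ _ K(1,2) _ C'])
      show "U f g \<in> carrier \<sigma>0" if "g \<in> ?G" for g using that th_closed \<sigma>0 by (simp add: U_def)
      show "U f (h * g) = act \<sigma>0 h (U f g)" if "h \<in> H0" "g \<in> ?G" for h g
      proof -
        have "h \<in> H" using that(1) H0 by blast
        then have "f (h * g) = act \<sigma> h (f g)" using D(3) that(2) by blast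
        then show ?thesis using th_h[OF that(1) D(1)[OF that(2)]] that H0G[OF that(1)] by (simp add: U_def GL_mult_closed)
      qed
      show "U f (g * k) = U f g" if "g \<in> ?G" "k \<in> K" for g k
        using K(3)[OF that] that KG by (simp add: U_def GL_mult_closed)
      show "\<exists>h\<in>H0. \<exists>c\<in>?C. g = h * c" if g: "g \<in> ?G" and nz: "U f g \<noteq> \<zero>\<^bsub>\<sigma>0\<^esub>" for g
      proof -
        have "f g \<noteq> \<zero>\<^bsub>tensor A B\<^esub>"
        proof
          assume "f g = \<zero>\<^bsub>tensor A B\<^esub>"
          then have "theta A (f g) (0\<^sub>v r) = \<zero>\<^bsub>A\<^esub>"
            using theta_cls[OF A B _ z, of "{#}"] by (simp add: tensor_zero eval_sum_empty[OF A])
          then show False using nz g \<sigma>0 by (simp add: U_def)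
        qed
        then obtain h c where hc: "h \<in> H" "c \<in> C" "g = h * c" using C(2)[OF g] by blast
        obtain h0 y where hy: "h0 \<in> H0" "y \<in> ?V" "s (0\<^sub>v r) * h = h0 * s y" using E[OF hc(1) z] by blast
        have h: "h = h0 * s y" using hy(3) s(3) HG[OF hc(1)] by simp
        have cG: "c \<in> ?G" using CG[OF hc(2)] .
        have "theta A (f g) (0\<^sub>v r) = act \<sigma>0 h0 (theta A (f c) y)"
          using I[OF hc(1) z hy(1,2,3) D(1)[OF cG]] D(3)[OF hc(1) cG] hc(3) by simp
        then have "theta A (f c) y \<noteq> \<zero>\<^bsub>A\<^esub>" using nz g act0(2)[OF hy(1)] \<sigma>0 by (auto simp: U_def)
        then have "y \<in> box r N" using N[OF hc(2)] hy(2) unfolding supported_def by blast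
        then have "s y * c \<in> ?C" using hc(2) by blast
        moreover have "g = h0 * (s y * c)" using hc(3) h GL_assoc[OF H0G[OF hy(1)] sG[OF hy(2)] cG] by simp
        ultimately show ?thesis using hy(1) by blast
      qed
    qed (simp add: U_def)
  qed
  have W: "W F \<in> carrier (cind n H \<sigma>)" and Wth: "\<And>g y. g \<in> ?G \<Longrightarrow> y \<in> ?V \<Longrightarrow> theta A (W F g) y = F (s y * g)"
    if F: "F \<in> carrier (cind n H0 \<sigma>0)" for F
  proof -
    note D = cind_carrierD[OF F, unfolded \<sigma>0]
    obtain K where K: "subgroup K (GL n)" "openin (GL_top n) K" "\<And>g k. g \<in> ?G \<Longrightarrow> k \<in> K \<Longrightarrow> F (g * k) = F g"
      using D(4) by blast
    obtain C where C: "compactin (GL_top n) C" "\<And>g. g \<in> ?G \<Longrightarrow> F g \<noteq> \<zero>\<^bsub>A\<^esub> \<Longrightarrow> \<exists>h\<in>H0. \<exists>c\<in>C. g = h * c"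
      using D(5) by blast
    have KG: "k \<in> ?G" if "k \<in> K" for k using K(1) that subgroup.mem_carrier by metis
    have CG: "c \<in> ?G" if "c \<in> C" for c using compactin_GL_carrier[OF C(1) that] .
    have ex: "\<exists>P. P \<in> carrier (tensor A B) \<and> (\<forall>y\<in>?V. theta A P y = F (s y * g))" if g: "g \<in> ?G" for g
    proof -
      let ?\<Phi> = "\<lambda>y. F (s y * g)"
      have gi: "inv\<^bsub>GL n\<^esub> g \<in> ?G" using g by blast
      obtain M where M: "\<forall>y\<in>?V. \<forall>h\<in>H0. \<forall>c\<in>(\<lambda>c. 1\<^sub>m n * c * inv\<^bsub>GL n\<^esub> g) ` C. s y = h * c \<longrightarrow> y \<in> box r M"
        using Pr[OF compactin_GL_translate[OF C(1) GL_one_closed gi]] by blast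
      \<comment> \<open>Translating C by the inverse of g turns a nonzero value at s y g into a
        factorisation of s y itself, to which properness applies.\<close>
      have sup: "supported r M \<zero>\<^bsub>A\<^esub> ?\<Phi>" unfolding supported_def
      proof (intro ballI impI)
        fix y assume y: "y \<in> ?V" and nz: "F (s y * g) \<noteq> \<zero>\<^bsub>A\<^esub>"
        obtain h c where hc: "h \<in> H0" "c \<in> C" "s y * g = h * c" using C(2)[OF GL_mult_closed[OF sG[OF y] g] nz] by blast
        have "s y = s y * g * inv\<^bsub>GL n\<^esub> g" using sG[OF y] g by (simp add: GL_inv_cancel)
        also have "\<dots> = h * (1\<^sub>m n * c * inv\<^bsub>GL n\<^esub> g)"
          unfolding hc(3) using H0G[OF hc(1)] CG[OF hc(2)] gi by (simp add: GL_assoc)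
        finally show "y \<in> box r M" using M y hc by blast
      qed
      \<comment> \<open>By continuity of s, for y' near y the matrix s y' g differs from s y g by a
        right factor in the invariance group K.\<close>
      have "\<exists>\<rho>>0. \<forall>d\<in>box r \<rho>. ?\<Phi> (y + d) = ?\<Phi> y" if y: "y \<in> ?V" for y
      proof -
        let ?a = "inv\<^bsub>GL n\<^esub> (s y * g)"
        have syg: "s y * g \<in> ?G" using sG[OF y] g by blast
        have a: "?a \<in> ?G" using syg by blast
        have "continuous_map (vec_top r) (GL_top n) ((\<lambda>x. ?a * x * g) \<circ> s)"
          by (rule continuous_map_compose[OF s(2) continuous_map_GL_translate[OF a g]])
        then have "openin (vec_top r) {y' \<in> ?V. ?a * s y' * g \<in> K}"
          using openin_continuous_map_preimage[OF _ K(2)] by fastforce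
        moreover have "y \<in> {y' \<in> ?V. ?a * s y' * g \<in> K}"
          using y subgroup.one_closed[OF K(1)] GL_assoc[OF a sG[OF y] g] GL_l_inv[OF syg] by simp
        ultimately obtain \<rho> where \<rho>: "\<rho> > 0" "\<And>d. d \<in> box r \<rho> \<Longrightarrow> y + d \<in> {y' \<in> ?V. ?a * s y' * g \<in> K}"
          unfolding openin_vec_top by blast
        have "?\<Phi> (y + d) = ?\<Phi> y" if "d \<in> box r \<rho>" for d
        proof -
          have yd: "y + d \<in> ?V" "?a * s (y + d) * g \<in> K" using \<rho>(2)[OF that] by auto
          have "s (y + d) * g = (s y * g) * (?a * s (y + d) * g)"
            using GL_inv_cancel(2)[OF syg GL_mult_closed[OF sG[OF yd(1)] g]] GL_assoc[OF a sG[OF yd(1)] g] by simp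
          then show ?thesis using K(3)[OF syg yd(2)] by simp
        qed
        then show ?thesis using \<rho>(1) by blast
      qed
      then obtain \<rho> where \<rho>: "0 < \<rho>" "loc_const r \<rho> ?\<Phi>" using loc_const_uniform[OF _ sup] by blast
      have "?\<Phi> y \<in> carrier A" if "y \<in> ?V" for y using D(1) sG[OF that] g by blast
      from theta_surj[OF A B this \<rho> sup] show ?thesis by blast
    qed
    have Wg: "W F g \<in> carrier (tensor A B)" "\<And>y. y \<in> ?V \<Longrightarrow> theta A (W F g) y = F (s y * g)" if g: "g \<in> ?G" for g
      using someI_ex[OF ex[OF g]] g by (auto simp: W_def)
    then show "\<And>g y. g \<in> ?G \<Longrightarrow> y \<in> ?V \<Longrightarrow> theta A (W F g) y = F (s y * g)" by blast
    show "W F \<in> carrier (cind n H \<sigma>)"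
    proof (rule cind_carrierI[OF _ _ _ K(1,2) _ C(1)])
      show "W F g \<in> carrier \<sigma>" if "g \<in> ?G" for g using Wg(1)[OF that] \<sigma> by simp
      show "W F (h * g) = act \<sigma> h (W F g)" if h: "h \<in> H" and g: "g \<in> ?G" for h g
      proof (rule th_inj)
        have hG: "h \<in> ?G" using HG[OF h] .
        show "W F (h * g) \<in> carrier (tensor A B)" using Wg(1)[OF GL_mult_closed[OF hG g]] .
        show "act \<sigma> h (W F g) \<in> carrier (tensor A B)" using cl[OF h Wg(1)[OF g]] .
        fix y assume y: "y \<in> ?V"
        obtain h0 y' where hy: "h0 \<in> H0" "y' \<in> ?V" "s y * h = h0 * s y'" using E[OF h y] by blast
        have "s y * (h * g) = h0 * (s y' * g)"
          using GL_assoc[OF sG[OF y] hG g] GL_assoc[OF H0G[OF hy(1)] sG[OF hy(2)] g] hy(3) by simp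
        then have "theta A (W F (h * g)) y = act \<sigma>0 h0 (F (s y' * g))"
          using Wg(2)[OF GL_mult_closed[OF hG g] y] D(3)[OF hy(1) GL_mult_closed[OF sG[OF hy(2)] g]] by simp
        also have "\<dots> = theta A (act \<sigma> h (W F g)) y"
          using I[OF h y hy Wg(1)[OF g]] Wg(2)[OF g hy(2)] by simp
        finally show "theta A (W F (h * g)) y = theta A (act \<sigma> h (W F g)) y" .
      qed
      show "W F (g * k) = W F g" if g: "g \<in> ?G" and k: "k \<in> K" for g k
      proof (rule th_inj)
        have gk: "g * k \<in> ?G" using g KG[OF k] by blast
        show "W F (g * k) \<in> carrier (tensor A B)" "W F g \<in> carrier (tensor A B)" using Wg(1) g gk by blast+
        fix y assume y: "y \<in> ?V"
        show "theta A (W F (g * k)) y = theta A (W F g) y"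
          using Wg(2)[OF gk y] Wg(2)[OF g y] GL_assoc[OF sG[OF y] g KG[OF k]] K(3)[OF GL_mult_closed[OF sG[OF y] g] k] by simp
      qed
      show "\<exists>h\<in>H. \<exists>c\<in>C. g = h * c" if g: "g \<in> ?G" and nz: "W F g \<noteq> \<zero>\<^bsub>\<sigma>\<^esub>" for g
      proof -
        have "\<exists>y\<in>?V. F (s y * g) \<noteq> \<zero>\<^bsub>A\<^esub>"
        proof (rule ccontr)
          assume no: "\<not> ?thesis"
          have "W F g = \<zero>\<^bsub>tensor A B\<^esub>"
          proof (rule th_inj[OF Wg(1)[OF g]])
            show "\<zero>\<^bsub>tensor A B\<^esub> \<in> carrier (tensor A B)" by (auto simp: tensor_zero tensor_carrier)
            fix y assume y: "y \<in> ?V"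
            have "theta A \<zero>\<^bsub>tensor A B\<^esub> y = \<zero>\<^bsub>A\<^esub>"
              using theta_cls[OF A B _ y, of "{#}"] by (simp add: tensor_zero eval_sum_empty[OF A])
            then show "theta A (W F g) y = theta A \<zero>\<^bsub>tensor A B\<^esub> y" using Wg(2)[OF g y] no y by simp
          qed
          then show False using nz \<sigma> by simp
        qed
        then obtain y where y: "y \<in> ?V" "F (s y * g) \<noteq> \<zero>\<^bsub>A\<^esub>" by blast
        obtain h c where hc: "h \<in> H0" "c \<in> C" "s y * g = h * c" using C(2)[OF GL_mult_closed[OF sG[OF y(1)] g] y(2)] by blast
        have si: "inv\<^bsub>GL n\<^esub> (s y) \<in> ?G" using sG[OF y(1)] by blast
        have "g = inv\<^bsub>GL n\<^esub> (s y) * (s y * g)" using sG[OF y(1)] g by (simp add: GL_inv_cancel)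
        also have "\<dots> = inv\<^bsub>GL n\<^esub> (s y) * h * c" unfolding hc(3) using GL_assoc[OF si H0G[OF hc(1)] CG[OF hc(2)]] by simp
        finally show ?thesis using Q[OF y(1) hc(1)] hc(2) by blast
      qed
    qed (simp add: W_def)
  qed
  have "U \<in> module_hom class_ring (cind n H \<sigma>) (cind n H0 \<sigma>0)"
    unfolding module_hom_def
  proof (intro CollectI conjI allI impI)
    show "U \<in> carrier (cind n H \<sigma>) \<rightarrow> carrier (cind n H0 \<sigma>0)" using U by blast
    fix f f' assume "f \<in> carrier (cind n H \<sigma>) \<and> f' \<in> carrier (cind n H \<sigma>)"
    then have "f g \<in> carrier (tensor A B)" "f' g \<in> carrier (tensor A B)" if "g \<in> ?G" for g
      using cind_carrierD(1) that \<sigma>(1) by blast+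
    then show "U (f \<oplus>\<^bsub>cind n H \<sigma>\<^esub> f') = U f \<oplus>\<^bsub>cind n H0 \<sigma>0\<^esub> U f'"
      using theta_add[OF A B _ _ z] \<sigma> \<sigma>0 by (auto simp: U_def cind_simps fun_eq_iff)
  next
    fix c f assume "c \<in> carrier (class_ring :: complex ring) \<and> f \<in> carrier (cind n H \<sigma>)"
    then have "f g \<in> carrier (tensor A B)" if "g \<in> ?G" for g using cind_carrierD(1) that \<sigma>(1) by blast
    then show "U (c \<odot>\<^bsub>cind n H \<sigma>\<^esub> f) = c \<odot>\<^bsub>cind n H0 \<sigma>0\<^esub> U f"
      using theta_smult[OF A B _ z] \<sigma> \<sigma>0 by (auto simp: U_def cind_simps fun_eq_iff)
  qed
  moreover have "bij_betw U (carrier (cind n H \<sigma>)) (carrier (cind n H0 \<sigma>0))"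
  proof (rule bij_betwI')
    fix f f' assume f: "f \<in> carrier (cind n H \<sigma>)" and f': "f' \<in> carrier (cind n H \<sigma>)"
    show "U f = U f' \<longleftrightarrow> f = f'"
    proof
      assume eq: "U f = U f'"
      show "f = f'"
      proof (rule extensionalityI[OF cind_carrierD(2)[OF f] cind_carrierD(2)[OF f']])
        fix g assume g: "g \<in> ?G"
        show "f g = f' g"
        proof (rule th_inj)
          show "f g \<in> carrier (tensor A B)" "f' g \<in> carrier (tensor A B)"
            using cind_carrierD(1)[OF f g] cind_carrierD(1)[OF f' g] \<sigma>(1) by auto
          fix y assume y: "y \<in> ?V"
          show "theta A (f g) y = theta A (f' g) y"
            using fs[OF f g y] fs[OF f' g y] fun_cong[OF eq, of "s y * g"] GL_mult_closed[OF sG[OF y] g] by (simp add: U_def)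
        qed
      qed
    qed simp
  next
    fix F assume F: "F \<in> carrier (cind n H0 \<sigma>0)"
    have "F = U (W F)"
      by (rule extensionalityI[OF cind_carrierD(2)[OF F]])
        (use Wth[OF F _ z] s(3) in \<open>auto simp: U_def\<close>)
    then show "\<exists>f\<in>carrier (cind n H \<sigma>). F = U f" using W[OF F] by blast
  qed (rule U)
  moreover have "U (act (cind n H \<sigma>) x f) = act (cind n H0 \<sigma>0) x (U f)" if "x \<in> ?G" for x f
    using that by (auto simp: U_def cind_simps fun_eq_iff GL_mult_closed)
  ultimately show ?thesis unfolding rep_iso_def by blast
qed

section \<open>Non-degenerate characters of the unipotent upper triangular group\<close>

section \<open>Unipotent characters and block triangular groups\<close>

lemma unip_addrow_mat: "i < j \<Longrightarrow> j < k \<Longrightarrow> addrow_mat k a i j \<in> unip k" for a :: "'f::field"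
  by (auto simp: unip_def upper_triangular_def)

lemma unip_carrier: "u \<in> unip k \<Longrightarrow> u \<in> carrier_mat k k"
  by (simp add: unip_def)

lemma addrow_mat_add:
  fixes a b :: "'f::field"
  assumes "i < j" "j < k"
  shows "addrow_mat k a i j * addrow_mat k b i j = addrow_mat k (a + b) i j"
proof -
  have "addrow_mat k a i j * addrow_mat k b i j = addrow a i j (addrow_mat k b i j)"
    by (rule addrow_mat[symmetric, of _ k k]) (use assms in auto)
  also have "\<dots> = addrow_mat k (a + b) i j" using assms by (intro eq_matI) auto
  finally show ?thesis .
qed

text \<open>The commutator relation between the root subgroups at (i, l) and (l, j), written without
  inverses.\<close>

lemma addrow_mat_commutator:
  fixes a :: "'f::field"
  assumes "i < l" "l < j" "j < k"
  shows "addrow_mat k a i l * addrow_mat k 1 l j = addrow_mat k 1 l j * (addrow_mat k a i l * addrow_mat k a i j)"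
proof -
  have L: "addrow_mat k a i l * addrow_mat k 1 l j = addrow a i l (addrow_mat k 1 l j)"
    by (rule addrow_mat[symmetric, of _ k k]) (use assms in auto)
  have R1: "addrow_mat k a i l * addrow_mat k a i j = addrow a i l (addrow_mat k a i j)"
    by (rule addrow_mat[symmetric, of _ k k]) (use assms in auto)
  have R2: "addrow_mat k 1 l j * addrow a i l (addrow_mat k a i j) = addrow 1 l j (addrow a i l (addrow_mat k a i j))"
    by (rule addrow_mat[symmetric, of _ k k]) (use assms in auto)
  show ?thesis unfolding L R1 R2 using assms by (intro eq_matI) auto
qed

lemma addrow_mat_unip_continuous:
  fixes i j k :: nat
  assumes "i < j" "j < k"
  shows "continuous_map euclidean (GL_top k) (\<lambda>a::'f::nonarch_local_field. addrow_mat k a i j)"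
  unfolding continuous_map_GL_top
proof (intro conjI allI impI)
  show "(\<lambda>a::'f. addrow_mat k a i j) \<in> topspace euclidean \<rightarrow> carrier (GL k)"
    using assms by (simp add: Pi_iff addrow_mat_GL)
  fix p q assume pq: "p < k" "q < k"
  show "continuous_map euclidean euclidean (\<lambda>a::'f. addrow_mat k a i j $$ (p, q))"
  proof (cases "p = i \<and> q = j")
    case True
    then have "(\<lambda>a::'f. addrow_mat k a i j $$ (p, q)) = (\<lambda>a. a)" using assms pq by (auto simp: fun_eq_iff)
    then show ?thesis by (simp add: continuous_on_id)
  next
    case False
    then have "(\<lambda>a::'f. addrow_mat k a i j $$ (p, q)) = (\<lambda>a. if p = q then 1 else 0)"
      using pq by (auto simp: fun_eq_iff)
    then show ?thesis by (simp add: continuous_on_const)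
  qed
qed

text \<open>The open kernel is pulled back along the continuous homomorphism from F onto the root
  subgroup.\<close>

lemma nondegenerate_char_simple_root:
  fixes \<phi> :: "'f::nonarch_local_field mat \<Rightarrow> complex"
  assumes \<phi>: "nondegenerate_char k \<phi>" and i: "Suc i < k"
  shows "nontrivial_add_char (\<lambda>a. \<phi> (addrow_mat k a i (Suc i)))"
proof -
  let ?E = "\<lambda>a::'f. addrow_mat k a i (Suc i)"
  have u: "?E a \<in> unip k" for a using unip_addrow_mat[of i "Suc i" k a] i by simp
  have op: "openin (subtopology (GL_top k) (unip k)) {u \<in> unip k. \<phi> u = 1}"
    and mult: "\<forall>u\<in>unip k. \<forall>v\<in>unip k. \<phi> (u * v) = \<phi> u * \<phi> v" and nz: "\<forall>u\<in>unip k. \<phi> u \<noteq> 0"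
    and nd: "\<exists>a. \<phi> (?E a) \<noteq> 1"
    using \<phi> i unfolding nondegenerate_char_def by blast+
  obtain W where W: "openin (GL_top k) W" "{u \<in> unip k. \<phi> u = 1} = W \<inter> unip k"
    using op unfolding openin_subtopology by blast
  have "openin euclidean {a \<in> topspace euclidean. ?E a \<in> W}"
    by (rule openin_continuous_map_preimage[OF addrow_mat_unip_continuous W(1)]) (use i in auto)
  moreover have "{a \<in> topspace euclidean. ?E a \<in> W} = {a. \<phi> (?E a) = 1}" using W(2) u by auto
  ultimately have "open {a. \<phi> (?E a) = 1}" by simp
  moreover have "\<phi> (?E (a + b)) = \<phi> (?E a) * \<phi> (?E b)" for a b
    using mult u addrow_mat_add[of i "Suc i" k a b] i by (metis lessI)
  ultimately show ?thesis using nz u nd unfolding nontrivial_add_char_def by blast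
qed

text \<open>Elements of a nonsimple root subgroup are commutators, and a homomorphism to the nonzero
  complex numbers is trivial on these.\<close>

lemma unip_char_nonsimple_root:
  fixes \<phi> :: "'f::nonarch_local_field mat \<Rightarrow> complex"
  assumes \<phi>: "nondegenerate_char k \<phi>" and ij: "Suc i < j" "j < k"
  shows "\<phi> (addrow_mat k a i j) = 1"
proof -
  have mult: "\<forall>u\<in>unip k. \<forall>v\<in>unip k. \<phi> (u * v) = \<phi> u * \<phi> v" and nz: "\<forall>u\<in>unip k. \<phi> u \<noteq> 0"
    using \<phi> unfolding nondegenerate_char_def by blast+
  let ?X = "addrow_mat k a i (Suc i)" and ?Y = "addrow_mat k 1 (Suc i) j" and ?Z = "addrow_mat k a i j"
  have u: "?X \<in> unip k" "?Y \<in> unip k" "?Z \<in> unip k" using ij by (auto intro!: unip_addrow_mat)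
  have XZ: "?X * ?Z \<in> unip k"
  proof -
    have e: "?X * ?Z = addrow a i (Suc i) ?Z" by (rule addrow_mat[symmetric, of _ k k]) (use ij in auto)
    show ?thesis unfolding e using ij by (auto simp: unip_def upper_triangular_def)
  qed
  have "\<phi> ?X * \<phi> ?Y = \<phi> ?Y * (\<phi> ?X * \<phi> ?Z)"
    using addrow_mat_commutator[of i "Suc i" j k a] ij mult u XZ by (metis lessI)
  then show ?thesis using nz u by auto
qed

text \<open>By self-duality of F each simple root subgroup contributes \<open>lam (c * a)\<close>
  with nonzero c; nonsimple roots contribute nothing. A unipotent matrix is reduced to the identity
  by removing its entries above the diagonal one at a time, which is a product decomposition into
  root elements.\<close>

lemma unip_char_formula:
  fixes \<phi> :: "'f::nonarch_local_field mat \<Rightarrow> complex"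
  assumes \<phi>: "nondegenerate_char k \<phi>" and lam: "nontrivial_add_char lam"
  shows "\<exists>c. (\<forall>i. Suc i < k \<longrightarrow> c i \<noteq> 0) \<and>
    (\<forall>u\<in>unip k. \<phi> u = lam (\<Sum>i<k - 1. c i * u $$ (i, Suc i)))"
proof -
  have ac: "add_char lam" using lam by (simp add: nontrivial_add_char_iff)
  have mult: "\<forall>u\<in>unip k. \<forall>v\<in>unip k. \<phi> (u * v) = \<phi> u * \<phi> v" and nz: "\<forall>u\<in>unip k. \<phi> u \<noteq> 0"
    using \<phi> unfolding nondegenerate_char_def by blast+
  have "\<exists>c. \<forall>a. \<phi> (addrow_mat k a i (Suc i)) = lam (c * a)" if "Suc i < k" for i
    using add_char_self_dual[OF lam] nondegenerate_char_simple_root[OF \<phi> that]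
    unfolding nontrivial_add_char_iff by blast
  then obtain c where c: "\<And>i a. Suc i < k \<Longrightarrow> \<phi> (addrow_mat k a i (Suc i)) = lam (c i * a)" by metis
  have c0: "c i \<noteq> 0" if i: "Suc i < k" for i
  proof
    assume "c i = 0"
    then have "\<phi> (addrow_mat k a i (Suc i)) = 1" for a using c[OF i] add_char_0[OF ac] by simp
    then show False using nondegenerate_char_simple_root[OF \<phi> i] by (simp add: nontrivial_add_char_iff)
  qed
  have "\<phi> u = lam (\<Sum>i<k - 1. c i * u $$ (i, Suc i))" if "u \<in> unip k" for u
    using that
  proof (induction "card {(i, j). i < j \<and> j < k \<and> u $$ (i, j) \<noteq> 0}" arbitrary: u rule: less_induct)
    case less
    let ?N = "\<lambda>u::'f mat. {(i, j). i < j \<and> j < k \<and> u $$ (i, j) \<noteq> 0}"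
    have fin: "finite (?N u)" for u :: "'f mat" by (rule finite_subset[of _ "{..<k} \<times> {..<k}"]) auto
    have uc: "u \<in> carrier_mat k k" "\<And>i j. i < k \<Longrightarrow> j < i \<Longrightarrow> u $$ (i, j) = 0" "\<And>i. i < k \<Longrightarrow> u $$ (i, i) = 1"
      using less.prems by (auto simp: unip_def upper_triangular_def)
    show ?case
    proof (cases "?N u = {}")
      case True
      then have "u = 1\<^sub>m k" using uc by (intro eq_matI) (auto, metis linorder_neqE_nat)
      moreover have "\<phi> (1\<^sub>m k) = 1"
      proof -
        have 1: "1\<^sub>m k \<in> unip k" by (auto simp: unip_def upper_triangular_def)
        then have "\<phi> (1\<^sub>m k * 1\<^sub>m k) = \<phi> (1\<^sub>m k) * \<phi> (1\<^sub>m k)" using mult by blast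
        then show ?thesis using nz 1 by auto
      qed
      ultimately show ?thesis using add_char_0[OF ac] by simp
    next
      case False
      \<comment> \<open>The lowest row with a nonzero entry above the diagonal. All rows below it
        are rows of the identity, so subtracting a multiple of row j changes the entry (i, j)
        only.\<close>
      define i where "i = Max (fst ` ?N u)"
      have "i \<in> fst ` ?N u" unfolding i_def using fin False by (intro Max_in) auto
      then obtain j where ij: "i < j" "j < k" "u $$ (i, j) \<noteq> 0" by auto
      have below: "u $$ (p, q) = (if p = q then 1 else 0)" if "i < p" "p < k" "q < k" for p q
      proof -
        have "u $$ (p, q) = 0" if "p < q"
        proof (rule ccontr)
          assume "u $$ (p, q) \<noteq> 0"
          then have "p \<in> fst ` ?N u" using that \<open>q < k\<close> by force
          then have "p \<le> i" unfolding i_def using fin by (intro Max_ge) auto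
          then show False using \<open>i < p\<close> by simp
        qed
        then show ?thesis using uc(2,3) that by (cases p q rule: linorder_cases) auto
      qed
      let ?a = "u $$ (i, j)"
      let ?v = "addrow (- ?a) i j u"
      have v: "?v $$ (p, q) = (if p = i \<and> q = j then 0 else u $$ (p, q))" if "p < k" "q < k" for p q
        using that uc(1) ij below[of j q] by auto
      have vu: "?v \<in> unip k" using less.prems ij v uc unfolding unip_def upper_triangular_def by auto
      have "u = addrow ?a i j ?v" using uc(1) ij below[of j] v by (intro eq_matI) auto
      also have "\<dots> = addrow_mat k ?a i j * ?v" by (rule addrow_mat[of _ k k]) (use uc(1) ij in auto)
      finally have \<phi>u: "\<phi> u = \<phi> (addrow_mat k ?a i j) * \<phi> ?v"
        using mult unip_addrow_mat[OF ij(1,2), of ?a] vu by metis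
      have "?N ?v = ?N u - {(i, j)}" using v ij by (auto split: if_splits)
      moreover have "(i, j) \<in> ?N u" using ij by simp
      then have "card (?N u - {(i, j)}) < card (?N u)" by (rule card_Diff1_less[OF fin])
      ultimately have "card (?N ?v) < card (?N u)" by (simp only:)
      from less.hyps[OF this vu] have IH: "\<phi> ?v = lam (\<Sum>i<k - 1. c i * ?v $$ (i, Suc i))" .
      show ?thesis
      proof (cases "j = Suc i")
        case True
        have "(\<Sum>p<k - 1. c p * u $$ (p, Suc p)) = (\<Sum>p<k - 1. (if p = i then c i * ?a else 0) + c p * ?v $$ (p, Suc p))"
          using v True by (intro sum.cong HOL.refl) auto
        also have "\<dots> = c i * ?a + (\<Sum>p<k - 1. c p * ?v $$ (p, Suc p))"
          using ij True by (simp add: sum.distrib)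
        finally show ?thesis using \<phi>u IH c[of i ?a] ij True add_charD(1)[OF ac] by simp
      next
        case False
        have "(\<Sum>p<k - 1. c p * u $$ (p, Suc p)) = (\<Sum>p<k - 1. c p * ?v $$ (p, Suc p))"
          using v False by (intro sum.cong HOL.refl) auto
        then show ?thesis using \<phi>u IH unip_char_nonsimple_root[OF \<phi>, of i j ?a] ij False by simp
      qed
    qed
  qed
  then show ?thesis by (intro exI[of _ c]) (use c0 in auto)
qed

section \<open>Block triangular groups with one GL_r block\<close>

lemma block_index [simp]:
  "i < p \<Longrightarrow> j < q \<Longrightarrow> block A i0 j0 p q $$ (i, j) = A $$ (i0 + i, j0 + j)"
  "dim_row (block A i0 j0 p q) = p" "dim_col (block A i0 j0 p q) = q" "block A i0 j0 p q \<in> carrier_mat p q"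
  by (auto simp: block_def)

lemma block_upper_index:
  fixes u1 :: "'f::field mat"
  assumes "u1 \<in> carrier_mat p p" "x \<in> carrier_mat p q" "y \<in> carrier_mat p s" "h \<in> carrier_mat q q"
    "z \<in> carrier_mat q s" "u2 \<in> carrier_mat s s" and ij: "i < p + q + s" "j < p + q + s"
  shows "block_upper u1 x y h z u2 $$ (i, j) =
    (if i < p then if j < p then u1 $$ (i, j) else if j < p + q then x $$ (i, j - p) else y $$ (i, j - (p + q))
     else if i < p + q then if j < p then 0 else if j < p + q then h $$ (i - p, j - p) else z $$ (i - p, j - (p + q))
     else if j < p + q then 0 else u2 $$ (i - (p + q), j - (p + q)))"
    "block_upper u1 x y h z u2 \<in> carrier_mat (p + q + s) (p + q + s)"
  using assms by (auto simp: block_upper_def append_rows_def)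

text \<open>Block upper triangular matrices that are unipotent upper triangular apart from a GL_r
  block at the indices m, ..., m + r - 1. Described entrywise, it covers \<open>HJ\<close> and
  \<open>HF\<close> and contains \<open>HB\<close>, so that all of them share the same
  calculations.\<close>

definition levi_stab :: "nat \<Rightarrow> nat \<Rightarrow> nat \<Rightarrow> 'f::field mat set" where
  "levi_stab m r n = {A \<in> carrier_mat n n.
     (\<forall>i<n. \<forall>j<n. \<not> (i \<in> {m..<m + r} \<and> j \<in> {m..<m + r}) \<longrightarrow>
        (j < i \<longrightarrow> A $$ (i, j) = 0) \<and> (i = j \<longrightarrow> A $$ (i, j) = 1)) \<and>
     block A m m r r \<in> carrier (GL r)}"

lemma levi_stabD:
  assumes "A \<in> levi_stab m r n"
  shows "A \<in> carrier_mat n n" "block A m m r r \<in> carrier (GL r)"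
    "i < n \<Longrightarrow> j < i \<Longrightarrow> \<not> (i \<in> {m..<m + r} \<and> j \<in> {m..<m + r}) \<Longrightarrow> A $$ (i, j) = 0"
    "i < n \<Longrightarrow> i \<notin> {m..<m + r} \<Longrightarrow> A $$ (i, i) = 1"
  using assms unfolding levi_stab_def by auto

lemma levi_stabI:
  assumes "A \<in> carrier_mat n n" "block A m m r r \<in> carrier (GL r)"
    "\<And>i j. i < n \<Longrightarrow> j < i \<Longrightarrow> \<not> (i \<in> {m..<m + r} \<and> j \<in> {m..<m + r}) \<Longrightarrow> A $$ (i, j) = 0"
    "\<And>i. i < n \<Longrightarrow> i \<notin> {m..<m + r} \<Longrightarrow> A $$ (i, i) = 1"
  shows "A \<in> levi_stab m r n"
  using assms unfolding levi_stab_def by auto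

lemma block_unip:
  assumes A: "A \<in> levi_stab m r n" and d: "k + p \<le> m \<or> m + r \<le> k" "k + p \<le> n"
  shows "block A k k p p \<in> unip p"
  unfolding unip_def upper_triangular_def using levi_stabD(3,4)[OF A] d by auto

lemma block_decomposition:
  fixes A :: "'f::field mat"
  assumes A: "A \<in> carrier_mat (p + q + s) (p + q + s)"
    and z: "\<And>i j. i < p + q + s \<Longrightarrow> j < p + q + s \<Longrightarrow> p \<le> i \<Longrightarrow> j < p \<or> (p + q \<le> i \<and> j < p + q) \<Longrightarrow> A $$ (i, j) = 0"
  shows "A = block_upper (block A 0 0 p p) (block A 0 p p q) (block A 0 (p + q) p s) (block A p p q q)
    (block A p (p + q) q s) (block A (p + q) (p + q) s s)"
    (is "A = ?B")
proof (rule eq_matI)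
  have B: "?B \<in> carrier_mat (p + q + s) (p + q + s)"
    using block_upper_index(2)[of "block A 0 0 p p" p "block A 0 p p q" q "block A 0 (p + q) p s" s
      "block A p p q q" "block A p (p + q) q s" "block A (p + q) (p + q) s s" 0 0]
    by (auto simp: block_upper_def append_rows_def)
  show "dim_row A = dim_row ?B" "dim_col A = dim_col ?B" using A B by auto
  fix i j assume "i < dim_row ?B" "j < dim_col ?B"
  then have ij: "i < p + q + s" "j < p + q + s" using B by auto
  show "A $$ (i, j) = ?B $$ (i, j)"
    by (subst block_upper_index(1)[where p=p and q=q and s=s]) (use ij z in auto)
qed

lemma HJ_iff:
  "h \<in> HJ r \<longleftrightarrow> (h :: 'f::field mat) \<in> levi_stab 1 r (r + 2)"
proof
  assume "h \<in> HJ r"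
  then obtain w a g v where h: "h = block_upper (1\<^sub>m 1) w a g v (1\<^sub>m 1)" and
    d: "w \<in> carrier_mat 1 r" "a \<in> carrier_mat 1 1" "g \<in> carrier (GL r)" "v \<in> carrier_mat r 1"
    unfolding HJ_def by blast
  note ix = block_upper_index[where p=1 and q=r and s=1, OF _ d(1,2) GL_carrier_mat[OF d(3)] d(4), of "1\<^sub>m 1" "1\<^sub>m 1", folded h]
  have n: "1 + r + 1 = r + 2" by simp
  show "h \<in> levi_stab 1 r (r + 2)"
  proof (rule levi_stabI)
    show "h \<in> carrier_mat (r + 2) (r + 2)" using ix(2)[of 0 0] by (simp add: n)
    have "block h 1 1 r r = g" using GL_carrier_mat[OF d(3)] ix(1) by (intro eq_matI) auto
    then show "block h 1 1 r r \<in> carrier (GL r)" using d(3) by simp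
  qed (use ix(1) in auto)
next
  assume h: "h \<in> levi_stab 1 r (r + 2)"
  note D = levi_stabD[OF h]
  have u: "block h 0 0 1 1 = 1\<^sub>m 1" "block h (1 + r) (1 + r) 1 1 = 1\<^sub>m 1"
    using D(4)[of 0] D(4)[of "r + 1"] by (auto intro!: eq_matI)
  have "h = block_upper (block h 0 0 1 1) (block h 0 1 1 r) (block h 0 (1 + r) 1 1) (block h 1 1 r r)
    (block h 1 (1 + r) r 1) (block h (1 + r) (1 + r) 1 1)"
    by (rule block_decomposition) (use D(1,3) in auto)
  then show "h \<in> HJ r" unfolding HJ_def u using D(2) block_index(4) by blast
qed

text \<open>The first and last indices of the middle factor h have diagonal entry 1, so they enlarge
  the unipotent corners to sizes m1 and m2; what remains is the GL_r block starting at index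
  m1.\<close>

lemma HF_eq:
  assumes "1 \<le> m1" "1 \<le> m2"
  shows "HF m1 m2 r = (levi_stab m1 r (m1 + m2 + r) :: 'f::field mat set)"
proof (intro Set.equalityI subsetI)
  have n: "(m1 - 1) + (r + 2) + (m2 - 1) = m1 + m2 + r" using assms by simp
  fix A :: "'f mat" assume "A \<in> HF m1 m2 r"
  then obtain u1 x y h z u2 where A: "A = block_upper u1 x y h z u2" and
    d: "u1 \<in> unip (m1 - 1)" "u2 \<in> unip (m2 - 1)" "h \<in> HJ r" "x \<in> carrier_mat (m1 - 1) (r + 2)"
      "y \<in> carrier_mat (m1 - 1) (m2 - 1)" "z \<in> carrier_mat (r + 2) (m2 - 1)"
    unfolding HF_def by blast
  note J = levi_stabD[OF d(3)[unfolded HJ_iff]]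
  note ix = block_upper_index[OF unip_carrier[OF d(1)] d(4,5) J(1) d(6) unip_carrier[OF d(2)], folded A, unfolded n]
  have u: "\<And>i j. i < m1 - 1 \<Longrightarrow> j < i \<Longrightarrow> u1 $$ (i, j) = 0" "\<And>i. i < m1 - 1 \<Longrightarrow> u1 $$ (i, i) = 1"
    "\<And>i j. i < m2 - 1 \<Longrightarrow> j < i \<Longrightarrow> u2 $$ (i, j) = 0" "\<And>i. i < m2 - 1 \<Longrightarrow> u2 $$ (i, i) = 1"
    using d(1,2) by (auto simp: unip_def upper_triangular_def)
  show "A \<in> levi_stab m1 r (m1 + m2 + r)"
  proof (rule levi_stabI)
    show "A \<in> carrier_mat (m1 + m2 + r) (m1 + m2 + r)" using ix(2)[of 0 0] assms by simp
    have "block A m1 m1 r r = block h 1 1 r r" using ix(1) assms by (intro eq_matI) (auto simp: Suc_diff_le)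
    then show "block A m1 m1 r r \<in> carrier (GL r)" using J(2) by simp
    show "A $$ (i, j) = 0" if "i < m1 + m2 + r" "j < i" "\<not> (i \<in> {m1..<m1 + r} \<and> j \<in> {m1..<m1 + r})" for i j
      using that ix(1)[of i j] u J(3)[of "i - (m1 - 1)" "j - (m1 - 1)"] assms by auto
    show "A $$ (i, i) = 1" if i: "i < m1 + m2 + r" "i \<notin> {m1..<m1 + r}" for i
    proof (cases "m1 - 1 \<le> i \<and> i < m1 + r + 1")
      case True
      then have "i - (m1 - 1) < r + 2" "i - (m1 - 1) \<notin> {1..<1 + r}" using i assms by auto
      from J(4)[OF this] show ?thesis using i ix(1)[of i i] True assms by auto
    next
      case False
      then show ?thesis using i ix(1)[of i i] u assms by auto
    qed
  qed
next
  fix A :: "'f mat" assume A: "A \<in> levi_stab m1 r (m1 + m2 + r)"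
  note D = levi_stabD[OF A]
  let ?p = "m1 - 1" and ?q = "r + 2" and ?s = "m2 - 1"
  have n: "?p + ?q + ?s = m1 + m2 + r" using assms by simp
  have e: "A = block_upper (block A 0 0 ?p ?p) (block A 0 ?p ?p ?q) (block A 0 (?p + ?q) ?p ?s) (block A ?p ?p ?q ?q)
    (block A ?p (?p + ?q) ?q ?s) (block A (?p + ?q) (?p + ?q) ?s ?s)"
  proof (rule block_decomposition)
    show "A \<in> carrier_mat (?p + ?q + ?s) (?p + ?q + ?s)" using D(1) unfolding n .
    fix i j assume "i < ?p + ?q + ?s" "j < ?p + ?q + ?s" "?p \<le> i" "j < ?p \<or> ?p + ?q \<le> i \<and> j < ?p + ?q"
    then have "i < m1 + m2 + r" "j < i" "\<not> (i \<in> {m1..<m1 + r} \<and> j \<in> {m1..<m1 + r})" using assms by auto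
    then show "A $$ (i, j) = 0" by (rule D(3))
  qed
  have u: "block A 0 0 ?p ?p \<in> unip ?p" "block A (?p + ?q) (?p + ?q) ?s ?s \<in> unip ?s"
    by (rule block_unip[OF A]; use assms in auto)+
  have "block A ?p ?p ?q ?q \<in> HJ r" unfolding HJ_iff
  proof (rule levi_stabI)
    have "block (block A ?p ?p ?q ?q) 1 1 r r = block A m1 m1 r r" using assms by (intro eq_matI) auto
    then show "block (block A ?p ?p ?q ?q) 1 1 r r \<in> carrier (GL r)" using D(2) by simp
    show "block A ?p ?p ?q ?q \<in> carrier_mat (r + 2) (r + 2)" by simp
    show "block A ?p ?p ?q ?q $$ (i, j) = 0" if ij: "i < r + 2" "j < i" "\<not> (i \<in> {1..<1 + r} \<and> j \<in> {1..<1 + r})" for i j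
    proof -
      have "?p + i < m1 + m2 + r" "?p + j < ?p + i" "\<not> (?p + i \<in> {m1..<m1 + r} \<and> ?p + j \<in> {m1..<m1 + r})"
        using ij assms by auto
      from D(3)[OF this] show ?thesis using ij by simp
    qed
    show "block A ?p ?p ?q ?q $$ (i, i) = 1" if i: "i < r + 2" "i \<notin> {1..<1 + r}" for i
    proof -
      have "?p + i < m1 + m2 + r" "?p + i \<notin> {m1..<m1 + r}" using i assms by auto
      from D(4)[OF this] show ?thesis using i by simp
    qed
  qed
  then show "A \<in> HF m1 m2 r" unfolding HF_def using e u block_index(4) by blast
qed

text \<open>In h = diag(1, g) the entry 1 has index a, so g starts at index a + 1. Besides
  triangularity, the only condition is that row a vanishes over the columns of g.\<close>

lemma HB_eq:
  "HB a b r = {A \<in> levi_stab (a + 1) r (a + b + r + 1). \<forall>j<r. A $$ (a, a + 1 + j) = (0::'f::field)}"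
proof (intro Set.equalityI subsetI)
  have n: "a + (r + 1) + b = a + b + r + 1" by simp
  let ?h = "\<lambda>g. four_block_mat (1\<^sub>m 1) (0\<^sub>m 1 r) (0\<^sub>m r 1) g :: 'f mat"
  fix A :: "'f mat" assume "A \<in> HB a b r"
  then obtain u1 x y g z u2 where A: "A = block_upper u1 x y (?h g) z u2" and
    d: "u1 \<in> unip a" "u2 \<in> unip b" "g \<in> carrier (GL r)" "x \<in> carrier_mat a (r + 1)"
      "y \<in> carrier_mat a b" "z \<in> carrier_mat (r + 1) b"
    unfolding HB_def by blast
  have hc: "?h g \<in> carrier_mat (r + 1) (r + 1)" using GL_carrier_mat[OF d(3)] by auto
  have hx: "?h g $$ (i, j) = (if i = 0 then if j = 0 then 1 else 0 else if j = 0 then 0 else g $$ (i - 1, j - 1))"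
    if "i < r + 1" "j < r + 1" for i j using that GL_carrier_mat[OF d(3)] by auto
  note ix = block_upper_index[OF unip_carrier[OF d(1)] d(4,5) hc d(6) unip_carrier[OF d(2)], folded A, unfolded n]
  have u: "\<And>i j. i < a \<Longrightarrow> j < i \<Longrightarrow> u1 $$ (i, j) = 0" "\<And>i. i < a \<Longrightarrow> u1 $$ (i, i) = 1"
    "\<And>i j. i < b \<Longrightarrow> j < i \<Longrightarrow> u2 $$ (i, j) = 0" "\<And>i. i < b \<Longrightarrow> u2 $$ (i, i) = 1"
    using d(1,2) by (auto simp: unip_def upper_triangular_def)
  have "A \<in> levi_stab (a + 1) r (a + b + r + 1)"
  proof (rule levi_stabI)
    show "A \<in> carrier_mat (a + b + r + 1) (a + b + r + 1)" using ix(2)[of 0 0] by simp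
    have "block A (a + 1) (a + 1) r r = g" using GL_carrier_mat[OF d(3)] ix(1) hx by (intro eq_matI) auto
    then show "block A (a + 1) (a + 1) r r \<in> carrier (GL r)" using d(3) by simp
    show "A $$ (i, j) = 0" if "i < a + b + r + 1" "j < i" "\<not> (i \<in> {a + 1..<a + 1 + r} \<and> j \<in> {a + 1..<a + 1 + r})" for i j
      using that ix(1)[of i j] u hx[of "i - a" "j - a"] by auto
    show "A $$ (i, i) = 1" if "i < a + b + r + 1" "i \<notin> {a + 1..<a + 1 + r}" for i
      using that ix(1)[of i i] u hx[of "i - a" "i - a"] by auto
  qed
  moreover have "A $$ (a, a + 1 + j) = 0" if "j < r" for j using that ix(1)[of a "a + 1 + j"] hx[of 0 "Suc j"] by auto
  ultimately show "A \<in> {A \<in> levi_stab (a + 1) r (a + b + r + 1). \<forall>j<r. A $$ (a, a + 1 + j) = 0}" by blast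
next
  fix A :: "'f mat" assume "A \<in> {A \<in> levi_stab (a + 1) r (a + b + r + 1). \<forall>j<r. A $$ (a, a + 1 + j) = 0}"
  then have A: "A \<in> levi_stab (a + 1) r (a + b + r + 1)" and z: "\<And>j. j < r \<Longrightarrow> A $$ (a, a + 1 + j) = 0" by auto
  note D = levi_stabD[OF A]
  have e: "A = block_upper (block A 0 0 a a) (block A 0 a a (r + 1)) (block A 0 (a + (r + 1)) a b) (block A a a (r + 1) (r + 1))
    (block A a (a + (r + 1)) (r + 1) b) (block A (a + (r + 1)) (a + (r + 1)) b b)"
  proof (rule block_decomposition)
    have "a + (r + 1) + b = a + b + r + 1" by simp
    then show "A \<in> carrier_mat (a + (r + 1) + b) (a + (r + 1) + b)" using D(1) by (simp only:)
    fix i j assume "i < a + (r + 1) + b" "j < a + (r + 1) + b" "a \<le> i" "j < a \<or> a + (r + 1) \<le> i \<and> j < a + (r + 1)"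
    then have "i < a + b + r + 1" "j < i" "\<not> (i \<in> {a + 1..<a + 1 + r} \<and> j \<in> {a + 1..<a + 1 + r})" by auto
    then show "A $$ (i, j) = 0" by (rule D(3))
  qed
  have u: "block A 0 0 a a \<in> unip a" "block A (a + (r + 1)) (a + (r + 1)) b b \<in> unip b"
    by (rule block_unip[OF A]; auto)+
  have h: "block A a a (r + 1) (r + 1) = four_block_mat (1\<^sub>m 1) (0\<^sub>m 1 r) (0\<^sub>m r 1) (block A (a + 1) (a + 1) r r)"
  proof (rule eq_matI)
    fix i j assume "i < dim_row (four_block_mat (1\<^sub>m 1) (0\<^sub>m 1 r) (0\<^sub>m r 1) (block A (a + 1) (a + 1) r r))"
      "j < dim_col (four_block_mat (1\<^sub>m 1) (0\<^sub>m 1 r) (0\<^sub>m r 1) (block A (a + 1) (a + 1) r r))"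
    then have ij: "i < r + 1" "j < r + 1" by auto
    have "A $$ (a + i, a) = 0" if "0 < i" using D(3)[of "a + i" a] ij that by auto
    moreover have "A $$ (a, a + j) = 0" if "0 < j" using z[of "j - 1"] ij that by auto
    moreover have "A $$ (a, a) = 1" using D(4)[of a] by simp
    ultimately show "block A a a (r + 1) (r + 1) $$ (i, j) =
        four_block_mat (1\<^sub>m 1) (0\<^sub>m 1 r) (0\<^sub>m r 1) (block A (a + 1) (a + 1) r r) $$ (i, j)"
      using ij by (cases i; cases j) auto
  qed auto
  show "A \<in> HB a b r"
    unfolding HB_def mem_Collect_eq
    by (intro exI conjI, rule e[unfolded h]) (use u D(2) in auto)
qed

text \<open>The determinant of a block triangular matrix is the product over its diagonal blocks,
  and the unipotent ones contribute 1.\<close>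

lemma levi_stab_det:
  fixes A :: "'f::field mat"
  assumes A: "A \<in> levi_stab m r n" and n: "m + r \<le> n"
  shows "det A = det (block A m m r r)"
proof -
  note D = levi_stabD[OF A]
  define s where "s = n - (m + r)"
  have n: "n = m + r + s" using n by (simp add: s_def)
  let ?u1 = "block A 0 0 m m" and ?x = "block A 0 m m r" and ?h = "block A m m r r"
    and ?y = "block A 0 (m + r) m s" and ?z = "block A m (m + r) r s" and ?u2 = "block A (m + r) (m + r) s s"
  have e: "A = block_upper ?u1 ?x ?y ?h ?z ?u2"
  proof (rule block_decomposition)
    show "A \<in> carrier_mat (m + r + s) (m + r + s)" using D(1) unfolding n .
    fix i j assume "i < m + r + s" "j < m + r + s" "m \<le> i" "j < m \<or> m + r \<le> i \<and> j < m + r"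
    then have "i < n" "j < i" "\<not> (i \<in> {m..<m + r} \<and> j \<in> {m..<m + r})" unfolding n by auto
    then show "A $$ (i, j) = 0" by (rule D(3))
  qed
  have u: "?u1 \<in> unip m" "?u2 \<in> unip s" using block_unip[OF A, of 0 m] block_unip[OF A, of "m + r" s] n by auto
  have du: "det u = 1" if "u \<in> unip k" for u :: "'f mat" and k
  proof -
    have "det u = prod_list (diag_mat u)"
      using that by (intro det_upper_triangular[of _ k]) (auto simp: unip_def)
    also have "diag_mat u = map (\<lambda>i. 1) [0..<k]" using that by (auto simp: diag_mat_def unip_def)
    finally show ?thesis by (simp add: map_replicate_const)
  qed
  let ?F = "four_block_mat ?u1 ?x (0\<^sub>m r m) ?h"
  have "det (four_block_mat ?F (?y @\<^sub>r ?z) (0\<^sub>m s (m + r)) ?u2) = det ?F * det ?u2"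
    by (rule det_four_block_mat_lower_left_zero[of _ "m + r" _ s]) (auto simp: append_rows_def)
  moreover have "det ?F = det ?u1 * det ?h"
    by (rule det_four_block_mat_lower_left_zero[of _ m _ r]) auto
  moreover have "A = four_block_mat ?F (?y @\<^sub>r ?z) (0\<^sub>m s (m + r)) ?u2"
    using e unfolding block_upper_def by simp
  ultimately show ?thesis using du[OF u(1)] du[OF u(2)] by simp
qed

lemma levi_stab_GL:
  assumes n: "m + r \<le> n"
  shows "levi_stab m r n \<subseteq> (carrier (GL n) :: 'f::field mat set)"
proof
  fix A :: "'f mat" assume A: "A \<in> levi_stab m r n"
  have "det A \<noteq> 0" unfolding levi_stab_det[OF A n] by (rule GL_det[OF levi_stabD(2)[OF A]])
  then show "A \<in> carrier (GL n)" unfolding carrier_GL using levi_stabD(1)[OF A] by simp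
qed

lemma mat_mult_index:
  fixes A B :: "'f::field mat"
  assumes "A \<in> carrier_mat n n" "B \<in> carrier_mat n n" "i < n" "j < n"
  shows "(A * B) $$ (i, j) = (\<Sum>k\<in>{0..<n}. A $$ (i, k) * B $$ (k, j))"
  using assms by (auto simp: scalar_prod_def)

text \<open>By the zero pattern, only indices inside the GL_r block contribute to the block of a
  product, so taking the block is multiplicative.\<close>

lemma levi_stab_mult:
  fixes A B :: "'f::field mat"
  assumes A: "A \<in> levi_stab m r n" and B: "B \<in> levi_stab m r n" and n: "m + r \<le> n"
  shows "A * B \<in> levi_stab m r n" "block (A * B) m m r r = block A m m r r * block B m m r r"
proof -
  note DA = levi_stabD[OF A] and DB = levi_stabD[OF B]
  let ?R = "{m..<m + r}"
  note ix = mat_mult_index[OF DA(1) DB(1)]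
  show bl: "block (A * B) m m r r = block A m m r r * block B m m r r"
  proof (rule eq_matI)
    fix i j assume "i < dim_row (block A m m r r * block B m m r r)" "j < dim_col (block A m m r r * block B m m r r)"
    then have ij: "i < r" "j < r" by auto
    have "(A * B) $$ (m + i, m + j) = (\<Sum>k\<in>{0..<n}. A $$ (m + i, k) * B $$ (k, m + j))"
      using ix ij n by simp
    also have "\<dots> = (\<Sum>k\<in>?R. A $$ (m + i, k) * B $$ (k, m + j))"
    proof (rule sum.mono_neutral_right)
      show "\<forall>k\<in>{0..<n} - ?R. A $$ (m + i, k) * B $$ (k, m + j) = 0"
      proof
        fix k assume k: "k \<in> {0..<n} - ?R"
        then consider "k < m" | "m + r \<le> k" "k < n" by force
        then show "A $$ (m + i, k) * B $$ (k, m + j) = 0"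
          using DA(3)[of "m + i" k] DB(3)[of k "m + j"] ij n by cases auto
      qed
    qed (use n in auto)
    also have "\<dots> = (\<Sum>k\<in>{0..<r}. A $$ (m + i, m + k) * B $$ (m + k, m + j))"
      using sum.shift_bounds_nat_ivl[of "\<lambda>k. A $$ (m + i, k) * B $$ (k, m + j)" 0 m r] by (simp add: add.commute)
    also have "\<dots> = (block A m m r r * block B m m r r) $$ (i, j)"
      using ij by (subst mat_mult_index[of _ r]) auto
    finally show "block (A * B) m m r r $$ (i, j) = (block A m m r r * block B m m r r) $$ (i, j)" using ij by simp
  qed auto
  show "A * B \<in> levi_stab m r n"
  proof (rule levi_stabI)
    show "A * B \<in> carrier_mat n n" using DA(1) DB(1) by simp
    show "block (A * B) m m r r \<in> carrier (GL r)" unfolding bl using DA(2) DB(2) by blast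
    show "(A * B) $$ (i, j) = 0" if ij: "i < n" "j < i" "\<not> (i \<in> ?R \<and> j \<in> ?R)" for i j
    proof -
      have "A $$ (i, k) * B $$ (k, j) = 0" if k: "k < n" for k
      proof (cases "A $$ (i, k) = 0")
        case False
        then have 1: "i \<le> k \<or> (i \<in> ?R \<and> k \<in> ?R)" using DA(3)[OF ij(1), of k] by force
        then have "j < k" "\<not> (k \<in> ?R \<and> j \<in> ?R)" using ij by auto
        then show ?thesis using DB(3)[OF k] by simp
      qed simp
      then have "(\<Sum>k\<in>{0..<n}. A $$ (i, k) * B $$ (k, j)) = 0" by (intro sum.neutral) auto
      then show ?thesis using ix[of i j] ij by simp
    qed
    show "(A * B) $$ (i, i) = 1" if i: "i < n" "i \<notin> ?R" for i
    proof -
      have "A $$ (i, k) * B $$ (k, i) = (if k = i then 1 else 0)" if k: "k < n" for k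
        using DA(3)[OF i(1), of k] DB(3)[OF k, of i] DA(4)[OF i] DB(4)[OF i] i by (cases k i rule: linorder_cases) auto
      then have "(A * B) $$ (i, i) = (\<Sum>k\<in>{0..<n}. if k = i then 1 else 0)" using ix[of i i] i by simp
      then show ?thesis using i by simp
    qed
  qed
qed

section \<open>Shears and generic linear forms on the block triangular group\<close>

definition row_shear :: "nat \<Rightarrow> nat \<Rightarrow> nat \<Rightarrow> 'f::field vec \<Rightarrow> 'f mat" where
  "row_shear m r n y = mat n n (\<lambda>(i, j). if i = j then 1 else if i = m - 1 \<and> j \<in> {m..<m + r} then y $ (j - m) else 0)"

text \<open>\<open>row_shear\<close> has y in row m - 1 over the GL_r block,
  \<open>col_shear\<close> has v in column m + r beside it. They are the w-part and the v-part of
  the Heisenberg group, and serve as the sections s in the two applications of induction in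
  stages.\<close>

definition col_shear :: "nat \<Rightarrow> nat \<Rightarrow> nat \<Rightarrow> 'f::field vec \<Rightarrow> 'f mat" where
  "col_shear m r n v = mat n n (\<lambda>(i, j). if i = j then 1 else if j = m + r \<and> i \<in> {m..<m + r} then v $ (i - m) else 0)"

lemma row_shear_levi: "1 \<le> m \<Longrightarrow> m + r \<le> n \<Longrightarrow> row_shear m r n y \<in> levi_stab m r n"
  and col_shear_levi: "m + r \<le> n \<Longrightarrow> col_shear m r n y \<in> levi_stab m r n"
  and shear_block: "1 \<le> m \<Longrightarrow> m + r \<le> n \<Longrightarrow> block (row_shear m r n y) m m r r = 1\<^sub>m r"
    "m + r \<le> n \<Longrightarrow> block (col_shear m r n y) m m r r = 1\<^sub>m r"
proof -
  show b: "block (row_shear m r n y) m m r r = 1\<^sub>m r" if "1 \<le> m" "m + r \<le> n"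
    using that by (intro eq_matI) (auto simp: row_shear_def)
  show c: "block (col_shear m r n y) m m r r = 1\<^sub>m r" if "m + r \<le> n"
    using that by (intro eq_matI) (auto simp: col_shear_def)
  show "row_shear m r n y \<in> levi_stab m r n" if "1 \<le> m" "m + r \<le> n"
    by (rule levi_stabI; (subst b[OF that])?; use that in \<open>auto simp: row_shear_def\<close>)
  show "col_shear m r n y \<in> levi_stab m r n" if "m + r \<le> n"
    by (rule levi_stabI; (subst c[OF that])?; use that in \<open>auto simp: col_shear_def\<close>)
qed

lemma row_shear_index:
  fixes h :: "'f::field mat"
  assumes m: "1 \<le> m" "m + r \<le> n" and h: "h \<in> carrier_mat n n" and y: "y \<in> carrier_vec r" and ij: "i < n" "j < n"
  shows "(row_shear m r n y * h) $$ (i, j) = h $$ (i, j) + (if i = m - 1 then (\<Sum>k<r. y $ k * h $$ (m + k, j)) else 0)"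
    "(h * row_shear m r n y) $$ (i, j) = h $$ (i, j) + (if j \<in> {m..<m + r} then h $$ (i, m - 1) * y $ (j - m) else 0)"
proof -
  let ?R = "{m..<m + r}"
  have s: "row_shear m r n y \<in> carrier_mat n n" by (simp add: row_shear_def)
  have "(row_shear m r n y * h) $$ (i, j) = (\<Sum>k\<in>{0..<n}. (if k = i then h $$ (k, j) else 0) +
      (if k \<in> ?R then if i = m - 1 then y $ (k - m) * h $$ (k, j) else 0 else 0))"
    unfolding mat_mult_index[OF s h ij] using m ij by (intro sum.cong HOL.refl) (auto simp: row_shear_def)
  also have "\<dots> = h $$ (i, j) + (\<Sum>k\<in>{0..<n} \<inter> ?R. if i = m - 1 then y $ (k - m) * h $$ (k, j) else 0)"
    by (subst sum.inter_restrict) (use ij in \<open>auto simp: sum.distrib\<close>)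
  also have "{0..<n} \<inter> ?R = {0 + m..<r + m}" using m by auto
  also have "(\<Sum>k\<in>{0 + m..<r + m}. if i = m - 1 then y $ (k - m) * h $$ (k, j) else 0) = (\<Sum>k\<in>{0..<r}. if i = m - 1 then y $ k * h $$ (m + k, j) else 0)"
    unfolding sum.shift_bounds_nat_ivl by (intro sum.cong HOL.refl) (simp add: add.commute)
  finally show "(row_shear m r n y * h) $$ (i, j) = h $$ (i, j) + (if i = m - 1 then (\<Sum>k<r. y $ k * h $$ (m + k, j)) else 0)"
    by (simp add: atLeast0LessThan)
  have "(h * row_shear m r n y) $$ (i, j) = (\<Sum>k\<in>{0..<n}. (if k = j then h $$ (i, k) else 0) +
      (if k = m - 1 then if j \<in> ?R then h $$ (i, k) * y $ (j - m) else 0 else 0))"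
    unfolding mat_mult_index[OF h s ij] using m ij by (intro sum.cong HOL.refl) (auto simp: row_shear_def)
  also have "\<dots> = h $$ (i, j) + (if j \<in> ?R then h $$ (i, m - 1) * y $ (j - m) else 0)"
    using ij m by (auto simp: sum.distrib)
  finally show "(h * row_shear m r n y) $$ (i, j) = h $$ (i, j) + (if j \<in> ?R then h $$ (i, m - 1) * y $ (j - m) else 0)" .
qed

lemma col_shear_index:
  fixes h :: "'f::field mat"
  assumes m: "m + r < n" and h: "h \<in> carrier_mat n n" and v: "v \<in> carrier_vec r" and ij: "i < n" "j < n"
  shows "(h * col_shear m r n v) $$ (i, j) = h $$ (i, j) + (if j = m + r then (\<Sum>k<r. h $$ (i, m + k) * v $ k) else 0)"
    "(col_shear m r n v * h) $$ (i, j) = h $$ (i, j) + (if i \<in> {m..<m + r} then v $ (i - m) * h $$ (m + r, j) else 0)"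
proof -
  let ?R = "{m..<m + r}"
  have s: "col_shear m r n v \<in> carrier_mat n n" by (simp add: col_shear_def)
  have "(h * col_shear m r n v) $$ (i, j) = (\<Sum>k\<in>{0..<n}. (if k = j then h $$ (i, k) else 0) +
      (if k \<in> ?R then if j = m + r then h $$ (i, k) * v $ (k - m) else 0 else 0))"
    unfolding mat_mult_index[OF h s ij] using m ij by (intro sum.cong HOL.refl) (auto simp: col_shear_def)
  also have "\<dots> = h $$ (i, j) + (\<Sum>k\<in>{0..<n} \<inter> ?R. if j = m + r then h $$ (i, k) * v $ (k - m) else 0)"
    by (subst sum.inter_restrict) (use ij in \<open>auto simp: sum.distrib\<close>)
  also have "{0..<n} \<inter> ?R = {0 + m..<r + m}" using m by auto
  also have "(\<Sum>k\<in>{0 + m..<r + m}. if j = m + r then h $$ (i, k) * v $ (k - m) else 0) = (\<Sum>k\<in>{0..<r}. if j = m + r then h $$ (i, m + k) * v $ k else 0)"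
    unfolding sum.shift_bounds_nat_ivl by (intro sum.cong HOL.refl) (simp add: add.commute)
  finally show "(h * col_shear m r n v) $$ (i, j) = h $$ (i, j) + (if j = m + r then (\<Sum>k<r. h $$ (i, m + k) * v $ k) else 0)"
    by (simp add: atLeast0LessThan)
  have "(col_shear m r n v * h) $$ (i, j) = (\<Sum>k\<in>{0..<n}. (if k = i then h $$ (k, j) else 0) +
      (if k = m + r then if i \<in> ?R then v $ (i - m) * h $$ (k, j) else 0 else 0))"
    unfolding mat_mult_index[OF s h ij] using m ij by (intro sum.cong HOL.refl) (auto simp: col_shear_def)
  also have "\<dots> = h $$ (i, j) + (if i \<in> ?R then v $ (i - m) * h $$ (m + r, j) else 0)"
    using ij m by (auto simp: sum.distrib)
  finally show "(col_shear m r n v * h) $$ (i, j) = h $$ (i, j) + (if i \<in> ?R then v $ (i - m) * h $$ (m + r, j) else 0)" .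
qed

lemma shear_inverse:
  fixes y :: "'f::field vec"
  assumes m: "1 \<le> m" "m + r < n" and y: "y \<in> carrier_vec r"
  shows "inv\<^bsub>GL n\<^esub> (row_shear m r n y) = row_shear m r n (- y)" "inv\<^bsub>GL n\<^esub> (col_shear m r n y) = col_shear m r n (- y)"
    "row_shear m r n (0\<^sub>v r) = 1\<^sub>m n" "col_shear m r n (0\<^sub>v r) = 1\<^sub>m n"
proof -
  have G: "levi_stab m r n \<subseteq> (carrier (GL n) :: 'f mat set)" using levi_stab_GL[of m r n] m by simp
  have R: "row_shear m r n x \<in> carrier (GL n)" for x :: "'f vec" using row_shear_levi[of m r n x] m G by auto
  have C: "col_shear m r n x \<in> carrier (GL n)" for x :: "'f vec" using col_shear_levi[of m r n x] m G by auto
  have m': "m + r \<le> n" using m by simp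
  have "row_shear m r n y * row_shear m r n (- y) = 1\<^sub>m n"
  proof (rule eq_matI)
    fix i j assume "i < dim_row (1\<^sub>m n :: 'f mat)" "j < dim_col (1\<^sub>m n :: 'f mat)"
    then have ij: "i < n" "j < n" by auto
    show "(row_shear m r n y * row_shear m r n (- y)) $$ (i, j) = 1\<^sub>m n $$ (i, j)"
      unfolding row_shear_index(2)[OF m(1) m' GL_carrier_mat[OF R] uminus_carrier_vec[THEN iffD2, OF y] ij]
      using ij m y by (auto simp: row_shear_def)
  qed (auto simp: row_shear_def)
  then show "inv\<^bsub>GL n\<^esub> (row_shear m r n y) = row_shear m r n (- y)" by (rule GL_inv_eq[OF R R])
  have "col_shear m r n y * col_shear m r n (- y) = 1\<^sub>m n"
  proof (rule eq_matI)
    fix i j assume "i < dim_row (1\<^sub>m n :: 'f mat)" "j < dim_col (1\<^sub>m n :: 'f mat)"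
    then have ij: "i < n" "j < n" by auto
    show "(col_shear m r n y * col_shear m r n (- y)) $$ (i, j) = 1\<^sub>m n $$ (i, j)"
      unfolding col_shear_index(2)[OF m(2) GL_carrier_mat[OF C] y ij]
      using ij m y by (auto simp: col_shear_def)
  qed (auto simp: col_shear_def)
  then show "inv\<^bsub>GL n\<^esub> (col_shear m r n y) = col_shear m r n (- y)" by (rule GL_inv_eq[OF C C])
qed (use m in \<open>auto simp: row_shear_def col_shear_def intro!: eq_matI\<close>)

lemma continuous_map_shear:
  assumes m: "1 \<le> m" "m + r < n"
  shows "continuous_map (vec_top r) (GL_top n) (row_shear m r n :: 'f::nonarch_local_field vec \<Rightarrow> 'f mat)"
    "continuous_map (vec_top r) (GL_top n) (col_shear m r n :: 'f::nonarch_local_field vec \<Rightarrow> 'f mat)"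
proof -
  have G: "levi_stab m r n \<subseteq> (carrier (GL n) :: 'f mat set)" using levi_stab_GL[of m r n] m by simp
  have v: "continuous_map (vec_top r) euclidean (\<lambda>x :: 'f vec. x $ k)" if "k < r" for k
    by (rule continuous_map_vec_entry[OF that])
  show "continuous_map (vec_top r) (GL_top n) (row_shear m r n :: 'f vec \<Rightarrow> 'f mat)"
    unfolding continuous_map_GL_top
  proof (intro conjI allI impI)
    show "(row_shear m r n :: 'f vec \<Rightarrow> 'f mat) \<in> topspace (vec_top r) \<rightarrow> carrier (GL n)"
      using row_shear_levi[of m r n] m G by auto
    fix i j assume ij: "i < n" "j < n"
    consider "i = j" | "i \<noteq> j" "i = m - 1 \<and> j \<in> {m..<m + r}" | "i \<noteq> j" "\<not> (i = m - 1 \<and> j \<in> {m..<m + r})" by blast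
    then show "continuous_map (vec_top r) euclidean (\<lambda>x :: 'f vec. row_shear m r n x $$ (i, j))"
      by cases (use ij v[of "j - m"] in \<open>auto simp: row_shear_def\<close>)
  qed
  show "continuous_map (vec_top r) (GL_top n) (col_shear m r n :: 'f vec \<Rightarrow> 'f mat)"
    unfolding continuous_map_GL_top
  proof (intro conjI allI impI)
    show "(col_shear m r n :: 'f vec \<Rightarrow> 'f mat) \<in> topspace (vec_top r) \<rightarrow> carrier (GL n)"
      using col_shear_levi[of m r n] m G by auto
    fix i j assume ij: "i < n" "j < n"
    consider "i = j" | "i \<noteq> j" "j = m + r \<and> i \<in> {m..<m + r}" | "i \<noteq> j" "\<not> (j = m + r \<and> i \<in> {m..<m + r})" by blast
    then show "continuous_map (vec_top r) euclidean (\<lambda>x :: 'f vec. col_shear m r n x $$ (i, j))"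
      by cases (use ij v[of "i - m"] in \<open>auto simp: col_shear_def\<close>)
  qed
qed

lemma sum_lessThan_add: "(\<Sum>i<a + b. f i) = (\<Sum>i<a. f i) + (\<Sum>i<b. f (a + i))" for f :: "nat \<Rightarrow> 'a::comm_monoid_add"
  by (induction b) (simp_all add: add.assoc)

text \<open>The i-th index outside the GL_r block, counted from 0.\<close>

definition flat :: "nat \<Rightarrow> nat \<Rightarrow> nat \<Rightarrow> nat" where
  "flat m r i = (if i < m then i else i + r)"

text \<open>A weighted sum of the entries between consecutive indices outside the GL_r block; the
  term that crosses the block is the entry (m - 1, m + r). Composed with an additive character it
  describes all generic characters that occur.\<close>

definition simple_sum :: "nat \<Rightarrow> nat \<Rightarrow> nat \<Rightarrow> (nat \<Rightarrow> 'f) \<Rightarrow> 'f::field mat \<Rightarrow> 'f" where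
  "simple_sum m r N c h = (\<Sum>i<N. c i * h $$ (flat m r i, flat m r (Suc i)))"

text \<open>The two unipotent corners contribute their simple roots. They are joined by the entry
  (m1 - 1, m1 + r), the centre of the Heisenberg group, on which \<open>lam\<close> acts directly;
  hence the coefficient 1 there.\<close>

lemma FJ_char:
  fixes lam :: "'f::nonarch_local_field \<Rightarrow> complex" and \<phi> :: "nat \<Rightarrow> 'f mat \<Rightarrow> complex"
  assumes lam: "nontrivial_add_char lam" and \<phi>: "\<And>k. nondegenerate_char k (\<phi> k)" and m: "1 \<le> m1" "1 \<le> m2"
  shows "\<exists>c. (\<forall>i<m1 + m2 - 1. c i \<noteq> 0) \<and> c (m1 - 1) = 1 \<and>
    (\<forall>h\<in>levi_stab m1 r (m1 + m2 + r). \<phi> m1 (block h 0 0 m1 m1) * \<phi> m2 (block h (m1 + r) (m1 + r) m2 m2) *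
       lam (h $$ (m1 - 1, m1 + r)) = lam (simple_sum m1 r (m1 + m2 - 1) c h))"
proof -
  have ac: "add_char lam" using lam by (simp add: nontrivial_add_char_iff)
  obtain p q where pq: "m1 = Suc p" "m2 = Suc q" using m by (cases m1; cases m2) auto
  obtain c1 where c1: "\<And>i. Suc i < m1 \<Longrightarrow> c1 i \<noteq> 0" "\<And>u. u \<in> unip m1 \<Longrightarrow> \<phi> m1 u = lam (\<Sum>i<p. c1 i * u $$ (i, Suc i))"
    using unip_char_formula[OF \<phi>[of m1] lam] unfolding pq by auto
  obtain c2 where c2: "\<And>i. Suc i < m2 \<Longrightarrow> c2 i \<noteq> 0" "\<And>u. u \<in> unip m2 \<Longrightarrow> \<phi> m2 u = lam (\<Sum>i<q. c2 i * u $$ (i, Suc i))"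
    using unip_char_formula[OF \<phi>[of m2] lam] unfolding pq by auto
  define c where "c i = (if i < p then c1 i else if i = p then 1 else c2 (i - m1))" for i
  have "\<phi> m1 (block h 0 0 m1 m1) * \<phi> m2 (block h (m1 + r) (m1 + r) m2 m2) * lam (h $$ (m1 - 1, m1 + r)) =
      lam (simple_sum m1 r (m1 + m2 - 1) c h)" if h: "h \<in> levi_stab m1 r (m1 + m2 + r)" for h
  proof -
    have 1: "\<phi> m1 (block h 0 0 m1 m1) = lam (\<Sum>i<p. c1 i * h $$ (i, Suc i))"
      using c1(2)[OF block_unip[OF h, of 0 m1]] by (simp add: pq)
    have 2: "\<phi> m2 (block h (m1 + r) (m1 + r) m2 m2) = lam (\<Sum>i<q. c2 i * h $$ (m1 + r + i, Suc (m1 + r + i)))"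
      using c2(2)[OF block_unip[OF h, of "m1 + r" m2]] by (simp add: pq)
    have N: "m1 + m2 - 1 = p + 1 + q" by (simp add: pq)
    have "simple_sum m1 r (m1 + m2 - 1) c h = (\<Sum>i<p. c1 i * h $$ (i, Suc i)) + h $$ (m1 - 1, m1 + r) +
        (\<Sum>i<q. c2 i * h $$ (m1 + r + i, Suc (m1 + r + i)))"
      unfolding simple_sum_def N sum_lessThan_add by (simp add: c_def flat_def pq add.commute add.left_commute)
    then show ?thesis unfolding 1 2 by (simp add: add_charD(1)[OF ac])
  qed
  moreover have "c i \<noteq> 0" if "i < m1 + m2 - 1" for i
  proof -
    consider "i < p" | "i = p" | "m1 \<le> i" using pq by linarith
    then show ?thesis using c1(1)[of i] c2(1)[of "i - m1"] that by cases (auto simp: c_def pq)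
  qed
  moreover have "c (m1 - 1) = 1" by (simp add: c_def pq)
  ultimately show ?thesis by (intro exI[of _ c]) auto
qed

text \<open>By self-duality \<open>\<psi>\<close> is \<open>lam (k * x)\<close> with k nonzero, so
  the two factors with \<open>\<psi>\<close> contribute the coefficient k at the entries joining
  index a to the two unipotent corners.\<close>

lemma HB_char:
  fixes lam \<psi> :: "'f::nonarch_local_field \<Rightarrow> complex" and \<phi> :: "nat \<Rightarrow> 'f mat \<Rightarrow> complex"
  assumes lam: "nontrivial_add_char lam" and \<psi>: "nontrivial_add_char \<psi>" and \<phi>: "\<And>k. nondegenerate_char k (\<phi> k)"
  shows "\<exists>c. (\<forall>i<a + b. c i \<noteq> 0) \<and> (\<forall>h\<in>levi_stab (a + 1) r (a + b + r + 1).
     \<phi> a (block h 0 0 a a) * \<phi> b (block h (a + r + 1) (a + r + 1) b b) *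
     (if a = 0 then 1 else \<psi> (h $$ (a - 1, a))) * (if b = 0 then 1 else \<psi> (h $$ (a, a + r + 1))) =
     lam (simple_sum (a + 1) r (a + b) c h))"
proof -
  have ac: "add_char lam" using lam by (simp add: nontrivial_add_char_iff)
  obtain k where k: "\<And>x. \<psi> x = lam (k * x)"
    using add_char_self_dual[OF lam, of \<psi>] \<psi> unfolding nontrivial_add_char_iff by blast
  have k0: "k \<noteq> 0" using \<psi> k add_char_0[OF ac] unfolding nontrivial_add_char_iff by auto
  obtain c1 where c1: "\<And>i. Suc i < a \<Longrightarrow> c1 i \<noteq> 0" "\<And>u. u \<in> unip a \<Longrightarrow> \<phi> a u = lam (\<Sum>i<a - 1. c1 i * u $$ (i, Suc i))"
    using unip_char_formula[OF \<phi>[of a] lam] by auto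
  obtain c2 where c2: "\<And>i. Suc i < b \<Longrightarrow> c2 i \<noteq> 0" "\<And>u. u \<in> unip b \<Longrightarrow> \<phi> b u = lam (\<Sum>i<b - 1. c2 i * u $$ (i, Suc i))"
    using unip_char_formula[OF \<phi>[of b] lam] by auto
  \<comment> \<open>The value k covers i = a - 1 and i = a, the entries on either side of index a;
    for a = 0 only the second is present.\<close>
  define c where "c i = (if Suc i < a then c1 i else if i \<le> a then k else c2 (i - a - 1))" for i
  have "\<phi> a (block h 0 0 a a) * \<phi> b (block h (a + r + 1) (a + r + 1) b b) *
     (if a = 0 then 1 else \<psi> (h $$ (a - 1, a))) * (if b = 0 then 1 else \<psi> (h $$ (a, a + r + 1))) =
     lam (simple_sum (a + 1) r (a + b) c h)" if h: "h \<in> levi_stab (a + 1) r (a + b + r + 1)" for h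
  proof -
    have 1: "\<phi> a (block h 0 0 a a) * (if a = 0 then 1 else \<psi> (h $$ (a - 1, a))) = lam (\<Sum>i<a. c i * h $$ (i, Suc i))"
    proof (cases a)
      case 0
      then show ?thesis using c1(2)[OF block_unip[OF h, of 0 a]] by (simp add: add_char_0[OF ac])
    next
      case (Suc p)
      have "\<phi> a (block h 0 0 a a) = lam (\<Sum>i<p. c1 i * h $$ (i, Suc i))"
        using c1(2)[OF block_unip[OF h, of 0 a]] by (simp add: Suc)
      then show ?thesis using Suc by (simp add: k c_def add_charD(1)[OF ac])
    qed
    have 2: "\<phi> b (block h (a + r + 1) (a + r + 1) b b) * (if b = 0 then 1 else \<psi> (h $$ (a, a + r + 1))) =
      lam (\<Sum>i<b. c (a + i) * h $$ (flat (a + 1) r (a + i), a + i + 1 + r))"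
    proof (cases b)
      case 0
      then show ?thesis using c2(2)[OF block_unip[OF h, of "a + r + 1" b]] by (simp add: add_char_0[OF ac])
    next
      case (Suc q)
      have "\<phi> b (block h (a + r + 1) (a + r + 1) b b) = lam (\<Sum>i<q. c2 i * h $$ (a + r + 1 + i, Suc (a + r + 1 + i)))"
        using c2(2)[OF block_unip[OF h, of "a + r + 1" b]] by (simp add: Suc)
      then show ?thesis unfolding Suc sum.lessThan_Suc_shift
        by (simp add: k c_def flat_def add_charD(1)[OF ac] add.commute add.left_commute mult.commute)
    qed
    have "simple_sum (a + 1) r (a + b) c h = (\<Sum>i<a. c i * h $$ (i, Suc i)) + (\<Sum>i<b. c (a + i) * h $$ (flat (a + 1) r (a + i), a + i + 1 + r))"
      unfolding simple_sum_def sum_lessThan_add by (simp add: flat_def)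
    then have "lam (simple_sum (a + 1) r (a + b) c h) =
        lam (\<Sum>i<a. c i * h $$ (i, Suc i)) * lam (\<Sum>i<b. c (a + i) * h $$ (flat (a + 1) r (a + i), a + i + 1 + r))"
      by (simp only: add_charD(1)[OF ac])
    then show ?thesis unfolding 1[symmetric] 2[symmetric] by (simp only: mult_ac)
  qed
  moreover have "c i \<noteq> 0" if "i < a + b" for i
    using c1(1)[of i] c2(1)[of "i - a - 1"] that k0 by (auto simp: c_def)
  ultimately show ?thesis by (intro exI[of _ c]) auto
qed

section \<open>Pullbacks, twists and explicit formulas for the Weil actions\<close>

lemma nu_add: "det g \<noteq> 0 \<Longrightarrow> nu (s + t) g = nu s g * nu t g"
  for g :: "'f::nonarch_local_field mat"
  by (simp add: nu_def powr_add)

lemma pull_simps [simp]: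
  "carrier (pull p \<rho>) = carrier \<rho>" "zero (pull p \<rho>) = zero \<rho>" "add (pull p \<rho>) = add \<rho>"
  "smult (pull p \<rho>) = smult \<rho>" "act (pull p \<rho>) h = act \<rho> (p h)"
  by (simp_all add: pull_def)

lemma twist_simps [simp]:
  "carrier (twist \<chi> \<rho>) = carrier \<rho>" "zero (twist \<chi> \<rho>) = zero \<rho>" "add (twist \<chi> \<rho>) = add \<rho>"
  "smult (twist \<chi> \<rho>) = smult \<rho>" "act (twist \<chi> \<rho>) h v = \<chi> h \<odot>\<^bsub>\<rho>\<^esub> act \<rho> h v"
  by (simp_all add: twist_def)

text \<open>The operations are copied from \<rho>; the negative of x is supplied as (-1) times
  x.\<close>

lemma pull_module:
  assumes M: "module class_ring \<rho>" shows "module class_ring (pull p \<rho>)"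
proof -
  note R = module_rules[OF M]
  have "abelian_group (pull p \<rho>)"
  proof (rule abelian_groupI)
    fix x y z assume x: "x \<in> carrier (pull p \<rho>)" and y: "y \<in> carrier (pull p \<rho>)" and z: "z \<in> carrier (pull p \<rho>)"
    show "x \<oplus>\<^bsub>pull p \<rho>\<^esub> y \<oplus>\<^bsub>pull p \<rho>\<^esub> z = x \<oplus>\<^bsub>pull p \<rho>\<^esub> (y \<oplus>\<^bsub>pull p \<rho>\<^esub> z)"
      using R(4)[of x y z] x y z by simp
    show "x \<oplus>\<^bsub>pull p \<rho>\<^esub> y = y \<oplus>\<^bsub>pull p \<rho>\<^esub> x" unfolding pull_simps by (rule R(5)) (use x y in simp_all)
    have "(- 1 + 1) \<odot>\<^bsub>\<rho>\<^esub> x = (- 1) \<odot>\<^bsub>\<rho>\<^esub> x \<oplus>\<^bsub>\<rho>\<^esub> x" using R(9)[of x "-1" 1] R(11)[of x] x by simp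
    then show "\<exists>y\<in>carrier (pull p \<rho>). y \<oplus>\<^bsub>pull p \<rho>\<^esub> x = \<zero>\<^bsub>pull p \<rho>\<^esub>"
      using R(12)[of x] R(3)[of x "-1"] x by (intro bexI[of _ "(- 1) \<odot>\<^bsub>\<rho>\<^esub> x"]) simp_all
  qed (use R(1,2,6) in simp_all)
  then show ?thesis using M unfolding module_def module_axioms_def by simp
qed

lemma smooth_repD:
  fixes \<pi> :: "('f::nonarch_local_field mat, 'v) rep"
  assumes "smooth_rep r \<pi>"
  shows "module class_ring \<pi>" "g \<in> carrier (GL r) \<Longrightarrow> lin_map \<pi> \<pi> (act \<pi> g)"
    "v \<in> carrier \<pi> \<Longrightarrow> act \<pi> (1\<^sub>m r) v = v"
proof -
  show M: "module class_ring \<pi>" using assms unfolding smooth_rep_def by blast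
  show "lin_map \<pi> \<pi> (act \<pi> g)" if "g \<in> carrier (GL r)"
    using assms that lin_map_module_hom[OF M M] unfolding smooth_rep_def by blast
  show "v \<in> carrier \<pi> \<Longrightarrow> act \<pi> (1\<^sub>m r) v = v" using assms unfolding smooth_rep_def by blast
qed

lemma lin_map_comp: "lin_map A B \<alpha> \<Longrightarrow> lin_map B C \<beta> \<Longrightarrow> lin_map A C (\<lambda>x. \<beta> (\<alpha> x))"
  unfolding lin_map_def by (simp add: Pi_iff)

lemma lin_map_pull: "lin_map \<pi> \<pi> \<alpha> \<Longrightarrow> lin_map (pull p \<pi>) (pull p \<pi>) \<alpha>"
  by (simp add: lin_map_def)

lemma tensor_smult_lin:
  fixes A :: "('g, 'a) rep" and B :: "('g, 'b) rep"
  assumes A: "module class_ring A" and B: "module class_ring B"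
  shows "lin_map (tensor A B) (tensor A B) (\<lambda>P. c \<odot>\<^bsub>tensor A B\<^esub> P)"
proof -
  let ?T = "tensor_map A B (\<lambda>a. c \<odot>\<^bsub>A\<^esub> a) (\<lambda>x. x)"
  have l: "lin_map (tensor A B) (tensor A B) ?T"
    by (rule tensor_map_lin[OF A B A B lin_map_smult[OF A] lin_map_id])
  have e: "?T P = c \<odot>\<^bsub>tensor A B\<^esub> P" if "P \<in> carrier (tensor A B)" for P
    using that tensor_map_cls[OF lin_map_smult[OF A] lin_map_id] tensor_smult_cls[OF A]
    unfolding tensor_carrier by fastforce
  have "P \<oplus>\<^bsub>tensor A B\<^esub> Q \<in> carrier (tensor A B)" if "P \<in> carrier (tensor A B)" "Q \<in> carrier (tensor A B)" for P Q
    using that tensor_add_cls[OF A B] unfolding tensor_carrier by fastforce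
  moreover have "d \<odot>\<^bsub>tensor A B\<^esub> P \<in> carrier (tensor A B)" if "P \<in> carrier (tensor A B)" for P d
    using that tensor_smult_cls[OF A] formal_sums_image[OF lin_map_smult[OF A] lin_map_id]
    unfolding tensor_carrier by fastforce
  moreover have "\<zero>\<^bsub>tensor A B\<^esub> \<in> carrier (tensor A B)" by (auto simp: tensor_zero tensor_carrier)
  ultimately show ?thesis using l unfolding lin_map_def Pi_iff by (simp add: e)
qed

lemma tensor_closed:
  fixes A :: "('g, 'a) rep" and B :: "('g, 'b) rep"
  assumes A: "module class_ring A" and B: "module class_ring B"
  shows "\<zero>\<^bsub>tensor A B\<^esub> \<in> carrier (tensor A B)"
    "P \<in> carrier (tensor A B) \<Longrightarrow> Q \<in> carrier (tensor A B) \<Longrightarrow> P \<oplus>\<^bsub>tensor A B\<^esub> Q \<in> carrier (tensor A B)"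
    "\<zero>\<^bsub>tensor A B\<^esub> \<oplus>\<^bsub>tensor A B\<^esub> \<zero>\<^bsub>tensor A B\<^esub> = \<zero>\<^bsub>tensor A B\<^esub>"
  using tensor_add_cls[OF A B] by (fastforce simp: tensor_zero tensor_carrier)+

text \<open>Both Weil actions have this shape: substitution by \<tau> followed by multiplication
  with a weight k. Linearity is then automatic once test functions are preserved.\<close>

lemma weighted_comp_lin_map:
  fixes B :: "(complex, 'f::nonarch_local_field vec \<Rightarrow> complex, 's) module_scheme"
  assumes B: "is_schwartz r B" and \<beta>: "\<And>f. f \<in> schwartz r \<Longrightarrow> \<beta> f = (\<lambda>x\<in>carrier_vec r. k x * f (\<tau> x))"
    and cl: "\<And>f. f \<in> schwartz r \<Longrightarrow> test_fun r (\<lambda>x. k x * f (\<tau> x))" and \<tau>: "\<And>x. x \<in> carrier_vec r \<Longrightarrow> \<tau> x \<in> carrier_vec r"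
  shows "lin_map B B \<beta>"
proof -
  note D = is_schwartzD[OF B] and M = module_rules[OF schwartz_module[OF B], unfolded is_schwartzD(1)[OF B]]
  have add: "(\<lambda>x\<in>carrier_vec r. f x + g x) \<in> schwartz r" if "f \<in> schwartz r" "g \<in> schwartz r" for f g :: "'f vec \<Rightarrow> complex"
    using M(2)[OF that] by (simp add: D)
  have sm: "(\<lambda>x\<in>carrier_vec r. c * f x) \<in> schwartz r" if "f \<in> schwartz r" for f :: "'f vec \<Rightarrow> complex" and c
    using M(3)[OF that] by (simp add: D)
  have z: "(\<lambda>x\<in>carrier_vec r. 0) \<in> (schwartz r :: ('f vec \<Rightarrow> complex) set)" using M(1) by (simp add: D)
  show ?thesis unfolding lin_map_def D
  proof (intro conjI ballI allI)
    show "\<beta> \<in> schwartz r \<rightarrow> schwartz r" using \<beta> schwartz_restrict[OF cl] by auto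
    show "\<beta> (\<lambda>x\<in>carrier_vec r. f x + g x) = (\<lambda>x\<in>carrier_vec r. \<beta> f x + \<beta> g x)"
      if "f \<in> schwartz r" "g \<in> schwartz r" for f g
      using that \<beta> add \<tau> by (auto simp: fun_eq_iff distrib_left)
    show "\<beta> (\<lambda>x\<in>carrier_vec r. c * f x) = (\<lambda>x\<in>carrier_vec r. c * \<beta> f x)" if "f \<in> schwartz r" for f c
      using that \<beta> sm \<tau> by (auto simp: fun_eq_iff)
    show "\<beta> (\<lambda>x\<in>carrier_vec r. 0) = (\<lambda>x\<in>carrier_vec r. 0)"
      using \<beta>[OF z] \<tau> by (auto simp: fun_eq_iff)
  qed
qed

definition row_part :: "nat \<Rightarrow> nat \<Rightarrow> 'f mat \<Rightarrow> 'f vec" where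
  "row_part m r h = vec r (\<lambda>j. h $$ (m - 1, m + j))"

definition col_part :: "nat \<Rightarrow> nat \<Rightarrow> 'f mat \<Rightarrow> 'f vec" where
  "col_part m r h = vec r (\<lambda>i. h $$ (m + i, m + r))"

lemma part_carrier [simp]: "row_part m r h \<in> carrier_vec r" "col_part m r h \<in> carrier_vec r"
  by (simp_all add: row_part_def col_part_def)

lemma HJ_block:
  fixes h :: "'f::field mat"
  assumes "1 \<le> m"
  shows "HJ_g r (block h (m - 1) (m - 1) (r + 2) (r + 2)) = block h m m r r"
    "HJ_k r (block h (m - 1) (m - 1) (r + 2) (r + 2)) = (h $$ (m - 1, m + r), col_part m r h,
       transpose_mat (inv\<^bsub>GL r\<^esub> (block h m m r r)) *\<^sub>v row_part m r h)"
proof -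
  show 1: "HJ_g r (block h (m - 1) (m - 1) (r + 2) (r + 2)) = block h m m r r"
    using assms unfolding HJ_g_def by (intro eq_matI) auto
  have "vec r (\<lambda>i. block h (m - 1) (m - 1) (r + 2) (r + 2) $$ (i + 1, r + 1)) = col_part m r h"
    "vec r (\<lambda>j. block h (m - 1) (m - 1) (r + 2) (r + 2) $$ (0, j + 1)) = row_part m r h"
    using assms unfolding col_part_def row_part_def by (auto intro!: eq_vecI)
  then show "HJ_k r (block h (m - 1) (m - 1) (r + 2) (r + 2)) = (h $$ (m - 1, m + r), col_part m r h,
       transpose_mat (inv\<^bsub>GL r\<^esub> (block h m m r r)) *\<^sub>v row_part m r h)"
    using assms unfolding HJ_k_def 1 by simp
qed

text \<open>The Heisenberg part of h is (a, v, w') with w' the transposed inverse of g applied to w.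
  Moving the transpose across the pairing shows that the phase and the argument of f both depend on
  g^(-1)(x + v).\<close>

lemma act_tilde:
  fixes \<phi> :: "nat \<Rightarrow> 'f::nonarch_local_field mat \<Rightarrow> complex" and h :: "'f mat"
  assumes m: "1 \<le> m1" and g: "block h m1 m1 r r \<in> carrier (GL r)" and lam: "add_char lam"
  shows "act (zetaF \<phi> lam m1 m2 r) h f = (\<lambda>x\<in>carrier_vec r.
    (nu ((real m1 - real m2) / 2) (block h m1 m1 r r) * nu (- 1 / 2) (block h m1 m1 r r) *
     (\<phi> m1 (block h 0 0 m1 m1) * \<phi> m2 (block h (m1 + r) (m1 + r) m2 m2) * lam (h $$ (m1 - 1, m1 + r))) *
     lam (- (row_part m1 r h \<bullet> (inv\<^bsub>GL r\<^esub> (block h m1 m1 r r) *\<^sub>v (x + col_part m1 r h))))) *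
    f (inv\<^bsub>GL r\<^esub> (block h m1 m1 r r) *\<^sub>v (x + col_part m1 r h)))"
proof -
  let ?g = "block h m1 m1 r r" and ?w = "row_part m1 r h" and ?v = "col_part m1 r h"
  have gi: "inv\<^bsub>GL r\<^esub> ?g \<in> carrier_mat r r" using g GL_carrier_mat by blast
  have "lam (h $$ (m1 - 1, m1 + r) - (transpose_mat (inv\<^bsub>GL r\<^esub> ?g) *\<^sub>v ?w) \<bullet> x - (transpose_mat (inv\<^bsub>GL r\<^esub> ?g) *\<^sub>v ?w) \<bullet> ?v) =
      lam (h $$ (m1 - 1, m1 + r)) * lam (- (?w \<bullet> (inv\<^bsub>GL r\<^esub> ?g *\<^sub>v (x + ?v))))" if x: "x \<in> carrier_vec r" for x
  proof -
    have "?w \<bullet> (inv\<^bsub>GL r\<^esub> ?g *\<^sub>v (x + ?v)) = (transpose_mat (inv\<^bsub>GL r\<^esub> ?g) *\<^sub>v ?w) \<bullet> (x + ?v)"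
      using transpose_vec_mult_scalar[OF gi, of "x + ?v" ?w] x by simp
    also have "\<dots> = (transpose_mat (inv\<^bsub>GL r\<^esub> ?g) *\<^sub>v ?w) \<bullet> x + (transpose_mat (inv\<^bsub>GL r\<^esub> ?g) *\<^sub>v ?w) \<bullet> ?v"
      by (rule scalar_prod_add_distrib[of _ r]) (use gi x in auto)
    finally show ?thesis unfolding add_charD(1)[OF lam, symmetric] by (simp add: diff_diff_add algebra_simps)
  qed
  then show ?thesis using m
    by (auto simp: zetaF_def extendF_def omega_tilde_def schwartz_rep_def projF_def
      HJ_block[OF m, simplified] tilde_k_def tilde_g_def twist_def pull_def fun_eq_iff)
qed

text \<open>Applying g^t to y + w', where w' is the transposed inverse of g applied to w, gives g^t
  y + w.\<close>

lemma act_hat: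
  fixes \<phi> :: "nat \<Rightarrow> 'f::nonarch_local_field mat \<Rightarrow> complex" and h :: "'f mat"
  assumes m: "1 \<le> m1" and g: "block h m1 m1 r r \<in> carrier (GL r)" and lam: "add_char lam"
  shows "act (zetaF_hat \<phi> lam m1 m2 r) h f = (\<lambda>y\<in>carrier_vec r.
    (nu ((real m1 - real m2) / 2) (block h m1 m1 r r) * nu (1 / 2) (block h m1 m1 r r) *
     (\<phi> m1 (block h 0 0 m1 m1) * \<phi> m2 (block h (m1 + r) (m1 + r) m2 m2) * lam (h $$ (m1 - 1, m1 + r))) *
     lam (y \<bullet> col_part m1 r h)) *
    f (transpose_mat (block h m1 m1 r r) *\<^sub>v y + row_part m1 r h))"
proof -
  let ?g = "block h m1 m1 r r" and ?w = "row_part m1 r h" and ?v = "col_part m1 r h"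
  have gi: "inv\<^bsub>GL r\<^esub> ?g \<in> carrier_mat r r" using g GL_carrier_mat by blast
  have "transpose_mat ?g *\<^sub>v (y + transpose_mat (inv\<^bsub>GL r\<^esub> ?g) *\<^sub>v ?w) = transpose_mat ?g *\<^sub>v y + ?w"
    if y: "y \<in> carrier_vec r" for y
  proof -
    have "transpose_mat ?g *\<^sub>v (transpose_mat (inv\<^bsub>GL r\<^esub> ?g) *\<^sub>v ?w) = (transpose_mat ?g * transpose_mat (inv\<^bsub>GL r\<^esub> ?g)) *\<^sub>v ?w"
      by (rule assoc_mult_mat_vec[symmetric, of _ r r _ r]) (use gi in auto)
    also have "transpose_mat ?g * transpose_mat (inv\<^bsub>GL r\<^esub> ?g) = transpose_mat (inv\<^bsub>GL r\<^esub> ?g * ?g)"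
      by (rule transpose_mult[symmetric, of _ r r _ r]) (use gi in auto)
    also have "\<dots> = 1\<^sub>m r" unfolding GL_l_inv[OF g] by simp
    finally have "transpose_mat ?g *\<^sub>v (transpose_mat (inv\<^bsub>GL r\<^esub> ?g) *\<^sub>v ?w) = ?w" by simp
    moreover have "transpose_mat ?g *\<^sub>v (y + transpose_mat (inv\<^bsub>GL r\<^esub> ?g) *\<^sub>v ?w) =
        transpose_mat ?g *\<^sub>v y + transpose_mat ?g *\<^sub>v (transpose_mat (inv\<^bsub>GL r\<^esub> ?g) *\<^sub>v ?w)"
      by (rule mult_add_distrib_mat_vec[of _ r r]) (use y gi in auto)
    ultimately show ?thesis by simp
  qed
  moreover have "y + transpose_mat (inv\<^bsub>GL r\<^esub> ?g) *\<^sub>v ?w \<in> carrier_vec r" if "y \<in> carrier_vec r" for y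
    using that gi by simp
  ultimately show ?thesis using m
    by (auto simp: zetaF_hat_def extendF_def omega_hat_def schwartz_rep_def projF_def
      HJ_block[OF m, simplified] hat_k_def hat_g_def twist_def pull_def fun_eq_iff add_charD(1)[OF lam])
qed

lemma zetaF_is_schwartz: "is_schwartz r (zetaF \<phi> lam m1 m2 r)" "is_schwartz r (zetaF_hat \<phi> lam m1 m2 r)"
  by (auto simp: is_schwartz_def zetaF_def zetaF_hat_def extendF_def omega_tilde_def omega_hat_def schwartz_rep_def)

text \<open>Each operator is composed of modulation, a linear substitution, translation and a
  scalar, all of which preserve test functions.\<close>

lemma zetaF_lin_map:
  fixes \<phi> :: "nat \<Rightarrow> 'f::nonarch_local_field mat \<Rightarrow> complex"
  assumes m: "1 \<le> m1" and g: "block h m1 m1 r r \<in> carrier (GL r)" and lam: "add_char lam"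
  shows "lin_map (zetaF \<phi> lam m1 m2 r) (zetaF \<phi> lam m1 m2 r) (act (zetaF \<phi> lam m1 m2 r) h)"
    "lin_map (zetaF_hat \<phi> lam m1 m2 r) (zetaF_hat \<phi> lam m1 m2 r) (act (zetaF_hat \<phi> lam m1 m2 r) h)"
proof -
  let ?g = "block h m1 m1 r r" and ?w = "row_part m1 r h" and ?v = "col_part m1 r h"
  have gi: "inv\<^bsub>GL r\<^esub> ?g \<in> carrier (GL r)" using g by blast
  have gi': "inv\<^bsub>GL r\<^esub> ?g \<in> carrier_mat r r" using GL_carrier_mat[OF gi] .
  have gt: "transpose_mat ?g \<in> carrier (GL r)" using g unfolding carrier_GL by (simp add: det_transpose[OF GL_carrier_mat[OF g]])
  have gt': "transpose_mat ?g \<in> carrier_mat r r" using GL_carrier_mat[OF gt] .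
  show "lin_map (zetaF \<phi> lam m1 m2 r) (zetaF \<phi> lam m1 m2 r) (act (zetaF \<phi> lam m1 m2 r) h)"
  proof (rule weighted_comp_lin_map[OF zetaF_is_schwartz(1) act_tilde[OF m g lam]])
    fix f :: "'f vec \<Rightarrow> complex" assume f: "f \<in> schwartz r"
    have "test_fun r (\<lambda>z. f z * lam (- (z \<bullet> ?w)))" using test_fun_char[OF lam _ schwartz_test_fun[OF f]] by simp
    then have "test_fun r (\<lambda>x. f (inv\<^bsub>GL r\<^esub> ?g *\<^sub>v (x + ?v)) * lam (- ((inv\<^bsub>GL r\<^esub> ?g *\<^sub>v (x + ?v)) \<bullet> ?w)))"
      by (rule test_fun_translate[OF test_fun_comp[OF gi], of _ ?v]) simp
    note t = test_fun_scale[OF this]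
    show "test_fun r (\<lambda>x. nu ((real m1 - real m2) / 2) ?g * nu (- 1 / 2) ?g *
       (\<phi> m1 (block h 0 0 m1 m1) * \<phi> m2 (block h (m1 + r) (m1 + r) m2 m2) * lam (h $$ (m1 - 1, m1 + r))) *
       lam (- (?w \<bullet> (inv\<^bsub>GL r\<^esub> ?g *\<^sub>v (x + ?v)))) * f (inv\<^bsub>GL r\<^esub> ?g *\<^sub>v (x + ?v)))"
      by (rule test_fun_cong[OF t[of "nu ((real m1 - real m2) / 2) ?g * nu (- 1 / 2) ?g *
       (\<phi> m1 (block h 0 0 m1 m1) * \<phi> m2 (block h (m1 + r) (m1 + r) m2 m2) * lam (h $$ (m1 - 1, m1 + r)))"]])
        (use gi' in \<open>simp add: comm_scalar_prod[of ?w r] mult_ac\<close>)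
  qed (use gi' in auto)
  show "lin_map (zetaF_hat \<phi> lam m1 m2 r) (zetaF_hat \<phi> lam m1 m2 r) (act (zetaF_hat \<phi> lam m1 m2 r) h)"
  proof (rule weighted_comp_lin_map[OF zetaF_is_schwartz(2) act_hat[OF m g lam]])
    fix f :: "'f vec \<Rightarrow> complex" assume f: "f \<in> schwartz r"
    obtain \<sigma> where \<sigma>: "0 < \<sigma>" "loc_const r \<sigma> (\<lambda>x. lam (x \<bullet> ?v))" using char_loc_const[OF lam, of ?v r] by auto
    have "test_fun r (\<lambda>y. f (y + ?w))" using test_fun_translate[OF schwartz_test_fun[OF f]] by simp
    note t = test_fun_scale[OF test_fun_mult[OF test_fun_comp[OF gt this] \<sigma>(2,1)]]
    show "test_fun r (\<lambda>y. nu ((real m1 - real m2) / 2) ?g * nu (1 / 2) ?g *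
       (\<phi> m1 (block h 0 0 m1 m1) * \<phi> m2 (block h (m1 + r) (m1 + r) m2 m2) * lam (h $$ (m1 - 1, m1 + r))) *
       lam (y \<bullet> ?v) * f (transpose_mat ?g *\<^sub>v y + ?w))"
      by (rule test_fun_cong[OF t[of "nu ((real m1 - real m2) / 2) ?g * nu (1 / 2) ?g *
       (\<phi> m1 (block h 0 0 m1 m1) * \<phi> m2 (block h (m1 + r) (m1 + r) m2 m2) * lam (h $$ (m1 - 1, m1 + r)))"]])
        (simp add: mult_ac)
  qed (intro add_carrier_vec mult_mat_vec_carrier[OF gt'] part_carrier)
qed

section \<open>Fourier-Jacobi inductions as inductions from smaller groups\<close>

section \<open>Restriction to Bessel subgroups\<close>

text \<open>The common shape of all inducing representations after reduction: \<pi> on the GL_r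
  block, a power of \<nu>, and a generic character given by coefficients c.\<close>

definition std_rep :: "nat \<Rightarrow> nat \<Rightarrow> nat \<Rightarrow> real \<Rightarrow> ('f \<Rightarrow> complex) \<Rightarrow> (nat \<Rightarrow> 'f) \<Rightarrow> ('f::nonarch_local_field mat, 'v) rep \<Rightarrow> ('f mat, 'v) rep" where
  "std_rep m r N t lam c \<pi> = twist (\<lambda>h. nu t (block h m m r r) * lam (simple_sum m r N c h)) (pull (\<lambda>h. block h m m r r) \<pi>)"

lemma std_rep_simps [simp]:
  "carrier (std_rep m r N t lam c \<pi>) = carrier \<pi>" "zero (std_rep m r N t lam c \<pi>) = zero \<pi>"
  "add (std_rep m r N t lam c \<pi>) = add \<pi>" "smult (std_rep m r N t lam c \<pi>) = smult \<pi>"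
  "act (std_rep m r N t lam c \<pi>) h v = (nu t (block h m m r r) * lam (simple_sum m r N c h)) \<odot>\<^bsub>\<pi>\<^esub> act \<pi> (block h m m r r) v"
  by (simp_all add: std_rep_def)

lemma one_mat_levi: "m + r \<le> n \<Longrightarrow> 1\<^sub>m n \<in> (levi_stab m r n :: 'f::field mat set)" "m + r \<le> n \<Longrightarrow> block (1\<^sub>m n :: 'f mat) m m r r = 1\<^sub>m r"
proof -
  show b: "block (1\<^sub>m n :: 'f mat) m m r r = 1\<^sub>m r" if "m + r \<le> n" using that by (intro eq_matI) auto
  show "1\<^sub>m n \<in> (levi_stab m r n :: 'f::field mat set)" if "m + r \<le> n"
    by (rule levi_stabI; (subst b[OF that])?; use that in auto)
qed

abbreviation FJ_rep :: "nat \<Rightarrow> nat \<Rightarrow> real \<Rightarrow> ('f::nonarch_local_field mat, 'v) rep \<Rightarrow> ('f mat, 'f vec \<Rightarrow> complex) rep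
    \<Rightarrow> ('f mat, ('v \<times> ('f vec \<Rightarrow> complex)) multiset set) rep" where
  "FJ_rep m r t \<pi> B \<equiv> twist (\<lambda>h. nu t (projF m r h)) (tensor (pull (projF m r) \<pi>) B)"

lemma FJ_rep_lin_map:
  fixes \<pi> :: "('f::nonarch_local_field mat, 'v) rep"
  assumes \<pi>: "smooth_rep r \<pi>" and B: "is_schwartz r B" and l: "lin_map B B (act B h)"
    and g: "block h m m r r \<in> carrier (GL r)"
  shows "lin_map (FJ_rep m r t \<pi> B) (FJ_rep m r t \<pi> B) (act (FJ_rep m r t \<pi> B) h)"
proof -
  let ?A = "pull (projF m r) \<pi>"
  note A = pull_module[OF smooth_repD(1)[OF \<pi>], of "projF m r"] and MB = schwartz_module[OF B]
  have "lin_map ?A ?A (act ?A h)"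
    using lin_map_pull[OF smooth_repD(2)[OF \<pi> g]] by (simp add: projF_def lin_map_def)
  then have "lin_map (tensor ?A B) (tensor ?A B) (tensor_map ?A B (act ?A h) (act B h))"
    by (rule tensor_map_lin[OF A MB A MB _ l])
  from lin_map_comp[OF this tensor_smult_lin[OF A MB, of "nu t (projF m r h)"]]
  show ?thesis by (simp add: lin_map_def tensor_act twist_def)
qed

text \<open>This is what permits reversing the isomorphism from a Fourier-Jacobi induction to its
  Bessel model in \<open>bessel_step\<close>.\<close>

lemma FJ_cind_closed:
  fixes \<pi> :: "('f::nonarch_local_field mat, 'v) rep"
  assumes \<pi>: "smooth_rep r \<pi>" and B: "is_schwartz r B" and n: "m + r \<le> n"
    and l: "\<And>h. h \<in> levi_stab m r n \<Longrightarrow> lin_map B B (act B h)"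
  shows "rep_closed (carrier (GL n)) (cind n (levi_stab m r n) (FJ_rep m r t \<pi> B))"
proof (rule cind_rep_closed[OF levi_stab_GL[OF n]])
  note A = pull_module[OF smooth_repD(1)[OF \<pi>], of "projF m r"] and MB = schwartz_module[OF B]
  show "lin_map (FJ_rep m r t \<pi> B) (FJ_rep m r t \<pi> B) (act (FJ_rep m r t \<pi> B) h)" if "h \<in> levi_stab m r n" for h
    using FJ_rep_lin_map[OF \<pi> B l[OF that] levi_stabD(2)[OF that]] .
qed (use tensor_closed[OF pull_module[OF smooth_repD(1)[OF \<pi>]] schwartz_module[OF B]]
    tensor_smult_lin[OF pull_module[OF smooth_repD(1)[OF \<pi>]] schwartz_module[OF B], of "projF m r"]
    in \<open>auto simp: lin_map_def Pi_iff\<close>)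

text \<open>The case of \<open>cind_stages\<close> where B acts by the weighted substitution k(h, x)
  f(\<tau>(h, x)). The coset reached from s y under h is then that of s y' with y' = \<tau>(h, y),
  and the weight k must equal the generic character at h0, up to the powers of \<nu>.\<close>

lemma FJ_stages:
  fixes \<pi> :: "('f::nonarch_local_field mat, 'v) rep" and s :: "'f vec \<Rightarrow> 'f mat"
  assumes \<pi>: "smooth_rep r \<pi>" and B: "is_schwartz r B" and n: "m + r \<le> n" and N: "N + r < n"
    and l: "\<And>h. h \<in> levi_stab m r n \<Longrightarrow> lin_map B B (act B h)"
    and actB: "\<And>h f x. h \<in> levi_stab m r n \<Longrightarrow> x \<in> carrier_vec r \<Longrightarrow> act B h f x = k h x * f (\<tau> h x)"
    and H0: "H0 \<subseteq> levi_stab m r n" "1\<^sub>m n \<in> H0"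
    and s: "\<And>y. y \<in> carrier_vec r \<Longrightarrow> s y \<in> levi_stab m r n" "continuous_map (vec_top r) (GL_top n) s" "s (0\<^sub>v r) = 1\<^sub>m n"
      "\<And>y. y \<in> carrier_vec r \<Longrightarrow> inv\<^bsub>GL n\<^esub> (s y) \<in> levi_stab m r n"
    and E: "\<And>h y. h \<in> levi_stab m r n \<Longrightarrow> y \<in> carrier_vec r \<Longrightarrow> \<tau> h y \<in> carrier_vec r \<and> s y * h * inv\<^bsub>GL n\<^esub> (s (\<tau> h y)) \<in> H0"
    and I: "\<And>h y h0 y'. h \<in> levi_stab m r n \<Longrightarrow> y \<in> carrier_vec r \<Longrightarrow> h0 \<in> H0 \<Longrightarrow> y' \<in> carrier_vec r \<Longrightarrow> s y * h = h0 * s y' \<Longrightarrow>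
      y' = \<tau> h y \<and> block h0 m m r r = block h m m r r \<and>
      nu t (block h m m r r) * k h y = nu t' (block h m m r r) * lam (simple_sum m r N c h0)"
    and Pr: "\<And>C. compactin (GL_top n) C \<Longrightarrow> \<exists>M. \<forall>y\<in>carrier_vec r. \<forall>h\<in>H0. \<forall>c\<in>C. s y = h * c \<longrightarrow> y \<in> box r M"
    and lam: "add_char lam"
  shows "rep_iso (carrier (GL n)) (cind n (levi_stab m r n) (FJ_rep m r t \<pi> B)) (cind n H0 (std_rep m r N t' lam c \<pi>))"
proof -
  let ?A = "pull (projF m r) \<pi>" and ?V = "carrier_vec r :: 'f vec set"
  note M = smooth_repD(1)[OF \<pi>]
  note A = pull_module[OF M, of "projF m r"] and MB = schwartz_module[OF B]
  have G: "levi_stab m r n \<subseteq> (carrier (GL n) :: 'f mat set)" by (rule levi_stab_GL[OF n])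
  have lA: "lin_map ?A ?A (act ?A h)" if "h \<in> levi_stab m r n" for h
    using lin_map_pull[OF smooth_repD(2)[OF \<pi> levi_stabD(2)[OF that]]] by (simp add: projF_def lin_map_def)
  have act_closed: "act \<pi> (block h m m r r) v \<in> carrier \<pi>" if "h \<in> levi_stab m r n" "v \<in> carrier \<pi>" for h v
    using lin_map_closed[OF smooth_repD(2)[OF \<pi> levi_stabD(2)[OF that(1)]] that(2)] .
  have cl: "act (FJ_rep m r t \<pi> B) h P \<in> carrier (tensor ?A B)" if "h \<in> levi_stab m r n" "P \<in> carrier (tensor ?A B)" for h P
    using lin_map_closed[OF FJ_rep_lin_map[OF \<pi> B l[OF that(1)] levi_stabD(2)[OF that(1)]], of P] that(2) by simp
  show ?thesis
  proof (rule cind_stages[OF A B])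
    show "levi_stab m r n \<subseteq> (carrier (GL n) :: 'f mat set)" by (rule G)
    show "inv\<^bsub>GL n\<^esub> (s y) * h \<in> levi_stab m r n" if "y \<in> ?V" "h \<in> H0" for y h
      using levi_stab_mult(1)[OF s(4)[OF that(1)] _ n] that(2) H0(1) by blast
    show "\<exists>h0\<in>H0. \<exists>y'\<in>?V. s y * h = h0 * s y'" if h: "h \<in> levi_stab m r n" and y: "y \<in> ?V" for h y
    proof (intro bexI)
      have "s y * h \<in> carrier (GL n)" using levi_stab_mult(1)[OF s(1)[OF y] h n] G by blast
      moreover have "s (\<tau> h y) \<in> carrier (GL n)" using s(1) E[OF h y] G by blast
      ultimately show "s y * h = s y * h * inv\<^bsub>GL n\<^esub> (s (\<tau> h y)) * s (\<tau> h y)"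
        by (simp only: GL_inv_cancel(4))
    qed (use E[OF h y] in auto)
    show "theta ?A (act (FJ_rep m r t \<pi> B) h P) y = act (std_rep m r N t' lam c \<pi>) h0 (theta ?A P y')"
      if h: "h \<in> levi_stab m r n" and y: "y \<in> ?V" and h0: "h0 \<in> H0" and y': "y' \<in> ?V" and eq: "s y * h = h0 * s y'"
        and P: "P \<in> carrier (tensor ?A B)" for h y h0 y' P
    proof -
      note i = I[OF h y h0 y' eq]
      have p: "projF m r h = block h m m r r" by (simp add: projF_def)
      let ?Q = "tensor_map ?A B (act ?A h) (act B h) P"
      have Q: "?Q \<in> carrier (tensor ?A B)"
        by (rule lin_map_closed[OF tensor_map_lin[OF A MB A MB lA[OF h] l[OF h]] P])
      have "theta ?A (act (FJ_rep m r t \<pi> B) h P) y = nu t (projF m r h) \<odot>\<^bsub>?A\<^esub> theta ?A ?Q y"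
        using theta_smult[OF A B Q y] by (simp add: tensor_act)
      also have "theta ?A ?Q y = k h y \<odot>\<^bsub>?A\<^esub> act ?A h (theta ?A P y')"
        by (rule theta_map[OF A B P y lA[OF h] l[OF h] _ y']) (use actB[OF h y] i in simp)
      also have "nu t (projF m r h) \<odot>\<^bsub>?A\<^esub> (k h y \<odot>\<^bsub>?A\<^esub> act ?A h (theta ?A P y')) =
          (nu t (projF m r h) * k h y) \<odot>\<^bsub>\<pi>\<^esub> act \<pi> (block h m m r r) (theta ?A P y')"
        using module_rules(10)[OF M, of "act \<pi> (block h m m r r) (theta ?A P y')"]
          act_closed[OF h, of "theta ?A P y'"] theta_closed[OF A B, of P y'] by (simp add: projF_def)
      finally show ?thesis using i by (simp add: p)
    qed
  next
    show "act (std_rep m r N t' lam c \<pi>) (1\<^sub>m n) a = a" if "a \<in> carrier ?A" for a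
    proof -
      have "simple_sum m r N c (1\<^sub>m n) = 0"
        unfolding simple_sum_def by (rule sum.neutral) (use N in \<open>auto simp: flat_def\<close>)
      moreover have "nu t' (1\<^sub>m r :: 'f mat) = 1" by (simp add: nu_def)
      moreover have b: "block (1\<^sub>m n :: 'f mat) m m r r = 1\<^sub>m r" by (rule one_mat_levi(2)[OF n])
      ultimately show ?thesis
        using that smooth_repD(3)[OF \<pi>, of a] module_rules(11)[OF M, of a] add_char_0[OF lam] by (simp add: b)
    qed
  next
    show "act (std_rep m r N t' lam c \<pi>) h \<zero>\<^bsub>?A\<^esub> = \<zero>\<^bsub>?A\<^esub>" if "h \<in> H0" for h
    proof -
      have "act \<pi> (block h m m r r) \<zero>\<^bsub>\<pi>\<^esub> = \<zero>\<^bsub>\<pi>\<^esub>"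
        using smooth_repD(2)[OF \<pi> levi_stabD(2)] that H0(1) unfolding lin_map_def by blast
      then show ?thesis using module_rules(13)[OF M] by simp
    qed
  next
    show "act (FJ_rep m r t \<pi> B) h P \<in> carrier (tensor ?A B)"
      if "h \<in> levi_stab m r n" "P \<in> carrier (tensor ?A B)" for h P using cl[OF that] .
  qed (use s H0 cl Pr in auto)
qed

text \<open>The condition w = 0, which defines the Bessel group by \<open>HB_row_free\<close>;
  \<open>col_free\<close> below is the condition v = 0. They are the stabilisers of 0 under the
  substitutions g^t y + w and g^(-1)(x + v).\<close>

definition row_free :: "nat \<Rightarrow> nat \<Rightarrow> nat \<Rightarrow> 'f::field mat set" where
  "row_free m r n = {A \<in> levi_stab m r n. \<forall>j<r. A $$ (m - 1, m + j) = 0}"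

definition col_free :: "nat \<Rightarrow> nat \<Rightarrow> nat \<Rightarrow> 'f::field mat set" where
  "col_free m r n = {A \<in> levi_stab m r n. \<forall>i<r. A $$ (m + i, m + r) = 0}"

text \<open>Of the entries in \<open>simple_sum\<close>, the left shear changes only the one at (m -
  1, m + r), by the pairing of y with the column v; the right shear changes columns of the GL_r
  block only.\<close>

lemma simple_sum_row_shear:
  fixes h h0 :: "'f::field mat"
  assumes m: "1 \<le> m" "m \<le> N" and n: "N + r < n" and h: "h \<in> carrier_mat n n" and h0: "h0 \<in> carrier_mat n n"
    and y: "y \<in> carrier_vec r" "y' \<in> carrier_vec r" and eq: "row_shear m r n y * h = h0 * row_shear m r n y'" and c: "c (m - 1) = 1"
  shows "simple_sum m r N c h0 = simple_sum m r N c h + y \<bullet> col_part m r h"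
proof -
  have mr: "m + r \<le> n" using m n by simp
  have "c i * h0 $$ (flat m r i, flat m r (Suc i)) = c i * h $$ (flat m r i, flat m r (Suc i)) +
      (if i = m - 1 then y \<bullet> col_part m r h else 0)" if i: "i < N" for i
  proof -
    have f: "flat m r i < n" "flat m r (Suc i) < n" "flat m r (Suc i) \<notin> {m..<m + r}" using i n by (auto simp: flat_def)
    have "h0 $$ (flat m r i, flat m r (Suc i)) = (h0 * row_shear m r n y') $$ (flat m r i, flat m r (Suc i))"
      using row_shear_index(2)[OF m(1) mr h0 y(2) f(1,2)] f(3) by auto
    also have "\<dots> = h $$ (flat m r i, flat m r (Suc i)) +
        (if flat m r i = m - 1 then \<Sum>k<r. y $ k * h $$ (m + k, flat m r (Suc i)) else 0)"
      unfolding eq[symmetric] by (rule row_shear_index(1)[OF m(1) mr h y(1) f(1,2)])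
    also have "(if flat m r i = m - 1 then \<Sum>k<r. y $ k * h $$ (m + k, flat m r (Suc i)) else 0) =
        (if i = m - 1 then y \<bullet> col_part m r h else 0)"
      using m y by (auto simp: flat_def col_part_def scalar_prod_def atLeast0LessThan)
    finally show ?thesis using c by (auto simp: distrib_left)
  qed
  then show ?thesis using m unfolding simple_sum_def by (simp add: sum.distrib)
qed

text \<open>The left shear changes rows of the GL_r block only. Removing the right shear subtracts
  the pairing of the row w with y' at the entry (m - 1, m + r).\<close>

lemma simple_sum_col_shear:
  fixes h h0 :: "'f::field mat"
  assumes m: "1 \<le> m" "m \<le> N" and n: "N + r < n" and h: "h \<in> levi_stab m r n" and h0: "h0 \<in> carrier_mat n n"
    and y: "y \<in> carrier_vec r" "y' \<in> carrier_vec r" and eq: "col_shear m r n y * h = h0 * col_shear m r n y'" and c: "c (m - 1) = 1"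
  shows "simple_sum m r N c h0 = simple_sum m r N c h + - (row_part m r h \<bullet> y')"
proof -
  have mr: "m + r < n" using m n by simp
  note hc = levi_stabD(1)[OF h]
  have nm: "\<not> m \<le> m - Suc 0" using m by simp
  have row: "h0 $$ (m - 1, m + k) = h $$ (m - 1, m + k)" if "k < r" for k
  proof -
    have "m - 1 < n" "m + k < n" using mr that by auto
    from col_shear_index(1)[OF mr h0 y(2) this] col_shear_index(2)[OF mr hc y(1) this] show ?thesis
      using eq that m by (simp add: nm)
  qed
  have "c i * h0 $$ (flat m r i, flat m r (Suc i)) = c i * h $$ (flat m r i, flat m r (Suc i)) +
      (if i = m - 1 then - (row_part m r h \<bullet> y') else 0)" if i: "i < N" for i
  proof -
    have f: "flat m r i < n" "flat m r (Suc i) < n" "flat m r i \<notin> {m..<m + r}" using i n by (auto simp: flat_def)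
    have "h $$ (flat m r i, flat m r (Suc i)) = (h0 * col_shear m r n y') $$ (flat m r i, flat m r (Suc i))"
      unfolding eq[symmetric] using col_shear_index(2)[OF mr hc y(1) f(1,2)] f(3) by auto
    also have "\<dots> = h0 $$ (flat m r i, flat m r (Suc i)) +
        (if flat m r (Suc i) = m + r then \<Sum>k<r. h0 $$ (flat m r i, m + k) * y' $ k else 0)"
      by (rule col_shear_index(1)[OF mr h0 y(2) f(1,2)])
    also have "(if flat m r (Suc i) = m + r then \<Sum>k<r. h0 $$ (flat m r i, m + k) * y' $ k else 0) =
        (if i = m - 1 then row_part m r h \<bullet> y' else 0)"
      using m y row by (auto simp: flat_def row_part_def scalar_prod_def atLeast0LessThan)
    finally show ?thesis using c by (auto simp: algebra_simps)
  qed
  then show ?thesis using m unfolding simple_sum_def by (simp add: sum.distrib)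
qed

text \<open>Over the GL_r block, row m - 1 of the sheared matrix is g^t y + w. A right row shear
  clears it precisely when its parameter is the negative of that vector, which gives existence and
  uniqueness of the factorisation.\<close>

lemma row_shear_stage:
  fixes h :: "'f::field mat"
  assumes m: "1 \<le> m" "m + r < n" and h: "h \<in> levi_stab m r n" and y: "y \<in> carrier_vec r"
  defines "\<tau> \<equiv> transpose_mat (block h m m r r) *\<^sub>v y + row_part m r h"
  shows "\<tau> \<in> carrier_vec r" "row_shear m r n y * h * inv\<^bsub>GL n\<^esub> (row_shear m r n \<tau>) \<in> row_free m r n"
    "h0 \<in> row_free m r n \<Longrightarrow> y' \<in> carrier_vec r \<Longrightarrow> row_shear m r n y * h = h0 * row_shear m r n y' \<Longrightarrow>
      y' = \<tau> \<and> block h0 m m r r = block h m m r r"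
proof -
  have m': "m + r \<le> n" using m by simp
  note hc = levi_stabD(1)[OF h]
  show t: "\<tau> \<in> carrier_vec r" unfolding \<tau>_def by (intro add_carrier_vec mult_mat_vec_carrier[of _ r r] part_carrier) (use y in simp_all)
  let ?X = "row_shear m r n y * h"
  have X: "?X \<in> levi_stab m r n" by (rule levi_stab_mult(1)[OF row_shear_levi[OF m(1) m'] h m'])
  have bX: "block ?X m m r r = block h m m r r"
    unfolding levi_stab_mult(2)[OF row_shear_levi[OF m(1) m'] h m'] shear_block(1)[OF m(1) m'] by simp
  have Xe: "?X $$ (m - 1, m + j) = \<tau> $ j" if j: "j < r" for j
  proof -
    have "m - 1 < n" "m + j < n" using m j by auto
    from row_shear_index(1)[OF m(1) m' hc y this] show ?thesis
      using j y unfolding \<tau>_def row_part_def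
      by (simp add: scalar_prod_def atLeast0LessThan mult.commute)
  qed
  have Xd: "?X $$ (m - 1, m - 1) = 1" using levi_stabD(4)[OF X, of "m - 1"] m by auto
  have ti: "- \<tau> \<in> carrier_vec r" using t by simp
  let ?h0 = "?X * row_shear m r n (- \<tau>)"
  have "?h0 \<in> levi_stab m r n" by (rule levi_stab_mult(1)[OF X row_shear_levi[OF m(1) m'] m'])
  moreover have "?h0 $$ (m - 1, m + j) = 0" if j: "j < r" for j
  proof -
    have "m - 1 < n" "m + j < n" using m j by auto
    from row_shear_index(2)[OF m(1) m' levi_stabD(1)[OF X] ti this] show ?thesis
      using j t Xe[OF j] Xd by simp
  qed
  ultimately show "?X * inv\<^bsub>GL n\<^esub> (row_shear m r n \<tau>) \<in> row_free m r n"
    unfolding shear_inverse(1)[OF m t] row_free_def by blast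
  show "y' = \<tau> \<and> block h0 m m r r = block h m m r r"
    if h0: "h0 \<in> row_free m r n" and y': "y' \<in> carrier_vec r" and eq: "?X = h0 * row_shear m r n y'"
  proof
    have H: "h0 \<in> levi_stab m r n" "\<And>j. j < r \<Longrightarrow> h0 $$ (m - 1, m + j) = 0" using h0 unfolding row_free_def by auto
    show "y' = \<tau>"
    proof (rule eq_vecI)
      fix j assume "j < dim_vec \<tau>"
      then have j: "j < r" using t by simp
      have "m - 1 < n" "m + j < n" using m j by auto
      from row_shear_index(2)[OF m(1) m' levi_stabD(1)[OF H(1)] y' this]
      have "?X $$ (m - 1, m + j) = y' $ j"
        using H(2)[OF j] levi_stabD(4)[OF H(1), of "m - 1"] m j unfolding eq by auto
      then show "y' $ j = \<tau> $ j" using Xe[OF j] by simp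
    qed (use t y' in auto)
    show "block h0 m m r r = block h m m r r"
      using levi_stab_mult(2)[OF H(1) row_shear_levi[OF m(1) m', of y'] m'] bX
      unfolding eq shear_block(1)[OF m(1) m'] by simp
  qed
qed

text \<open>Beside the GL_r block, column m + r of the sheared matrix is y + v. Clearing it from the
  right by a column shear with parameter -\<tau> amounts to g \<tau> = y + v.\<close>

lemma col_shear_stage:
  fixes h :: "'f::field mat"
  assumes m: "1 \<le> m" "m + r < n" and h: "h \<in> levi_stab m r n" and y: "y \<in> carrier_vec r"
  defines "\<tau> \<equiv> inv\<^bsub>GL r\<^esub> (block h m m r r) *\<^sub>v (y + col_part m r h)"
  shows "\<tau> \<in> carrier_vec r" "col_shear m r n y * h * inv\<^bsub>GL n\<^esub> (col_shear m r n \<tau>) \<in> col_free m r n"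
    "h0 \<in> col_free m r n \<Longrightarrow> y' \<in> carrier_vec r \<Longrightarrow> col_shear m r n y * h = h0 * col_shear m r n y' \<Longrightarrow>
      y' = \<tau> \<and> block h0 m m r r = block h m m r r"
proof -
  have m': "m + r \<le> n" using m by simp
  note hc = levi_stabD(1)[OF h] and g = levi_stabD(2)[OF h]
  let ?g = "block h m m r r"
  have gi: "inv\<^bsub>GL r\<^esub> ?g \<in> carrier (GL r)" using g by blast
  have yc: "y + col_part m r h \<in> carrier_vec r" using y by simp
  show t: "\<tau> \<in> carrier_vec r" unfolding \<tau>_def by (rule mult_mat_vec_carrier[OF GL_carrier_mat[OF gi] yc])
  let ?X = "col_shear m r n y * h"
  have X: "?X \<in> levi_stab m r n" by (rule levi_stab_mult(1)[OF col_shear_levi[OF m'] h m'])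
  have bX: "block ?X m m r r = ?g"
    unfolding levi_stab_mult(2)[OF col_shear_levi[OF m'] h m'] shear_block(2)[OF m'] by simp
  have q: "h $$ (m + r, m + r) = 1" using levi_stabD(4)[OF h, of "m + r"] m by auto
  have Xe: "?X $$ (m + i, m + r) = (y + col_part m r h) $ i" if i: "i < r" for i
  proof -
    have "m + i < n" "m + r < n" using m i by auto
    from col_shear_index(2)[OF m(2) hc y this] show ?thesis
      using i y q by (simp add: col_part_def add.commute)
  qed
  have g\<tau>: "?g *\<^sub>v \<tau> = y + col_part m r h"
    unfolding \<tau>_def using assoc_mult_mat_vec[OF GL_carrier_mat[OF g] GL_carrier_mat[OF gi] yc] GL_r_inv[OF g] yc by simp
  have XR: "?X $$ (m + i, m + k) = ?g $$ (i, k)" if "i < r" "k < r" for i k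
    using that bX block_index(1)[OF that, of ?X m m] by simp
  have mv: "(\<Sum>k<r. A $$ (m + i, m + k) * v $ k) = (block A m m r r *\<^sub>v v) $ i"
    if "i < r" "v \<in> carrier_vec r" for A :: "'f mat" and v i
    using that by (simp add: scalar_prod_def atLeast0LessThan)
  have ti: "- \<tau> \<in> carrier_vec r" using t by simp
  let ?h0 = "?X * col_shear m r n (- \<tau>)"
  have "?h0 \<in> levi_stab m r n" by (rule levi_stab_mult(1)[OF X col_shear_levi[OF m'] m'])
  moreover have "?h0 $$ (m + i, m + r) = 0" if i: "i < r" for i
  proof -
    have "m + i < n" "m + r < n" using m i by auto
    from col_shear_index(1)[OF m(2) levi_stabD(1)[OF X] ti this]
    have "?h0 $$ (m + i, m + r) = ?X $$ (m + i, m + r) + (?g *\<^sub>v (- \<tau>)) $ i"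
      using mv[OF i ti, of ?X] bX by simp
    also have "(?g *\<^sub>v (- \<tau>)) $ i = - (?g *\<^sub>v \<tau>) $ i"
      using i t by simp
    finally show ?thesis using Xe[OF i] g\<tau> i by simp
  qed
  ultimately show "?X * inv\<^bsub>GL n\<^esub> (col_shear m r n \<tau>) \<in> col_free m r n"
    unfolding shear_inverse(2)[OF m t] col_free_def by blast
  show "y' = \<tau> \<and> block h0 m m r r = ?g"
    if h0: "h0 \<in> col_free m r n" and y': "y' \<in> carrier_vec r" and eq: "?X = h0 * col_shear m r n y'"
  proof
    have H: "h0 \<in> levi_stab m r n" "\<And>j. j < r \<Longrightarrow> h0 $$ (m + j, m + r) = 0" using h0 unfolding col_free_def by auto
    show b: "block h0 m m r r = ?g"
      using levi_stab_mult(2)[OF H(1) col_shear_levi[OF m', of y'] m'] bX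
      unfolding eq shear_block(2)[OF m'] by simp
    have "?g *\<^sub>v y' = y + col_part m r h"
    proof (rule eq_vecI)
      fix i assume "i < dim_vec (y + col_part m r h)"
      then have i: "i < r" by (simp add: col_part_def)
      have "m + i < n" "m + r < n" using m i by auto
      from col_shear_index(1)[OF m(2) levi_stabD(1)[OF H(1)] y' this]
      have "?X $$ (m + i, m + r) = (?g *\<^sub>v y') $ i" using H(2)[OF i] mv[OF i y', of h0] unfolding eq b by simp
      then show "(?g *\<^sub>v y') $ i = (y + col_part m r h) $ i" using Xe[OF i] by simp
    qed (use yc in \<open>auto simp: col_part_def\<close>)
    then show "y' = \<tau>"
      unfolding \<tau>_def using assoc_mult_mat_vec[OF GL_carrier_mat[OF gi] GL_carrier_mat[OF g] y'] GL_l_inv[OF g] y' by simp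
  qed
qed

text \<open>From \<open>row_shear m r n y = h * c\<close> the vector y can be read off as the part
  of row m - 1 of c over the GL_r block: row m - 1 of h has 1 on the diagonal and zeros over the
  block, and further right it meets only zeros of c. Entries of c are bounded on a compact
  set.\<close>

lemma row_shear_proper:
  fixes C :: "'f::nonarch_local_field mat set"
  assumes m: "1 \<le> m" "m + r < n" and C: "compactin (GL_top n) C"
  shows "\<exists>M. \<forall>y\<in>carrier_vec r. \<forall>h\<in>row_free m r n. \<forall>c\<in>C. row_shear m r n y = h * c \<longrightarrow> y \<in> box r M"
proof -
  have "\<exists>M\<ge>0. \<forall>j\<in>{..<r}. \<forall>x\<in>C. nabs (x $$ (m - 1, m + j)) \<le> M"
    by (rule compactin_bounded_finite[OF C finite_lessThan]) (rule continuous_map_GL_entry, use m in auto)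
  then obtain M where M: "\<And>j x. j < r \<Longrightarrow> x \<in> C \<Longrightarrow> nabs (x $$ (m - 1, m + j)) \<le> M" by blast
  have "y \<in> box r M" if y: "y \<in> carrier_vec r" and h: "h \<in> row_free m r n" and c: "c \<in> C" and eq: "row_shear m r n y = h * c"
    for y :: "'f vec" and h c :: "'f mat"
  proof -
    have H: "h \<in> levi_stab m r n" "\<And>j. j < r \<Longrightarrow> h $$ (m - 1, m + j) = 0" using h unfolding row_free_def by auto
    note D = levi_stabD[OF H(1)]
    have cc: "c \<in> carrier_mat n n" using GL_carrier_mat[OF compactin_GL_carrier[OF C c]] .
    note ix = mat_mult_index[OF D(1) cc, folded eq]
    \<comment> \<open>Upwards from the last row: below the GL_r block h is unipotent and the shear
      has identity rows, so c vanishes there in the columns of the block.\<close>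
    have low: "c $$ (p, m + j) = 0" if "m + r \<le> p" "p < n" "j < r" for p j
      using that
    proof (induction "n - p" arbitrary: p rule: less_induct)
      case less
      have "h $$ (p, k) * c $$ (k, m + j) = (if k = p then c $$ (p, m + j) else 0)" if k: "k < n" for k
      proof (cases k p rule: linorder_cases)
        case less
        then show ?thesis using D(3)[of p k] \<open>m + r \<le> p\<close> \<open>p < n\<close> by auto
      next
        case equal
        then show ?thesis using D(4)[of p] \<open>m + r \<le> p\<close> \<open>p < n\<close> by auto
      next
        case greater
        then show ?thesis using less.hyps[of k] less.prems k by auto
      qed
      then have "(\<Sum>k\<in>{0..<n}. h $$ (p, k) * c $$ (k, m + j)) = (\<Sum>k\<in>{0..<n}. if k = p then c $$ (p, m + j) else 0)"
        by (intro sum.cong HOL.refl) auto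
      then have "row_shear m r n y $$ (p, m + j) = c $$ (p, m + j)"
        using ix[of p "m + j"] less.prems m by simp
      then show ?case using less.prems m by (auto simp: row_shear_def split: if_splits)
    qed
    have "y $ j = c $$ (m - 1, m + j)" if j: "j < r" for j
    proof -
      have "h $$ (m - 1, k) * c $$ (k, m + j) = (if k = m - 1 then c $$ (m - 1, m + j) else 0)" if k: "k < n" for k
      proof -
        consider "k < m - 1" | "k = m - 1" | "m \<le> k" "k < m + r" | "m + r \<le> k" using m by linarith
        then show ?thesis
        proof cases
          case 1
          then show ?thesis using D(3)[of "m - 1" k] m by auto
        next
          case 2
          then show ?thesis using D(4)[of "m - 1"] m by auto
        next
          case 3
          then show ?thesis using H(2)[of "k - m"] m by auto
        next
          case 4
          then show ?thesis using low[OF _ k j] m by auto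
        qed
      qed
      then have "(\<Sum>k\<in>{0..<n}. h $$ (m - 1, k) * c $$ (k, m + j)) = (\<Sum>k\<in>{0..<n}. if k = m - 1 then c $$ (m - 1, m + j) else 0)"
        by (intro sum.cong HOL.refl) auto
      then have "row_shear m r n y $$ (m - 1, m + j) = c $$ (m - 1, m + j)"
        using ix[of "m - 1" "m + j"] j m by simp
      moreover have "row_shear m r n y $$ (m - 1, m + j) = y $ j"
      proof -
        have "m - 1 < n" "m + j < n" "m - 1 \<noteq> m + j" "m + j \<in> {m..<m + r}" using j m by auto
        then show ?thesis unfolding row_shear_def by simp
      qed
      ultimately show ?thesis by simp
    qed
    then have "nabs (y $ j) \<le> M" if "j < r" for j using M[OF that c] that by simp
    then show ?thesis unfolding box_def by (intro CollectI conjI allI impI y)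
  qed
  then show ?thesis by blast
qed

text \<open>Passing to inverses, c^(-1) is the column shear by -y times h, and since h has no
  entries in the cleared column, -y appears there as entries of c^(-1). Inversion is continuous, so
  these are bounded on C.\<close>

lemma col_shear_proper:
  fixes C :: "'f::nonarch_local_field mat set"
  assumes m: "1 \<le> m" "m + r < n" and C: "compactin (GL_top n) C"
  shows "\<exists>M. \<forall>y\<in>carrier_vec r. \<forall>h\<in>col_free m r n. \<forall>c\<in>C. col_shear m r n y = h * c \<longrightarrow> y \<in> box r M"
proof -
  have m': "m + r \<le> n" using m by simp
  have G: "levi_stab m r n \<subseteq> (carrier (GL n) :: 'f mat set)" by (rule levi_stab_GL[OF m'])
  have "\<exists>M\<ge>0. \<forall>i\<in>{..<r}. \<forall>x\<in>(\<lambda>A. inv\<^bsub>GL n\<^esub> A) ` C. nabs (x $$ (m + i, m + r)) \<le> M"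
    by (rule compactin_bounded_finite[OF image_compactin[OF C continuous_map_mat_inv] finite_lessThan])
      (rule continuous_map_GL_entry, use m in auto)
  then obtain M where M: "\<And>i x. i < r \<Longrightarrow> x \<in> C \<Longrightarrow> nabs ((inv\<^bsub>GL n\<^esub> x) $$ (m + i, m + r)) \<le> M" by blast
  have "y \<in> box r M" if y: "y \<in> carrier_vec r" and h: "h \<in> col_free m r n" and c: "c \<in> C" and eq: "col_shear m r n y = h * c"
    for y :: "'f vec" and h c :: "'f mat"
  proof -
    have H: "h \<in> levi_stab m r n" "\<And>j. j < r \<Longrightarrow> h $$ (m + j, m + r) = 0" using h unfolding col_free_def by auto
    have hG: "h \<in> carrier (GL n)" using H(1) G by blast
    have cG: "c \<in> carrier (GL n)" using compactin_GL_carrier[OF C c] .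
    have sG: "col_shear m r n x \<in> carrier (GL n)" for x :: "'f vec" using col_shear_levi[OF m'] G by blast
    have yi: "- y \<in> carrier_vec r" using y by simp
    have "c * (col_shear m r n (- y) * h) = 1\<^sub>m n"
    proof -
      have "c = inv\<^bsub>GL n\<^esub> h * col_shear m r n y" unfolding eq using GL_inv_cancel(1)[OF hG cG] by simp
      then have "c * (col_shear m r n (- y) * h) = inv\<^bsub>GL n\<^esub> h * (col_shear m r n y * (inv\<^bsub>GL n\<^esub> (col_shear m r n y) * h))"
        unfolding shear_inverse(2)[OF m y] using GL_assoc[OF GL_inv_closed[OF hG] sG GL_mult_closed[OF sG hG], of y "- y"] by simp
      also have "\<dots> = 1\<^sub>m n" using GL_inv_cancel(2)[OF sG hG, of y] GL_l_inv[OF hG] by simp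
      finally show ?thesis .
    qed
    then have ci: "inv\<^bsub>GL n\<^esub> c = col_shear m r n (- y) * h" by (rule GL_inv_eq[OF cG GL_mult_closed[OF sG hG]])
    have "nabs (y $ i) \<le> M" if i: "i < r" for i
    proof -
      have "m + i < n" "m + r < n" using m i by auto
      from col_shear_index(2)[OF m(2) levi_stabD(1)[OF H(1)] yi this]
      have "(inv\<^bsub>GL n\<^esub> c) $$ (m + i, m + r) = - y $ i"
        unfolding ci using H(2)[OF i] levi_stabD(4)[OF H(1), of "m + r"] i y m by auto
      then show ?thesis using M[OF i c] by simp
    qed
    then show ?thesis unfolding box_def by (intro CollectI conjI allI impI y)
  qed
  then show ?thesis by blast
qed

definition FJ_data :: "nat \<Rightarrow> nat \<Rightarrow> nat \<Rightarrow> (nat \<Rightarrow> 'f::nonarch_local_field mat \<Rightarrow> complex) \<Rightarrow> ('f \<Rightarrow> complex) \<Rightarrow> (nat \<Rightarrow> 'f) \<Rightarrow> bool" where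
  "FJ_data m1 m2 r \<phi> lam c \<longleftrightarrow> c (m1 - 1) = 1 \<and>
    (\<forall>h\<in>levi_stab m1 r (m1 + m2 + r). \<phi> m1 (block h 0 0 m1 m1) * \<phi> m2 (block h (m1 + r) (m1 + r) m2 m2) *
       lam (h $$ (m1 - 1, m1 + r)) = lam (simple_sum m1 r (m1 + m2 - 1) c h))"

text \<open>The phase y \<bullet> v of the hat action is exactly the change of the generic linear
  form under the row shear. The exponents of \<nu> add up to (m2 - m1) + (m1 - m2) / 2 + 1 /
  2.\<close>

lemma hat_iso:
  fixes \<pi> :: "('f::nonarch_local_field mat, 'v) rep"
  assumes lam: "add_char lam" and m: "1 \<le> m1" "1 \<le> m2" and n: "n = m1 + m2 + r" and \<pi>: "smooth_rep r \<pi>"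
    and c: "FJ_data m1 m2 r \<phi> lam c"
  shows "rep_iso (carrier (GL n)) (cind n (levi_stab m1 r n) (FJ_rep m1 r (real m2 - real m1) \<pi> (zetaF_hat \<phi> lam m1 m2 r)))
    (cind n (row_free m1 r n) (std_rep m1 r (m1 + m2 - 1) ((real m2 - real m1 + 1) / 2) lam c \<pi>))"
proof -
  let ?N = "m1 + m2 - 1" and ?B = "zetaF_hat \<phi> lam m1 m2 r"
  have mr: "m1 + r < n" "m1 + r \<le> n" "m1 \<le> ?N" "?N + r < n" using m n by auto
  have c1: "c (m1 - 1) = 1" using c unfolding FJ_data_def by blast
  show ?thesis
  proof (rule FJ_stages[where s = "row_shear m1 r n" and \<tau> = "\<lambda>h y. transpose_mat (block h m1 m1 r r) *\<^sub>v y + row_part m1 r h"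
      and k = "\<lambda>h y. nu ((real m1 - real m2) / 2) (block h m1 m1 r r) * nu (1 / 2) (block h m1 m1 r r) *
         lam (simple_sum m1 r ?N c h) * lam (y \<bullet> col_part m1 r h)", OF \<pi> zetaF_is_schwartz(2) mr(2,4)])
    fix h :: "'f mat" assume h: "h \<in> levi_stab m1 r n"
    note g = levi_stabD(2)[OF h]
    show "lin_map ?B ?B (act ?B h)" by (rule zetaF_lin_map(2)[OF m(1) g lam])
    have cc: "\<phi> m1 (block h 0 0 m1 m1) * \<phi> m2 (block h (m1 + r) (m1 + r) m2 m2) *
       lam (h $$ (m1 - 1, m1 + r)) = lam (simple_sum m1 r ?N c h)" using c h unfolding FJ_data_def n by blast
    show "act ?B h f x = nu ((real m1 - real m2) / 2) (block h m1 m1 r r) * nu (1 / 2) (block h m1 m1 r r) *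
         lam (simple_sum m1 r ?N c h) * lam (x \<bullet> col_part m1 r h) * f (transpose_mat (block h m1 m1 r r) *\<^sub>v x + row_part m1 r h)"
      if "x \<in> carrier_vec r" for f x
      unfolding act_hat[OF m(1) g lam] cc using that by simp
    fix y :: "'f vec" assume y: "y \<in> carrier_vec r"
    show "transpose_mat (block h m1 m1 r r) *\<^sub>v y + row_part m1 r h \<in> carrier_vec r \<and>
        row_shear m1 r n y * h * inv\<^bsub>GL n\<^esub> (row_shear m1 r n (transpose_mat (block h m1 m1 r r) *\<^sub>v y + row_part m1 r h)) \<in> row_free m1 r n"
      using row_shear_stage(1,2)[OF m(1) mr(1) h y] by blast
    fix h0 y' assume h0: "h0 \<in> row_free m1 r n" and y': "y' \<in> carrier_vec r" and eq: "row_shear m1 r n y * h = h0 * row_shear m1 r n y'"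
    have h0': "h0 \<in> carrier_mat n n" using h0 levi_stabD(1) unfolding row_free_def by blast
    have S: "simple_sum m1 r ?N c h0 = simple_sum m1 r ?N c h + y \<bullet> col_part m1 r h"
      by (rule simple_sum_row_shear[where c=c, OF m(1) mr(3,4) levi_stabD(1)[OF h] h0' y y' eq c1])
    have e: "(real m2 - real m1 + 1) / 2 = (real m2 - real m1) + ((real m1 - real m2) / 2 + 1 / 2)" by (simp add: field_simps)
    show "y' = transpose_mat (block h m1 m1 r r) *\<^sub>v y + row_part m1 r h \<and> block h0 m1 m1 r r = block h m1 m1 r r \<and>
      nu (real m2 - real m1) (block h m1 m1 r r) * (nu ((real m1 - real m2) / 2) (block h m1 m1 r r) * nu (1 / 2) (block h m1 m1 r r) *
         lam (simple_sum m1 r ?N c h) * lam (y \<bullet> col_part m1 r h)) =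
      nu ((real m2 - real m1 + 1) / 2) (block h m1 m1 r r) * lam (simple_sum m1 r ?N c h0)"
      using row_shear_stage(3)[OF m(1) mr(1) h y h0 y' eq] unfolding S add_charD(1)[OF lam] e nu_add[OF GL_det[OF g]]
      by (simp only: mult_ac)
  next
    show "row_free m1 r n \<subseteq> (levi_stab m1 r n :: 'f mat set)" unfolding row_free_def by blast
    have "(1\<^sub>m n :: 'f mat) $$ (m1 - 1, m1 + j) = 0" if "j < r" for j
    proof -
      have "m1 - 1 < n" "m1 + j < n" "m1 - 1 \<noteq> m1 + j" using m mr that by auto
      then show ?thesis by simp
    qed
    then show "(1\<^sub>m n :: 'f mat) \<in> row_free m1 r n" unfolding row_free_def using one_mat_levi(1)[OF mr(2)] by blast
    show "continuous_map (vec_top r) (GL_top n) (row_shear m1 r n :: 'f vec \<Rightarrow> 'f mat)" by (rule continuous_map_shear(1)[OF m(1) mr(1)])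
    show "row_shear m1 r n (0\<^sub>v r) = (1\<^sub>m n :: 'f mat)" by (rule shear_inverse(3)[OF m(1) mr(1) zero_carrier_vec])
    show "row_shear m1 r n y \<in> (levi_stab m1 r n :: 'f mat set)" for y by (rule row_shear_levi[OF m(1) mr(2)])
    show "inv\<^bsub>GL n\<^esub> (row_shear m1 r n y) \<in> (levi_stab m1 r n :: 'f mat set)" if "y \<in> carrier_vec r" for y
      unfolding shear_inverse(1)[OF m(1) mr(1) that] by (rule row_shear_levi[OF m(1) mr(2)])
    show "\<exists>M. \<forall>y\<in>carrier_vec r. \<forall>h\<in>row_free m1 r n. \<forall>c\<in>C. row_shear m1 r n y = h * c \<longrightarrow> y \<in> box r M"
      if "compactin (GL_top n) C" for C :: "'f mat set" by (rule row_shear_proper[OF m(1) mr(1) that])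
  qed (rule lam)
qed

text \<open>The phase -(w \<bullet> \<tau>) of the tilde action is the change of the generic linear
  form under the column shear. The exponents of \<nu> add up to (m2 - m1) + (m1 - m2) / 2 - 1 /
  2.\<close>

lemma tilde_iso:
  fixes \<pi> :: "('f::nonarch_local_field mat, 'v) rep"
  assumes lam: "add_char lam" and m: "1 \<le> m1" "1 \<le> m2" and n: "n = m1 + m2 + r" and \<pi>: "smooth_rep r \<pi>"
    and c: "FJ_data m1 m2 r \<phi> lam c"
  shows "rep_iso (carrier (GL n)) (cind n (levi_stab m1 r n) (FJ_rep m1 r (real m2 - real m1) \<pi> (zetaF \<phi> lam m1 m2 r)))
    (cind n (col_free m1 r n) (std_rep m1 r (m1 + m2 - 1) ((real m2 - real m1 - 1) / 2) lam c \<pi>))"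
proof -
  let ?N = "m1 + m2 - 1" and ?B = "zetaF \<phi> lam m1 m2 r"
  let ?\<tau> = "\<lambda>h y. inv\<^bsub>GL r\<^esub> (block h m1 m1 r r) *\<^sub>v (y + col_part m1 r h)"
  have mr: "m1 + r < n" "m1 + r \<le> n" "m1 \<le> ?N" "?N + r < n" using m n by auto
  have c1: "c (m1 - 1) = 1" using c unfolding FJ_data_def by blast
  show ?thesis
  proof (rule FJ_stages[where s = "col_shear m1 r n" and \<tau> = ?\<tau>
      and k = "\<lambda>h y. nu ((real m1 - real m2) / 2) (block h m1 m1 r r) * nu (- 1 / 2) (block h m1 m1 r r) *
         lam (simple_sum m1 r ?N c h) * lam (- (row_part m1 r h \<bullet> ?\<tau> h y))", OF \<pi> zetaF_is_schwartz(1) mr(2,4)])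
    fix h :: "'f mat" assume h: "h \<in> levi_stab m1 r n"
    note g = levi_stabD(2)[OF h]
    show "lin_map ?B ?B (act ?B h)" by (rule zetaF_lin_map(1)[OF m(1) g lam])
    have cc: "\<phi> m1 (block h 0 0 m1 m1) * \<phi> m2 (block h (m1 + r) (m1 + r) m2 m2) *
       lam (h $$ (m1 - 1, m1 + r)) = lam (simple_sum m1 r ?N c h)" using c h unfolding FJ_data_def n by blast
    show "act ?B h f x = nu ((real m1 - real m2) / 2) (block h m1 m1 r r) * nu (- 1 / 2) (block h m1 m1 r r) *
         lam (simple_sum m1 r ?N c h) * lam (- (row_part m1 r h \<bullet> ?\<tau> h x)) * f (?\<tau> h x)"
      if "x \<in> carrier_vec r" for f x
      unfolding act_tilde[OF m(1) g lam] cc using that by simp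
    fix y :: "'f vec" assume y: "y \<in> carrier_vec r"
    show "?\<tau> h y \<in> carrier_vec r \<and> col_shear m1 r n y * h * inv\<^bsub>GL n\<^esub> (col_shear m1 r n (?\<tau> h y)) \<in> col_free m1 r n"
      using col_shear_stage(1,2)[OF m(1) mr(1) h y] by blast
    fix h0 y' assume h0: "h0 \<in> col_free m1 r n" and y': "y' \<in> carrier_vec r" and eq: "col_shear m1 r n y * h = h0 * col_shear m1 r n y'"
    have h0': "h0 \<in> carrier_mat n n" using h0 levi_stabD(1) unfolding col_free_def by blast
    note st = col_shear_stage(3)[OF m(1) mr(1) h y h0 y' eq]
    have S: "simple_sum m1 r ?N c h0 = simple_sum m1 r ?N c h + - (row_part m1 r h \<bullet> ?\<tau> h y)"
      using simple_sum_col_shear[where N="?N" and c=c, OF m(1) mr(3,4) h h0' y y' eq c1] st by simp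
    have e: "(real m2 - real m1 - 1) / 2 = (real m2 - real m1) + ((real m1 - real m2) / 2 + - 1 / 2)" by (simp add: field_simps)
    show "y' = ?\<tau> h y \<and> block h0 m1 m1 r r = block h m1 m1 r r \<and>
      nu (real m2 - real m1) (block h m1 m1 r r) * (nu ((real m1 - real m2) / 2) (block h m1 m1 r r) * nu (- 1 / 2) (block h m1 m1 r r) *
         lam (simple_sum m1 r ?N c h) * lam (- (row_part m1 r h \<bullet> ?\<tau> h y))) =
      nu ((real m2 - real m1 - 1) / 2) (block h m1 m1 r r) * lam (simple_sum m1 r ?N c h0)"
      using st unfolding S add_charD(1)[OF lam] e nu_add[OF GL_det[OF g]]
      by (simp only: mult_ac)
  next
    show "col_free m1 r n \<subseteq> (levi_stab m1 r n :: 'f mat set)" unfolding col_free_def by blast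
    have "(1\<^sub>m n :: 'f mat) $$ (m1 + i, m1 + r) = 0" if "i < r" for i
    proof -
      have "m1 + i < n" "m1 + r < n" "m1 + i \<noteq> m1 + r" using m mr that by auto
      then show ?thesis by simp
    qed
    then show "(1\<^sub>m n :: 'f mat) \<in> col_free m1 r n" unfolding col_free_def using one_mat_levi(1)[OF mr(2)] by blast
    show "continuous_map (vec_top r) (GL_top n) (col_shear m1 r n :: 'f vec \<Rightarrow> 'f mat)" by (rule continuous_map_shear(2)[OF m(1) mr(1)])
    show "col_shear m1 r n (0\<^sub>v r) = (1\<^sub>m n :: 'f mat)" by (rule shear_inverse(4)[OF m(1) mr(1) zero_carrier_vec])
    show "col_shear m1 r n y \<in> (levi_stab m1 r n :: 'f mat set)" for y by (rule col_shear_levi[OF mr(2)])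
    show "inv\<^bsub>GL n\<^esub> (col_shear m1 r n y) \<in> (levi_stab m1 r n :: 'f mat set)" if "y \<in> carrier_vec r" for y
      unfolding shear_inverse(2)[OF m(1) mr(1) that] by (rule col_shear_levi[OF mr(2)])
    show "\<exists>M. \<forall>y\<in>carrier_vec r. \<forall>h\<in>col_free m1 r n. \<forall>c\<in>C. col_shear m1 r n y = h * c \<longrightarrow> y \<in> box r M"
      if "compactin (GL_top n) C" for C :: "'f mat set" by (rule col_shear_proper[OF m(1) mr(1) that])
  qed (rule lam)
qed

section \<open>The Fourier transform between the two Weil representations\<close>

lemma fourier_map_lin_map:
  fixes B B' :: "(complex, 'f::nonarch_local_field vec \<Rightarrow> complex, 's) module_scheme"
  assumes lam: "nontrivial_add_char lam" and B: "is_schwartz r B" and B': "is_schwartz r B'"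
  shows "lin_map B B' (fourier_map r lam)"
proof (rule lin_map_module_hom[OF schwartz_module[OF B] schwartz_module[OF B']])
  have ac: "add_char lam" using lam by (simp add: nontrivial_add_char_iff)
  note D = is_schwartzD[OF B] and D' = is_schwartzD[OF B']
  have add: "fourier_map r lam (\<lambda>x\<in>carrier_vec r. f x + g x) = (\<lambda>x\<in>carrier_vec r. fourier_map r lam f x + fourier_map r lam g x)"
    if f: "f \<in> schwartz r" and g: "g \<in> schwartz r" for f g
  proof -
    note tf = schwartz_test_fun[OF f] and tg = schwartz_test_fun[OF g]
    have "fourier r lam (\<lambda>x\<in>carrier_vec r. f x + g x) y = fourier r lam f y + fourier r lam g y" if y: "y \<in> carrier_vec r" for y
      using fourier_cong[OF ac test_fun_add[OF tf tg] y, of "\<lambda>x\<in>carrier_vec r. f x + g x"] fourier_add[OF ac tf tg y] by simp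
    then show ?thesis by (auto simp: fourier_map_def fun_eq_iff)
  qed
  have sm: "fourier_map r lam (\<lambda>x\<in>carrier_vec r. c * f x) = (\<lambda>x\<in>carrier_vec r. c * fourier_map r lam f x)"
    if f: "f \<in> schwartz r" for c f
  proof -
    note tf = schwartz_test_fun[OF f]
    have "fourier r lam (\<lambda>x\<in>carrier_vec r. c * f x) y = c * fourier r lam f y" if y: "y \<in> carrier_vec r" for y
      using fourier_cong[OF ac test_fun_scale[OF tf] y, of c "\<lambda>x\<in>carrier_vec r. c * f x"] fourier_scale[OF ac tf y] by simp
    then show ?thesis by (auto simp: fourier_map_def fun_eq_iff)
  qed
  show "fourier_map r lam \<in> module_hom class_ring B B'"
    unfolding module_hom_def using fourier_map_schwartz[OF lam] add sm by (simp add: D D' Pi_iff)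
qed

text \<open>The tilde action is, up to a scalar, modulation by w, then substitution of g^(-1) x,
  then translation by v. The transform turns these into translation by w, substitution of g^t y with
  the factor |det g|, and modulation by v, which is the hat action; the factor raises the exponent
  -1/2 to 1/2.\<close>

lemma fourier_intertwines:
  fixes h :: "'f::nonarch_local_field mat"
  assumes lam: "nontrivial_add_char lam" and m: "1 \<le> m1" and g: "block h m1 m1 r r \<in> carrier (GL r)" and f: "f \<in> schwartz r"
  shows "fourier_map r lam (act (zetaF \<phi> lam m1 m2 r) h f) = act (zetaF_hat \<phi> lam m1 m2 r) h (fourier_map r lam f)"
proof -
  have ac: "add_char lam" using lam by (simp add: nontrivial_add_char_iff)
  let ?g = "block h m1 m1 r r" and ?w = "row_part m1 r h" and ?v = "col_part m1 r h"
  have gi: "inv\<^bsub>GL r\<^esub> ?g \<in> carrier (GL r)" using g by blast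
  let ?K = "\<phi> m1 (block h 0 0 m1 m1) * \<phi> m2 (block h (m1 + r) (m1 + r) m2 m2) * lam (h $$ (m1 - 1, m1 + r))"
  let ?s = "nu ((real m1 - real m2) / 2) ?g"
  define F1 where "F1 z = f z * lam (- (z \<bullet> ?w))" for z
  define F2 where "F2 x = F1 (inv\<^bsub>GL r\<^esub> ?g *\<^sub>v x)" for x
  define F3 where "F3 x = F2 (x + ?v)" for x
  have t: "test_fun r f" by (rule schwartz_test_fun[OF f])
  have t1: "test_fun r F1" unfolding F1_def by (rule test_fun_char[OF ac part_carrier(1) t])
  have t2: "test_fun r F2" unfolding F2_def by (rule test_fun_comp[OF gi t1])
  have t3: "test_fun r F3" unfolding F3_def by (rule test_fun_translate[OF t2 part_carrier(2)])
  have "fourier r lam (act (zetaF \<phi> lam m1 m2 r) h f) y =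
      ?s * nu (1 / 2) ?g * ?K * lam (y \<bullet> ?v) * fourier r lam f (transpose_mat ?g *\<^sub>v y + ?w)" if y: "y \<in> carrier_vec r" for y
  proof -
    have gy: "transpose_mat ?g *\<^sub>v y \<in> carrier_vec r" by (rule mult_mat_vec_carrier[of _ r r]) (use y in simp_all)
    have "fourier r lam (\<lambda>x. (?s * nu (- 1 / 2) ?g * ?K) * F3 x) y = fourier r lam (act (zetaF \<phi> lam m1 m2 r) h f) y"
    proof (rule fourier_cong[OF ac test_fun_scale[OF t3] y])
      fix x :: "'f vec" assume x: "x \<in> carrier_vec r"
      have "inv\<^bsub>GL r\<^esub> ?g *\<^sub>v (x + ?v) \<in> carrier_vec r"
        by (rule mult_mat_vec_carrier[OF GL_carrier_mat[OF gi]]) (use x in simp)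
      then show "(?s * nu (- 1 / 2) ?g * ?K) * F3 x = act (zetaF \<phi> lam m1 m2 r) h f x"
        unfolding act_tilde[OF m g ac] F3_def F2_def F1_def using x comm_scalar_prod[OF part_carrier(1), of _ r m1 h] by simp
    qed
    also have "fourier r lam (\<lambda>x. (?s * nu (- 1 / 2) ?g * ?K) * F3 x) y = (?s * nu (- 1 / 2) ?g * ?K) * fourier r lam F3 y"
      by (rule fourier_scale[OF ac t3 y])
    also have "fourier r lam F3 y = lam (?v \<bullet> y) * fourier r lam F2 y"
      unfolding F3_def by (rule fourier_translate[OF ac t2 y part_carrier(2)])
    also have "fourier r lam F2 y = of_real (nabs (det ?g)) * fourier r lam F1 (transpose_mat ?g *\<^sub>v y)"
      unfolding F2_def by (rule fourier_GL[OF ac t1 y g])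
    also have "fourier r lam F1 (transpose_mat ?g *\<^sub>v y) = fourier r lam f (transpose_mat ?g *\<^sub>v y + ?w)"
      unfolding F1_def by (rule fourier_modulate[OF ac t gy part_carrier(1)])
    finally have "fourier r lam (act (zetaF \<phi> lam m1 m2 r) h f) y =
      ?s * (nu (- 1 / 2) ?g * of_real (nabs (det ?g))) * ?K * lam (y \<bullet> ?v) * fourier r lam f (transpose_mat ?g *\<^sub>v y + ?w)"
      using comm_scalar_prod[OF part_carrier(2) y, of m1 h] by (simp add: mult_ac)
    also have "nu (- 1 / 2) ?g * of_real (nabs (det ?g)) = nu (1 / 2) ?g"
    proof -
      have "nu 1 ?g = of_real (nabs (det ?g))" by (simp add: nu_def)
      then show ?thesis using nu_add[OF GL_det[OF g], of "- 1 / 2" 1] by simp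
    qed
    finally show ?thesis .
  qed
  moreover have "transpose_mat ?g *\<^sub>v y + ?w \<in> carrier_vec r" if "y \<in> carrier_vec r" for y
    by (intro add_carrier_vec mult_mat_vec_carrier[of _ r r] part_carrier) (use that in simp_all)
  ultimately show ?thesis
    unfolding act_hat[OF m g ac] by (simp add: fourier_map_def fun_eq_iff)
qed

lemma GL_inv_one: "inv\<^bsub>GL n\<^esub> (1\<^sub>m n) = (1\<^sub>m n :: 'f::field mat)"
  by (rule GL_inv_eq) auto

text \<open>The identity of \<pi> tensored with the Fourier transform is an isomorphism of the
  inducing representations, to which \<open>cind_iso_conj\<close> is applied with t = 1.\<close>

lemma fourier_iso:
  fixes \<pi> :: "('f::nonarch_local_field mat, 'v) rep"
  assumes lam: "nontrivial_add_char lam" and m: "1 \<le> m1" and n: "m1 + r \<le> n" and \<pi>: "smooth_rep r \<pi>"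
  shows "rep_iso (carrier (GL n)) (cind n (levi_stab m1 r n) (FJ_rep m1 r t \<pi> (zetaF \<phi> lam m1 m2 r)))
    (cind n (levi_stab m1 r n) (FJ_rep m1 r t \<pi> (zetaF_hat \<phi> lam m1 m2 r)))"
proof -
  have ac: "add_char lam" using lam by (simp add: nontrivial_add_char_iff)
  let ?A = "pull (projF m1 r) \<pi>" and ?B = "zetaF \<phi> lam m1 m2 r" and ?B' = "zetaF_hat \<phi> lam m1 m2 r"
  let ?F = "fourier_map r lam" and ?H = "levi_stab m1 r n :: 'f mat set"
  let ?T = "tensor_map ?A ?B' (\<lambda>x. x) ?F"
  note A = pull_module[OF smooth_repD(1)[OF \<pi>], of "projF m1 r"]
  note sB = zetaF_is_schwartz(1)[of r \<phi> lam m1 m2] and sB' = zetaF_is_schwartz(2)[of r \<phi> lam m1 m2]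
  note B = schwartz_module[OF sB] and B' = schwartz_module[OF sB']
  have G: "?H \<subseteq> carrier (GL n)" by (rule levi_stab_GL[OF n])
  have F: "lin_map ?B ?B' ?F" by (rule fourier_map_lin_map[OF lam sB sB'])
  have T: "lin_map (tensor ?A ?B) (tensor ?A ?B') ?T" by (rule tensor_map_lin[OF A B A B' lin_map_id F])
  have "bij_betw ?F (carrier ?B) (carrier ?B')" using fourier_map_bij[OF lam, of r] by (simp add: is_schwartzD[OF sB] is_schwartzD[OF sB'])
  then have Tb: "bij_betw ?T (carrier (tensor ?A ?B)) (carrier (tensor ?A ?B'))" by (rule tensor_map_bij[OF A B B' F])
  have eq: "?T (act (FJ_rep m1 r t \<pi> ?B) h P) = act (FJ_rep m1 r t \<pi> ?B') h (?T P)"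
    if h: "h \<in> ?H" and P: "P \<in> carrier (tensor ?A ?B)" for h P
  proof -
    note g = levi_stabD(2)[OF h]
    have lA: "lin_map ?A ?A (act ?A h)" using lin_map_pull[OF smooth_repD(2)[OF \<pi> g]] by (simp add: projF_def lin_map_def)
    have lB: "lin_map ?B ?B (act ?B h)" "lin_map ?B' ?B' (act ?B' h)" using zetaF_lin_map[OF m g ac] by auto
    obtain X where X: "X \<in> formal_sums ?A ?B" "P = tcls ?A ?B X" using P unfolding tensor_carrier by blast
    let ?a = "\<lambda>\<alpha> \<beta>. image_mset (\<lambda>(a, b). (\<alpha> a, \<beta> b))"
    have Q: "act (tensor ?A ?B) h P = tcls ?A ?B (?a (act ?A h) (act ?B h) X)"
      unfolding tensor_act X(2) by (rule tensor_map_cls[OF lA lB(1) X(1)])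
    have X1: "?a (act ?A h) (act ?B h) X \<in> formal_sums ?A ?B" by (rule formal_sums_image[OF lA lB(1) X(1)])
    have X2: "?a (\<lambda>x. x) ?F X \<in> formal_sums ?A ?B'" by (rule formal_sums_image[OF lin_map_id F X(1)])
    have "?T (act (tensor ?A ?B) h P) = tcls ?A ?B' (?a (\<lambda>x. x) ?F (?a (act ?A h) (act ?B h) X))"
      unfolding Q by (rule tensor_map_cls[OF lin_map_id F X1])
    also have "?a (\<lambda>x. x) ?F (?a (act ?A h) (act ?B h) X) = ?a (act ?A h) (act ?B' h) (?a (\<lambda>x. x) ?F X)"
    proof -
      have "?F (act ?B h b) = act ?B' h (?F b)" if "(a, b) \<in># X" for a b
        using fourier_intertwines[OF lam m g, of b] that X(1) is_schwartzD(1)[OF sB] unfolding formal_sums_def by auto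
      then show ?thesis by (auto simp: image_mset.compositionality comp_def intro!: image_mset_cong)
    qed
    also have "tcls ?A ?B' (?a (act ?A h) (act ?B' h) (?a (\<lambda>x. x) ?F X)) = act (tensor ?A ?B') h (?T P)"
      unfolding tensor_act X(2) tensor_map_cls[OF lin_map_id F X(1)] by (rule tensor_map_cls[OF lA lB(2) X2, symmetric])
    finally have e: "?T (act (tensor ?A ?B) h P) = act (tensor ?A ?B') h (?T P)" .
    have "act (tensor ?A ?B) h P \<in> carrier (tensor ?A ?B)" unfolding Q tensor_carrier using X1 by blast
    then show ?thesis using T e unfolding lin_map_def by simp
  qed
  have c1: "1\<^sub>m n * h * inv\<^bsub>GL n\<^esub> (1\<^sub>m n) = h" "inv\<^bsub>GL n\<^esub> (1\<^sub>m n) * h * 1\<^sub>m n = h" if "h \<in> ?H" for h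
    using that G by (auto simp: GL_inv_one)
  show ?thesis
  proof (rule cind_iso_conj[OF G G GL_one_closed])
    show "lin_map (FJ_rep m1 r t \<pi> ?B) (FJ_rep m1 r t \<pi> ?B') ?T" using T by (simp add: lin_map_def)
    show "bij_betw ?T (carrier (FJ_rep m1 r t \<pi> ?B)) (carrier (FJ_rep m1 r t \<pi> ?B'))" using Tb by simp
    show "act (FJ_rep m1 r t \<pi> ?B) h P \<in> carrier (FJ_rep m1 r t \<pi> ?B)" if h: "h \<in> ?H" and P: "P \<in> carrier (FJ_rep m1 r t \<pi> ?B)" for h P
      by (rule lin_map_closed[OF FJ_rep_lin_map[OF \<pi> sB _ levi_stabD(2)[OF h]] P])
        (rule zetaF_lin_map(1)[OF m levi_stabD(2)[OF h] ac])
    show "?T (act (FJ_rep m1 r t \<pi> ?B) (1\<^sub>m n * h * inv\<^bsub>GL n\<^esub> (1\<^sub>m n)) P) = act (FJ_rep m1 r t \<pi> ?B') h (?T P)"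
      if h: "h \<in> ?H" and P: "P \<in> carrier (FJ_rep m1 r t \<pi> ?B)" for h P
      unfolding c1[OF h] by (rule eq[OF h]) (use P in simp)
    show "\<zero>\<^bsub>FJ_rep m1 r t \<pi> ?B\<^esub> \<in> carrier (FJ_rep m1 r t \<pi> ?B)" using tensor_closed(1)[OF A B] by simp
  qed (simp_all only: c1)
qed

section \<open>Conjugation by diagonal and permutation matrices\<close>

definition diag_of :: "nat \<Rightarrow> (nat \<Rightarrow> 'f) \<Rightarrow> 'f::field mat" where
  "diag_of n \<tau> = mat n n (\<lambda>(i, j). if i = j then \<tau> i else 0)"

lemma diag_of_conj:
  fixes h :: "'f::field mat"
  assumes \<tau>: "\<forall>i<n. \<tau> i \<noteq> 0"
  shows "diag_of n \<tau> \<in> carrier (GL n)" "inv\<^bsub>GL n\<^esub> (diag_of n \<tau>) = diag_of n (\<lambda>i. inverse (\<tau> i))"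
    "h \<in> carrier_mat n n \<Longrightarrow> i < n \<Longrightarrow> j < n \<Longrightarrow> (diag_of n \<tau> * h * inv\<^bsub>GL n\<^esub> (diag_of n \<tau>)) $$ (i, j) = \<tau> i * h $$ (i, j) * inverse (\<tau> j)"
    "h \<in> carrier_mat n n \<Longrightarrow> i < n \<Longrightarrow> j < n \<Longrightarrow> (inv\<^bsub>GL n\<^esub> (diag_of n \<tau>) * h * diag_of n \<tau>) $$ (i, j) = inverse (\<tau> i) * h $$ (i, j) * \<tau> j"
proof -
  have d: "diag_of n \<sigma> \<in> carrier_mat n n" for \<sigma> :: "nat \<Rightarrow> 'f" by (simp add: diag_of_def)
  have l: "(diag_of n \<sigma> * A) $$ (i, j) = \<sigma> i * A $$ (i, j)" if "A \<in> carrier_mat n n" "i < n" "j < n" for \<sigma> and A :: "'f mat" and i j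
  proof -
    have "(diag_of n \<sigma> * A) $$ (i, j) = (\<Sum>k\<in>{0..<n}. if k = i then \<sigma> i * A $$ (i, j) else 0)"
      unfolding mat_mult_index[OF d that] using that by (intro sum.cong HOL.refl) (auto simp: diag_of_def)
    then show ?thesis using that by simp
  qed
  have r: "(A * diag_of n \<sigma>) $$ (i, j) = A $$ (i, j) * \<sigma> j" if "A \<in> carrier_mat n n" "i < n" "j < n" for \<sigma> and A :: "'f mat" and i j
  proof -
    have "(A * diag_of n \<sigma>) $$ (i, j) = (\<Sum>k\<in>{0..<n}. if k = j then A $$ (i, j) * \<sigma> j else 0)"
      unfolding mat_mult_index[OF that(1) d that(2,3)] using that by (intro sum.cong HOL.refl) (auto simp: diag_of_def)
    then show ?thesis using that by simp
  qed
  have one: "diag_of n \<sigma> * diag_of n (\<lambda>i. inverse (\<sigma> i)) = 1\<^sub>m n" if "\<forall>i<n. \<sigma> i \<noteq> 0" for \<sigma> :: "nat \<Rightarrow> 'f"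
  proof (rule eq_matI)
    fix i j assume "i < dim_row (1\<^sub>m n :: 'f mat)" "j < dim_col (1\<^sub>m n :: 'f mat)"
    then have ij: "i < n" "j < n" by auto
    show "(diag_of n \<sigma> * diag_of n (\<lambda>i. inverse (\<sigma> i))) $$ (i, j) = 1\<^sub>m n $$ (i, j)"
      unfolding l[OF d ij] using ij that by (simp add: diag_of_def)
  qed (simp_all add: diag_of_def)
  have GL: "diag_of n \<sigma> \<in> carrier (GL n)" if "\<forall>i<n. \<sigma> i \<noteq> 0" for \<sigma> :: "nat \<Rightarrow> 'f"
  proof -
    have "det (diag_of n \<sigma>) * det (diag_of n (\<lambda>i. inverse (\<sigma> i))) = 1"
      unfolding det_mult[OF d d, symmetric] one[OF that] by simp
    then show ?thesis unfolding carrier_GL using d by auto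
  qed
  show G: "diag_of n \<tau> \<in> carrier (GL n)" by (rule GL[OF \<tau>])
  have "diag_of n (\<lambda>i. inverse (\<tau> i)) \<in> carrier (GL n)" by (rule GL) (use \<tau> in simp)
  then show i: "inv\<^bsub>GL n\<^esub> (diag_of n \<tau>) = diag_of n (\<lambda>i. inverse (\<tau> i))" by (rule GL_inv_eq[OF G _ one[OF \<tau>]])
  show "(diag_of n \<tau> * h * inv\<^bsub>GL n\<^esub> (diag_of n \<tau>)) $$ (i, j) = \<tau> i * h $$ (i, j) * inverse (\<tau> j)"
    if "h \<in> carrier_mat n n" "i < n" "j < n" for i j
    unfolding i using r[OF mult_carrier_mat[OF d that(1)] that(2,3)] l[OF that] by simp
  show "(inv\<^bsub>GL n\<^esub> (diag_of n \<tau>) * h * diag_of n \<tau>) $$ (i, j) = inverse (\<tau> i) * h $$ (i, j) * \<tau> j"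
    if "h \<in> carrier_mat n n" "i < n" "j < n" for i j
    unfolding i using r[OF mult_carrier_mat[OF d that(1)] that(2,3)] l[OF that] by simp
qed

text \<open>Rescaling entries by \<sigma> i and \<tau> j keeps all zeros; reciprocal factors keep
  the unit diagonal, and trivial factors on the GL_r block keep that block.\<close>

lemma row_free_scaled:
  fixes h A :: "'f::field mat"
  assumes h: "h \<in> row_free m r n" and A: "A \<in> carrier_mat n n" and m: "1 \<le> m" "m + r \<le> n"
    and e: "\<And>i j. i < n \<Longrightarrow> j < n \<Longrightarrow> A $$ (i, j) = \<sigma> i * h $$ (i, j) * \<tau> j"
    and d: "\<And>i. i < n \<Longrightarrow> \<sigma> i * \<tau> i = 1" and R: "\<And>i. m \<le> i \<Longrightarrow> i < m + r \<Longrightarrow> \<sigma> i = 1 \<and> \<tau> i = 1"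
  shows "A \<in> row_free m r n" "block A m m r r = block h m m r r"
proof -
  have H: "h \<in> levi_stab m r n" "\<And>j. j < r \<Longrightarrow> h $$ (m - 1, m + j) = 0" using h unfolding row_free_def by auto
  note D = levi_stabD[OF H(1)]
  show b: "block A m m r r = block h m m r r" using e R m by (intro eq_matI) auto
  have "A \<in> levi_stab m r n"
  proof (rule levi_stabI[OF A])
    show "block A m m r r \<in> carrier (GL r)" unfolding b by (rule D(2))
    show "A $$ (i, j) = 0" if "i < n" "j < i" "\<not> (i \<in> {m..<m + r} \<and> j \<in> {m..<m + r})" for i j
      using e[of i j] D(3)[OF that] that by simp
    show "A $$ (i, i) = 1" if "i < n" "i \<notin> {m..<m + r}" for i
      using e[of i i] D(4)[OF that] d[OF that(1)] that by simp
  qed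
  moreover have "A $$ (m - 1, m + j) = 0" if j: "j < r" for j
    using e[of "m - 1" "m + j"] H(2)[OF j] m j by simp
  ultimately show "A \<in> row_free m r n" unfolding row_free_def by blast
qed

text \<open>Agreement is required only on H: the character \<open>zetaB\<close> matches a standard
  one there by \<open>HB_char\<close>, but is defined on all matrices.\<close>

definition is_std where
  "is_std H m r N t lam c \<pi> \<sigma> \<longleftrightarrow> carrier \<sigma> = carrier \<pi> \<and> zero \<sigma> = zero \<pi> \<and> add \<sigma> = add \<pi> \<and> smult \<sigma> = smult \<pi> \<and>
     (\<forall>h\<in>H. \<forall>v\<in>carrier \<pi>. act \<sigma> h v = act (std_rep m r N t lam c \<pi>) h v)"

lemma is_std_std_rep: "is_std H m r N t lam c \<pi> (std_rep m r N t lam c \<pi>)"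
  by (simp add: is_std_def)

lemma std_rep_closed:
  fixes \<pi> :: "('f::nonarch_local_field mat, 'v) rep"
  assumes \<pi>: "smooth_rep r \<pi>" and h: "block h m m r r \<in> carrier (GL r)" and v: "v \<in> carrier \<pi>"
  shows "act (std_rep m r N t lam c \<pi>) h v \<in> carrier \<pi>"
  using module_rules(3)[OF smooth_repD(1)[OF \<pi>] lin_map_closed[OF smooth_repD(2)[OF \<pi> h] v]] by simp

text \<open>Conjugation by a suitable diagonal matrix rescales the simple entries and so replaces
  the coefficients c by c', while the GL_r block, and with it \<pi> and the power of \<nu>, is
  untouched.\<close>

lemma std_iso:
  fixes \<pi> :: "('f::nonarch_local_field mat, 'v) rep" and \<sigma> \<sigma>' :: "('f mat, 'v) rep"
  assumes \<pi>: "smooth_rep r \<pi>" and n: "n = N + r + 1" and m: "1 \<le> m" "m \<le> N + 1"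
    and c: "\<And>i. i < N \<Longrightarrow> c i \<noteq> 0" "\<And>i. i < N \<Longrightarrow> c' i \<noteq> 0"
    and \<sigma>: "is_std (row_free m r n) m r N t lam c \<pi> \<sigma>" and \<sigma>': "is_std (row_free m r n) m r N t lam c' \<pi> \<sigma>'"
  shows "rep_iso (carrier (GL n)) (cind n (row_free m r n) \<sigma>) (cind n (row_free m r n) \<sigma>')"
proof -
  let ?H = "row_free m r n :: 'f mat set"
  \<comment> \<open>Conjugation multiplies the i-th simple entry by q i / q (i + 1), so consecutive
    quotients must be c i / c' i. On the GL_r block \<tau> is 1.\<close>
  define q where "q k = (\<Prod>i<k. c i / c' i)" for k
  define \<tau> where "\<tau> j = (if j < m then q j else if j < m + r then 1 else q (j - r))" for j
  have mr: "m + r \<le> n" using m n by simp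
  have q: "q k \<noteq> 0" if "k \<le> N" for k using that c unfolding q_def by auto
  have \<tau>: "\<forall>i<n. \<tau> i \<noteq> 0" using q m n by (auto simp: \<tau>_def)
  have \<tau>R: "\<tau> i = 1" if "m \<le> i" "i < m + r" for i using that by (simp add: \<tau>_def)
  have \<tau>f: "\<tau> (flat m r i) = q i" for i by (simp add: \<tau>_def flat_def)
  let ?t = "diag_of n \<tau>"
  note C = diag_of_conj[OF \<tau>]
  have HL: "h \<in> levi_stab m r n" if "h \<in> ?H" for h using that unfolding row_free_def by blast
  have HG: "?H \<subseteq> carrier (GL n)" using levi_stab_GL[OF mr] HL by blast
  have Hc: "h \<in> carrier_mat n n" if "h \<in> ?H" for h using GL_carrier_mat HG that by blast
  have tG: "?t \<in> carrier_mat n n" "inv\<^bsub>GL n\<^esub> ?t \<in> carrier_mat n n" using C(1) GL_carrier_mat by blast+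
  have Z: "?t * h * inv\<^bsub>GL n\<^esub> ?t \<in> ?H" "block (?t * h * inv\<^bsub>GL n\<^esub> ?t) m m r r = block h m m r r" if h: "h \<in> ?H" for h
    by (rule row_free_scaled[OF h _ m(1) mr C(3)[OF Hc[OF h]]]; use tG Hc[OF h] \<tau> \<tau>R in simp)+
  have Z': "inv\<^bsub>GL n\<^esub> ?t * h * ?t \<in> ?H" if h: "h \<in> ?H" for h
    by (rule row_free_scaled[OF h _ m(1) mr C(4)[OF Hc[OF h]]]; use tG Hc[OF h] \<tau> \<tau>R in simp)
  have S: "simple_sum m r N c (?t * h * inv\<^bsub>GL n\<^esub> ?t) = simple_sum m r N c' h" if h: "h \<in> ?H" for h
    unfolding simple_sum_def
  proof (rule sum.cong[OF HOL.refl])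
    fix i assume "i \<in> {..<N}"
    then have i: "i < N" by simp
    then have f: "flat m r i < n" "flat m r (Suc i) < n" using n by (auto simp: flat_def)
    have "q (Suc i) = q i * (c i / c' i)" by (simp add: q_def)
    then have "c i * (q i * inverse (q (Suc i))) = c' i" using c[of i] q[of i] q[of "Suc i"] i by (simp add: field_simps)
    then show "c i * (?t * h * inv\<^bsub>GL n\<^esub> ?t) $$ (flat m r i, flat m r (Suc i)) = c' i * h $$ (flat m r i, flat m r (Suc i))"
      unfolding C(3)[OF Hc[OF h] f] \<tau>f by (simp add: mult_ac)
  qed
  note s = \<sigma>[unfolded is_std_def] and s' = \<sigma>'[unfolded is_std_def]
  show ?thesis
  proof (rule cind_iso_conj[OF HG HG C(1) Z(1) Z'])
    show "lin_map \<sigma> \<sigma>' (\<lambda>x. x)" using s s' by (simp add: lin_map_def)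
    show "bij_betw (\<lambda>x. x) (carrier \<sigma>) (carrier \<sigma>')" using s s' by (simp add: bij_betw_def inj_on_def)
    show "act \<sigma> h v \<in> carrier \<sigma>" if "h \<in> ?H" "v \<in> carrier \<sigma>" for h v
      using s that std_rep_closed[OF \<pi> levi_stabD(2)[OF HL[OF that(1)]]] by metis
    show "act \<sigma> (?t * h * inv\<^bsub>GL n\<^esub> ?t) v = act \<sigma>' h v" if h: "h \<in> ?H" and v: "v \<in> carrier \<sigma>" for h v
    proof -
      have v': "v \<in> carrier \<pi>" using v s by blast
      have "act \<sigma> (?t * h * inv\<^bsub>GL n\<^esub> ?t) v = act (std_rep m r N t lam c \<pi>) (?t * h * inv\<^bsub>GL n\<^esub> ?t) v" using s Z(1)[OF h] v' by blast
      also have "\<dots> = act (std_rep m r N t lam c' \<pi>) h v" by (simp add: Z(2)[OF h] S[OF h])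
      also have "\<dots> = act \<sigma>' h v" using s' h v' by simp
      finally show ?thesis .
    qed
    show "\<zero>\<^bsub>\<sigma>\<^esub> \<in> carrier \<sigma>" using s module_rules(1)[OF smooth_repD(1)[OF \<pi>]] by simp
  qed
qed

definition perm_mat :: "nat \<Rightarrow> (nat \<Rightarrow> nat) \<Rightarrow> 'f::field mat" where
  "perm_mat n p = mat n n (\<lambda>(i, j). if i = p j then 1 else 0)"

lemma perm_mat_conj:
  fixes h :: "'f::field mat"
  assumes p: "\<forall>i<n. p i < n \<and> q (p i) = i" and q: "\<forall>i<n. q i < n \<and> p (q i) = i"
  shows "perm_mat n p \<in> (carrier (GL n) :: 'f mat set)" "inv\<^bsub>GL n\<^esub> (perm_mat n p) = (perm_mat n q :: 'f mat)"
    "h \<in> carrier_mat n n \<Longrightarrow> i < n \<Longrightarrow> j < n \<Longrightarrow> (perm_mat n p * h * perm_mat n q) $$ (i, j) = h $$ (q i, q j)"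
    "h \<in> carrier_mat n n \<Longrightarrow> i < n \<Longrightarrow> j < n \<Longrightarrow> (perm_mat n q * h * perm_mat n p) $$ (i, j) = h $$ (p i, p j)"
proof -
  have d: "perm_mat n s \<in> (carrier_mat n n :: 'f mat set)" for s by (simp add: perm_mat_def)
  have r: "(A * perm_mat n s) $$ (i, j) = A $$ (i, s j)" if "s j < n" "A \<in> carrier_mat n n" "i < n" "j < n" for A :: "'f mat" and s i j
  proof -
    have "(A * perm_mat n s) $$ (i, j) = (\<Sum>k\<in>{0..<n}. if k = s j then A $$ (i, s j) else 0)"
      unfolding mat_mult_index[OF that(2) d that(3,4)] using that by (intro sum.cong HOL.refl) (auto simp: perm_mat_def)
    then show ?thesis using that by simp
  qed
  have l: "(perm_mat n s * A) $$ (i, j) = A $$ (s' i, j)"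
    if s: "\<forall>i<n. s i < n \<and> s' (s i) = i" "\<forall>i<n. s' i < n \<and> s (s' i) = i"
      and A: "A \<in> carrier_mat n n" "i < n" "j < n" for A :: "'f mat" and s s' i j
  proof -
    have "(perm_mat n s * A) $$ (i, j) = (\<Sum>k\<in>{0..<n}. if k = s' i then A $$ (s' i, j) else 0)"
      unfolding mat_mult_index[OF d A]
    proof (rule sum.cong[OF HOL.refl])
      fix k assume "k \<in> {0..<n}"
      then have k: "k < n" by simp
      have "s' (s k) = k" "s (s' i) = i" using s k A(2) by blast+
      then have "i = s k \<longleftrightarrow> k = s' i" by metis
      then show "perm_mat n s $$ (i, k) * A $$ (k, j) = (if k = s' i then A $$ (s' i, j) else 0)"
        using k A(2) unfolding perm_mat_def by simp
    qed
    then show ?thesis using s(2) A(2) by simp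
  qed
  have one: "perm_mat n p * perm_mat n q = (1\<^sub>m n :: 'f mat)"
  proof (rule eq_matI)
    fix i j assume "i < dim_row (1\<^sub>m n :: 'f mat)" "j < dim_col (1\<^sub>m n :: 'f mat)"
    then have ij: "i < n" "j < n" by auto
    show "(perm_mat n p * perm_mat n q) $$ (i, j) = (1\<^sub>m n :: 'f mat) $$ (i, j)"
      using r[of q j "perm_mat n p" i] q d ij by (simp add: perm_mat_def)
  qed (simp_all add: perm_mat_def)
  have "det (perm_mat n p :: 'f mat) * det (perm_mat n q :: 'f mat) = 1"
    unfolding det_mult[OF d d, symmetric] one by simp
  then have G: "perm_mat n p \<in> (carrier (GL n) :: 'f mat set)" "perm_mat n q \<in> (carrier (GL n) :: 'f mat set)"
    unfolding carrier_GL using d by auto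
  then show "perm_mat n p \<in> (carrier (GL n) :: 'f mat set)" "inv\<^bsub>GL n\<^esub> (perm_mat n p) = (perm_mat n q :: 'f mat)"
    using GL_inv_eq[OF G one] by auto
  show "(perm_mat n p * h * perm_mat n q) $$ (i, j) = h $$ (q i, q j)"
    if "h \<in> carrier_mat n n" "i < n" "j < n" for i j
    using r[OF _ mult_carrier_mat[OF d that(1)] that(2,3), of q p] l[OF p q that(1,2), of "q j"] q that by simp
  show "(perm_mat n q * h * perm_mat n p) $$ (i, j) = h $$ (p i, p j)"
    if "h \<in> carrier_mat n n" "i < n" "j < n" for i j
    using r[OF _ mult_carrier_mat[OF d that(1)] that(2,3), of p q] l[OF q p that(1,2), of "p j"] p that by simp
qed

text \<open>Moving index m behind the GL_r block exchanges the two descriptions: row m cleared over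
  the block becomes the lower triangular zeros in row m + r, and the zeros below the diagonal in
  column m become the cleared column m + r. The order of the indices outside the block is unchanged,
  so the generic linear form is the same.\<close>

lemma col_free_iso:
  fixes \<pi> :: "('f::nonarch_local_field mat, 'v) rep"
  assumes \<pi>: "smooth_rep r \<pi>" and n: "n = N + r + 1" and m: "m + r < n"
  shows "rep_iso (carrier (GL n)) (cind n (col_free m r n) (std_rep m r N t lam c \<pi>)) (cind n (row_free (m + 1) r n) (std_rep (m + 1) r N t lam c \<pi>))"
proof -
  \<comment> \<open>The cycle sending m to m + r and lowering m + 1, ..., m + r by one; q is its
    inverse.\<close>
  define p where "p k = (if k < m then k else if k = m then m + r else if k \<le> m + r then k - 1 else k)" for k
  define q where "q k = (if k < m then k else if k < m + r then k + 1 else if k = m + r then m else k)" for k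
  have p: "p i < n \<and> q (p i) = i" if "i < n" for i using that m by (auto simp: p_def q_def)
  have q: "q i < n \<and> p (q i) = i" if "i < n" for i using that m by (auto simp: p_def q_def)
  let ?H = "col_free m r n :: 'f mat set" and ?H' = "row_free (m + 1) r n :: 'f mat set"
  let ?t = "perm_mat n p :: 'f mat"
  have pq: "\<forall>i<n. p i < n \<and> q (p i) = i" "\<forall>i<n. q i < n \<and> p (q i) = i" using p q by blast+
  note C = perm_mat_conj[OF pq]
  have ti: "inv\<^bsub>GL n\<^esub> ?t = perm_mat n q" by (rule C(2))
  have tc: "?t \<in> carrier_mat n n" "perm_mat n q \<in> (carrier_mat n n :: 'f mat set)" by (simp_all add: perm_mat_def)
  have HL: "h \<in> levi_stab m r n" if "h \<in> ?H" for h using that unfolding col_free_def by blast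
  have HL': "h \<in> levi_stab (m + 1) r n" if "h \<in> ?H'" for h using that unfolding row_free_def by blast
  have HG: "?H \<subseteq> carrier (GL n)" "?H' \<subseteq> carrier (GL n)"
    using levi_stab_GL[of m r n] levi_stab_GL[of "m + 1" r n] HL HL' m by auto
  have qR: "q (m + i) = Suc (m + i)" and pR: "p (Suc (m + i)) = m + i" if "i < r" for i
    using that by (auto simp: p_def q_def)
  have b: "block (?t * h * perm_mat n q) m m r r = block h (m + 1) (m + 1) r r" if h: "h \<in> carrier_mat n n" for h
    using C(3)[OF h] m qR by (intro eq_matI) auto
  have b': "block (perm_mat n q * h * ?t) (m + 1) (m + 1) r r = block h m m r r" if h: "h \<in> carrier_mat n n" for h
    using C(4)[OF h] m pR by (intro eq_matI) auto
  have Z: "?t * h * perm_mat n q \<in> ?H" if h: "h \<in> ?H'" for h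
  proof -
    note D = levi_stabD[OF HL'[OF h]]
    have z: "h $$ (m, m + 1 + j) = 0" if "j < r" for j using h that unfolding row_free_def by simp
    note e = C(3)[OF D(1)]
    have "?t * h * perm_mat n q \<in> levi_stab m r n"
    proof (rule levi_stabI)
      show "?t * h * perm_mat n q \<in> carrier_mat n n" using tc D(1) by simp
      show "block (?t * h * perm_mat n q) m m r r \<in> carrier (GL r)" unfolding b[OF D(1)] by (rule D(2))
      show "(?t * h * perm_mat n q) $$ (i, i) = 1" if i: "i < n" "i \<notin> {m..<m + r}" for i
      proof -
        have "q i < n" "q i \<notin> {m + 1..<m + 1 + r}" using i q[OF i(1)] by (auto simp: q_def)
        then show ?thesis using e[OF i(1) i(1)] D(4) by simp
      qed
      show "(?t * h * perm_mat n q) $$ (i, j) = 0" if ij: "i < n" "j < i" "\<not> (i \<in> {m..<m + r} \<and> j \<in> {m..<m + r})" for i j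
      proof -
        have jn: "j < n" using ij by simp
        \<comment> \<open>Only the entries in row m + r over the block are not covered by
          triangularity of h; they come from row m of h, which is cleared.\<close>
        show ?thesis
        proof (cases "i = m + r \<and> m \<le> j")
          case True
          then have "q i = m" "q j = m + 1 + (j - m)" "j - m < r" using ij by (auto simp: q_def)
          then show ?thesis using e[OF ij(1) jn] z[of "j - m"] by simp
        next
          case False
          then have "q i < n" "q j < q i" "\<not> (q i \<in> {m + 1..<m + 1 + r} \<and> q j \<in> {m + 1..<m + 1 + r})"
            using ij q[OF ij(1)] by (auto simp: q_def)
          then show ?thesis using e[OF ij(1) jn] D(3) by simp
        qed
      qed
    qed
    moreover have "(?t * h * perm_mat n q) $$ (m + i, m + r) = 0" if i: "i < r" for i
    proof -
      have "m + i < n" "m + r < n" using m i by auto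
      note e[OF this]
      moreover have "q (m + i) = m + 1 + i" "q (m + r) = m" using i by (auto simp: q_def)
      ultimately show ?thesis using D(3)[of "m + 1 + i" m] m i by simp
    qed
    ultimately show ?thesis unfolding col_free_def by blast
  qed
  have Z': "perm_mat n q * h * ?t \<in> ?H'" if h: "h \<in> ?H" for h
  proof -
    note D = levi_stabD[OF HL[OF h]]
    have z: "h $$ (m + j, m + r) = 0" if "j < r" for j using h that unfolding col_free_def by simp
    note e = C(4)[OF D(1)]
    have "perm_mat n q * h * ?t \<in> levi_stab (m + 1) r n"
    proof (rule levi_stabI)
      show "perm_mat n q * h * ?t \<in> carrier_mat n n" using tc D(1) by simp
      show "block (perm_mat n q * h * ?t) (m + 1) (m + 1) r r \<in> carrier (GL r)" unfolding b'[OF D(1)] by (rule D(2))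
      show "(perm_mat n q * h * ?t) $$ (i, i) = 1" if i: "i < n" "i \<notin> {m + 1..<m + 1 + r}" for i
      proof -
        have "p i < n" "p i \<notin> {m..<m + r}" using i p[OF i(1)] by (auto simp: p_def)
        then show ?thesis using e[OF i(1) i(1)] D(4) by simp
      qed
      show "(perm_mat n q * h * ?t) $$ (i, j) = 0" if ij: "i < n" "j < i" "\<not> (i \<in> {m + 1..<m + 1 + r} \<and> j \<in> {m + 1..<m + 1 + r})" for i j
      proof -
        have jn: "j < n" using ij by simp
        show ?thesis
        proof (cases "j = m \<and> i \<le> m + r")
          case True
          then have "p i = m + (i - (m + 1))" "p j = m + r" "i - (m + 1) < r" using ij by (auto simp: p_def)
          then show ?thesis using e[OF ij(1) jn] z[of "i - (m + 1)"] by simp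
        next
          case False
          then have "p i < n" "p j < p i" "\<not> (p i \<in> {m..<m + r} \<and> p j \<in> {m..<m + r})"
            using ij p[OF ij(1)] by (auto simp: p_def)
          then show ?thesis using e[OF ij(1) jn] D(3) by simp
        qed
      qed
    qed
    moreover have "(perm_mat n q * h * ?t) $$ (m, m + 1 + i) = 0" if i: "i < r" for i
    proof -
      have "m < n" "m + 1 + i < n" using m i by auto
      note e[OF this]
      moreover have "p m = m + r" "p (m + 1 + i) = m + i" using i by (auto simp: p_def)
      ultimately show ?thesis using D(3)[of "m + r" "m + i"] m i by simp
    qed
    ultimately show ?thesis unfolding row_free_def by simp
  qed
  have S: "simple_sum m r N c (?t * h * perm_mat n q) = simple_sum (m + 1) r N c h" if h: "h \<in> carrier_mat n n" for h
    unfolding simple_sum_def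
  proof (rule sum.cong[OF HOL.refl])
    fix i assume "i \<in> {..<N}"
    then have f: "flat m r i < n" "flat m r (Suc i) < n" using n by (auto simp: flat_def)
    have "q (flat m r i) = flat (m + 1) r i" for i by (auto simp: flat_def q_def)
    then show "c i * (?t * h * perm_mat n q) $$ (flat m r i, flat m r (Suc i)) = c i * h $$ (flat (m + 1) r i, flat (m + 1) r (Suc i))"
      unfolding C(3)[OF h f] by simp
  qed
  show ?thesis
  proof (rule cind_iso_conj[OF HG C(1), unfolded ti, OF Z Z'])
    show "lin_map (std_rep m r N t lam c \<pi>) (std_rep (m + 1) r N t lam c \<pi>) (\<lambda>x. x)" by (simp add: lin_map_def)
    show "bij_betw (\<lambda>x. x) (carrier (std_rep m r N t lam c \<pi>)) (carrier (std_rep (m + 1) r N t lam c \<pi>))" by (simp add: bij_betw_def inj_on_def)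
    show "act (std_rep m r N t lam c \<pi>) h v \<in> carrier (std_rep m r N t lam c \<pi>)" if "h \<in> ?H" "v \<in> carrier (std_rep m r N t lam c \<pi>)" for h v
      using std_rep_closed[OF \<pi> levi_stabD(2)[OF HL[OF that(1)]], of v] that(2) by (simp only: std_rep_simps)
    show "act (std_rep m r N t lam c \<pi>) (?t * h * perm_mat n q) v = act (std_rep (m + 1) r N t lam c \<pi>) h v"
      if h: "h \<in> ?H'" for h v
      unfolding std_rep_simps b[OF levi_stabD(1)[OF HL'[OF h]]] S[OF levi_stabD(1)[OF HL'[OF h]]] ..
    show "\<zero>\<^bsub>std_rep m r N t lam c \<pi>\<^esub> \<in> carrier (std_rep m r N t lam c \<pi>)" using module_rules(1)[OF smooth_repD(1)[OF \<pi>]] by simp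
  qed
qed

section \<open>Normalised Bessel inductions and the chain to the Rankin-Selberg case\<close>

definition bessel :: "nat \<Rightarrow> nat \<Rightarrow> nat \<Rightarrow> ('f \<Rightarrow> complex) \<Rightarrow> ('f::nonarch_local_field mat, 'v) rep \<Rightarrow> ('f mat, 'f mat \<Rightarrow> 'v) rep" where
  "bessel a b r lam \<pi> = cind (a + b + r + 1) (row_free (a + 1) r (a + b + r + 1))
     (std_rep (a + 1) r (a + b) ((real b - real a) / 2) lam (\<lambda>_. 1) \<pi>)"

lemma FJ_data_exists:
  fixes lam :: "'f::nonarch_local_field \<Rightarrow> complex"
  assumes lam: "nontrivial_add_char lam" and \<phi>: "\<And>k. nondegenerate_char k (\<phi> k)" and m: "1 \<le> m1" "1 \<le> m2"
  obtains c where "FJ_data m1 m2 r \<phi> lam c" "\<And>i. i < m1 + m2 - 1 \<Longrightarrow> c i \<noteq> 0"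
proof -
  obtain c where "(\<forall>i<m1 + m2 - 1. c i \<noteq> 0) \<and> c (m1 - 1) = 1 \<and>
    (\<forall>h\<in>levi_stab m1 r (m1 + m2 + r). \<phi> m1 (block h 0 0 m1 m1) * \<phi> m2 (block h (m1 + r) (m1 + r) m2 m2) *
       lam (h $$ (m1 - 1, m1 + r)) = lam (simple_sum m1 r (m1 + m2 - 1) c h))"
    using FJ_char[OF lam \<phi> m] by (rule exE)
  then show ?thesis by (intro that[of c]) (simp_all add: FJ_data_def)
qed

text \<open>The pair (m1, m2) = (a + 1, b) in \<open>hat_iso\<close>, whose exponent becomes (b - a)
  / 2. Then \<open>std_iso\<close> replaces the coefficients by 1, the normalisation used in
  \<open>bessel\<close>.\<close>

lemma hat_bessel_iso:
  fixes \<pi> :: "('f::nonarch_local_field mat, 'v) rep"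
  assumes lam: "nontrivial_add_char lam" and \<phi>: "\<And>k. nondegenerate_char k (\<phi> k)" and \<pi>: "smooth_rep r \<pi>"
    and n: "n = a + b + r + 1" and b: "1 \<le> b"
  shows "rep_iso (carrier (GL n)) (cind n (levi_stab (a + 1) r n)
      (FJ_rep (a + 1) r (real b - real (a + 1)) \<pi> (zetaF_hat \<phi> lam (a + 1) b r))) (bessel a b r lam \<pi>)"
proof -
  have ac: "add_char lam" using lam by (simp add: nontrivial_add_char_iff)
  have a: "1 \<le> a + 1" by simp
  obtain c where c: "FJ_data (a + 1) b r \<phi> lam c" "\<And>i. i < a + 1 + b - 1 \<Longrightarrow> c i \<noteq> 0"
    using FJ_data_exists[OF lam \<phi> a b] by blast
  have n': "n = a + 1 + b + r" using n by simp
  have t: "(real b - real (a + 1) + 1) / 2 = (real b - real a) / 2" "a + 1 + b - 1 = a + b" by simp_all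
  have n2: "n = a + b + r + 1" and a2: "a + 1 \<le> a + b + 1" using n by simp_all
  have "rep_iso (carrier (GL n)) (cind n (row_free (a + 1) r n) (std_rep (a + 1) r (a + b) ((real b - real a) / 2) lam c \<pi>))
    (cind n (row_free (a + 1) r n) (std_rep (a + 1) r (a + b) ((real b - real a) / 2) lam (\<lambda>_. 1) \<pi>))"
    by (rule std_iso[OF \<pi> n2 a a2 _ _ is_std_std_rep is_std_std_rep]) (use c(2) in auto)
  from rep_iso_trans[OF hat_iso[OF ac a b n' \<pi> c(1), unfolded t] this] show ?thesis unfolding bessel_def n .
qed

text \<open>The pair (m1, m2) = (a, b + 1) in \<open>tilde_iso\<close>, whose exponent again becomes
  (b - a) / 2; \<open>col_free_iso\<close> passes to the Bessel group and \<open>std_iso\<close>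
  normalises the coefficients.\<close>

lemma tilde_bessel_iso:
  fixes \<pi> :: "('f::nonarch_local_field mat, 'v) rep"
  assumes lam: "nontrivial_add_char lam" and \<phi>: "\<And>k. nondegenerate_char k (\<phi> k)" and \<pi>: "smooth_rep r \<pi>"
    and n: "n = a + b + r + 1" and a: "1 \<le> a"
  shows "rep_iso (carrier (GL n)) (cind n (levi_stab a r n)
      (FJ_rep a r (real (b + 1) - real a) \<pi> (zetaF \<phi> lam a (b + 1) r))) (bessel a b r lam \<pi>)"
proof -
  have ac: "add_char lam" using lam by (simp add: nontrivial_add_char_iff)
  have b: "1 \<le> b + 1" by simp
  obtain c where c: "FJ_data a (b + 1) r \<phi> lam c" "\<And>i. i < a + (b + 1) - 1 \<Longrightarrow> c i \<noteq> 0"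
    using FJ_data_exists[OF lam \<phi> a b] by blast
  have n': "n = a + (b + 1) + r" using n by simp
  have t: "(real (b + 1) - real a - 1) / 2 = (real b - real a) / 2" "a + (b + 1) - 1 = a + b" by simp_all
  have n2: "n = a + b + r + 1" and a2: "1 \<le> a + 1" "a + 1 \<le> a + b + 1" and ar: "a + r < n" using n by simp_all
  have "rep_iso (carrier (GL n)) (cind n (row_free (a + 1) r n) (std_rep (a + 1) r (a + b) ((real b - real a) / 2) lam c \<pi>))
    (cind n (row_free (a + 1) r n) (std_rep (a + 1) r (a + b) ((real b - real a) / 2) lam (\<lambda>_. 1) \<pi>))"
    by (rule std_iso[OF \<pi> n2 a2 _ _ is_std_std_rep is_std_std_rep]) (use c(2) in auto)
  from rep_iso_trans[OF col_free_iso[OF \<pi> n2 ar] this]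
  have "rep_iso (carrier (GL n)) (cind n (col_free a r n) (std_rep a r (a + b) ((real b - real a) / 2) lam c \<pi>)) (bessel a b r lam \<pi>)"
    unfolding bessel_def n .
  from rep_iso_trans[OF tilde_iso[OF ac a b n' \<pi> c(1), unfolded t] this] show ?thesis .
qed

lemma rep_iso_refl: "rep_iso G \<rho> \<rho>"
  unfolding rep_iso_def by (rule bexI[of _ "\<lambda>x. x"]) (auto simp: module_hom_def bij_betw_def)

text \<open>Both sides are Fourier-Jacobi inductions for (a + 1, b + 1): the left one in the tilde
  model, the right one in the hat model, and the Fourier transform connects them.\<close>

lemma bessel_step:
  fixes \<phi> :: "nat \<Rightarrow> 'f::nonarch_local_field mat \<Rightarrow> complex" and \<pi> :: "('f mat, 'v) rep"
  assumes lam: "nontrivial_add_char lam" and \<phi>: "\<And>k. nondegenerate_char k (\<phi> k)" and \<pi>: "smooth_rep r \<pi>"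
    and n: "n = a + b + r + 2"
  shows "rep_iso (carrier (GL n)) (bessel (a + 1) b r lam \<pi>) (bessel a (b + 1) r lam \<pi>)"
proof -
  have ac: "add_char lam" using lam by (simp add: nontrivial_add_char_iff)
  have n1: "n = (a + 1) + b + r + 1" and n2: "n = a + (b + 1) + r + 1" and i: "1 \<le> a + 1" "1 \<le> b + 1" and nr: "a + 1 + r \<le> n"
    using n by simp_all
  let ?t = "real (b + 1) - real (a + 1)"
  let ?T = "cind n (levi_stab (a + 1) r n) (FJ_rep (a + 1) r ?t \<pi> (zetaF \<phi> lam (a + 1) (b + 1) r))"
  have "rep_closed (carrier (GL n)) ?T"
    by (rule FJ_cind_closed[OF \<pi> zetaF_is_schwartz(1) nr]) (rule zetaF_lin_map(1)[OF i(1) levi_stabD(2) ac])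
  from rep_iso_sym[OF tilde_bessel_iso[OF lam \<phi> \<pi> n1 i(1)] this]
  have "rep_iso (carrier (GL n)) (bessel (a + 1) b r lam \<pi>) ?T" .
  from rep_iso_trans[OF this fourier_iso[OF lam i(1) nr \<pi>]] rep_iso_trans hat_bessel_iso[OF lam \<phi> \<pi> n2 i(2)]
  show ?thesis by blast
qed

lemma bessel_chain:
  fixes \<phi> :: "nat \<Rightarrow> 'f::nonarch_local_field mat \<Rightarrow> complex" and \<pi> :: "('f mat, 'v) rep"
  assumes lam: "nontrivial_add_char lam" and \<phi>: "\<And>k. nondegenerate_char k (\<phi> k)" and \<pi>: "smooth_rep r \<pi>"
    and n: "n = a + b + r + 1"
  shows "rep_iso (carrier (GL n)) (bessel a b r lam \<pi>) (bessel 0 (a + b) r lam \<pi>)"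
  using n
proof (induction a arbitrary: b)
  case 0
  show ?case by (simp add: rep_iso_refl)
next
  case (Suc a)
  have "n = a + b + r + 2" "n = a + Suc b + r + 1" using Suc.prems by simp_all
  from rep_iso_trans[OF bessel_step[OF lam \<phi> \<pi> this(1)] Suc.IH[OF this(2), simplified Suc_eq_plus1]]
  show ?case by (simp add: add_ac)
qed

lemma HB_row_free: "HB a b r = row_free (a + 1) r (a + b + r + 1)"
  unfolding HB_eq row_free_def by simp

text \<open>On the Bessel group the exponents b - a and -(b - a) / 2 combine to (b - a) / 2, and
  \<open>HB_char\<close> puts the remaining character into standard form. Both directions are
  obtained by exchanging the two sides in \<open>std_iso\<close>.\<close>

lemma zetaB_std:
  fixes lam :: "'f::nonarch_local_field \<Rightarrow> complex" and \<phi> :: "nat \<Rightarrow> 'f mat \<Rightarrow> complex" and \<pi> :: "('f mat, 'v) rep"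
  assumes lam: "nontrivial_add_char lam" and \<psi>: "nontrivial_add_char \<psi>" and \<phi>: "\<And>k. nondegenerate_char k (\<phi> k)"
    and \<pi>: "smooth_rep r \<pi>" and n: "n = a + b + r + 1" and t: "t = real b - real a"
  shows "rep_iso (carrier (GL n)) (cind n (HB a b r) (twist (\<lambda>h. nu t (projB a r h)) (twist (zetaB \<phi> \<psi> a b r) (pull (projB a r) \<pi>))))
      (bessel a b r lam \<pi>)"
    "rep_iso (carrier (GL n)) (bessel a b r lam \<pi>)
      (cind n (HB a b r) (twist (\<lambda>h. nu t (projB a r h)) (twist (zetaB \<phi> \<psi> a b r) (pull (projB a r) \<pi>))))"
proof -
  let ?\<sigma> = "twist (\<lambda>h. nu t (projB a r h)) (twist (zetaB \<phi> \<psi> a b r) (pull (projB a r) \<pi>))"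
  let ?H = "row_free (a + 1) r n :: 'f mat set"
  obtain c where c: "\<forall>i<a + b. c i \<noteq> 0" "\<forall>h\<in>levi_stab (a + 1) r (a + b + r + 1).
     \<phi> a (block h 0 0 a a) * \<phi> b (block h (a + r + 1) (a + r + 1) b b) *
     (if a = 0 then 1 else \<psi> (h $$ (a - 1, a))) * (if b = 0 then 1 else \<psi> (h $$ (a, a + r + 1))) =
     lam (simple_sum (a + 1) r (a + b) c h)"
    using HB_char[OF lam \<psi> \<phi>, of a b r] by (elim exE conjE)
  have s: "is_std ?H (a + 1) r (a + b) ((real b - real a) / 2) lam c \<pi> ?\<sigma>"
    unfolding is_std_def
  proof (intro conjI ballI)
    fix h v assume h: "h \<in> ?H" and v: "v \<in> carrier \<pi>"
    let ?g = "block h (a + 1) (a + 1) r r"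
    have hl: "h \<in> levi_stab (a + 1) r (a + b + r + 1)" using h unfolding row_free_def n by blast
    note g = levi_stabD(2)[OF hl]
    have z: "zetaB \<phi> \<psi> a b r h = lam (simple_sum (a + 1) r (a + b) c h) * nu (- (real b - real a) / 2) ?g"
      unfolding zetaB_def projB_def using c(2) hl by simp
    have e: "(real b - real a) / 2 = (real b - real a) + - (real b - real a) / 2" by (simp add: field_simps)
    have nue: "nu ((real b - real a) / 2) ?g = nu (real b - real a) ?g * nu (- (real b - real a) / 2) ?g"
      by (subst e) (rule nu_add[OF GL_det[OF g]])
    have w: "act \<pi> ?g v \<in> carrier \<pi>" by (rule lin_map_closed[OF smooth_repD(2)[OF \<pi> g] v])
    have "act ?\<sigma> h v = nu t ?g \<odot>\<^bsub>\<pi>\<^esub> (zetaB \<phi> \<psi> a b r h \<odot>\<^bsub>\<pi>\<^esub> act \<pi> ?g v)" by (simp add: projB_def)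
    also have "\<dots> = (nu t ?g * zetaB \<phi> \<psi> a b r h) \<odot>\<^bsub>\<pi>\<^esub> act \<pi> ?g v"
      by (rule module_rules(10)[OF smooth_repD(1)[OF \<pi>] w, symmetric])
    also have "nu t ?g * zetaB \<phi> \<psi> a b r h = nu ((real b - real a) / 2) ?g * lam (simple_sum (a + 1) r (a + b) c h)"
      unfolding z t nue by (simp only: mult_ac)
    finally show "act ?\<sigma> h v = act (std_rep (a + 1) r (a + b) ((real b - real a) / 2) lam c \<pi>) h v" by simp
  qed simp_all
  have H: "HB a b r = ?H" unfolding HB_row_free n ..
  have a: "1 \<le> a + 1" "a + 1 \<le> a + b + 1" by simp_all
  show "rep_iso (carrier (GL n)) (cind n (HB a b r) ?\<sigma>) (bessel a b r lam \<pi>)"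
    unfolding bessel_def n[symmetric] H by (rule std_iso[OF \<pi> n a _ _ s is_std_std_rep]) (use c(1) in auto)
  show "rep_iso (carrier (GL n)) (bessel a b r lam \<pi>) (cind n (HB a b r) ?\<sigma>)"
    unfolding bessel_def n[symmetric] H by (rule std_iso[OF \<pi> n a _ _ is_std_std_rep s]) (use c(1) in auto)
qed

theorem corollary6p3:
  fixes \<psi> lam :: "'f::nonarch_local_field \<Rightarrow> complex"
    and \<phi> :: "nat \<Rightarrow> 'f mat \<Rightarrow> complex"
    and \<pi> :: "('f mat, 'v) rep"
    and m1 m2 r n :: nat
  assumes "nontrivial_add_char \<psi>" and "nontrivial_add_char lam"
    and "\<forall>k. nondegenerate_char k (\<phi> k)"
    and "m1 \<ge> 1" and "m2 \<ge> 1" and "r \<ge> 1" and "n = m1 + m2 + r"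
    and "smooth_rep r \<pi>"
  shows
    "rep_iso (carrier (GL n))
       (cind n (HF m1 m2 r)
          (twist (\<lambda>h. nu (real m2 - real m1) (projF m1 r h))
             (tensor (pull (projF m1 r) \<pi>) (zetaF \<phi> lam m1 m2 r))))
       (cind n (HF m1 m2 r)
          (twist (\<lambda>h. nu (real m2 - real m1) (projF m1 r h))
             (tensor (pull (projF m1 r) \<pi>) (zetaF_hat \<phi> lam m1 m2 r)))) \<and>
     rep_iso (carrier (GL n))
       (cind n (HF m1 m2 r)
          (twist (\<lambda>h. nu (real m2 - real m1) (projF m1 r h))
             (tensor (pull (projF m1 r) \<pi>) (zetaF_hat \<phi> lam m1 m2 r))))
       (cind n (HB (m1 - 1) m2 r)
          (twist (\<lambda>h. nu (real m2 - real m1 + 1) (projB (m1 - 1) r h))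
             (twist (zetaB \<phi> \<psi> (m1 - 1) m2 r) (pull (projB (m1 - 1) r) \<pi>)))) \<and>
     rep_iso (carrier (GL n))
       (cind n (HB (m1 - 1) m2 r)
          (twist (\<lambda>h. nu (real m2 - real m1 + 1) (projB (m1 - 1) r h))
             (twist (zetaB \<phi> \<psi> (m1 - 1) m2 r) (pull (projB (m1 - 1) r) \<pi>))))
       (cind n (HR (m1 - 1 + m2) r)
          (twist (\<lambda>h. nu (real m1 + real m2 - 1) (projR r h))
             (twist (zetaR \<phi> \<psi> (m1 - 1 + m2) r) (pull (projR r) \<pi>))))"
proof (intro conjI)
  note \<psi> = assms(1) and lam = assms(2) and m = assms(4,5) and n = assms(7) and \<pi> = assms(8)
  have \<phi>: "nondegenerate_char k (\<phi> k)" for k using assms(3) by blast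
  \<comment> \<open>In terms of a, both exponents in the statement have the form required by
    \<open>zetaB_std\<close>, second index minus first: m2 - a for the Bessel group and (a + m2) - 0
    for the Rankin-Selberg group.\<close>
  let ?a = "m1 - 1"
  have a: "?a + 1 = m1" "m1 + r \<le> n" and n1: "n = ?a + m2 + r + 1" "n = 0 + (?a + m2) + r + 1"
    and t: "real m2 - real m1 + 1 = real m2 - real ?a" "real m1 + real m2 - 1 = real (?a + m2) - real 0"
    using m n by auto
  have HF: "HF m1 m2 r = (levi_stab m1 r n :: 'f mat set)" unfolding n by (rule HF_eq[OF m])
  show "rep_iso (carrier (GL n)) (cind n (HF m1 m2 r) (FJ_rep m1 r (real m2 - real m1) \<pi> (zetaF \<phi> lam m1 m2 r)))
     (cind n (HF m1 m2 r) (FJ_rep m1 r (real m2 - real m1) \<pi> (zetaF_hat \<phi> lam m1 m2 r)))"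
    unfolding HF by (rule fourier_iso[OF lam m(1) a(2) \<pi>])
  note B = zetaB_std[OF lam \<psi> \<phi> \<pi> n1(1) t(1)] and R = zetaB_std[OF lam \<psi> \<phi> \<pi> n1(2) t(2)]
  show "rep_iso (carrier (GL n)) (cind n (HF m1 m2 r) (FJ_rep m1 r (real m2 - real m1) \<pi> (zetaF_hat \<phi> lam m1 m2 r)))
       (cind n (HB ?a m2 r) (twist (\<lambda>h. nu (real m2 - real m1 + 1) (projB ?a r h)) (twist (zetaB \<phi> \<psi> ?a m2 r) (pull (projB ?a r) \<pi>))))"
    unfolding HF by (rule rep_iso_trans[OF hat_bessel_iso[OF lam \<phi> \<pi> n1(1) m(2), unfolded a(1)] B(2)])
  have P: "projR r = (projB 0 r :: 'f mat \<Rightarrow> 'f mat)" "zetaR \<phi> \<psi> (?a + m2) r = zetaB \<phi> \<psi> 0 (?a + m2) r"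
    by (auto simp: projR_def zetaR_def)
  \<comment> \<open>Both inductions are compared with their normalised models, and
    \<open>bessel_chain\<close> moves all m1 - 1 rows across the GL_r block.\<close>
  show "rep_iso (carrier (GL n))
       (cind n (HB ?a m2 r) (twist (\<lambda>h. nu (real m2 - real m1 + 1) (projB ?a r h)) (twist (zetaB \<phi> \<psi> ?a m2 r) (pull (projB ?a r) \<pi>))))
       (cind n (HR (?a + m2) r) (twist (\<lambda>h. nu (real m1 + real m2 - 1) (projR r h)) (twist (zetaR \<phi> \<psi> (?a + m2) r) (pull (projR r) \<pi>))))"
    unfolding P HR_def by (rule rep_iso_trans[OF B(1) rep_iso_trans[OF bessel_chain[OF lam \<phi> \<pi> n1(1)] R(2)]])
qed

end
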